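(* Let $A=kQ/I$ and let $\mathcal R$ be a reduction system satisfying condition $(\lozenge)$ for $I$, with associated sets $\mathcal A_n$ ($n\ge -1$), maps $\delta_n$ and sets $\overline{\mathcal L}_n^{\prec}(q)$. There exist $A$-bimodule morphisms $d_i:A\otimes_E k\mathcal A_i\otimes_E A\to A\otimes_E k\mathcal A_{i-1}\otimes_E A$ for $i\in\mathbb N_0$ and $d_{-1}:A\otimes_E A\to A$, with $d_{-1}=\delta_{-1}$, such that (1) $d_{i-1}\circ d_i=0$ for all $i\in\mathbb N_0$, and (2) $(d_i-\delta_i)(1\otimes q\otimes 1)\in\langle\overline{\mathcal L}_{i-1}^{\prec}(q)\rangle_{\mathbb Z}$ for all $i\ge 0$ and all $q\in\mathcal A_i$.
   Context: Let $k$ be a field, $Q$ a quiver with finitely many vertices, $Q_n$ the set of paths of length $n$, $Q_{\ge n}=\bigcup_{i\ge n}Q_i$, $E=kQ_0$. Let $I$ be a two-sided ideal of $kQ$, $A=kQ/I$, $\pi:kQ\to A$ the projection; assume $\pi(Q_0\cup Q_1)$ is linearly independent. A path $p$ is a divisor of a path $q$ if $q=apb$ for paths $a,b$; it is a left divisor if moreover $a$ is a vertex, and a right divisor if $b$ is a vertex. An element $f\in kQ$ is parallel to a path $s$ if all paths in the support of $f$ have the same source and target as $s$. $p\in x$ means that the path $p$ is in the support of $x\in kQ$. $\langle X\rangle_R$ denotes the $R$-linear span of $X$. Reduction systems. A reduction system is a set $\mathcal R=\{(s_i,f_i)\}_{i\in\Gamma}$ with $s_i\in Q_{\ge0}$,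 $f_i\in kQ$ parallel to $s_i$, $f_i\ne s_i$, and $s_i$ not dividing $s_j$ for $i\neq j$. For $(s,f)\in\mathcal R$ and paths $a,c$ with $asc\ne0$ in $kQ$, the basic reduction $r_{a,s,c}:kQ\to kQ$ is the linear map with $r_{a,s,c}(asc)=afc$ and $r_{a,s,c}(q)=q$ for every path $q\ne asc$. A reduction $r=(r_n,\dots,r_1)$ is a finite sequence of basic reductions, acting on $kQ$ as $r_n\circ\cdots\circ r_1$. $x\in kQ$ is irreducible if $r(x)=x$ for all basic reductions $r$ (otherwise reducible). A path $p$ is reduction-finite if for every infinite sequence $(r_i)_{i\in\mathbb N}$ of basic reductions the sequence $r_n\circ\cdots\circ r_1(p)$ is eventually constant in $n$; it is reduction-unique if it is reduction-finite and $r(p)=r'(p)$ for any two reductions $r,r'$ with $r(p),r'(p)$ both irreducible. $\mathcal R$ satisfies $(\lozenge)$ for $I$ if $I$ is the two-sided ideal generated by $\{s-f\}_{(s,f)\in\mathcal R}$, every path is reduction-unique, and $f$ is irreducible for each $(s,f)\in\mathcal R$. Put $S=\{s:(s,f)\in\mathcal R\}$, assumed to satisfy $S\subseteq Q_{\ge2}$, and let $\mathcal B$ be the set of irreducible paths; $\{\pi(b):b\in\mathcal B\}$ is a basis of $A$. Ambiguities. $\mathcal A_{-1}=Q_0$, $\mathcal A_0=Q_1$, $\mathcal A_1=S$. For $n\ge2$, $\mathcal A_n$ is the set of $n$-ambiguities: paths $p=u_0u_1\cdots u_n$ with $u_0\in Q_1$, $u_1,\dots,u_n$ irreducible paths, such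 that for all $0\le i<n$, $u_iu_{i+1}$ is reducible but $u_id$ is irreducible for each proper left divisor $d$ of $u_{i+1}$ (left factorization). It is a known fact that these are the same as the paths $p=v_n\cdots v_0$ with $v_0\in Q_1$, $v_1,\dots,v_n$ irreducible, such that for all $0\le i<n$, $v_{i+1}v_i$ is reducible but $dv_i$ is irreducible for each proper right divisor $d$ of $v_{i+1}$ (right factorization), and that the factorizations are unique. Maps. $\delta_{-1}:A\otimes_E k\mathcal A_{-1}\otimes_E A\cong A\otimes_E A\to A$ is multiplication. For $n\ge0$, $\delta_n:A\otimes_E k\mathcal A_n\otimes_E A\to A\otimes_E k\mathcal A_{n-1}\otimes_E A$ is the $A$-bimodule map given on $q\in\mathcal A_n$ as follows: if $n$ is even and $q=u_0\cdots u_n=v_n\cdots v_0$ are the left and right factorizations, $\delta_n(1\otimes q\otimes1)=\pi(v_n)\otimes v_{n-1}\cdots v_0\otimes 1-1\otimes u_0\cdots u_{n-1}\otimes\pi(u_n)$ (for $n=0$: $\delta_0(1\otimes\alpha\otimes1)=\pi(\alpha)\otimes1-1\otimes\pi(\alpha)$); if $n$ is odd, $\delta_n(1\otimes q\otimes1)=\sum\pi(a)\otimes p\otimes\pi(c)$, summed over all $p\in\mathcal A_{n-1}$ and paths $a,c$ with $apc=q$. Order. On $k^\times Q_{\ge0}:=\{\lambda p:\lambda\in k^\times,p\in Q_{\ge0}\}\cup\{0\}$ let $\preceq$ be the least reflexive and transitive relation such that $\lambda p\preceq\mu q$ whenever there is a reduction $r$ with $r(\mu q)=\lambda p+x$, $p\notin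 x$, and such that $0\preceq\lambda p$ always. Write $\prec$ for $\preceq$ and $\neq$. For $n\ge-1$, $\overline{\mathcal L}_n^{\prec}(\mu q)=\{\lambda\pi(b)\otimes p\otimes\pi(b'): b,b'\in\mathcal B,\ p\in\mathcal A_n,\ \lambda bpb'\prec\mu q\}\subseteq A\otimes_E k\mathcal A_n\otimes_E A.$ *)

theory Defs
  imports "HOL-Algebra.Algebra" "HOL-Library.Poly_Mapping" "Graph_Theory.Graph_Theory"
begin

section \<open>Quivers, paths and the path algebra\<close>

text \<open>
  A quiver is a \<^locale>\<open>wf_digraph\<close>: parallel arcs and loops are allowed, and the arc set may be
  infinite.  A path is its source vertex together with its list of arcs, so that vertices are the
  paths with no arcs.  Arcs are listed in the order in which they are written in a product, and
  the product of p and q is nonzero iff the target of p is the source of q; the opposite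
  convention amounts to replacing the quiver by its opposite.
\<close>

type_synonym ('v, 'e) path = "'v \<times> 'e list"
type_synonym ('v, 'e, 'k) lincomb = "('v, 'e) path \<Rightarrow>\<^sub>0 'k"

definition paths :: "('v, 'e) pre_digraph \<Rightarrow> ('v, 'e) path set"
  where "paths Q = {(u, p). \<exists>v. pre_digraph.awalk Q u p v}"

definition paths_len :: "('v, 'e) pre_digraph \<Rightarrow> nat \<Rightarrow> ('v, 'e) path set"
  where "paths_len Q n = {p \<in> paths Q. length (snd p) = n}"

definition paths_ge :: "('v, 'e) pre_digraph \<Rightarrow> nat \<Rightarrow> ('v, 'e) path set"
  where "paths_ge Q n = (\<Union>i\<in>{n..}. paths_len Q i)"

abbreviation psrc :: "('v, 'e) path \<Rightarrow> 'v"
  where "psrc p \<equiv> fst p"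

definition ptgt :: "('v, 'e) pre_digraph \<Rightarrow> ('v, 'e) path \<Rightarrow> 'v"
  where "ptgt Q p = pre_digraph.awlast Q (fst p) (snd p)"

definition joinable :: "('v, 'e) pre_digraph \<Rightarrow> ('v, 'e) path \<Rightarrow> ('v, 'e) path \<Rightarrow> bool"
  where "joinable Q p q \<longleftrightarrow> ptgt Q p = psrc q"

text \<open>Only meaningful if p and q are joinable.\<close>
definition pcomp :: "('v, 'e) path \<Rightarrow> ('v, 'e) path \<Rightarrow> ('v, 'e) path"
  where "pcomp p q = (fst p, snd p @ snd q)"

text \<open>The product of a nonempty list of successively joinable paths.\<close>
definition pconcat :: "('v, 'e) path list \<Rightarrow> ('v, 'e) path"
  where "pconcat ps = (fst (hd ps), concat (map snd ps))"

definition path_divides :: "('v, 'e) pre_digraph \<Rightarrow> ('v, 'e) path \<Rightarrow> ('v, 'e) path \<Rightarrow> bool"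
  where "path_divides Q p q \<longleftrightarrow>
    (\<exists>a\<in>paths Q. \<exists>b\<in>paths Q. joinable Q a p \<and> joinable Q p b \<and> q = pcomp (pcomp a p) b)"

definition left_divides :: "('v, 'e) pre_digraph \<Rightarrow> ('v, 'e) path \<Rightarrow> ('v, 'e) path \<Rightarrow> bool"
  where "left_divides Q p q \<longleftrightarrow>
    (\<exists>a\<in>paths_len Q 0. \<exists>b\<in>paths Q. joinable Q a p \<and> joinable Q p b \<and> q = pcomp (pcomp a p) b)"

definition right_divides :: "('v, 'e) pre_digraph \<Rightarrow> ('v, 'e) path \<Rightarrow> ('v, 'e) path \<Rightarrow> bool"
  where "right_divides Q p q \<longleftrightarrow>
    (\<exists>a\<in>paths Q. \<exists>b\<in>paths_len Q 0. joinable Q a p \<and> joinable Q p b \<and> q = pcomp (pcomp a p) b)"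

definition kscale :: "'k::field \<Rightarrow> ('v, 'e, 'k) lincomb \<Rightarrow> ('v, 'e, 'k) lincomb"
  where "kscale c x = Poly_Mapping.map ((*) c) x"

abbreviation kpath :: "('v, 'e) path \<Rightarrow> ('v, 'e, 'k::field) lincomb"
  where "kpath p \<equiv> Poly_Mapping.single p 1"

definition pmult :: "('v, 'e) pre_digraph \<Rightarrow>
    ('v, 'e, 'k::field) lincomb \<Rightarrow> ('v, 'e, 'k) lincomb \<Rightarrow> ('v, 'e, 'k) lincomb"
  where "pmult Q x y =
    (\<Sum>p\<in>Poly_Mapping.keys x. \<Sum>q\<in>Poly_Mapping.keys y.
       if joinable Q p q
       then Poly_Mapping.single (pcomp p q) (Poly_Mapping.lookup x p * Poly_Mapping.lookup y q)
       else 0)"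

definition path_span :: "('v, 'e) path set \<Rightarrow> ('v, 'e, 'k::field) lincomb set"
  where "path_span P = {x. Poly_Mapping.keys x \<subseteq> P}"

definition path_algebra :: "('v, 'e) pre_digraph \<Rightarrow> ('v, 'e, 'k::field) lincomb ring"
  where "path_algebra Q =
    \<lparr>carrier = path_span (paths Q), monoid.mult = pmult Q,
     one = (\<Sum>v\<in>verts Q. kpath (v, [])), ring.zero = 0, ring.add = (+)\<rparr>"

lemma pmult_superset:
  assumes "finite S" "finite T" "Poly_Mapping.keys x \<subseteq> S" "Poly_Mapping.keys y \<subseteq> T"
  shows "pmult Q x y =
    (\<Sum>p\<in>S. \<Sum>q\<in>T. if joinable Q p q
       then Poly_Mapping.single (pcomp p q) (Poly_Mapping.lookup x p * Poly_Mapping.lookup y q)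
       else 0)"
proof -
  have "pmult Q x y = (\<Sum>p\<in>Poly_Mapping.keys x. \<Sum>q\<in>T. if joinable Q p q
       then Poly_Mapping.single (pcomp p q) (Poly_Mapping.lookup x p * Poly_Mapping.lookup y q)
       else 0)"
    unfolding pmult_def using assms
    by (intro sum.cong refl sum.mono_neutral_left) (auto simp: in_keys_iff)
  also have "\<dots> = (\<Sum>p\<in>S. \<Sum>q\<in>T. if joinable Q p q
       then Poly_Mapping.single (pcomp p q) (Poly_Mapping.lookup x p * Poly_Mapping.lookup y q)
       else 0)"
    using assms by (intro sum.mono_neutral_left) (auto simp: in_keys_iff intro!: sum.neutral)
  finally show ?thesis .
qed

lemma pmult_add_left: "pmult Q (x + x') y = pmult Q x y + pmult Q x' y"
proof -
  let ?S = "Poly_Mapping.keys x \<union> Poly_Mapping.keys x'" and ?T = "Poly_Mapping.keys y"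
  have "Poly_Mapping.keys (x + x') \<subseteq> ?S"
    by (rule Poly_Mapping.keys_add)
  then show ?thesis
    by (simp add: pmult_superset[of ?S ?T _ y] del: sum.distrib flip: sum.distrib)
       (intro sum.cong refl, simp add: lookup_add distrib_right single_add)
qed

lemma pmult_add_right: "pmult Q x (y + y') = pmult Q x y + pmult Q x y'"
proof -
  let ?T = "Poly_Mapping.keys y \<union> Poly_Mapping.keys y'" and ?S = "Poly_Mapping.keys x"
  have "Poly_Mapping.keys (y + y') \<subseteq> ?T"
    by (rule Poly_Mapping.keys_add)
  then show ?thesis
    by (simp add: pmult_superset[of ?S ?T x] del: sum.distrib flip: sum.distrib)
       (intro sum.cong refl, simp add: lookup_add distrib_left single_add)
qed

lemma pmult_zero [simp]: "pmult Q 0 y = 0" "pmult Q x 0 = 0"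
  by (simp_all add: pmult_def)

lemma pmult_single:
  "pmult Q (Poly_Mapping.single p a) (Poly_Mapping.single q b) =
    (if joinable Q p q then Poly_Mapping.single (pcomp p q) (a * b) else 0)"
  by (subst pmult_superset[of "{p}" "{q}"]) auto

lemma pmult_sum_left: "pmult Q (\<Sum>i\<in>S. f i) y = (\<Sum>i\<in>S. pmult Q (f i) y)"
  by (induction S rule: infinite_finite_induct) (auto simp: pmult_add_left)

lemma pmult_sum_right: "pmult Q x (\<Sum>i\<in>S. f i) = (\<Sum>i\<in>S. pmult Q x (f i))"
  by (induction S rule: infinite_finite_induct) (auto simp: pmult_add_right)

lemma lincomb_induct [case_names zero single add]:
  assumes "P 0" "\<And>p c. p \<in> Poly_Mapping.keys x \<Longrightarrow> P (Poly_Mapping.single p c)"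
    "\<And>y z. P y \<Longrightarrow> P z \<Longrightarrow> P (y + z)"
  shows "P (x :: 'p \<Rightarrow>\<^sub>0 'k::comm_monoid_add)"
proof -
  have "P (\<Sum>p\<in>S. Poly_Mapping.single p (Poly_Mapping.lookup x p))"
    if "S \<subseteq> Poly_Mapping.keys x" for S
    using finite_subset[OF that finite_keys] that
    by (induction S rule: finite_induct) (auto intro: assms)
  moreover have "(\<Sum>p\<in>Poly_Mapping.keys x. Poly_Mapping.single p (Poly_Mapping.lookup x p)) = x"
    by (rule poly_mapping_eqI)
      (auto simp: lookup_sum lookup_single when_def in_keys_iff)
  ultimately show ?thesis by force
qed

lemma ptgt_conv: "ptgt Q p = (if snd p = [] then fst p else head Q (last (snd p)))"
  by (auto simp: ptgt_def pre_digraph.awalk_verts_conv)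

lemma joinable_pcomp:
  assumes "joinable Q p q"
  shows "joinable Q (pcomp p q) r \<longleftrightarrow> joinable Q q r" "joinable Q r (pcomp p q) \<longleftrightarrow> joinable Q r p"
  using assms by (auto simp: joinable_def ptgt_conv pcomp_def)

lemma pmult_assoc: "pmult Q (pmult Q x y) z = pmult Q x (pmult Q y z)"
proof (induction x rule: lincomb_induct)
  case (single p a)
  show ?case
  proof (induction y rule: lincomb_induct)
    case (single q b)
    show ?case
    proof (induction z rule: lincomb_induct)
      case (single r c)
      show ?case
        by (auto simp: pmult_single joinable_pcomp mult.assoc) (auto simp: pcomp_def)
    qed (auto simp: pmult_add_right)
  qed (auto simp: pmult_add_right pmult_add_left)
qed (auto simp: pmult_add_left)

lemma pmult_one_left:
  assumes "finite (verts Q)" "x \<in> path_span (paths Q)"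
  shows "pmult Q (\<Sum>v\<in>verts Q. kpath (v, [])) x = x"
proof (induction x rule: lincomb_induct)
  case (single p c)
  have "fst p \<in> verts Q"
    using single assms(2) by (auto simp: path_span_def paths_def pre_digraph.awalk_def)
  thus ?case using assms(1) unfolding pmult_sum_left
    by (subst sum.remove[of _ "fst p"])
       (auto simp: pmult_single joinable_def ptgt_conv pcomp_def intro!: sum.neutral)
qed (auto simp: pmult_add_right)

lemma (in wf_digraph) ptgt_in_verts: "p \<in> paths G \<Longrightarrow> ptgt G p \<in> verts G"
  by (auto simp: paths_def ptgt_def awlast_in_verts)

lemma pmult_one_right:
  assumes "wf_digraph Q" "finite (verts Q)" "x \<in> path_span (paths Q)"
  shows "pmult Q x (\<Sum>v\<in>verts Q. kpath (v, [])) = x"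
proof (induction x rule: lincomb_induct)
  case (single p c)
  have "ptgt Q p \<in> verts Q"
    using single assms(3) by (intro wf_digraph.ptgt_in_verts[OF assms(1)]) (auto simp: path_span_def)
  thus ?case using assms(2) unfolding pmult_sum_right
    by (subst sum.remove[of _ "ptgt Q p"])
       (auto simp: pmult_single joinable_def pcomp_def intro!: sum.neutral)
qed (auto simp: pmult_add_left)

lemma (in wf_digraph) pcomp_in_paths:
  assumes "p \<in> paths G" "q \<in> paths G" "joinable G p q"
  shows "pcomp p q \<in> paths G"
proof -
  obtain v w where p: "awalk (fst p) (snd p) v" and q: "awalk (fst q) (snd q) w"
    using assms(1,2) unfolding paths_def by auto
  have "v = fst q"
    using p assms(3) unfolding joinable_def ptgt_def by (metis awalkE')
  with p q have "awalk (fst p) (snd p @ snd q) w"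
    by (metis awalk_appendI)
  then show ?thesis
    unfolding pcomp_def paths_def by blast
qed

lemma path_span_closed:
  "0 \<in> path_span P" "x \<in> path_span P \<Longrightarrow> y \<in> path_span P \<Longrightarrow> x + y \<in> path_span P"
  "x \<in> path_span P \<Longrightarrow> - x \<in> path_span P"
  using Poly_Mapping.keys_add[of x y] by (auto simp: path_span_def in_keys_iff)

lemma path_span_sum: "(\<And>i. i \<in> S \<Longrightarrow> f i \<in> path_span P) \<Longrightarrow> sum f S \<in> path_span P"
  by (induction S rule: infinite_finite_induct) (auto intro: path_span_closed)

lemma path_span_single: "p \<in> P \<Longrightarrow> Poly_Mapping.single p c \<in> path_span P"
  by (auto simp: path_span_def)

lemma pmult_closed:
  assumes "wf_digraph Q" "x \<in> path_span (paths Q)" "y \<in> path_span (paths Q)"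
  shows "pmult Q x y \<in> path_span (paths Q)"
proof -
  have "(if joinable Q p q
      then Poly_Mapping.single (pcomp p q) (Poly_Mapping.lookup x p * Poly_Mapping.lookup y q)
      else 0) \<in> path_span (paths Q)"
    if "p \<in> Poly_Mapping.keys x" "q \<in> Poly_Mapping.keys y" for p q
  proof (cases "joinable Q p q")
    case True
    have "p \<in> paths Q" "q \<in> paths Q"
      using that assms(2,3) unfolding path_span_def by blast+
    then show ?thesis
      using True by (simp add: path_span_single wf_digraph.pcomp_in_paths[OF assms(1)])
  qed (simp add: path_span_closed(1))
  then show ?thesis
    unfolding pmult_def by (intro path_span_sum)
qed

text \<open>The unit needs finitely many vertices.\<close>
lemma ring_path_algebra:
  assumes "wf_digraph Q" "finite (verts Q)"
  shows "ring (path_algebra Q :: ('v, 'e, 'k::field) lincomb ring)"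
proof (rule ringI)
  show "abelian_group (path_algebra Q :: ('v, 'e, 'k) lincomb ring)"
  proof (rule abelian_groupI)
    fix x :: "('v, 'e, 'k) lincomb" assume "x \<in> carrier (path_algebra Q)"
    thus "\<exists>y\<in>carrier (path_algebra Q). y \<oplus>\<^bsub>path_algebra Q\<^esub> x = \<zero>\<^bsub>path_algebra Q\<^esub>"
      by (intro bexI[of _ "- x"]) (auto simp: path_algebra_def path_span_closed)
  qed (auto simp: path_algebra_def path_span_closed algebra_simps)
  have "(v, []) \<in> paths Q" if "v \<in> verts Q" for v
    using that by (auto simp: paths_def pre_digraph.awalk_def pre_digraph.cas.simps)
  hence one: "(\<Sum>v\<in>verts Q. kpath (v, [])) \<in> (path_span (paths Q) :: ('v, 'e, 'k) lincomb set)"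
    by (intro path_span_sum path_span_single)
  show "Group.monoid (path_algebra Q :: ('v, 'e, 'k) lincomb ring)"
    unfolding path_algebra_def
    by (rule monoidI; unfold partial_object.simps monoid.simps)
       (rule pmult_closed[OF assms(1)] one pmult_assoc pmult_one_left[OF assms(2)]
         pmult_one_right[OF assms]; assumption)+
qed (simp_all only: path_algebra_def partial_object.simps monoid.simps ring.simps
       pmult_add_left pmult_add_right)

text \<open>The projection from the path algebra onto its quotient by I.\<close>
definition proj :: "('v, 'e) pre_digraph \<Rightarrow> ('v, 'e, 'k::field) lincomb set \<Rightarrow>
    ('v, 'e, 'k) lincomb \<Rightarrow> ('v, 'e, 'k) lincomb set"
  where "proj Q I x = I +>\<^bsub>path_algebra Q\<^esub> x"

text \<open>Linear independence of the family of the classes of the paths in P; the coefficients are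
  the coefficients of x.\<close>
definition proj_independent :: "('v, 'e) pre_digraph \<Rightarrow> ('v, 'e, 'k::field) lincomb set \<Rightarrow>
    ('v, 'e) path set \<Rightarrow> bool"
  where "proj_independent Q I P \<longleftrightarrow>
    (\<forall>x \<in> path_span P.
       finsum (path_algebra Q Quot I)
         (\<lambda>p. proj Q I (kscale (Poly_Mapping.lookup x p) (kpath p))) (Poly_Mapping.keys x)
         = \<zero>\<^bsub>path_algebra Q Quot I\<^esub>
       \<longrightarrow> x = 0)"


section \<open>Reduction systems\<close>

type_synonym ('v, 'e, 'k) redsys = "(('v, 'e) path \<times> ('v, 'e, 'k) lincomb) set"

definition path_parallel :: "('v, 'e) pre_digraph \<Rightarrow> ('v, 'e, 'k::field) lincomb \<Rightarrow> ('v, 'e) path \<Rightarrow> bool"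
  where "path_parallel Q f s \<longleftrightarrow> (\<forall>p\<in>Poly_Mapping.keys f. psrc p = psrc s \<and> ptgt Q p = ptgt Q s)"

definition reduction_system :: "('v, 'e) pre_digraph \<Rightarrow> ('v, 'e, 'k::field) redsys \<Rightarrow> bool"
  where "reduction_system Q R \<longleftrightarrow>
    (\<forall>(s, f)\<in>R. s \<in> paths_ge Q 0 \<and> f \<in> carrier (path_algebra Q) \<and> path_parallel Q f s \<and> f \<noteq> kpath s) \<and>
    (\<forall>(s, f)\<in>R. \<forall>(s', f')\<in>R. (s, f) \<noteq> (s', f') \<longrightarrow> \<not> path_divides Q s s')"

definition basic_red :: "('v, 'e) pre_digraph \<Rightarrow> ('v, 'e) path \<Rightarrow> ('v, 'e) path \<Rightarrow> ('v, 'e) path \<Rightarrow>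
    ('v, 'e, 'k::field) lincomb \<Rightarrow> ('v, 'e, 'k) lincomb \<Rightarrow> ('v, 'e, 'k) lincomb"
  where "basic_red Q a s c f x =
    (\<Sum>q\<in>Poly_Mapping.keys x. kscale (Poly_Mapping.lookup x q)
       (if q = pcomp (pcomp a s) c then pmult Q (pmult Q (kpath a) f) (kpath c) else kpath q))"

definition basic_reductions :: "('v, 'e) pre_digraph \<Rightarrow> ('v, 'e, 'k::field) redsys \<Rightarrow>
    (('v, 'e, 'k) lincomb \<Rightarrow> ('v, 'e, 'k) lincomb) set"
  where "basic_reductions Q R =
    {basic_red Q a s c f | a s c f.
       (s, f) \<in> R \<and> a \<in> paths Q \<and> c \<in> paths Q \<and> joinable Q a s \<and> joinable Q s c}"

text \<open>The list holds the basic reductions in the order in which they are applied.\<close>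
definition reductions :: "('v, 'e) pre_digraph \<Rightarrow> ('v, 'e, 'k::field) redsys \<Rightarrow>
    (('v, 'e, 'k) lincomb \<Rightarrow> ('v, 'e, 'k) lincomb) set"
  where "reductions Q R = {fold id rs | rs. set rs \<subseteq> basic_reductions Q R}"

definition irreducible_elt :: "('v, 'e) pre_digraph \<Rightarrow> ('v, 'e, 'k::field) redsys \<Rightarrow>
    ('v, 'e, 'k) lincomb \<Rightarrow> bool"
  where "irreducible_elt Q R x \<longleftrightarrow> (\<forall>r\<in>basic_reductions Q R. r x = x)"

definition irreducible_paths :: "('v, 'e) pre_digraph \<Rightarrow> ('v, 'e, 'k::field) redsys \<Rightarrow>
    ('v, 'e) path set"
  where "irreducible_paths Q R = {p \<in> paths Q. irreducible_elt Q R (kpath p)}"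

definition reduction_finite :: "('v, 'e) pre_digraph \<Rightarrow> ('v, 'e, 'k::field) redsys \<Rightarrow>
    ('v, 'e) path \<Rightarrow> bool"
  where "reduction_finite Q R p \<longleftrightarrow>
    (\<forall>r :: nat \<Rightarrow> _. range r \<subseteq> basic_reductions Q R \<longrightarrow>
       (\<exists>N. \<forall>n\<ge>N. fold r [0..<n] (kpath p) = fold r [0..<N] (kpath p)))"

definition reduction_unique :: "('v, 'e) pre_digraph \<Rightarrow> ('v, 'e, 'k::field) redsys \<Rightarrow>
    ('v, 'e) path \<Rightarrow> bool"
  where "reduction_unique Q R p \<longleftrightarrow> reduction_finite Q R p \<and>
    (\<forall>r\<in>reductions Q R. \<forall>r'\<in>reductions Q R.
       irreducible_elt Q R (r (kpath p)) \<and> irreducible_elt Q R (r' (kpath p)) \<longrightarrow>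
       r (kpath p) = r' (kpath p))"

definition diamond :: "('v, 'e) pre_digraph \<Rightarrow> ('v, 'e, 'k::field) redsys \<Rightarrow>
    ('v, 'e, 'k) lincomb set \<Rightarrow> bool"
  where "diamond Q R I \<longleftrightarrow>
    I = Idl\<^bsub>path_algebra Q\<^esub> {kpath s - f | s f. (s, f) \<in> R} \<and>
    (\<forall>p\<in>paths Q. reduction_unique Q R p) \<and>
    (\<forall>(s, f)\<in>R. irreducible_elt Q R f)"

text \<open>The preorder on scalar multiples of paths; its field consists of the \<open>\<lambda> p\<close> with
  \<open>\<lambda> \<noteq> 0\<close>, and of 0.\<close>
inductive red_le :: "('v, 'e) pre_digraph \<Rightarrow> ('v, 'e, 'k::field) redsys \<Rightarrow>
    ('v, 'e, 'k) lincomb \<Rightarrow> ('v, 'e, 'k) lincomb \<Rightarrow> bool" for Q R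
  where
    refl: "p \<in> paths Q \<Longrightarrow> red_le Q R (Poly_Mapping.single p l) (Poly_Mapping.single p l)"
  | refl_zero: "red_le Q R 0 0"
  | trans: "red_le Q R x y \<Longrightarrow> red_le Q R y z \<Longrightarrow> red_le Q R x z"
  | reduce: "p \<in> paths Q \<Longrightarrow> q \<in> paths Q \<Longrightarrow> l \<noteq> 0 \<Longrightarrow> m \<noteq> 0 \<Longrightarrow> r \<in> reductions Q R \<Longrightarrow>
      r (Poly_Mapping.single q m) = Poly_Mapping.single p l + x \<Longrightarrow> p \<notin> Poly_Mapping.keys x \<Longrightarrow>
      red_le Q R (Poly_Mapping.single p l) (Poly_Mapping.single q m)"
  | zero: "p \<in> paths Q \<Longrightarrow> red_le Q R 0 (Poly_Mapping.single p l)"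

definition red_less :: "('v, 'e) pre_digraph \<Rightarrow> ('v, 'e, 'k::field) redsys \<Rightarrow>
    ('v, 'e, 'k) lincomb \<Rightarrow> ('v, 'e, 'k) lincomb \<Rightarrow> bool"
  where "red_less Q R x y \<longleftrightarrow> red_le Q R x y \<and> x \<noteq> y"


section \<open>Ambiguities\<close>

text \<open>The list is \<open>u\<^sub>0, \<dots>, u\<^sub>n\<close>.\<close>
definition is_left_factorization :: "('v, 'e) pre_digraph \<Rightarrow> ('v, 'e, 'k::field) redsys \<Rightarrow>
    nat \<Rightarrow> ('v, 'e) path \<Rightarrow> ('v, 'e) path list \<Rightarrow> bool"
  where "is_left_factorization Q R n p us \<longleftrightarrow>
    length us = Suc n \<and> p = pconcat us \<and> us ! 0 \<in> paths_len Q 1 \<and>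
    (\<forall>i\<in>{1..n}. us ! i \<in> irreducible_paths Q R) \<and>
    (\<forall>i<n. joinable Q (us ! i) (us ! Suc i) \<and>
       pcomp (us ! i) (us ! Suc i) \<notin> irreducible_paths Q R \<and>
       (\<forall>d\<in>paths Q. left_divides Q d (us ! Suc i) \<and> d \<noteq> us ! Suc i \<longrightarrow>
          pcomp (us ! i) d \<in> irreducible_paths Q R))"

text \<open>The list is \<open>v\<^sub>0, \<dots>, v\<^sub>n\<close>, whereas the product is \<open>v\<^sub>n \<cdots> v\<^sub>0\<close>.\<close>
definition is_right_factorization :: "('v, 'e) pre_digraph \<Rightarrow> ('v, 'e, 'k::field) redsys \<Rightarrow>
    nat \<Rightarrow> ('v, 'e) path \<Rightarrow> ('v, 'e) path list \<Rightarrow> bool"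
  where "is_right_factorization Q R n p vs \<longleftrightarrow>
    length vs = Suc n \<and> p = pconcat (rev vs) \<and> vs ! 0 \<in> paths_len Q 1 \<and>
    (\<forall>i\<in>{1..n}. vs ! i \<in> irreducible_paths Q R) \<and>
    (\<forall>i<n. joinable Q (vs ! Suc i) (vs ! i) \<and>
       pcomp (vs ! Suc i) (vs ! i) \<notin> irreducible_paths Q R \<and>
       (\<forall>d\<in>paths Q. right_divides Q d (vs ! Suc i) \<and> d \<noteq> vs ! Suc i \<longrightarrow>
          pcomp d (vs ! i) \<in> irreducible_paths Q R))"

definition left_factorization :: "('v, 'e) pre_digraph \<Rightarrow> ('v, 'e, 'k::field) redsys \<Rightarrow>
    nat \<Rightarrow> ('v, 'e) path \<Rightarrow> ('v, 'e) path list"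
  where "left_factorization Q R n p = (THE us. is_left_factorization Q R n p us)"

definition right_factorization :: "('v, 'e) pre_digraph \<Rightarrow> ('v, 'e, 'k::field) redsys \<Rightarrow>
    nat \<Rightarrow> ('v, 'e) path \<Rightarrow> ('v, 'e) path list"
  where "right_factorization Q R n p = (THE vs. is_right_factorization Q R n p vs)"

definition ambiguities :: "('v, 'e) pre_digraph \<Rightarrow> ('v, 'e, 'k::field) redsys \<Rightarrow>
    int \<Rightarrow> ('v, 'e) path set"
  where "ambiguities Q R n =
    (if n = -1 then paths_len Q 0
     else if n = 0 then paths_len Q 1
     else if n = 1 then fst ` R
     else {p \<in> paths Q. n \<ge> 2 \<and> (\<exists>us. is_left_factorization Q R (nat n) p us)})"


section \<open>Bimodules and tensor products\<close>

text \<open>As with \<^const>\<open>free_Abelian_group\<close>, the underlying abelian groups are monoid records,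
  written multiplicatively.\<close>

record ('a, 'm) bimod = "'m monoid" +
  lact :: "'a \<Rightarrow> 'm \<Rightarrow> 'm"
  ract :: "'m \<Rightarrow> 'a \<Rightarrow> 'm"

definition bimod_hom :: "('a, 'z) ring_scheme \<Rightarrow> ('a, 'm, 'x) bimod_scheme \<Rightarrow>
    ('a, 'n, 'y) bimod_scheme \<Rightarrow> ('m \<Rightarrow> 'n) set"
  where "bimod_hom A M N = {f \<in> hom M N. \<forall>a\<in>carrier A. \<forall>x\<in>carrier M.
    f (lact M a x) = lact N a (f x) \<and> f (ract M x a) = ract N (f x) a}"

definition regular_bimod :: "('a, 'z) ring_scheme \<Rightarrow> ('a, 'a) bimod"
  where "regular_bimod A = \<lparr>carrier = carrier A, monoid.mult = ring.add A, one = ring.zero A,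
    lact = monoid.mult A, ract = monoid.mult A\<rparr>"

text \<open>
  For a ring A, a subring E of some ring with a homomorphism \<open>\<phi>\<close> from E to A, and an
  E-bimodule M, the A-bimodule \<open>A \<otimes>\<^sub>E M \<otimes>\<^sub>E A\<close> is the free abelian group on
  \<open>A \<times> M \<times> A\<close> modulo the relations making \<open>x \<otimes> m \<otimes> y\<close> additive in each argument
  and E-balanced in both places.
\<close>

definition tensor_rels :: "('a, 'z) ring_scheme \<Rightarrow> 'r set \<Rightarrow> ('r \<Rightarrow> 'a) \<Rightarrow>
    ('r, 'm, 'y) bimod_scheme \<Rightarrow> ('a \<times> 'm \<times> 'a \<Rightarrow>\<^sub>0 int) set"
  where "tensor_rels A E \<phi> M =
    {frag_of (x \<oplus>\<^bsub>A\<^esub> x', m, y) - frag_of (x, m, y) - frag_of (x', m, y) | x x' m y.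
       x \<in> carrier A \<and> x' \<in> carrier A \<and> m \<in> carrier M \<and> y \<in> carrier A} \<union>
    {frag_of (x, m \<otimes>\<^bsub>M\<^esub> m', y) - frag_of (x, m, y) - frag_of (x, m', y) | x m m' y.
       x \<in> carrier A \<and> m \<in> carrier M \<and> m' \<in> carrier M \<and> y \<in> carrier A} \<union>
    {frag_of (x, m, y \<oplus>\<^bsub>A\<^esub> y') - frag_of (x, m, y) - frag_of (x, m, y') | x m y y'.
       x \<in> carrier A \<and> m \<in> carrier M \<and> y \<in> carrier A \<and> y' \<in> carrier A} \<union>
    {frag_of (x \<otimes>\<^bsub>A\<^esub> \<phi> e, m, y) - frag_of (x, lact M e m, y) | x e m y.
       x \<in> carrier A \<and> e \<in> E \<and> m \<in> carrier M \<and> y \<in> carrier A} \<union>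
    {frag_of (x, ract M m e, y) - frag_of (x, m, \<phi> e \<otimes>\<^bsub>A\<^esub> y) | x e m y.
       x \<in> carrier A \<and> e \<in> E \<and> m \<in> carrier M \<and> y \<in> carrier A}"

definition tensor_free :: "('a, 'z) ring_scheme \<Rightarrow> ('r, 'm, 'y) bimod_scheme \<Rightarrow>
    ('a \<times> 'm \<times> 'a \<Rightarrow>\<^sub>0 int) monoid"
  where "tensor_free A M = free_Abelian_group (carrier A \<times> carrier M \<times> carrier A)"

definition tensor_null :: "('a, 'z) ring_scheme \<Rightarrow> 'r set \<Rightarrow> ('r \<Rightarrow> 'a) \<Rightarrow>
    ('r, 'm, 'y) bimod_scheme \<Rightarrow> ('a \<times> 'm \<times> 'a \<Rightarrow>\<^sub>0 int) set"
  where "tensor_null A E \<phi> M = generate (tensor_free A M) (tensor_rels A E \<phi> M)"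

definition tensor :: "('a, 'z) ring_scheme \<Rightarrow> 'r set \<Rightarrow> ('r \<Rightarrow> 'a) \<Rightarrow>
    ('r, 'm, 'y) bimod_scheme \<Rightarrow> ('a, ('a \<times> 'm \<times> 'a \<Rightarrow>\<^sub>0 int) set) bimod"
  where "tensor A E \<phi> M =
   (let F = tensor_free A M; N = tensor_null A E \<phi> M in
    \<lparr>carrier = carrier (F Mod N), monoid.mult = monoid.mult (F Mod N), one = one (F Mod N),
     lact = (\<lambda>a C. \<Union>c\<in>C. N #>\<^bsub>F\<^esub> frag_extend (\<lambda>(x, m, y). frag_of (a \<otimes>\<^bsub>A\<^esub> x, m, y)) c),
     ract = (\<lambda>C a. \<Union>c\<in>C. N #>\<^bsub>F\<^esub> frag_extend (\<lambda>(x, m, y). frag_of (x, m, y \<otimes>\<^bsub>A\<^esub> a)) c)\<rparr>)"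

definition pure_tensor :: "('a, 'z) ring_scheme \<Rightarrow> 'r set \<Rightarrow> ('r \<Rightarrow> 'a) \<Rightarrow>
    ('r, 'm, 'y) bimod_scheme \<Rightarrow> 'a \<Rightarrow> 'm \<Rightarrow> 'a \<Rightarrow> ('a \<times> 'm \<times> 'a \<Rightarrow>\<^sub>0 int) set"
  where "pure_tensor A E \<phi> M x m y =
    tensor_null A E \<phi> M #>\<^bsub>tensor_free A M\<^esub> frag_of (x, m, y)"


section \<open>The bimodules \<open>A \<otimes>\<^sub>E k\<A>\<^sub>n \<otimes>\<^sub>E A\<close> and the maps \<open>\<delta>\<^sub>n\<close>\<close>

text \<open>The span of a set of paths, as a bimodule over the span of the vertices.\<close>
definition span_bimod :: "('v, 'e) pre_digraph \<Rightarrow> ('v, 'e) path set \<Rightarrow>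
    (('v, 'e, 'k::field) lincomb, ('v, 'e, 'k) lincomb) bimod"
  where "span_bimod Q P = \<lparr>carrier = path_span P, monoid.mult = (+), one = 0,
    lact = pmult Q, ract = pmult Q\<rparr>"

type_synonym ('v, 'e, 'k) algelt = "('v, 'e, 'k) lincomb set"
type_synonym ('v, 'e, 'k) tenselt =
  "(('v, 'e, 'k) algelt \<times> ('v, 'e, 'k) lincomb \<times> ('v, 'e, 'k) algelt \<Rightarrow>\<^sub>0 int) set"

definition resbimod :: "('v, 'e) pre_digraph \<Rightarrow> ('v, 'e, 'k::field) lincomb set \<Rightarrow>
    ('v, 'e, 'k) redsys \<Rightarrow> int \<Rightarrow> (('v, 'e, 'k) algelt, ('v, 'e, 'k) tenselt) bimod"
  where "resbimod Q I R n = tensor (path_algebra Q Quot I) (path_span (paths_len Q 0)) (proj Q I)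
    (span_bimod Q (ambiguities Q R n))"

definition tens :: "('v, 'e) pre_digraph \<Rightarrow> ('v, 'e, 'k::field) lincomb set \<Rightarrow>
    ('v, 'e, 'k) redsys \<Rightarrow> int \<Rightarrow>
    ('v, 'e, 'k) algelt \<Rightarrow> ('v, 'e, 'k) lincomb \<Rightarrow> ('v, 'e, 'k) algelt \<Rightarrow> ('v, 'e, 'k) tenselt"
  where "tens Q I R n = pure_tensor (path_algebra Q Quot I) (path_span (paths_len Q 0)) (proj Q I)
    (span_bimod Q (ambiguities Q R n))"

text \<open>
  The value of \<open>\<delta>\<^sub>n\<close> on \<open>1 \<otimes> q \<otimes> 1\<close>.  Under the identification of
  \<open>A \<otimes>\<^sub>E kQ\<^sub>0 \<otimes>\<^sub>E A\<close> with \<open>A \<otimes>\<^sub>E A\<close>, an element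
  \<open>x \<otimes> y\<close> of the latter is \<open>x \<otimes> 1 \<otimes> y\<close>, where 1 is the sum of the vertices.
\<close>
definition delta_gen :: "('v, 'e) pre_digraph \<Rightarrow> ('v, 'e, 'k::field) lincomb set \<Rightarrow>
    ('v, 'e, 'k) redsys \<Rightarrow> nat \<Rightarrow> ('v, 'e) path \<Rightarrow> ('v, 'e, 'k) tenselt"
  where "delta_gen Q I R n q =
   (let A = path_algebra Q Quot I; T = resbimod Q I R (int n - 1); t = tens Q I R (int n - 1);
        \<pi> = (\<lambda>p. proj Q I (kpath p)) in
    if n = 0 then
      t (\<pi> q) \<one>\<^bsub>path_algebra Q\<^esub> \<one>\<^bsub>A\<^esub> \<otimes>\<^bsub>T\<^esub> inv\<^bsub>T\<^esub> t \<one>\<^bsub>A\<^esub> \<one>\<^bsub>path_algebra Q\<^esub> (\<pi> q)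
    else if even n then
      let us = left_factorization Q R n q; vs = right_factorization Q R n q in
      t (\<pi> (vs ! n)) (kpath (pconcat (rev (take n vs)))) \<one>\<^bsub>A\<^esub> \<otimes>\<^bsub>T\<^esub>
      inv\<^bsub>T\<^esub> t \<one>\<^bsub>A\<^esub> (kpath (pconcat (take n us))) (\<pi> (us ! n))
    else
      finprod T (\<lambda>(a, p, c). t (\<pi> a) (kpath p) (\<pi> c))
        {(a, p, c). p \<in> ambiguities Q R (int n - 1) \<and> a \<in> paths Q \<and> c \<in> paths Q \<and>
           joinable Q a p \<and> joinable Q p c \<and> pcomp (pcomp a p) c = q})"

text \<open>Bimodule maps are only determined on the carrier, hence the restriction to extensional
  functions.\<close>
definition delta :: "('v, 'e) pre_digraph \<Rightarrow> ('v, 'e, 'k::field) lincomb set \<Rightarrow>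
    ('v, 'e, 'k) redsys \<Rightarrow> nat \<Rightarrow> ('v, 'e, 'k) tenselt \<Rightarrow> ('v, 'e, 'k) tenselt"
  where "delta Q I R n =
   (let A = path_algebra Q Quot I in
    THE f. f \<in> bimod_hom A (resbimod Q I R (int n)) (resbimod Q I R (int n - 1)) \<and>
      f \<in> extensional (carrier (resbimod Q I R (int n))) \<and>
      (\<forall>q\<in>ambiguities Q R (int n).
         f (tens Q I R (int n) \<one>\<^bsub>A\<^esub> (kpath q) \<one>\<^bsub>A\<^esub>) = delta_gen Q I R n q))"

text \<open>The map \<open>\<delta>\<^sub>-\<^sub>1\<close>: under the same identification, the multiplication of A.\<close>
definition delta_aug :: "('v, 'e) pre_digraph \<Rightarrow> ('v, 'e, 'k::field) lincomb set \<Rightarrow>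
    ('v, 'e, 'k) redsys \<Rightarrow> ('v, 'e, 'k) tenselt \<Rightarrow> ('v, 'e, 'k) algelt"
  where "delta_aug Q I R =
   (let A = path_algebra Q Quot I in
    THE f. f \<in> bimod_hom A (resbimod Q I R (-1)) (regular_bimod A) \<and>
      f \<in> extensional (carrier (resbimod Q I R (-1))) \<and>
      (\<forall>x\<in>carrier A. \<forall>e\<in>path_span (paths_len Q 0). \<forall>y\<in>carrier A.
         f (tens Q I R (-1) x e y) = x \<otimes>\<^bsub>A\<^esub> proj Q I e \<otimes>\<^bsub>A\<^esub> y))"

definition Lbar :: "('v, 'e) pre_digraph \<Rightarrow> ('v, 'e, 'k::field) lincomb set \<Rightarrow>
    ('v, 'e, 'k) redsys \<Rightarrow> int \<Rightarrow> ('v, 'e, 'k) lincomb \<Rightarrow> ('v, 'e, 'k) tenselt set"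
  where "Lbar Q I R n z =
    {tens Q I R n (proj Q I (kscale l (kpath b))) (kpath p) (proj Q I (kpath b')) | l b p b'.
       b \<in> irreducible_paths Q R \<and> b' \<in> irreducible_paths Q R \<and> p \<in> ambiguities Q R n \<and>
       red_less Q R (kscale l (pmult Q (pmult Q (kpath b) (kpath p)) (kpath b'))) z}"

end

theory Submission
  imports Defs
begin

text \<open>
  Write elements of \<open>A \<otimes> k\<A>\<^sub>n \<otimes> A\<close> as combinations of triples of paths with irreducible outer
  components.  For the monomial algebra with the same tips, the maps \<open>\<delta>\<^sub>n\<close> have a contracting
  homotopy S that is read off from the positions of ambiguities in words.  In A itself the identity
  \<open>\<delta> S + S \<delta> = 1\<close> still holds modulo terms that are smaller in the order \<open>\<prec>\<close>, which is
  well-founded.  So the differentials can be chosen degree by degree: \<open>\<delta>(q)\<close> is corrected by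
  terms below q to a cycle, and the new differential is exact because \<open>1 - d S - S d\<close> is nilpotent
  on every element.
\<close>

text \<open>A preimage supplied by bare exactness could contain terms above q, so exactness is
  carried through the recursion in a form that also bounds weights. The order compares multiples
  \<open>\<lambda> p\<close>, not paths: changing the coefficient of a lower term may destroy
  comparability. Hence spaces of lower terms are integral spans, and apart from signs a scalar is
  applied to a term only together with its bound. Triples are kept unreduced as long as possible,
  because then their product is a definite word, and both \<open>\<delta>\<close> and S merely move
  the two cuts in this word. The map \<open>rho\<close> replaces the outer paths by normal forms and
  strictly lowers every term with a reducible outer path; this produces the error terms of the
  monomial identity. The remaining cancellation rests on an adjunction between the first end to the
  right and the last start to the left that make a segment reducible; it also makes left and right
  factorizations agree. Degrees are shifted by one: n counts the factors of an ambiguity, vertices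
  have degree 0, and the parities of \<open>\<delta>\<close> are reversed.\<close>

definition scl :: "'k::field \<Rightarrow> ('a \<Rightarrow>\<^sub>0 'k) \<Rightarrow> ('a \<Rightarrow>\<^sub>0 'k)"
  where "scl c x = Poly_Mapping.map ((*) c) x"

text \<open>Linear extension of a map given on a basis. Nearly all operators below are of this form,
  so identities between them are checked on single basis elements.\<close>

definition lin :: "('a \<Rightarrow> ('b \<Rightarrow>\<^sub>0 'k::field)) \<Rightarrow> ('a \<Rightarrow>\<^sub>0 'k) \<Rightarrow> ('b \<Rightarrow>\<^sub>0 'k)"
  where "lin g x = (\<Sum>a\<in>Poly_Mapping.keys x. scl (Poly_Mapping.lookup x a) (g a))"

lemma lookup_scl [simp]: "Poly_Mapping.lookup (scl c x) a = c * Poly_Mapping.lookup x a"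
  by (simp add: scl_def map.rep_eq when_def)

lemma kscale_eq_scl: "kscale = scl"
  by (simp add: fun_eq_iff kscale_def scl_def)

lemma scl_simps [simp]:
  "scl c 0 = 0" "scl 0 x = 0" "scl 1 x = x" "scl c (scl d x) = scl (c * d) x"
  "scl c (Poly_Mapping.single a d) = Poly_Mapping.single a (c * d)"
  by (rule poly_mapping_eqI; simp add: lookup_single when_def)+

lemma scl_add: "scl c (x + y) = scl c x + scl c y" "scl (c + d) x = scl c x + scl d x"
  by (rule poly_mapping_eqI; simp add: lookup_add algebra_simps)+

lemma scl_diff: "scl c (x - y) = scl c x - scl c y"
  by (rule poly_mapping_eqI; simp add: lookup_minus algebra_simps)

lemma scl_minus: "scl c (- x) = - scl c x"
  by (rule poly_mapping_eqI; simp)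

lemma scl_uminus_one: "scl (- 1) x = - x"
  by (rule poly_mapping_eqI; simp)

lemma scl_sum: "scl c (sum f S) = (\<Sum>i\<in>S. scl c (f i))"
  by (induction S rule: infinite_finite_induct) (auto simp: scl_add)

lemma keys_scl: "Poly_Mapping.keys (scl c x) \<subseteq> Poly_Mapping.keys x"
  by (auto simp: in_keys_iff)

lemma keys_scl_eq: "c \<noteq> 0 \<Longrightarrow> Poly_Mapping.keys (scl c x) = Poly_Mapping.keys x"
  by (auto simp: in_keys_iff)

lemma keys_sum_subset:
  "(\<And>i. i \<in> S \<Longrightarrow> Poly_Mapping.keys (f i) \<subseteq> K) \<Longrightarrow> Poly_Mapping.keys (sum f S) \<subseteq> K"
  by (induction S rule: infinite_finite_induct) (auto dest!: subsetD[OF keys_add])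

lemma lin_superset:
  assumes "finite S" "Poly_Mapping.keys x \<subseteq> S"
  shows "lin g x = (\<Sum>a\<in>S. scl (Poly_Mapping.lookup x a) (g a))"
  unfolding lin_def using assms
  by (intro sum.mono_neutral_left) (auto simp: in_keys_iff)

lemma lin_zero [simp]: "lin g 0 = 0"
  by (simp add: lin_def)

lemma lin_single [simp]: "lin g (Poly_Mapping.single a c) = scl c (g a)"
  by (subst lin_superset[of "{a}"]) auto

lemma lin_add: "lin g (x + y) = lin g x + lin g y"
  using keys_add[of x y]
  by (simp add: lin_superset[of "Poly_Mapping.keys x \<union> Poly_Mapping.keys y"] lookup_add scl_add
      sum.distrib)

lemma lin_scl: "lin g (scl c x) = scl c (lin g x)"
  using keys_scl[of c x]
  by (simp add: lin_superset[of "Poly_Mapping.keys x"] scl_sum)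

lemma lin_minus: "lin g (- x) = - lin g x"
  using lin_scl[of g "- 1" x] by (simp add: scl_uminus_one)

lemma lin_diff: "lin g (x - y) = lin g x - lin g y"
  using lin_add[of g x "- y"] by (simp add: lin_minus)

lemma lin_sum: "lin g (sum f S) = (\<Sum>i\<in>S. lin g (f i))"
  by (induction S rule: infinite_finite_induct) (auto simp: lin_add)

lemma lin_lin: "lin g (lin h x) = lin (\<lambda>a. lin g (h a)) x"
  by (simp add: lin_def[of h] lin_def[of "\<lambda>a. lin g (h a)"] lin_sum lin_scl)

lemma lin_cong:
  assumes "\<And>a. a \<in> Poly_Mapping.keys x \<Longrightarrow> g a = h a"
  shows "lin g x = lin h x"
  unfolding lin_def using assms by (intro sum.cong) auto

lemma lin_kpath [simp]: "lin (\<lambda>a. Poly_Mapping.single a 1) x = x"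
  by (rule poly_mapping_eqI) (auto simp: lin_def lookup_sum lookup_single when_def in_keys_iff)

lemma lin_fun_add: "lin (\<lambda>a. g a + h a) x = lin g x + lin h x"
  by (simp add: lin_def scl_add sum.distrib)

lemma lin_fun_scl: "lin (\<lambda>a. scl c (g a)) x = scl c (lin g x)"
  by (simp add: lin_def scl_sum mult.commute)

lemma lin_fun_zero [simp]: "lin (\<lambda>a. 0) x = 0"
  by (simp add: lin_def)

lemma keys_lin:
  assumes "\<And>a. a \<in> Poly_Mapping.keys x \<Longrightarrow> Poly_Mapping.keys (g a) \<subseteq> K"
  shows "Poly_Mapping.keys (lin g x) \<subseteq> K"
  unfolding lin_def by (intro keys_sum_subset order_trans[OF keys_scl assms])

lemma lincomb_expand: "x = (\<Sum>a\<in>Poly_Mapping.keys x. Poly_Mapping.single a (Poly_Mapping.lookup x a))"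
  by (rule poly_mapping_eqI) (auto simp: lookup_sum lookup_single when_def in_keys_iff)

text \<open>With a fixed index set K a hypothesis on the support of x becomes a hypothesis on one
  index, while sums need no side condition.\<close>

lemma keys_induct [consumes 1, case_names zero single add]:
  assumes "Poly_Mapping.keys x \<subseteq> K" "P 0"
    "\<And>a c. a \<in> K \<Longrightarrow> P (Poly_Mapping.single a c)" "\<And>y z. P y \<Longrightarrow> P z \<Longrightarrow> P (y + z)"
  shows "P (x :: 'a \<Rightarrow>\<^sub>0 'k::field)"
proof -
  have "P (\<Sum>a\<in>S. Poly_Mapping.single a (Poly_Mapping.lookup x a))" if "S \<subseteq> K" for S
    using that assms(2-4) by (induction S rule: infinite_finite_induct) auto
  then show ?thesis using assms(1) lincomb_expand[of x] by metis
qed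

section \<open>Chains of tips in a word\<close>

text \<open>Positions in a word are integers, and \<open>red i j\<close> says that the segment from i to j is reducible.
  Left factorizations are greedy: every break in \<open>chain red hi i\<close> is the first position at which
  the segment starting two breaks earlier becomes reducible, and \<open>hi + 1\<close> if there is none.
  Right factorizations are obtained by mirroring the word.\<close>
definition nxt :: "(int \<Rightarrow> int \<Rightarrow> bool) \<Rightarrow> int \<Rightarrow> int \<Rightarrow> int"
  where "nxt red hi i = Min (insert (hi + 1) {j. i \<le> j \<and> j \<le> hi \<and> red i j})"

fun chain :: "(int \<Rightarrow> int \<Rightarrow> bool) \<Rightarrow> int \<Rightarrow> int \<Rightarrow> nat \<Rightarrow> int"
  where
    "chain red hi i 0 = i"
  | "chain red hi i (Suc 0) = i + 1"
  | "chain red hi i (Suc (Suc n)) = nxt red hi (chain red hi i n)"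

text \<open>The inequality at m = n concerns the break after the last one; for
  \<open>n \<ge> 2\<close> it says that the last factor is irreducible. The inequalities before it
  say the same of the earlier factors. Since n counts factors, this describes
  (n-1)-ambiguities.\<close>

definition amb :: "(int \<Rightarrow> int \<Rightarrow> bool) \<Rightarrow> int \<Rightarrow> nat \<Rightarrow> int \<Rightarrow> int \<Rightarrow> bool"
  where "amb red hi n i j \<longleftrightarrow> chain red hi i n = j \<and> j \<le> hi \<and>
    (\<forall>m\<le>n. chain red hi i m < chain red hi i (Suc m))"

abbreviation flip :: "(int \<Rightarrow> int \<Rightarrow> bool) \<Rightarrow> int \<Rightarrow> int \<Rightarrow> bool"
  where "flip red \<equiv> \<lambda>i j. red (- j) (- i)"

text \<open>The only input about tips: a segment that contains a reducible one is reducible, and a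
  reducible segment has length at least 2, as tips have.\<close>

locale tips =
  fixes red :: "int \<Rightarrow> int \<Rightarrow> bool" and lo hi :: int
  assumes mono: "red i j \<Longrightarrow> lo \<le> i' \<Longrightarrow> i' \<le> i \<Longrightarrow> j \<le> j' \<Longrightarrow> j' \<le> hi \<Longrightarrow> red i' j'"
    and bound: "red i j \<Longrightarrow> lo \<le> i \<and> i + 2 \<le> j \<and> j \<le> hi"
begin

abbreviation "nx \<equiv> nxt red hi"
abbreviation "B \<equiv> chain red hi"
abbreviation "Amb \<equiv> amb red hi"
text \<open>Breaks of the right factorization of a segment ending at j: the greedy chain of the
  mirrored word, with negated positions.\<close>

abbreviation "C \<equiv> \<lambda>j n. - chain (flip red) (- lo) (- j) n"
abbreviation "pv \<equiv> \<lambda>j. - nxt (flip red) (- lo) (- j)"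

lemma flip: "tips (flip red) (- hi) (- lo)"
proof
  fix i j i' j' assume "red (- j) (- i)" "- hi \<le> i'" "i' \<le> i" "j \<le> j'" "j' \<le> - lo"
  then show "red (- j') (- i')" using mono[of "- j" "- i" "- j'" "- i'"] by auto
next
  fix i j assume "red (- j) (- i)" then show "- hi \<le> i \<and> i + 2 \<le> j \<and> j \<le> - lo"
    using bound[of "- j" "- i"] by auto
qed

lemma nxt_fin: "finite {j. i \<le> j \<and> j \<le> hi \<and> red i j}"
  by (rule finite_subset[of _ "{i..hi}"]) auto

text \<open>The default value hi + 1 exceeds every admissible j, so the case in which no reducible
  end exists needs no separate treatment.\<close>

lemma nxt_le_iff: "lo \<le> i \<Longrightarrow> j \<le> hi \<Longrightarrow> nx i \<le> j \<longleftrightarrow> red i j"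
  unfolding nxt_def using nxt_fin[of i] mono[of i _ i j] bound[of i j]
  by (subst Min_le_iff) (auto intro!: exI[of _ j])

lemma nxt_upper: "nx i \<le> hi + 1"
  unfolding nxt_def using nxt_fin[of i] by (subst Min_le_iff) auto

lemma nxt_lower: "i + 1 \<le> hi \<Longrightarrow> i + 2 \<le> nx i"
  unfolding nxt_def using nxt_fin[of i] bound by (subst Min_ge_iff) auto

lemma nxt_mono: "lo \<le> i \<Longrightarrow> i \<le> i' \<Longrightarrow> nx i \<le> nx i'"
proof (cases "nx i' \<le> hi")
  case True
  moreover assume "lo \<le> i" "i \<le> i'"
  moreover have "red i' (nx i')" using nxt_le_iff[of i' "nx i'"] True \<open>lo \<le> i\<close> \<open>i \<le> i'\<close> by auto
  ultimately have "red i (nx i')" using mono by blast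
  then show ?thesis using nxt_le_iff[of i "nx i'"] True \<open>lo \<le> i\<close> by auto
qed (use nxt_upper[of i] nxt_upper[of i'] in auto)

text \<open>Both inequalities say that the segment from i to j is reducible. In this form the
  statement is an adjunction between \<open>nx\<close> and \<open>pv\<close>, which is what makes
  left chains and right chains comparable.\<close>

lemma galois: "lo \<le> i \<Longrightarrow> j \<le> hi \<Longrightarrow> nx i \<le> j \<longleftrightarrow> i \<le> pv j"
proof -
  assume a: "lo \<le> i" "j \<le> hi"
  have "- pv j \<le> - i \<longleftrightarrow> red i j"
    using tips.nxt_le_iff[OF flip, of "- j" "- i"] a by auto
  then show ?thesis using nxt_le_iff[OF a] by auto
qed

lemma nxt_ge: "i \<le> hi + 1 \<Longrightarrow> i \<le> nx i"
  unfolding nxt_def using nxt_fin[of i] by (subst Min_ge_iff) auto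

lemma chain_bounds: "lo \<le> i \<Longrightarrow> i \<le> hi \<Longrightarrow> i \<le> B i n \<and> B i n \<le> hi + 1"
proof (induction n rule: induct_nat_012)
  case (ge2 n)
  then show ?case using nxt_ge[of "B i n"] nxt_upper[of "B i n"] by auto
qed auto

lemma chain_lo: "lo \<le> i \<Longrightarrow> i \<le> hi \<Longrightarrow> lo \<le> B i n"
  using chain_bounds[of i n] by auto

lemma chain_mono:
  assumes "lo \<le> i" "i \<le> i'" "i' \<le> hi" shows "B i n \<le> B i' n"
  using assms
proof (induction n rule: induct_nat_012)
  case (ge2 n)
  then show ?case using chain_lo[of i n] by (auto intro!: nxt_mono)
qed auto

text \<open>A chain advances by two indices at a time, so even and odd breaks are two separate
  sequences. Here the base case is \<open>i + 1 \<le> i'\<close>, and monotonicity of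
  \<open>nx\<close> does the rest.\<close>

lemma chain_shift_even:
  assumes "lo \<le> i" "i < i'" "i' \<le> hi" "even n" shows "B i (Suc n) \<le> B i' n"
  using assms
proof (induction n rule: induct_nat_012)
  case (ge2 n)
  then show ?case using chain_lo[of i "Suc n"] by (auto intro!: nxt_mono)
qed auto

text \<open>The base case \<open>B i' 1 = i' + 1 \<le> nx i = B i 2\<close> is where the hypothesis
  on \<open>i'\<close> enters; \<open>nx\<close> carries it two indices further each time.\<close>

lemma chain_shift_odd:
  assumes "lo \<le> i" "i \<le> hi" "lo \<le> i'" "i' \<le> hi" "i' < nx i" "odd n" shows "B i' n \<le> B i (Suc n)"
  using assms
proof (induction n rule: induct_nat_012)
  case (ge2 n)
  then show ?case using chain_lo[of i' n] by (auto intro!: nxt_mono)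
qed auto

lemma amb_bounds:
  assumes "lo \<le> i" "Amb n i j" shows "i \<le> j" "i \<le> hi" "j \<le> hi" "lo \<le> j"
proof -
  have *: "i + int m \<le> B i m" if "m \<le> n" for m
    using that assms(2)
  proof (induction m)
    case (Suc m)
    then show ?case using Suc by (auto simp: amb_def dest!: spec[of _ m])
  qed auto
  show "j \<le> hi" using assms(2) by (auto simp: amb_def)
  show "i \<le> j" using *[of n] assms(2) by (auto simp: amb_def)
  then show "i \<le> hi" "lo \<le> j" using assms \<open>j \<le> hi\<close> by auto
qed

text \<open>Moving two breaks turns \<open>nx\<close> on one side into \<open>pv\<close> on the
  other, so both inequalities pass from m to m + 2 through the adjunction. The cases m = 0 and m = 1
  use that both kinds of chain begin with a factor of length 1.\<close>

lemma interleave: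
  assumes "lo \<le> i" "Amb n i j" "m \<le> n"
  shows "B i (n - m) \<le> C j m \<and> C j m < B i (Suc (n - m))"
  using assms(3)
proof (induction m rule: induct_nat_012)
  case 0
  then show ?case using assms(2) by (auto simp: amb_def)
next
  case 1
  then show ?case using assms(2) by (auto simp: amb_def Suc_diff_Suc dest!: spec[of _ "n - 1"])
next
  case (ge2 m)
  have 1: "Suc (Suc (n - Suc (Suc m))) = n - m" "Suc (Suc (Suc (n - Suc (Suc m)))) = Suc (n - m)"
    using ge2.prems by auto
  have IH: "B i (n - m) \<le> C j m" "C j m < B i (Suc (n - m))" using ge2 by auto
  have hi: "i \<le> hi" using amb_bounds[OF assms(1,2)] by auto
  have "C j m \<le> hi"
    using IH(2) chain_bounds[OF assms(1) hi, of "Suc (n - m)"] by auto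
  then show ?case
    using galois[of "B i (n - Suc (Suc m))" "C j m"] galois[of "B i (Suc (n - Suc (Suc m)))" "C j m"]
      IH chain_lo[OF assms(1) hi] by (auto simp flip: 1)
qed

text \<open>Consecutive right breaks are strictly ordered because a left break separates them. Only
  the final inequality, which looks beyond the start i, needs the adjunction once more. This is the
  coincidence of left and right factorizations.\<close>

lemma amb_flip:
  assumes "lo \<le> i" "Amb n i j" shows "amb (flip red) (- lo) n (- j) (- i)"
proof -
  have hi: "i \<le> hi" using amb_bounds[OF assms] by auto
  have "C j (Suc m) < C j m" if m: "m \<le> n" for m
  proof (cases "m = n")
    case False
    then have "Suc m \<le> n" using m by auto
    then show ?thesis
      using interleave[OF assms, of m] interleave[OF assms, of "Suc m"] by (auto simp: Suc_diff_le Suc_diff_Suc)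
  next
    case True
    show ?thesis
    proof (cases n)
      case (Suc n')
      have "C j n' < nx i" using interleave[OF assms, of n'] Suc by (auto simp: numeral_2_eq_2)
      moreover have "C j n' \<le> hi"
        using interleave[OF assms, of n'] chain_bounds[OF assms(1) hi, of "Suc (n - n')"] Suc by auto
      ultimately show ?thesis
        using galois[of i "C j n'"] interleave[OF assms, of n] assms(1) Suc True by auto
    qed (auto simp: True)
  qed
  moreover have "C j n = i" using interleave[OF assms, of n] by auto
  ultimately show ?thesis using assms(1) by (auto simp: amb_def)
qed

lemma amb_flip_iff:
  assumes "lo \<le> i" "j \<le> hi" shows "amb (flip red) (- lo) n (- j) (- i) \<longleftrightarrow> Amb n i j"
  using amb_flip[OF assms(1)] tips.amb_flip[OF flip, of "- j" n "- i"] assms by auto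

lemma chain_eq: "Amb n i j \<Longrightarrow> B i n = j"
  unfolding amb_def by blast

lemma chain_flip_eq: "lo \<le> i \<Longrightarrow> Amb n i j \<Longrightarrow> C j n = i"
  using amb_flip[of i n j] unfolding amb_def by simp

lemma amb_fun: "Amb n i j \<Longrightarrow> Amb n i j' \<Longrightarrow> j = j'"
  by (auto simp: amb_def)

lemma amb_inj: "lo \<le> i \<Longrightarrow> lo \<le> i' \<Longrightarrow> Amb n i j \<Longrightarrow> Amb n i' j \<Longrightarrow> i = i'"
  using amb_flip[of i n j] amb_flip[of i' n j] by (auto simp: amb_def)

text \<open>Monotone chains give the weak inequality; equal ends would force equal starts by
  \<open>amb_inj\<close>.\<close>

lemma amb_mono: "lo \<le> i \<Longrightarrow> i < i' \<Longrightarrow> Amb n i j \<Longrightarrow> Amb n i' j' \<Longrightarrow> j < j'"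
  using chain_mono[of i i' n] amb_bounds[of i' n j'] amb_inj[of i i' n j] by (force simp: amb_def)

lemma amb_prefix: "Amb (Suc n) i j \<Longrightarrow> Amb n i (B i n) \<and> B i n < j"
  by (auto simp: amb_def dest: spec[of _ n])

lemma amb_suffix:
  assumes "lo \<le> i" "Amb (Suc n) i j" shows "Amb n (C j n) j" "i < C j n"
proof -
  have f: "amb (flip red) (- lo) n (- j) (- C j n) \<and> - C j n < - i"
    using tips.amb_prefix[OF flip amb_flip[OF assms]] by simp
  then show "i < C j n" by auto
  then show "Amb n (C j n) j"
    using f amb_flip_iff[of "C j n" j n] assms amb_bounds[OF assms] by auto
qed

text \<open>The next break is \<open>nx (B i n)\<close>, and it lies in the word iff the segment
  from \<open>B i n\<close> to the end is reducible. The break after that starts from j; as the tail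
  is irreducible it falls beyond the end and imposes no further condition.\<close>

lemma amb_extend:
  assumes "lo \<le> i" "Amb (Suc n) i j" "\<not> red j hi"
  shows "(\<exists>J. Amb (Suc (Suc n)) i J) \<longleftrightarrow> red (B i n) hi"
proof -
  have hi: "i \<le> hi" "j \<le> hi" "lo \<le> j" and j: "B i (Suc n) = j" using amb_bounds[OF assms(1,2)] assms by (auto simp: amb_def)
  have "nx j > hi" using nxt_le_iff[of j hi] assms hi by auto
  then show ?thesis
    using nxt_le_iff[of "B i n" hi] chain_lo[OF assms(1) hi(1), of n] assms(2) j
    by (auto simp: amb_def le_Suc_eq)
qed

lemma amb_extend_left:
  assumes "lo \<le> i" "Amb (Suc n) i j" "\<not> red lo i"
  shows "(\<exists>I\<ge>lo. Amb (Suc (Suc n)) I j) \<longleftrightarrow> red lo (C j n)"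
proof -
  have "(\<exists>J. amb (flip red) (- lo) (Suc (Suc n)) (- j) J) \<longleftrightarrow> red lo (C j n)"
    using tips.amb_extend[OF flip _ amb_flip[OF assms(1,2)]] amb_bounds[OF assms(1,2)] assms(3) by simp
  moreover have "(\<exists>J. amb (flip red) (- lo) (Suc (Suc n)) (- j) J) \<longleftrightarrow> (\<exists>I\<ge>lo. Amb (Suc (Suc n)) I j)"
  proof
    assume "\<exists>J. amb (flip red) (- lo) (Suc (Suc n)) (- j) J"
    then obtain J where J: "amb (flip red) (- lo) (Suc (Suc n)) (- j) J" by blast
    then have "lo \<le> - J" unfolding amb_def by linarith
    then show "\<exists>I\<ge>lo. Amb (Suc (Suc n)) I j"
      using amb_flip_iff[of "- J" j "Suc (Suc n)"] J amb_bounds[OF assms(1,2)] by (intro exI[of _ "- J"]) simp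
  next
    assume "\<exists>I\<ge>lo. Amb (Suc (Suc n)) I j"
    then show "\<exists>J. amb (flip red) (- lo) (Suc (Suc n)) (- j) J"
      using amb_flip by blast
  qed
  ultimately show ?thesis by simp
qed

text \<open>Modulo lower terms only the ambiguities with irreducible surroundings survive.\<close>
definition Good :: "nat \<Rightarrow> int \<Rightarrow> int \<Rightarrow> bool"
  where "Good n i j \<longleftrightarrow> lo \<le> i \<and> Amb n i j \<and> \<not> red lo i \<and> \<not> red j hi"

lemma good_less: "Good n i j \<Longrightarrow> i < nx lo"
  using nxt_le_iff[of lo i] amb_bounds[of i n j] by (auto simp: Good_def)

lemma goodD: "Good n i j \<Longrightarrow> lo \<le> i" "Good n i j \<Longrightarrow> Amb n i j" "Good n i j \<Longrightarrow> i \<le> hi"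
  "Good n i j \<Longrightarrow> j \<le> hi"
  using amb_bounds(2,3)[of i n j] by (simp_all add: Good_def)

text \<open>An occurrence starting after lo also ends after j, and the comparison of right chains at
  the even index n - 1 then pushes its start to k or beyond.\<close>

lemma good_odd_start:
  assumes "odd n" "Amb n lo j" "lo \<le> k" "Amb (n - 1) k j" "Good n i' j'" "i' < k"
  shows "i' = lo"
proof (rule ccontr)
  assume "i' \<noteq> lo"
  then have "lo < i'" using goodD[OF assms(5)] by simp
  then have 1: "j < j'" using amb_mono assms(2) goodD[OF assms(5)] by blast
  have b: "j' \<le> hi" "lo \<le> j" using goodD[OF assms(5)] amb_bounds[OF _ assms(2)] by simp_all
  have "C j (n - 1) \<le> C j' (Suc (n - 1))"
    using tips.chain_shift_even[OF flip, of "- j'" "- j" "n - 1"] 1 b assms(1)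
    by (simp del: chain.simps)
  then have "k \<le> i'"
    using chain_flip_eq[OF assms(3,4)] chain_flip_eq[OF goodD(1,2)[OF assms(5)]] odd_pos[OF assms(1)]
    by (simp del: chain.simps)
  then show False using assms(6) by simp
qed

text \<open>Irreducibility of the prefix gives \<open>i' < nx lo\<close>, which is the condition
  under which an odd chain from \<open>i'\<close> stays behind the chain from lo.\<close>

lemma good_odd_end:
  assumes "odd n" "Amb (Suc n) lo J" "Good n i' j'"
  shows "j' \<le> J"
  using chain_shift_odd[OF _ amb_bounds(2)[OF _ assms(2)] goodD(1,3)[OF assms(3)] good_less[OF assms(3)] assms(1)]
    chain_eq[OF assms(2)] chain_eq[OF goodD(2)[OF assms(3)]] by simp

lemma good_even_prefix:
  assumes "even n" "n > 0" "Amb n lo j" "Good n i' j'"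
  shows "B i' (n - 1) \<le> j"
  using chain_shift_odd[OF _ amb_bounds(2)[OF _ assms(3)] goodD(1,3)[OF assms(4)] good_less[OF assms(4)], of "n - 1"]
    chain_eq[OF assms(3)] assms(1,2) by (simp del: chain.simps)

text \<open>If k differs from lo, the occurrence ends after j, and its right chain lies behind that
  of j, which is still at or beyond \<open>nx lo\<close>. So the segment reaching back to lo is
  reducible and the occurrence extends to the left. From lo itself there is no room to
  extend.\<close>

lemma good_even_left:
  assumes "even n" "n > 0" "Amb n lo j" "Good n k j'"
  shows "(\<exists>i\<ge>lo. Amb (Suc n) i j') \<longleftrightarrow> k \<noteq> lo"
proof
  assume "\<exists>i\<ge>lo. Amb (Suc n) i j'"
  then obtain i where i: "i \<ge> lo" "Amb (Suc n) i j'" by auto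
  have "C j' n = k" using chain_flip_eq goodD(1,2)[OF assms(4)] by blast
  then show "k \<noteq> lo" using amb_suffix[OF i] i by auto
next
  assume "k \<noteq> lo"
  then have k: "lo < k" "Amb n k j'" "\<not> red lo k" using assms(4) by (auto simp: Good_def)
  have 1: "j < j'" using amb_mono[of lo k n j j'] assms k by auto
  have b: "j' \<le> hi" "lo \<le> j" using amb_bounds[of k n j'] amb_bounds[of lo n j] assms k by auto
  obtain n' where n: "n = Suc (Suc n')" using assms(1,2) by (cases n; cases "n - 1") auto
  have "C j n' \<le> C j' (Suc n')"
    using tips.chain_shift_even[OF flip, of "- j'" "- j" n'] 1 b assms(1) n by (auto simp del: chain.simps)
  moreover have "B lo 2 \<le> C j n'" using interleave[of lo n j n'] assms(3) n by (auto simp del: chain.simps simp: numeral_2_eq_2)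
  ultimately have "nx lo \<le> C j' (Suc n')" by (auto simp: numeral_2_eq_2)
  moreover have "C j' (Suc n') \<le> hi"
    using tips.chain_bounds[OF flip, of "- j'" "Suc n'"] b 1 by auto
  ultimately have "red lo (C j' (Suc n'))" using nxt_le_iff[of lo "C j' (Suc n')"] by auto
  then show "\<exists>i\<ge>lo. Amb (Suc n) i j'"
    using amb_extend_left[of k "Suc n'" j'] k n by auto
qed

end

section \<open>Segments of a path\<close>

abbreviation plen :: "('v, 'e) path \<Rightarrow> nat"
  where "plen p \<equiv> length (snd p)"

text \<open>The source is computed as the target of the prefix, so that an empty segment is the
  correct vertex.\<close>

definition seg :: "('v, 'e) pre_digraph \<Rightarrow> ('v, 'e) path \<Rightarrow> nat \<Rightarrow> nat \<Rightarrow> ('v, 'e) path"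
  where "seg Q w i j = (ptgt Q (fst w, take i (snd w)), take (j - i) (drop i (snd w)))"

definition sandwich :: "('v, 'e) pre_digraph \<Rightarrow> ('v, 'e) path \<Rightarrow> ('v, 'e) path \<Rightarrow>
    ('v, 'e, 'k::field) lincomb \<Rightarrow> ('v, 'e, 'k) lincomb"
  where "sandwich Q a c = lin (\<lambda>q. if joinable Q a q \<and> joinable Q q c
    then kpath (pcomp (pcomp a q) c) else 0)"

lemma pmult_scl_left: "pmult Q (scl c x) y = scl c (pmult Q x y)"
proof (induction x rule: lincomb_induct)
  case (single p d)
  show ?case by (induction y rule: lincomb_induct) (auto simp: pmult_single pmult_add_right scl_add mult_ac)
qed (auto simp: pmult_add_left scl_add)

lemma pmult_scl_right: "pmult Q x (scl c y) = scl c (pmult Q x y)"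
proof (induction x rule: lincomb_induct)
  case (single p d)
  show ?case by (induction y rule: lincomb_induct) (auto simp: pmult_single pmult_add_right scl_add mult_ac)
qed (auto simp: pmult_add_left scl_add)

lemma pmult_diff_left: "pmult Q (x - y) z = pmult Q x z - pmult Q y z"
  using pmult_add_left[of Q "x - y" y z] by simp

lemma pmult_diff_right: "pmult Q z (x - y) = pmult Q z x - pmult Q z y"
  using pmult_add_right[of Q z "x - y" y] by simp

lemma sandwich_conv: "sandwich Q a c x = pmult Q (pmult Q (kpath a) x) (kpath c)"
  unfolding sandwich_def
  by (induction x rule: lincomb_induct)
    (auto simp: pmult_single joinable_pcomp lin_add pmult_add_left pmult_add_right)

lemma basic_red_conv:
  "basic_red Q a s c f = lin (\<lambda>q. if q = pcomp (pcomp a s) c then sandwich Q a c f else kpath q)"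
  by (rule ext) (simp add: basic_red_def lin_def kscale_eq_scl sandwich_conv cong: if_cong)

lemma sandwich_kpath:
  "sandwich Q a c (kpath q) = (if joinable Q a q \<and> joinable Q q c then kpath (pcomp (pcomp a q) c) else 0)"
  by (simp add: sandwich_def)

lemma sandwich_linear:
  "sandwich Q a c (x + y) = sandwich Q a c x + sandwich Q a c y"
  "sandwich Q a c (x - y) = sandwich Q a c x - sandwich Q a c y"
  "sandwich Q a c (scl k x) = scl k (sandwich Q a c x)"
  "sandwich Q a c 0 = 0"
  by (simp_all add: sandwich_def lin_add lin_diff lin_scl)

lemma pcomp_cancel:
  assumes "joinable Q a q" "joinable Q a q'" "pcomp (pcomp a q) c = pcomp (pcomp a q') c"
  shows "q = q'"
  using assms by (auto simp: pcomp_def joinable_def intro: prod_eqI)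

lemma ptgt_pcomp: "joinable Q p q \<Longrightarrow> ptgt Q (pcomp p q) = ptgt Q q"
  by (auto simp: ptgt_conv pcomp_def joinable_def)

lemma pcomp_assoc: "pcomp (pcomp p q) r = pcomp p (pcomp q r)"
  by (simp add: pcomp_def)

lemma fst_pcomp [simp]: "fst (pcomp p q) = fst p"
  and plen_pcomp [simp]: "plen (pcomp p q) = plen p + plen q"
  by (simp_all add: pcomp_def)

context wf_digraph
begin

lemma paths_iff: "p \<in> paths G \<longleftrightarrow> fst p \<in> verts G \<and> set (snd p) \<subseteq> arcs G \<and> cas (fst p) (snd p) (ptgt G p)"
proof
  assume "p \<in> paths G"
  then obtain v where "awalk (fst p) (snd p) v" by (auto simp: paths_def)
  then show "fst p \<in> verts G \<and> set (snd p) \<subseteq> arcs G \<and> cas (fst p) (snd p) (ptgt G p)"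
    unfolding ptgt_def by (metis awalk_def awalkE')
next
  assume "fst p \<in> verts G \<and> set (snd p) \<subseteq> arcs G \<and> cas (fst p) (snd p) (ptgt G p)"
  then show "p \<in> paths G" unfolding paths_def awalk_def by (cases p) auto
qed

lemma paths_pcompD:
  assumes "pcomp p q \<in> paths G" "joinable G p q"
  shows "p \<in> paths G" "q \<in> paths G"
proof -
  have t: "ptgt G (pcomp p q) = ptgt G q" using assms(2) by (rule ptgt_pcomp)
  have c: "cas (fst p) (snd p @ snd q) (ptgt G q)" and s: "fst p \<in> verts G" "set (snd p) \<subseteq> arcs G" "set (snd q) \<subseteq> arcs G"
    using assms(1) t by (auto simp: paths_iff pcomp_def)
  then have 1: "cas (fst p) (snd p) (ptgt G p)" "cas (fst q) (snd q) (ptgt G q)"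
    using assms(2) by (auto simp: ptgt_def joinable_def cas_append_iff)
  then show "p \<in> paths G" using s by (auto simp: paths_iff)
  then have "fst q \<in> verts G" using assms(2) ptgt_in_verts[of p] by (simp add: joinable_def)
  then show "q \<in> paths G" using s 1 by (auto simp: paths_iff)
qed

lemma vertex_path: "v \<in> verts G \<Longrightarrow> (v, []) \<in> paths G"
  by (simp add: paths_iff ptgt_conv cas.simps)

lemma fst_in_verts: "p \<in> paths G \<Longrightarrow> fst p \<in> verts G"
  by (simp add: paths_iff)

lemma joinable_vertex [simp]:
  "joinable G (v, []) p \<longleftrightarrow> v = fst p" "joinable G p (v, []) \<longleftrightarrow> ptgt G p = v"
  by (auto simp: joinable_def ptgt_conv)

lemma pcomp_vertex [simp]: "pcomp p (v, []) = p" "fst p = v \<Longrightarrow> pcomp (v, []) p = p"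
  by (auto simp: pcomp_def)

lemma ptgt_vertex [simp]: "ptgt G (v, []) = v"
  by (simp add: ptgt_conv)

lemma plen_seg [simp]: "i \<le> j \<Longrightarrow> j \<le> plen w \<Longrightarrow> plen (seg G w i j) = j - i"
  by (simp add: seg_def)

lemma ptgt_take_drop:
  "i \<le> j \<Longrightarrow> j \<le> length p \<Longrightarrow>
   ptgt G (ptgt G (u, take i p), take (j - i) (drop i p)) = ptgt G (u, take j p)"
proof -
  assume a: "i \<le> j" "j \<le> length p"
  have "take j p = take i p @ take (j - i) (drop i p)" using a by (metis le_add_diff_inverse take_add)
  then show ?thesis by (auto simp: ptgt_conv)
qed

lemma seg_joinable: "i \<le> j \<Longrightarrow> j \<le> plen w \<Longrightarrow> joinable G (seg G w i j) (seg G w j k)"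
  by (simp add: joinable_def seg_def ptgt_take_drop)

lemma seg_pcomp:
  assumes "i \<le> j" "j \<le> k" "k \<le> plen w" shows "pcomp (seg G w i j) (seg G w j k) = seg G w i k"
proof -
  have "take (k - i) (drop i (snd w)) = take (j - i) (drop i (snd w)) @ take (k - j) (drop (j - i) (drop i (snd w)))"
    using assms take_add[of "j - i" "k - j" "drop i (snd w)"] by simp
  then show ?thesis using assms by (simp add: pcomp_def seg_def)
qed

lemma seg_full [simp]: "seg G w 0 (plen w) = w"
  by (simp add: seg_def)

lemma seg_empty: "seg G w i i = (fst (seg G w i j), [])"
  by (simp add: seg_def)

lemma seg_in_paths:
  assumes "w \<in> paths G" "i \<le> j" "j \<le> plen w" shows "seg G w i j \<in> paths G"
proof -
  have w: "w = pcomp (seg G w 0 i) (pcomp (seg G w i j) (seg G w j (plen w)))"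
    using assms by (simp add: seg_pcomp)
  have "joinable G (seg G w 0 i) (pcomp (seg G w i j) (seg G w j (plen w)))"
    using assms by (simp add: seg_pcomp seg_joinable)
  then have "pcomp (seg G w i j) (seg G w j (plen w)) \<in> paths G"
    using w assms(1) paths_pcompD by metis
  then show ?thesis using assms by (meson paths_pcompD seg_joinable)
qed

lemma seg_pcomp_split:
  assumes "joinable G p q" "w = pcomp p q"
  shows "seg G w 0 (plen p) = p" "seg G w (plen p) (plen w) = q"
  using assms by (auto simp: seg_def pcomp_def joinable_def intro: prod_eqI)

lemma seg_pcomp3:
  assumes "joinable G a p" "joinable G p c" "w = pcomp (pcomp a p) c"
  shows "seg G w 0 (plen a) = a" "seg G w (plen a) (plen a + plen p) = p"
    "seg G w (plen a + plen p) (plen w) = c"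
  using assms ptgt_pcomp[OF assms(1)] by (auto simp: seg_def pcomp_def joinable_def intro!: prod_eqI)

lemma seg_seg:
  assumes "i' \<le> j'" "i + j' \<le> j" "j \<le> plen w"
  shows "seg G (seg G w i j) i' j' = seg G w (i + i') (i + j')"
proof -
  have "ptgt G (ptgt G (fst w, take i (snd w)), take i' (take (j - i) (drop i (snd w))))
    = ptgt G (fst w, take (i + i') (snd w))"
    using ptgt_take_drop[of i "i + i'" "snd w" "fst w"] assms by (simp add: min_def)
  then show ?thesis using assms
    by (auto simp: seg_def drop_take min_def add.commute)
qed

end

section \<open>Reductions and normal forms\<close>

locale rsys = wf_digraph Q for Q :: "('v, 'e) pre_digraph" +
  fixes I :: "('v, 'e, 'k::field) lincomb set" and R :: "('v, 'e, 'k) redsys"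
  assumes fin_verts: "finite (verts Q)"
    and ideal_I: "ideal I (path_algebra Q)"
    and redsys: "reduction_system Q R"
    and diam: "diamond Q R I"
    and tips_ge: "fst ` R \<subseteq> paths_ge Q 2"
begin

abbreviation "irrp \<equiv> irreducible_paths Q R"
abbreviation "jn \<equiv> joinable Q"
abbreviation "P \<equiv> paths Q"
abbreviation "sw \<equiv> sandwich Q"

definition par :: "('v, 'e) path \<Rightarrow> ('v, 'e) path \<Rightarrow> bool"
  where "par p q \<longleftrightarrow> fst p = fst q \<and> ptgt Q p = ptgt Q q"

lemma par_simps: "par p q \<Longrightarrow> jn a p \<longleftrightarrow> jn a q" "par p q \<Longrightarrow> jn p c \<longleftrightarrow> jn q c"
  "par p q \<Longrightarrow> par q r \<Longrightarrow> par p r" "par p p"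
  by (auto simp: par_def joinable_def)

lemma par_pcomp: "par p q \<Longrightarrow> jn a p \<Longrightarrow> jn p c \<Longrightarrow> par (pcomp (pcomp a p) c) (pcomp (pcomp a q) c)"
  unfolding par_def by (simp add: joinable_def ptgt_pcomp)

text \<open>Reductions replace a path by combinations of parallel paths. Whether outer paths compose
  with a whole combination can therefore be read off from one representative.\<close>

definition parset :: "('v, 'e) path \<Rightarrow> ('v, 'e) path set"
  where "parset p = {q \<in> P. par q p}"

lemma R_D:
  assumes "(s, f) \<in> R"
  shows "s \<in> P" "Poly_Mapping.keys f \<subseteq> parset s" "f \<noteq> kpath s" "2 \<le> plen s"
proof -
  show "s \<in> P" "f \<noteq> kpath s" "Poly_Mapping.keys f \<subseteq> parset s"
    using redsys assms
    by (fastforce simp: reduction_system_def paths_ge_def paths_len_def path_algebra_def path_span_def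
        path_parallel_def parset_def par_def)+
  show "2 \<le> plen s" using tips_ge assms by (force simp: paths_ge_def paths_len_def)
qed

lemma keys_sandwich:
  assumes "Poly_Mapping.keys f \<subseteq> parset s" "a \<in> P" "c \<in> P" "jn a s" "jn s c"
  shows "Poly_Mapping.keys (sw a c f) \<subseteq> parset (pcomp (pcomp a s) c)"
  unfolding sandwich_def using assms
  by (intro keys_lin) (auto simp: parset_def pcomp_in_paths joinable_pcomp par_simps intro!: par_pcomp)

lemma sandwich_eq_0:
  assumes "Poly_Mapping.keys f \<subseteq> parset s" "\<not> (jn a s \<and> jn s c)" shows "sw a c f = 0"
proof -
  have "sw a c f = lin (\<lambda>_. 0) f" unfolding sandwich_def
    using assms by (intro lin_cong) (auto simp: parset_def par_simps)
  then show ?thesis by simp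
qed

lemma lookup_sandwich:
  assumes "Poly_Mapping.keys f \<subseteq> parset s" "jn a s" "jn s c" "par q s"
  shows "Poly_Mapping.lookup (sw a c f) (pcomp (pcomp a q) c) = Poly_Mapping.lookup f q"
  using assms(1)
proof (induction f rule: keys_induct)
  case (single q' d)
  then have q': "par q' s" by (auto simp: parset_def)
  then show ?case using assms(2-4) pcomp_cancel[of Q a q q' c]
    by (auto simp: sandwich_def par_simps lookup_single when_def)
qed (auto simp: sandwich_linear lookup_add)

lemma basic_redE:
  assumes "r \<in> basic_reductions Q R"
  obtains a s c f where "(s, f) \<in> R" "a \<in> P" "c \<in> P" "jn a s" "jn s c"
    "r = lin (\<lambda>q. if q = pcomp (pcomp a s) c then sw a c f else kpath q)"
  using assms by (auto simp: basic_reductions_def basic_red_conv)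

text \<open>Multiplication by a and c preserves coefficients, so equality here would give f = s,
  which a reduction system excludes.\<close>

lemma basic_red_moves:
  assumes "(s, f) \<in> R" "jn a s" "jn s c"
  shows "sw a c f \<noteq> kpath (pcomp (pcomp a s) c)"
proof
  assume eq: "sw a c f = kpath (pcomp (pcomp a s) c)"
  have "f = kpath s"
  proof (rule poly_mapping_eqI)
    fix q
    show "Poly_Mapping.lookup f q = Poly_Mapping.lookup (kpath s) q"
    proof (cases "par q s")
      case True
      then show ?thesis
        using lookup_sandwich[OF R_D(2)[OF assms(1)] assms(2,3) True] eq pcomp_cancel[of Q a q s c] assms(2,3)
        by (cases "q = s") (auto simp: lookup_single when_def par_simps split: if_splits)
    next
      case False
      then have "q \<notin> Poly_Mapping.keys f" "q \<noteq> s" using R_D(2)[OF assms(1)] by (auto simp: parset_def par_def)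
      then show ?thesis by (auto simp: in_keys_iff lookup_single)
    qed
  qed
  then show False using R_D(3)[OF assms(1)] by blast
qed

definition linear_op :: "(('v, 'e, 'k) lincomb \<Rightarrow> ('v, 'e, 'k) lincomb) \<Rightarrow> bool"
  where "linear_op r \<longleftrightarrow> (\<forall>x y. r (x + y) = r x + r y) \<and> (\<forall>c x. r (scl c x) = scl c (r x))"

lemma linear_opD:
  assumes "linear_op r"
  shows "r (x + y) = r x + r y" "r (scl c x) = scl c (r x)" "r 0 = 0" "r (- x) = - r x" "r (x - y) = r x - r y"
proof -
  show a: "\<And>x y. r (x + y) = r x + r y" and b: "\<And>c x. r (scl c x) = scl c (r x)"
    using assms by (auto simp: linear_op_def)
  show "r 0 = 0" using b[of 0 0] by simp
  show m: "\<And>x. r (- x) = - r x" using b[of "- 1"] by (simp add: scl_uminus_one)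
  show "r (x - y) = r x - r y" using a[of x "- y"] m by simp
qed

lemma linear_op_lin: assumes "linear_op r" shows "r x = lin (\<lambda>p. r (kpath p)) x"
proof (induction x rule: lincomb_induct)
  case (single p c)
  then show ?case using linear_opD(2)[OF assms, of c "kpath p"] by simp
qed (auto simp: linear_opD[OF assms] lin_add)

lemma basic_linear: "r \<in> basic_reductions Q R \<Longrightarrow> linear_op r"
  by (erule basic_redE) (auto simp: linear_op_def lin_add lin_scl)

lemma reductions_induct [consumes 1, case_names id step]:
  assumes "r \<in> reductions Q R" "T (\<lambda>x. x)"
    "\<And>r r'. r \<in> reductions Q R \<Longrightarrow> T r \<Longrightarrow> r' \<in> basic_reductions Q R \<Longrightarrow> T (\<lambda>x. r' (r x))"
  shows "T r"
proof -
  obtain rs where rs: "r = fold id rs" "set rs \<subseteq> basic_reductions Q R"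
    using assms(1) by (auto simp: reductions_def)
  have "T (fold id rs)" using rs(2)
  proof (induction rs rule: rev_induct)
    case Nil then show ?case using assms(2) by (simp add: id_def)
  next
    case (snoc r' rs)
    then have "T (\<lambda>x. r' (fold id rs x))" using assms(3)[of "fold id rs" r'] unfolding reductions_def by fastforce
    then show ?case by (simp add: comp_def id_def)
  qed
  then show ?thesis using rs by simp
qed

lemma reductions_id: "(\<lambda>x. x) \<in> reductions Q R"
  unfolding reductions_def by (rule CollectI, rule exI[of _ "[]"]) (simp add: id_def)

lemma reductions_comp:
  assumes "r \<in> reductions Q R" "r' \<in> reductions Q R" shows "(\<lambda>x. r' (r x)) \<in> reductions Q R"
proof -
  obtain rs rs' where "r = fold id rs" "r' = fold id rs'" "set rs \<subseteq> basic_reductions Q R" "set rs' \<subseteq> basic_reductions Q R"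
    using assms by (auto simp: reductions_def)
  then show ?thesis unfolding reductions_def
    by (intro CollectI exI[of _ "rs @ rs'"]) (simp add: comp_def)
qed

lemma basic_reductions: "r \<in> basic_reductions Q R \<Longrightarrow> r \<in> reductions Q R"
  unfolding reductions_def by (rule CollectI, rule exI[of _ "[r]"]) simp

lemma reductions_linear: "r \<in> reductions Q R \<Longrightarrow> linear_op r"
proof (induction r rule: reductions_induct)
  case (step r r')
  show ?case unfolding linear_op_def
    by (simp add: linear_opD[OF step.IH] linear_opD[OF basic_linear[OF step.hyps(2)]])
qed (simp add: linear_op_def)

lemma basic_parset:
  assumes "r \<in> basic_reductions Q R" "Poly_Mapping.keys x \<subseteq> parset p"
  shows "Poly_Mapping.keys (r x) \<subseteq> parset p"
  using assms(1)
proof (cases rule: basic_redE)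
  case (1 a s c f)
  have "Poly_Mapping.keys (sw a c f) \<subseteq> parset p" if "pcomp (pcomp a s) c \<in> parset p"
    using keys_sandwich[OF R_D(2)[OF 1(1)] 1(2-5)] that
    by (force simp: parset_def intro: par_simps(3))
  moreover have "Poly_Mapping.keys (kpath q) \<subseteq> parset p" if "q \<in> parset p" for q
    using that by simp
  ultimately show ?thesis unfolding 1(6) using assms(2)
    by (intro keys_lin) (simp split: if_splits; metis subsetD)
qed

lemma reductions_parset:
  "r \<in> reductions Q R \<Longrightarrow> Poly_Mapping.keys x \<subseteq> parset p \<Longrightarrow> Poly_Mapping.keys (r x) \<subseteq> parset p"
  by (induction r rule: reductions_induct) (auto simp: basic_parset)

lemma keys_kpath_parset: "p \<in> P \<Longrightarrow> Poly_Mapping.keys (Poly_Mapping.single p c) \<subseteq> parset p"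
  by (auto simp: parset_def par_simps)

lemma reductions_span:
  assumes "r \<in> reductions Q R" "x \<in> path_span P" shows "r x \<in> path_span P"
proof -
  have "Poly_Mapping.keys (r (kpath p)) \<subseteq> P" if "p \<in> P" for p
    using reductions_parset[OF assms(1) keys_kpath_parset[OF that]] by (auto simp: parset_def)
  then have "Poly_Mapping.keys (lin (\<lambda>p. r (kpath p)) x) \<subseteq> P"
    using assms(2) unfolding path_span_def by (intro keys_lin) blast
  then show ?thesis
    using linear_op_lin[OF reductions_linear[OF assms(1)], of x] unfolding path_span_def by simp
qed

text \<open>A basic reduction is the identity on all paths but one, hence differs from the identity
  by a map of rank at most one. This explicit form is what the well-foundedness argument computes
  with.\<close>

lemma basic_shift:
  assumes "r \<in> basic_reductions Q R" "r (kpath p) \<noteq> kpath p"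
  shows "r y = y + scl (Poly_Mapping.lookup y p) (r (kpath p) - kpath p)"
  using assms(1)
proof (cases rule: basic_redE)
  case (1 a s c f)
  then have p: "p = pcomp (pcomp a s) c" using assms(2) by (auto split: if_splits)
  show ?thesis
  proof (induction y rule: lincomb_induct)
    case (add y z)
    then show ?case by (simp add: linear_opD[OF basic_linear[OF assms(1)]] lookup_add scl_add)
  qed (auto simp: 1(6) p lookup_single when_def scl_diff)
qed

text \<open>A basic step at \<open>a' s c'\<close> becomes the step at \<open>a a' s c' c\<close>.
  If these paths do not compose, multiplication kills both sides of the step and the identity serves
  instead. This is the source of the compatibility of the order with multiplication.\<close>

lemma reduction_lift:
  assumes "r \<in> reductions Q R" "a \<in> P" "c \<in> P"
  shows "\<exists>r'\<in>reductions Q R. \<forall>x. r' (sw a c x) = sw a c (r x)"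
  using assms(1)
proof (induction r rule: reductions_induct)
  case id
  show ?case by (rule bexI[OF _ reductions_id]) simp
next
  case (step r r1)
  then obtain r' where r': "r' \<in> reductions Q R" "\<And>x. r' (sw a c x) = sw a c (r x)" by blast
  obtain r2 where r2: "r2 \<in> reductions Q R" "\<And>x. r2 (sw a c x) = sw a c (r1 x)"
    using step.hyps(2)
  proof (cases rule: basic_redE)
    case (1 a' s c' f)
    let ?t = "pcomp (pcomp a' s) c'"
    note r1 = 1(6)
    have keysf: "Poly_Mapping.keys (sw a' c' f) \<subseteq> parset ?t"
      using keys_sandwich[OF R_D(2)[OF 1(1)] 1(2-5)] .
    show ?thesis
    proof (cases "jn a ?t \<and> jn ?t c")
      case True
      then have j: "jn a a'" "jn c' c" using 1 by (simp_all add: joinable_pcomp)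
      let ?r2 = "basic_red Q (pcomp a a') s (pcomp c' c) f"
      have sw: "sw (pcomp a a') (pcomp c' c) f = sw a c (sw a' c' f)"
        unfolding sandwich_conv using j by (simp add: pmult_assoc pmult_single[of _ a 1 a' 1, symmetric] flip: pmult_single)
           (simp add: pmult_single flip: pmult_assoc)
      have eq: "pcomp (pcomp (pcomp a a') s) (pcomp c' c) = pcomp (pcomp a ?t) c" by (simp add: pcomp_assoc)
      have "?r2 \<in> reductions Q R"
        using 1 j assms unfolding basic_reductions_def
        by (intro basic_reductions[unfolded basic_reductions_def] CollectI exI[of _ "pcomp a a'"] exI[of _ s]
            exI[of _ "pcomp c' c"] exI[of _ f]) (simp add: joinable_pcomp pcomp_in_paths)
      moreover have "?r2 (sw a c x) = sw a c (r1 x)" for x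
      proof (induction x rule: lincomb_induct)
        case (single p d)
        have p: "Poly_Mapping.single p d = scl d (kpath p)" by simp
        have "?r2 (sw a c (kpath p)) = sw a c (r1 (kpath p))"
          using True pcomp_cancel[of Q a p ?t c] unfolding basic_red_conv 1(6) eq sw
          by (auto simp: sandwich_kpath)
        then show ?case unfolding p sandwich_linear
          by (simp add: linear_opD[OF basic_linear[OF step.hyps(2)]] sandwich_linear basic_red_conv lin_scl del: scl_simps)
      qed (simp_all add: sandwich_linear linear_opD[OF basic_linear[OF step.hyps(2)]], simp_all add: basic_red_conv lin_add)
      ultimately show ?thesis using that by blast
    next
      case False
      have 0: "sw a c (kpath ?t) = (0 :: ('v, 'e, 'k) lincomb)" using False unfolding sandwich_kpath by (rule if_not_P)
      have 1: "sw a c (sw a' c' f) = 0" by (rule sandwich_eq_0[OF keysf False])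
      have "sw a c (r1 x) = sw a c x" for x
      proof (induction x rule: lincomb_induct)
        case (single p d)
        have p: "Poly_Mapping.single p d = scl d (kpath p)" by simp
        show ?case using 0 1 r1 unfolding p linear_opD[OF basic_linear[OF step.hyps(2)]] sandwich_linear
          by simp
      qed (simp_all add: sandwich_linear linear_opD[OF basic_linear[OF step.hyps(2)]])
      then show ?thesis using that[OF reductions_id] by simp
    qed
  qed
  show ?case by (rule bexI[OF _ reductions_comp[OF r'(1) r2(1)]]) (simp add: r'(2) r2(2))
qed

end

lemma pmult_minus: "pmult Q (- x) y = - pmult Q x y" "pmult Q x (- y) = - pmult Q x y"
  using pmult_scl_left[of Q "- 1" x y] pmult_scl_right[of Q x "- 1" y] by (simp_all add: scl_uminus_one)

lemma single_eq_0_iff [simp]: "Poly_Mapping.single a c = 0 \<longleftrightarrow> c = 0"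
  by (metis keys_single keys_zero insert_not_empty single_zero)

lemma scl_neg: "scl (- c) x = - scl c x"
  by (rule poly_mapping_eqI) simp

context rsys
begin

section \<open>Reduction-finiteness as accessibility of effective steps\<close>

definition stp :: "('v, 'e, 'k) lincomb rel"
  where "stp = {(y, x). \<exists>r\<in>basic_reductions Q R. y = r x \<and> y \<noteq> x}"

text \<open>An infinite descending sequence is an infinite sequence of basic reductions that moves
  the element every time; reduction-finiteness forbids it.\<close>

lemma kpath_acc: assumes "p \<in> P" shows "kpath p \<in> Wellfounded.acc stp"
proof (rule ccontr)
  assume "kpath p \<notin> Wellfounded.acc stp"
  then have "\<exists>f. (f (0::nat) = kpath p \<and> f 0 \<notin> Wellfounded.acc stp) \<and>
     (\<forall>n. f (Suc n) \<notin> Wellfounded.acc stp \<and> (f (Suc n), f n) \<in> stp)"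
    using dependent_nat_choice[of "\<lambda>n x. x \<notin> Wellfounded.acc stp \<and> (n = 0 \<longrightarrow> x = kpath p)" "\<lambda>n x y. (y, x) \<in> stp"]
    by (metis nat.distinct(1) not_acc_down)
  then obtain f where f: "f (0::nat) = kpath p" "\<And>n. (f (Suc n), f n) \<in> stp" by blast
  then have "\<forall>n. \<exists>r\<in>basic_reductions Q R. f (Suc n) = r (f n) \<and> f (Suc n) \<noteq> f n" by (auto simp: stp_def)
  then obtain r where r: "\<And>n. r n \<in> basic_reductions Q R" "\<And>n. f (Suc n) = r n (f n)" "\<And>n. f (Suc n) \<noteq> f n"
    by metis
  have *: "fold r [0..<n] (kpath p) = f n" for n
    by (induction n) (auto simp: f r(2))
  have "reduction_finite Q R p" using diam assms by (auto simp: diamond_def reduction_unique_def)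
  moreover have "range r \<subseteq> basic_reductions Q R" using r(1) by (rule image_subsetI)
  ultimately have "\<exists>N. \<forall>n\<ge>N. fold r [0..<n] (kpath p) = fold r [0..<N] (kpath p)"
    unfolding reduction_finite_def by (elim allE impE)
  then obtain N where N: "\<forall>n\<ge>N. f n = f N" unfolding * by (elim exE)
  show False using r(3)[of N] N[THEN spec[of _ "Suc N"]] by simp
qed

lemma acc_basic:
  assumes "x \<in> Wellfounded.acc stp" "r \<in> basic_reductions Q R" shows "r x \<in> Wellfounded.acc stp"
proof (cases "r x = x")
  case False
  then have "\<exists>r'\<in>basic_reductions Q R. r x = r' x \<and> r x \<noteq> x" by (intro bexI[OF _ assms(2)]) simp
  then have "(r x, x) \<in> stp" unfolding stp_def by simp
  then show ?thesis by (rule acc_downward[OF assms(1)])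
qed (simp add: assms(1))

lemma acc_reduction: "r \<in> reductions Q R \<Longrightarrow> x \<in> Wellfounded.acc stp \<Longrightarrow> r x \<in> Wellfounded.acc stp"
  by (induction r rule: reductions_induct) (simp, blast intro: acc_basic)

lemma acc_irreducible:
  "x \<in> Wellfounded.acc stp \<Longrightarrow> \<exists>r\<in>reductions Q R. irreducible_elt Q R (r x)"
proof (induction x rule: acc_induct_rule)
  case (1 x)
  show ?case
  proof (cases "irreducible_elt Q R x")
    case True
    then show ?thesis by (intro bexI[OF _ reductions_id]) simp
  next
    case False
    then obtain r where r: "r \<in> basic_reductions Q R" "r x \<noteq> x" by (auto simp: irreducible_elt_def)
    then obtain r' where "r' \<in> reductions Q R" "irreducible_elt Q R (r' (r x))"
      using 1(2)[of "r x"] by (auto simp: stp_def)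
    then show ?thesis
      by (intro bexI[OF _ reductions_comp[OF basic_reductions[OF r(1)]]])
  qed
qed

subsection \<open>Well-foundedness\<close>

definition below :: "('v, 'e) path rel"
  where "below = {(p', p). p \<in> P \<and> (\<exists>r\<in>basic_reductions Q R. r (kpath p) \<noteq> kpath p \<and>
    p' \<in> Poly_Mapping.keys (r (kpath p)))}"

text \<open>Cancellation is the difficulty: an infinite descending chain of paths need not give an
  infinite sequence of reductions.  Take an element reachable from a path, minimal among those
  whose support meets the set of bad paths.  Each reduction at a bad path of its support must
  kill its bad part u, and then two such reductions applied alternately make the bad part
  alternate between \<open>p\<close> and \<open>p - u / c\<close> forever.\<close>
lemma wf_below: "wf below"
proof -
  define bad where "bad p \<longleftrightarrow> p \<in> P \<and> p \<notin> Wellfounded.acc below" for p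
  \<comment> \<open>Projection onto the bad part of an element; everything below tracks only this
    part.\<close>
  define \<beta> where "\<beta> = lin (\<lambda>q. if bad q then kpath q else (0 :: ('v, 'e, 'k) lincomb))"
  have \<beta>_add: "\<beta> (x + y) = \<beta> x + \<beta> y" and \<beta>_scl: "\<beta> (scl c x) = scl c (\<beta> x)" and
    \<beta>_diff: "\<beta> (x - y) = \<beta> x - \<beta> y" for x y c
    by (simp_all add: \<beta>_def lin_add lin_scl lin_diff)
  have lookup_\<beta>: "Poly_Mapping.lookup (\<beta> x) p = (if bad p then Poly_Mapping.lookup x p else 0)" for x p
    unfolding \<beta>_def by (induction x rule: lincomb_induct) (auto simp: lin_add lookup_add lookup_single when_def)
  have "\<exists>r\<in>basic_reductions Q R. r (kpath p) \<noteq> kpath p \<and> \<beta> (r (kpath p)) \<noteq> 0" if bad_p: "bad p" for p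
  proof -
    obtain p' where p': "(p', p) \<in> below" "p' \<notin> Wellfounded.acc below"
      using not_acc_down[of p below] bad_p unfolding bad_def by blast
    then obtain r where r: "r \<in> basic_reductions Q R" "r (kpath p) \<noteq> kpath p" "p' \<in> Poly_Mapping.keys (r (kpath p))"
      by (auto simp: below_def)
    have "p' \<in> P" using r basic_parset[OF r(1) keys_kpath_parset, of p] bad_p by (auto simp: parset_def bad_def)
    then have "Poly_Mapping.lookup (\<beta> (r (kpath p))) p' \<noteq> 0"
      using p' r(3) by (simp add: lookup_\<beta> bad_def in_keys_iff)
    then show ?thesis using r by (metis lookup_zero)
  qed
  \<comment> \<open>One reduction is fixed for each bad path. It can be chosen to leave a bad path
    in the result, since a path that is not accessible has another such path below it.\<close>
  then obtain \<rho> where \<rho>: "\<And>p. bad p \<Longrightarrow> \<rho> p \<in> basic_reductions Q R" "\<And>p. bad p \<Longrightarrow> \<rho> p (kpath p) \<noteq> kpath p"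
    "\<And>p. bad p \<Longrightarrow> \<beta> (\<rho> p (kpath p)) \<noteq> 0" by metis
  have shift: "\<rho> p y = y + scl (Poly_Mapping.lookup y p) (\<rho> p (kpath p) - kpath p)" if "bad p" for p y
    using basic_shift[OF \<rho>(1,2)[OF that]] .
  have moves: "\<rho> p y \<noteq> y" if "bad p" "Poly_Mapping.lookup y p \<noteq> 0" for p y
  proof
    assume "\<rho> p y = y"
    then have "scl (Poly_Mapping.lookup y p) (\<rho> p (kpath p) - kpath p) = 0" using shift[OF that(1), of y] by simp
    then have "scl (inverse (Poly_Mapping.lookup y p)) (scl (Poly_Mapping.lookup y p) (\<rho> p (kpath p) - kpath p)) = 0" by simp
    then show False using that \<rho>(2)[of p] by simp
  qed
  have stp\<rho>: "(\<rho> p y, y) \<in> stp" if "bad p" "Poly_Mapping.lookup y p \<noteq> 0" for p y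
    using moves[OF that] \<rho>(1)[OF that(1)] by (auto simp: stp_def)
  have \<beta>_kpath: "\<beta> (kpath p) = kpath p" if "bad p" for p using that by (simp add: \<beta>_def)
  have \<beta>_minus: "\<beta> (- x) = - \<beta> x" for x by (simp add: \<beta>_def lin_minus)
  have \<beta>_single: "\<beta> (Poly_Mapping.single p c) = Poly_Mapping.single p c" if "bad p" for p c using that by (simp add: \<beta>_def)
  \<comment> \<open>Induction over accessible elements plays the part of choosing a minimal one:
    every element one step further already has bad part 0.\<close>
  have no_bad: "\<beta> x = 0" if "x \<in> Wellfounded.acc stp" for x
    using that
  proof (induction x rule: acc_induct_rule)
    case (1 x)
    show ?case
    proof (rule ccontr)
      assume u0: "\<beta> x \<noteq> 0"
      define u where "u = \<beta> x"
      \<comment> \<open>The step at p makes the bad part vanish, so u plus the coefficient of p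
        times the bad part of \<open>\<rho> p (kpath p) - kpath p\<close> is 0. Solving this gives
        the formula.\<close>
      have u: "\<beta> (\<rho> p (kpath p)) = kpath p - scl (inverse (Poly_Mapping.lookup u p)) u"
        if "p \<in> Poly_Mapping.keys u" for p
      proof -
        have p: "bad p" "Poly_Mapping.lookup x p \<noteq> 0" "Poly_Mapping.lookup u p = Poly_Mapping.lookup x p"
          using that by (auto simp: u_def in_keys_iff lookup_\<beta> split: if_splits)
        have "\<beta> (\<rho> p x) = 0" using 1(2)[OF stp\<rho>[OF p(1,2)]] .
        then have "u + scl (Poly_Mapping.lookup u p) (\<beta> (\<rho> p (kpath p)) - kpath p) = 0"
          by (subst (asm) shift[OF p(1)]) (simp add: \<beta>_add \<beta>_scl \<beta>_diff u_def[symmetric] \<beta>_kpath[OF p(1)] p(3))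
        then have "scl (inverse (Poly_Mapping.lookup u p)) (u + scl (Poly_Mapping.lookup u p) (\<beta> (\<rho> p (kpath p)) - kpath p)) = 0" by simp
        then have "scl (inverse (Poly_Mapping.lookup u p)) u + (\<beta> (\<rho> p (kpath p)) - kpath p) = 0"
          using p by (simp add: scl_add)
        moreover have "\<beta> (\<rho> p (kpath p)) = (scl (inverse (Poly_Mapping.lookup u p)) u + (\<beta> (\<rho> p (kpath p)) - kpath p))
          + (kpath p - scl (inverse (Poly_Mapping.lookup u p)) u)" by simp
        ultimately show ?thesis by simp
      qed
      have bad_u: "bad p" if "p \<in> Poly_Mapping.keys u" for p
        using that by (auto simp: u_def in_keys_iff lookup_\<beta> split: if_splits)
      obtain p where p: "p \<in> Poly_Mapping.keys u"
        using u0 unfolding u_def by (metis in_keys_iff lookup_zero poly_mapping_eqI)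
      \<comment> \<open>Were p the only bad path in the support, u would be a multiple of p, and the
        formula just proved would give bad part 0 for the reduced p, contrary to the choice of
        \<rho>.\<close>
      obtain p' where p': "p' \<in> Poly_Mapping.keys u" "p' \<noteq> p"
      proof (rule ccontr)
        assume "\<not> thesis"
        then have "Poly_Mapping.keys u \<subseteq> {p}" using that by blast
        then have "kpath p = scl (inverse (Poly_Mapping.lookup u p)) u" using p
          by (intro poly_mapping_eqI) (auto simp: lookup_single when_def in_keys_iff)
        then show False using \<rho>(3)[OF bad_u[OF p]] u[OF p] by simp
      qed
      define c where "c = inverse (Poly_Mapping.lookup u p)"
      define c' where "c' = inverse (Poly_Mapping.lookup u p')"
      have c: "c \<noteq> 0" "Poly_Mapping.lookup u p * c = 1" "c' \<noteq> 0" "Poly_Mapping.lookup u p' * c' = 1"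
        using p p' by (auto simp: c_def c'_def in_keys_iff)
      \<comment> \<open>Each of the two bad parts is one step away from the other: the reduction at
        p subtracts c u, and the reduction at \<open>p'\<close>, which meets the coefficient
        \<open>- c\<close> times that of u, adds it back. So neither occurs on an accessible
        element, although the path p itself has the first one.\<close>
      have "\<beta> y \<noteq> kpath p \<and> \<beta> y \<noteq> kpath p - scl c u" if "y \<in> Wellfounded.acc stp" for y
        using that
      proof (induction y rule: acc_induct_rule)
        case (1 y)
        have "\<beta> y \<noteq> kpath p"
        proof
          assume y: "\<beta> y = kpath p"
          have ly: "Poly_Mapping.lookup y p = 1" using y lookup_\<beta>[of y p] bad_u[OF p] by simp
          have "\<beta> (\<rho> p y) = kpath p - scl c u"
            by (subst shift[OF bad_u[OF p]]) (simp add: \<beta>_add \<beta>_scl \<beta>_diff y u[OF p] \<beta>_kpath[OF bad_u[OF p]] ly c_def)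
          then show False using 1(2)[OF stp\<rho>[OF bad_u[OF p], of y]] ly by simp
        qed
        moreover have "\<beta> y \<noteq> kpath p - scl c u"
        proof
          assume y: "\<beta> y = kpath p - scl c u"
          have ly: "Poly_Mapping.lookup y p' = - (c * Poly_Mapping.lookup u p')"
            using arg_cong[OF y, of "\<lambda>z. Poly_Mapping.lookup z p'"] lookup_\<beta>[of y p'] bad_u[OF p'(1)] p'(2)
            by (simp add: lookup_minus lookup_single)
          have "\<beta> (\<rho> p' y) = kpath p"
            using c(4) by (subst shift[OF bad_u[OF p'(1)]])
             (simp add: \<beta>_add \<beta>_scl \<beta>_diff y u[OF p'(1)] \<beta>_kpath[OF bad_u[OF p'(1)]] ly c'_def[symmetric]
               scl_minus mult.assoc scl_diff scl_neg single_uminus \<beta>_minus \<beta>_single[OF bad_u[OF p'(1)]])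
          then show False using 1(2)[OF stp\<rho>[OF bad_u[OF p'(1)], of y]] ly c p' by (simp add: in_keys_iff)
        qed
        ultimately show ?case by blast
      qed
      then show False using kpath_acc[of p] bad_u[OF p] \<beta>_kpath[of p] by (auto simp: bad_def)
    qed
  qed
  have "\<not> bad p" for p
    using no_bad[OF kpath_acc[of p]] \<beta>_kpath[of p] by (auto simp: bad_def)
  then have "p \<in> Wellfounded.acc below" for p
    by (cases "p \<in> P") (auto simp: bad_def below_def intro: accI)
  then show ?thesis by (simp add: wf_iff_acc)
qed

subsection \<open>Normal forms\<close>

definition nfp :: "('v, 'e) path \<Rightarrow> ('v, 'e, 'k) lincomb"
  where "nfp p = (if p \<in> P then SOME y. \<exists>r\<in>reductions Q R. y = r (kpath p) \<and> irreducible_elt Q R y else kpath p)"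

definition nf :: "('v, 'e, 'k) lincomb \<Rightarrow> ('v, 'e, 'k) lincomb"
  where "nf = lin nfp"

lemma nf_linear:
  "nf 0 = 0" "nf (x + y) = nf x + nf y" "nf (x - y) = nf x - nf y" "nf (scl c x) = scl c (nf x)" "nf (- x) = - nf x"
  by (simp_all add: nf_def lin_add lin_diff lin_scl lin_minus)

lemma nfp_eq:
  assumes "p \<in> P" "r \<in> reductions Q R" "irreducible_elt Q R (r (kpath p))"
  shows "r (kpath p) = nfp p"
proof -
  have "\<exists>r\<in>reductions Q R. nfp p = r (kpath p) \<and> irreducible_elt Q R (nfp p)"
    using assms unfolding nfp_def by simp (rule someI_ex, blast)
  then obtain r' where r': "r' \<in> reductions Q R" "nfp p = r' (kpath p)" "irreducible_elt Q R (r' (kpath p))" by auto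
  have "reduction_unique Q R p" using diam assms(1) by (auto simp: diamond_def)
  then show ?thesis using r' assms unfolding reduction_unique_def by simp
qed

lemma irr_reduction: assumes "r \<in> reductions Q R" "irreducible_elt Q R x" shows "r x = x"
  using assms(1) by (induction r rule: reductions_induct) (use assms(2) in \<open>auto simp: irreducible_elt_def\<close>)

text \<open>Later reductions fix whatever is already irreducible, so the paths can be treated one
  after another by one composite reduction. Consequently the linear map \<open>nf\<close> agrees on
  any given element with a reduction.\<close>

lemma simultaneous:
  assumes "finite Y" "Y \<subseteq> P"
  shows "\<exists>r\<in>reductions Q R. \<forall>p\<in>Y. irreducible_elt Q R (r (kpath p))"
  using assms
proof (induction Y rule: finite_induct)
  case empty
  then show ?case using reductions_id by auto
next
  case (insert p Y)
  then obtain r where r: "r \<in> reductions Q R" "\<forall>p\<in>Y. irreducible_elt Q R (r (kpath p))" by auto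
  obtain r' where r': "r' \<in> reductions Q R" "irreducible_elt Q R (r' (r (kpath p)))"
    using acc_irreducible[OF acc_reduction[OF r(1) kpath_acc[of p]]] insert.prems by blast
  then show ?case using r
    by (intro bexI[OF _ reductions_comp[OF r(1) r'(1)]]) (auto simp: irr_reduction)
qed

lemma nf_reduction:
  assumes "x \<in> path_span P" shows "\<exists>r\<in>reductions Q R. r x = nf x"
proof -
  have Yk: "Poly_Mapping.keys x \<subseteq> P" using assms by (simp add: path_span_def)
  obtain r where r: "r \<in> reductions Q R" "\<forall>p\<in>Poly_Mapping.keys x. irreducible_elt Q R (r (kpath p))"
    using simultaneous[OF finite_keys Yk] by blast
  have "r x = lin (\<lambda>p. r (kpath p)) x" using linear_op_lin[OF reductions_linear[OF r(1)]] .
  also have "\<dots> = nf x" unfolding nf_def using r Yk by (intro lin_cong nfp_eq) auto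
  finally show ?thesis using r by blast
qed

lemma nfp_irreducible: assumes "p \<in> P" shows "irreducible_elt Q R (nfp p)"
  using simultaneous[of "{p}"] nfp_eq[OF assms] assms by fastforce

text \<open>One movable path in the support suffices to move x: the basic reduction changes x by a
  nonzero multiple of a nonzero vector, so nothing can cancel.\<close>

lemma irreducible_elt_iff: "irreducible_elt Q R x \<longleftrightarrow> (\<forall>p\<in>Poly_Mapping.keys x. irreducible_elt Q R (kpath p))"
proof
  assume x: "irreducible_elt Q R x"
  show "\<forall>p\<in>Poly_Mapping.keys x. irreducible_elt Q R (kpath p)"
  proof (rule ccontr)
    assume "\<not> ?thesis"
    then obtain p r where p: "p \<in> Poly_Mapping.keys x" "r \<in> basic_reductions Q R" "r (kpath p) \<noteq> kpath p"
      by (auto simp: irreducible_elt_def)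
    then have "r x = x + scl (Poly_Mapping.lookup x p) (r (kpath p) - kpath p)" using basic_shift by blast
    moreover have "r x = x" using x p by (auto simp: irreducible_elt_def)
    ultimately have "scl (Poly_Mapping.lookup x p) (r (kpath p) - kpath p) = 0" by simp
    then have "scl (inverse (Poly_Mapping.lookup x p)) (scl (Poly_Mapping.lookup x p) (r (kpath p) - kpath p)) = 0" by simp
    then show False using p by (simp add: in_keys_iff)
  qed
next
  assume a: "\<forall>p\<in>Poly_Mapping.keys x. irreducible_elt Q R (kpath p)"
  show "irreducible_elt Q R x" unfolding irreducible_elt_def
  proof
    fix r assume r: "r \<in> basic_reductions Q R"
    have "r x = lin (\<lambda>p. r (kpath p)) x" using linear_op_lin[OF basic_linear[OF r]] .
    also have "\<dots> = lin kpath x" using a r by (intro lin_cong) (auto simp: irreducible_elt_def)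
    finally show "r x = x" by simp
  qed
qed

lemma nfp_keys: assumes "p \<in> P" shows "Poly_Mapping.keys (nfp p) \<subseteq> parset p \<inter> irrp"
proof -
  obtain r where r: "r \<in> reductions Q R" "irreducible_elt Q R (r (kpath p))"
    using simultaneous[of "{p}"] assms by auto
  have 1: "Poly_Mapping.keys (nfp p) \<subseteq> parset p"
    using reductions_parset[OF r(1) keys_kpath_parset[OF assms, of 1]] nfp_eq[OF assms r] by simp
  have 2: "\<forall>q\<in>Poly_Mapping.keys (nfp p). irreducible_elt Q R (kpath q)"
    using nfp_irreducible[OF assms] irreducible_elt_iff by blast
  show ?thesis using 1 2 by (auto simp: irreducible_paths_def parset_def)
qed

lemma nfp_irr: "p \<in> irrp \<Longrightarrow> nfp p = kpath p"
  using nfp_eq[OF _ reductions_id] by (auto simp: irreducible_paths_def)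

lemma irrpD: "p \<in> irrp \<Longrightarrow> p \<in> P" by (simp add: irreducible_paths_def)

lemma nf_keys: "x \<in> path_span P \<Longrightarrow> Poly_Mapping.keys (nf x) \<subseteq> irrp"
  unfolding nf_def path_span_def using nfp_keys by (intro keys_lin) blast

lemma nf_parset: "Poly_Mapping.keys x \<subseteq> parset p \<Longrightarrow> Poly_Mapping.keys (nf x) \<subseteq> parset p"
  unfolding nf_def
proof (rule keys_lin)
  fix q assume "q \<in> Poly_Mapping.keys x" "Poly_Mapping.keys x \<subseteq> parset p"
  then have q: "q \<in> parset p" by (rule rev_subsetD)
  then have "Poly_Mapping.keys (nfp q) \<subseteq> parset q" using nfp_keys by (simp add: parset_def)
  also have "parset q \<subseteq> parset p" using q unfolding parset_def by (metis (no_types, lifting) Collect_mono mem_Collect_eq par_simps(3))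
  finally show "Poly_Mapping.keys (nfp q) \<subseteq> parset p" .
qed

lemma nf_fixed: "Poly_Mapping.keys x \<subseteq> irrp \<Longrightarrow> nf x = x"
  by (induction x rule: keys_induct) (auto simp: nf_def lin_add nfp_irr)

lemma nf_span: "x \<in> path_span P \<Longrightarrow> nf x \<in> path_span P"
  using nf_keys[of x] irrpD by (auto simp: path_span_def)

lemma nf_nf: "x \<in> path_span P \<Longrightarrow> nf (nf x) = nf x"
  using nf_fixed nf_keys by blast

lemma nf_kpath: "nf (kpath p) = nfp p" by (simp add: nf_def)

lemma path_span_diff: "x \<in> path_span Y \<Longrightarrow> y \<in> path_span Y \<Longrightarrow> x - y \<in> path_span Y"
  using path_span_closed(2)[of x Y "- y"] path_span_closed(3)[of y Y] by simp

text \<open>Following r by a reduction to normal form yields an irreducible reduct of p, and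
  reduction-uniqueness leaves only one.\<close>

lemma nf_of_reduction:
  assumes "r \<in> reductions Q R" "x \<in> path_span P" shows "nf (r x) = nf x"
proof -
  have k: "nf (r (kpath p)) = nfp p" if "p \<in> P" for p
  proof -
    have "r (kpath p) \<in> path_span P" by (rule reductions_span[OF assms(1) path_span_single[OF that]])
    then obtain r' where r': "r' \<in> reductions Q R" "r' (r (kpath p)) = nf (r (kpath p))" using nf_reduction by blast
    have "irreducible_elt Q R (nf (r (kpath p)))"
      using nf_keys[OF \<open>r (kpath p) \<in> path_span P\<close>]
      by (subst irreducible_elt_iff) (auto simp: irreducible_paths_def)
    then show ?thesis using nfp_eq[OF that reductions_comp[OF assms(1) r'(1)]] r' by simp
  qed
  have "nf (r x) = lin (\<lambda>p. nf (r (kpath p))) x"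
    by (subst linear_op_lin[OF reductions_linear[OF assms(1)]]) (simp add: nf_def lin_lin)
  also have "\<dots> = nf x" unfolding nf_def using assms(2) k by (intro lin_cong) (auto simp: path_span_def nf_def)
  finally show ?thesis .
qed

section \<open>The ideal as the kernel of the normal form\<close>

lemma carrier_pa [simp]: "carrier (path_algebra Q) = path_span P"
  and mult_pa [simp]: "x \<otimes>\<^bsub>path_algebra Q\<^esub> y = pmult Q x y"
  and add_pa [simp]: "x \<oplus>\<^bsub>path_algebra Q\<^esub> y = x + y"
  and zero_pa [simp]: "\<zero>\<^bsub>path_algebra Q\<^esub> = 0"
  by (simp_all add: path_algebra_def)

abbreviation "one_pa \<equiv> \<one>\<^bsub>path_algebra Q\<^esub>"

lemma ring_pa: "ring (path_algebra Q :: ('v, 'e, 'k) lincomb ring)"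
  using ring_path_algebra[OF _ fin_verts] wf_digraph_axioms by blast

lemma one_closed: "one_pa \<in> (path_span P :: ('v, 'e, 'k) lincomb set)"
  using ring.ring_simprules(6)[OF ring_pa] by simp

lemma pmult_one:
  fixes x :: "('v, 'e, 'k) lincomb"
  shows "x \<in> path_span P \<Longrightarrow> pmult Q one_pa x = x" "x \<in> path_span P \<Longrightarrow> pmult Q x one_pa = x"
  using monoid.l_one[OF ring.axioms(2)[OF ring_pa], of x] monoid.r_one[OF ring.axioms(2)[OF ring_pa], of x]
  by simp_all

lemma I_closed:
  "x \<in> I \<Longrightarrow> x \<in> path_span P" "x \<in> I \<Longrightarrow> y \<in> I \<Longrightarrow> x + y \<in> I" "0 \<in> I"
  "x \<in> I \<Longrightarrow> - x \<in> I" "x \<in> I \<Longrightarrow> y \<in> path_span P \<Longrightarrow> pmult Q y x \<in> I"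
  "x \<in> I \<Longrightarrow> y \<in> path_span P \<Longrightarrow> pmult Q x y \<in> I" "x \<in> I \<Longrightarrow> scl c x \<in> I"
proof -
  interpret i: ideal I "path_algebra Q" by (rule ideal_I)
  show c: "x \<in> I \<Longrightarrow> x \<in> path_span P" for x using i.Icarr by simp
  show "x \<in> I \<Longrightarrow> y \<in> I \<Longrightarrow> x + y \<in> I" using additive_subgroup.a_closed[OF ideal.axioms(1)[OF ideal_I]] by simp
  show "0 \<in> I" using additive_subgroup.zero_closed[OF ideal.axioms(1)[OF ideal_I]] by simp
  show m: "x \<in> I \<Longrightarrow> y \<in> path_span P \<Longrightarrow> pmult Q y x \<in> I" for x y using i.I_l_closed by simp
  show "x \<in> I \<Longrightarrow> y \<in> path_span P \<Longrightarrow> pmult Q x y \<in> I" using i.I_r_closed by simp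
  show s: "x \<in> I \<Longrightarrow> scl c x \<in> I" for x c
    using m[of x "scl c one_pa"] one_closed pmult_one(1)[OF c, of x] order_trans[OF keys_scl[of c one_pa]]
    by (simp add: pmult_scl_left path_span_def)
  show "x \<in> I \<Longrightarrow> - x \<in> I" using s[of x "- 1"] by (simp add: scl_uminus_one)
qed

lemma diff_nf_in_I: assumes "x \<in> path_span P" shows "x - nf x \<in> I"
proof -
  have gen: "kpath s - f \<in> I" if "(s, f) \<in> R" for s f
  proof -
    have "I = Idl\<^bsub>path_algebra Q\<^esub> {kpath s - f | s f. (s, f) \<in> R}" using diam by (simp add: diamond_def)
    moreover have "kpath s - f \<in> path_span P" if "(s, f) \<in> R" for s f
      using R_D[OF that] by (intro path_span_diff) (auto simp: path_span_def parset_def)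
    then have "{kpath s - f | s f. (s, f) \<in> R} \<subseteq> carrier (path_algebra Q)" by auto
    ultimately have "{kpath s - f | s f. (s, f) \<in> R} \<subseteq> I" using ring.genideal_self[OF ring_pa] by simp
    then show ?thesis using that by blast
  qed
  have "x - r x \<in> I" if "r \<in> basic_reductions Q R" for r x
    using that
  proof (cases rule: basic_redE)
    case (1 a s c f)
    have i: "sw a c (kpath s - f) \<in> I"
      unfolding sandwich_conv using 1 gen by (intro I_closed path_span_single) auto
    show ?thesis unfolding 1(6)
    proof (induction x rule: lincomb_induct)
      case (single p d)
      show ?case using I_closed(7)[OF i, of d] I_closed(3) 1
        by (auto simp: sandwich_linear(2) sandwich_kpath scl_diff)
    next
      case (add y z)
      then show ?case using I_closed(2)[OF add] by (simp add: lin_add algebra_simps)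
    qed (simp add: I_closed)
  qed note basic = this
  have "x - r x \<in> I" if "r \<in> reductions Q R" for r
    using that
  proof (induction r rule: reductions_induct)
    case (step r r')
    then show ?case using I_closed(2)[OF step.IH basic[of r' "r x"]] by simp
  qed (simp add: I_closed)
  then show ?thesis using nf_reduction[OF assms] by metis
qed

text \<open>The elements whose products with arbitrary factors on both sides all have normal form 0
  form an ideal, and it contains the generators because \<open>a s c\<close> reduces to
  \<open>a f c\<close>. Surrounding by units then recovers x itself.\<close>

lemma nf_I: assumes "x \<in> I" shows "nf x = 0"
proof -
  define J where "J = {x \<in> path_span P. \<forall>y\<in>path_span P. \<forall>z\<in>path_span P. nf (pmult Q (pmult Q y x) z) = 0}"
  have "ideal J (path_algebra Q)"
  proof (rule idealI[OF ring_pa])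
    show "subgroup J (add_monoid (path_algebra Q))"
    proof (rule group.subgroupI)
      show "Group.group (add_monoid (path_algebra Q :: ('v, 'e, 'k) lincomb ring))"
        using abelian_group.a_group[OF ring.is_abelian_group[OF ring_pa]] .
      fix x assume x: "x \<in> J"
      have "inv\<^bsub>add_monoid (path_algebra Q)\<^esub> x = - x"
        using x ring.ring_simprules(3,9)[OF ring_pa]
        by (intro group.inv_equality[OF abelian_group.a_group[OF ring.is_abelian_group[OF ring_pa]]])
          (auto simp: J_def path_span_closed)
      then show "inv\<^bsub>add_monoid (path_algebra Q)\<^esub> x \<in> J"
        using x by (simp add: J_def path_span_closed pmult_minus nf_linear)
    qed (auto simp: J_def path_span_closed pmult_add_left pmult_add_right nf_linear intro!: exI[of _ 0])
  next
    fix x y :: "('v, 'e, 'k) lincomb" assume "x \<in> J" "y \<in> carrier (path_algebra Q)"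
    then show "y \<otimes>\<^bsub>path_algebra Q\<^esub> x \<in> J" "x \<otimes>\<^bsub>path_algebra Q\<^esub> y \<in> J"
      using pmult_closed[OF wf_digraph_axioms] by (auto simp: J_def) (metis pmult_assoc)+
  qed
  moreover have "{kpath s - f | s f. (s, f) \<in> R} \<subseteq> J"
  proof safe
    fix s f assume sf: "(s, f) \<in> R"
    have fs: "f \<in> path_span P" using R_D[OF sf] by (auto simp: path_span_def parset_def)
    have *: "nf (sw a c (kpath s - f)) = 0" if "a \<in> P" "c \<in> P" for a c
    proof (cases "jn a s \<and> jn s c")
      case True
      have r: "basic_red Q a s c f \<in> reductions Q R"
        using that sf True unfolding basic_reductions_def
        by (intro basic_reductions[unfolded basic_reductions_def] CollectI exI[of _ a] exI[of _ s] exI[of _ c] exI[of _ f]) simp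
      have "nf (basic_red Q a s c f (kpath (pcomp (pcomp a s) c))) = nf (kpath (pcomp (pcomp a s) c))"
        using True that R_D[OF sf] by (intro nf_of_reduction[OF r] path_span_single) (auto simp: pcomp_in_paths joinable_pcomp)
      then show ?thesis using True by (simp add: basic_red_conv sandwich_linear sandwich_kpath nf_linear)
    next
      case False
      have "sw a c f = 0" using sandwich_eq_0[OF R_D(2)[OF sf] False] .
      moreover have "sw a c (kpath s) = (0 :: ('v, 'e, 'k) lincomb)" using False unfolding sandwich_kpath by (rule if_not_P)
      ultimately show ?thesis by (simp add: sandwich_linear nf_linear)
    qed
    have "nf (pmult Q (pmult Q y (kpath s - f)) z) = 0" if y: "y \<in> path_span P" and z: "z \<in> path_span P" for y z
      using y unfolding path_span_def mem_Collect_eq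
    proof (induction y rule: keys_induct)
      case (single a d)
      have a: "Poly_Mapping.single a d = scl d (kpath a)" by simp
      show ?case using z unfolding path_span_def mem_Collect_eq
      proof (induction z rule: keys_induct)
        case (single c d')
        have c: "Poly_Mapping.single c d' = scl d' (kpath c)" by simp
        show ?case using *[OF \<open>a \<in> P\<close> \<open>c \<in> P\<close>] unfolding a c pmult_scl_left pmult_scl_right nf_linear(4)
          by (simp add: sandwich_conv)
      qed (auto simp: pmult_add_right nf_linear)
    qed (auto simp: pmult_add_left nf_linear)
    then show "kpath s - f \<in> J" unfolding J_def using R_D(1)[OF sf] fs
      by (auto intro!: path_span_diff path_span_single)
  qed
  ultimately have "Idl\<^bsub>path_algebra Q\<^esub> {kpath s - f | s f. (s, f) \<in> R} \<subseteq> J"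
    by (rule ring.genideal_minimal[OF ring_pa])
  then have "x \<in> J" using assms diam by (auto simp: diamond_def)
  then have "nf (pmult Q (pmult Q one_pa x) one_pa) = 0" "x \<in> path_span P" using one_closed by (auto simp: J_def)
  then show ?thesis by (simp add: pmult_one)
qed

lemma nf_eq_iff: "x \<in> path_span P \<Longrightarrow> y \<in> path_span P \<Longrightarrow> nf x = nf y \<longleftrightarrow> x - y \<in> I"
proof
  assume a: "x \<in> path_span P" "y \<in> path_span P" "nf x = nf y"
  show "x - y \<in> I"
    using I_closed(2)[OF diff_nf_in_I[OF a(1)] I_closed(4)[OF diff_nf_in_I[OF a(2)]]] a(3) by simp
qed (use nf_I[of "x - y"] in \<open>auto simp: nf_linear\<close>)

end

lemma lin_fun_diff: "lin (\<lambda>a. g a - h a) x = lin g x - lin h x"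
  using lin_fun_add[of "\<lambda>a. g a - h a" h x] by simp

lemma single_eqD: "Poly_Mapping.single p l = Poly_Mapping.single q m \<Longrightarrow> l \<noteq> 0 \<Longrightarrow> p = q \<and> l = m"
  by (metis lookup_single_eq lookup_single_not_eq)

text \<open>Integral spans, not k-subspaces: the sets S used below are not stable under scalars,
  since the coefficient of a generator takes part in its comparison with the bound.\<close>

inductive_set zsp :: "'a::ab_group_add set \<Rightarrow> 'a set" for S where
  zero: "0 \<in> zsp S"
| base: "x \<in> S \<Longrightarrow> x \<in> zsp S"
| add: "x \<in> zsp S \<Longrightarrow> y \<in> zsp S \<Longrightarrow> x + y \<in> zsp S"
| minus: "x \<in> zsp S \<Longrightarrow> - x \<in> zsp S"

lemma zsp_diff: "x \<in> zsp S \<Longrightarrow> y \<in> zsp S \<Longrightarrow> x - y \<in> zsp S"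
  using zsp.add[of x S "- y"] zsp.minus[of y S] by simp

lemma zsp_sum: "(\<And>i. i \<in> J \<Longrightarrow> f i \<in> zsp S) \<Longrightarrow> sum f J \<in> zsp S"
  by (induction J rule: infinite_finite_induct) (auto intro: zsp.intros)

lemma zsp_hom:
  assumes "x \<in> zsp S" "\<And>x y. f (x + y) = f x + f y" "\<And>s. s \<in> S \<Longrightarrow> f s \<in> zsp S'"
  shows "f x \<in> zsp S'"
proof -
  have 0: "f 0 = 0" using assms(2)[of 0 0] by simp
  have m: "f (- x) = - f x" for x using assms(2)[of x "- x"] 0 by (simp add: eq_neg_iff_add_eq_0 add.commute)
  show ?thesis using assms(1) by induction (auto simp: 0 m assms intro: zsp.intros)
qed

lemma zsp_mono: "S \<subseteq> S' \<Longrightarrow> zsp S \<subseteq> zsp S'"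
  using zsp_hom[of _ S "\<lambda>x. x" S'] by (auto intro: zsp.base)

type_synonym ('v, 'e) triple = "('v, 'e) path \<times> ('v, 'e) path \<times> ('v, 'e) path"

text \<open>A triple \<open>(a, p, c)\<close> stands for \<open>a \<otimes> p \<otimes> c\<close> before a and c are replaced by their normal forms.
  In these coordinates \<open>dif Q g\<close> is the bimodule map with the values \<open>g q\<close> on \<open>1 \<otimes> q \<otimes> 1\<close>.\<close>
definition tri :: "('v, 'e, 'k::field) lincomb \<Rightarrow> ('v, 'e) path \<Rightarrow> ('v, 'e, 'k) lincomb \<Rightarrow>
    (('v, 'e) triple \<Rightarrow>\<^sub>0 'k)"
  where "tri x p y = lin (\<lambda>a. lin (\<lambda>c. Poly_Mapping.single (a, p, c) 1) y) x"

definition bact :: "('v, 'e) pre_digraph \<Rightarrow> ('v, 'e, 'k::field) lincomb \<Rightarrow> ('v, 'e, 'k) lincomb \<Rightarrow>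
    (('v, 'e) triple \<Rightarrow>\<^sub>0 'k) \<Rightarrow> (('v, 'e) triple \<Rightarrow>\<^sub>0 'k)"
  where "bact Q u v = lin (\<lambda>(x, p, y). tri (pmult Q u (kpath x)) p (pmult Q (kpath y) v))"

definition dif :: "('v, 'e) pre_digraph \<Rightarrow> (('v, 'e) path \<Rightarrow> (('v, 'e) triple \<Rightarrow>\<^sub>0 'k::field)) \<Rightarrow>
    (('v, 'e) triple \<Rightarrow>\<^sub>0 'k) \<Rightarrow> (('v, 'e) triple \<Rightarrow>\<^sub>0 'k)"
  where "dif Q g = lin (\<lambda>(a, q, c). bact Q (kpath a) (kpath c) (g q))"

text \<open>The word spelled by a triple. A multiple of a triple is compared in the order through
  the same multiple of this word.\<close>

definition wt :: "('v, 'e) triple \<Rightarrow> ('v, 'e) path"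
  where "wt t = pcomp (pcomp (fst t) (fst (snd t))) (snd (snd t))"

lemma tri_linear:
  "tri (x + x') p y = tri x p y + tri x' p y" "tri x p (y + y') = tri x p y + tri x p y'"
  "tri (scl k x) p y = scl k (tri x p y)" "tri x p (scl k y) = scl k (tri x p y)"
  "tri 0 p y = 0" "tri x p 0 = 0"
  by (simp_all add: tri_def lin_add lin_fun_add lin_scl lin_fun_scl)

lemma tri_single: "tri (Poly_Mapping.single a k) p (Poly_Mapping.single c l) = Poly_Mapping.single (a, p, c) (k * l)"
  by (simp add: tri_def)

lemma bact_linear:
  "bact Q u v (x + y) = bact Q u v x + bact Q u v y" "bact Q u v (x - y) = bact Q u v x - bact Q u v y"
  "bact Q u v (scl k x) = scl k (bact Q u v x)" "bact Q u v 0 = 0" "bact Q u v (- x) = - bact Q u v x"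
  by (simp_all add: bact_def lin_add lin_diff lin_scl lin_minus)

lemma bact_sum: "bact Q u v (sum f J) = (\<Sum>i\<in>J. bact Q u v (f i))"
  by (simp add: bact_def lin_sum)

lemma bact_args:
  "bact Q (u + u') v x = bact Q u v x + bact Q u' v x" "bact Q u (v + v') x = bact Q u v x + bact Q u v' x"
  "bact Q (scl k u) v x = scl k (bact Q u v x)" "bact Q u (scl k v) x = scl k (bact Q u v x)"
  "bact Q 0 v x = 0" "bact Q u 0 x = 0"
  by (simp_all add: bact_def pmult_add_left pmult_add_right tri_linear pmult_scl_left pmult_scl_right
      case_prod_unfold lin_fun_add lin_fun_scl)

lemma bact_tri: "bact Q u v (tri x p y) = tri (pmult Q u x) p (pmult Q y v)"
proof (induction x rule: lincomb_induct)
  case (single a k)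
  show ?case
  proof (induction y rule: lincomb_induct)
    case (single c l)
    have 1: "pmult Q u (Poly_Mapping.single a k) = scl k (pmult Q u (kpath a))" by (simp flip: pmult_scl_right)
    have 2: "pmult Q (Poly_Mapping.single c l) v = scl l (pmult Q (kpath c) v)" by (simp flip: pmult_scl_left)
    show ?case unfolding tri_single 1 2 tri_linear by (simp add: bact_def mult.commute)
  qed (auto simp: tri_linear bact_linear pmult_add_left)
qed (auto simp: tri_linear bact_linear pmult_add_right)

lemma bact_bact: "bact Q u v (bact Q u' v' x) = bact Q (pmult Q u u') (pmult Q v' v) x"
proof (induction x rule: lincomb_induct)
  case (single t k)
  obtain a p c where t: "t = (a, p, c)" by (cases t) auto
  have s: "Poly_Mapping.single t k = tri (Poly_Mapping.single a k) p (kpath c)" by (simp add: t tri_single)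
  show ?case unfolding s bact_tri by (simp add: pmult_assoc)
qed (auto simp: bact_linear)

lemma dif_linear:
  "dif Q g (x + y) = dif Q g x + dif Q g y" "dif Q g (x - y) = dif Q g x - dif Q g y"
  "dif Q g (scl k x) = scl k (dif Q g x)" "dif Q g 0 = 0" "dif Q g (- x) = - dif Q g x"
  by (simp_all add: dif_def lin_add lin_diff lin_scl lin_minus)

lemma dif_tri: "dif Q g (tri u q v) = bact Q u v (g q)"
proof (induction u rule: lincomb_induct)
  case (single a k)
  show ?case
  proof (induction v rule: lincomb_induct)
    case (single c l)
    have 1: "Poly_Mapping.single a k = scl k (kpath a)" "Poly_Mapping.single c l = scl l (kpath c)" by simp_all
    have *: "bact Q (Poly_Mapping.single a k) (Poly_Mapping.single c l) (g q) = scl (k * l) (bact Q (kpath a) (kpath c) (g q))"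
      unfolding 1 bact_args by (simp add: mult.commute)
    show ?case unfolding tri_single * by (simp add: dif_def)
  qed (auto simp: tri_linear dif_linear bact_args)
qed (auto simp: tri_linear dif_linear bact_args)

lemma dif_bact: "dif Q g (bact Q u v x) = bact Q u v (dif Q g x)"
proof (induction x rule: lincomb_induct)
  case (single t k)
  obtain a p c where t: "t = (a, p, c)" by (cases t) auto
  have s: "Poly_Mapping.single t k = tri (Poly_Mapping.single a k) p (kpath c)" by (simp add: t tri_single)
  show ?case unfolding s bact_tri dif_tri bact_bact ..
qed (auto simp: bact_linear dif_linear)

lemma bact_single:
  "bact Q (kpath a) (kpath c) (Poly_Mapping.single (x, p, y) k) =
    (if joinable Q a x \<and> joinable Q y c then Poly_Mapping.single (pcomp a x, p, pcomp y c) k else 0)"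
  by (simp add: bact_def pmult_single tri_single tri_linear)

context rsys
begin

section \<open>Normal forms of the outer components\<close>

lemma pmult_nf:
  assumes "u \<in> path_span P" "x \<in> path_span P"
  shows "nf (pmult Q (nf u) x) = nf (pmult Q u x)" "nf (pmult Q u (nf x)) = nf (pmult Q u x)"
proof -
  note c = pmult_closed[OF wf_digraph_axioms]
  have "pmult Q u x - pmult Q (nf u) x \<in> I"
    using I_closed(6)[OF diff_nf_in_I[OF assms(1)] assms(2)] by (simp add: pmult_diff_left)
  then show "nf (pmult Q (nf u) x) = nf (pmult Q u x)"
    using nf_eq_iff[OF c[OF assms] c[OF nf_span[OF assms(1)] assms(2)]] by simp
  have "pmult Q u x - pmult Q u (nf x) \<in> I"
    using I_closed(5)[OF diff_nf_in_I[OF assms(2)] assms(1)] by (simp add: pmult_diff_right)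
  then show "nf (pmult Q u (nf x)) = nf (pmult Q u x)"
    using nf_eq_iff[OF c[OF assms] c[OF assms(1) nf_span[OF assms(2)]]] by simp
qed

text \<open>Two combinations of composable triples represent the same tensor iff \<open>rho\<close>
  agrees on them (\<open>Phi_Psi\<close>, \<open>Psi_rho\<close>). Operators on triples therefore
  matter only after a final \<open>rho\<close>.\<close>

definition rho :: "(('v, 'e) triple \<Rightarrow>\<^sub>0 'k) \<Rightarrow> (('v, 'e) triple \<Rightarrow>\<^sub>0 'k)"
  where "rho = lin (\<lambda>(a, p, c). tri (nfp a) p (nfp c))"

lemma rho_linear:
  "rho (x + y) = rho x + rho y" "rho (x - y) = rho x - rho y" "rho (scl k x) = scl k (rho x)" "rho 0 = 0"
  "rho (- x) = - rho x"
  by (simp_all add: rho_def lin_add lin_diff lin_scl lin_minus)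

lemma rho_sum: "rho (sum f J) = (\<Sum>i\<in>J. rho (f i))"
  by (simp add: rho_def lin_sum)

lemma rho_tri: "rho (tri u p v) = tri (nf u) p (nf v)"
proof (induction u rule: lincomb_induct)
  case (single a k)
  show ?case
  proof (induction v rule: lincomb_induct)
    case (single c l)
    show ?case by (simp add: tri_single rho_def nf_def tri_linear mult.commute)
  qed (auto simp: tri_linear rho_linear nf_linear)
qed (auto simp: tri_linear rho_linear nf_linear)

definition TP :: "('v, 'e) triple set"
  where "TP = {(a, p, c). a \<in> P \<and> c \<in> P}"

definition Fsp :: "(('v, 'e) triple \<Rightarrow>\<^sub>0 'k) set"
  where "Fsp = {x. Poly_Mapping.keys x \<subseteq> TP}"

lemma Fsp_induct [consumes 1, case_names zero tri add]:
  assumes "x \<in> Fsp" "T 0" "\<And>a p c k. a \<in> P \<Longrightarrow> c \<in> P \<Longrightarrow> T (tri (Poly_Mapping.single a k) p (kpath c))"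
    "\<And>y z. T y \<Longrightarrow> T z \<Longrightarrow> T (y + z)"
  shows "T x"
  using assms(1) unfolding Fsp_def mem_Collect_eq
proof (induction x rule: keys_induct)
  case (single t k)
  then show ?case using assms(3)[of "fst t" "snd (snd t)" k "fst (snd t)"] by (auto simp: TP_def tri_single)
qed (use assms in auto)

lemma kpath_span: "a \<in> P \<Longrightarrow> Poly_Mapping.single a k \<in> path_span P"
  by (rule path_span_single)

lemma rho_rho: "x \<in> Fsp \<Longrightarrow> rho (rho x) = rho x"
  by (induction x rule: Fsp_induct) (auto simp: rho_linear rho_tri nf_nf kpath_span)

lemma rho_bact:
  assumes "x \<in> Fsp" "u \<in> path_span P" "v \<in> path_span P"
  shows "rho (bact Q (nf u) (nf v) x) = rho (bact Q u v x)" "rho (bact Q u v (rho x)) = rho (bact Q u v x)"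
  using assms
  by (induction x rule: Fsp_induct; simp add: bact_linear rho_linear bact_tri rho_tri pmult_nf kpath_span)+

lemma rho_bact_eq:
  assumes "x \<in> Fsp" "u \<in> path_span P" "v \<in> path_span P" "u' \<in> path_span P" "v' \<in> path_span P"
    "nf u = nf u'" "nf v = nf v'"
  shows "rho (bact Q u v x) = rho (bact Q u' v' x)"
  using rho_bact(1)[OF assms(1,2,3)] rho_bact(1)[OF assms(1,4,5)] assms(6,7) by simp

text \<open>Classes in A of the outer paths act in the same way as the paths once the result is
  normalized. This permits computing bimodule maps on unreduced words.\<close>

lemma rho_dif:
  assumes "Poly_Mapping.keys x \<subseteq> {(a, p, c). a \<in> P \<and> c \<in> P \<and> p \<in> K}" "\<And>q. q \<in> K \<Longrightarrow> g q \<in> Fsp"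
  shows "rho (dif Q g (rho x)) = rho (dif Q g x)"
  using assms(1)
proof (induction x rule: keys_induct)
  case (single t k)
  obtain a q c where t: "t = (a, q, c)" by (cases t) auto
  have s: "Poly_Mapping.single t k = tri (Poly_Mapping.single a k) q (kpath c)" by (simp add: t tri_single)
  show ?case unfolding s rho_tri dif_tri using single t assms(2)
    by (intro rho_bact(1)) (auto intro: kpath_span)
qed (auto simp: rho_linear dif_linear)

section \<open>The order\<close>

abbreviation "rle \<equiv> red_le Q R"
abbreviation "rlt \<equiv> red_less Q R"

lemma basic_below:
  assumes "r \<in> basic_reductions Q R" "p \<in> P"
  shows "Poly_Mapping.keys (r (kpath p)) \<subseteq> insert p {p'. (p', p) \<in> below}"
proof (cases "r (kpath p) = kpath p")
  case False
  then show ?thesis using assms unfolding below_def by blast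
qed simp

text \<open>As soon as one step moves q, the whole support lies strictly below q, and further steps
  only descend.\<close>

lemma reductions_below:
  assumes "r \<in> reductions Q R" "q \<in> P"
  shows "r (kpath q) = kpath q \<or> Poly_Mapping.keys (r (kpath q)) \<subseteq> {p. (p, q) \<in> below\<^sup>+}"
  using assms(1)
proof (induction r rule: reductions_induct)
  case (step r r')
  show ?case
  proof (cases "r (kpath q) = kpath q")
    case True
    then show ?thesis using step.hyps(2) assms(2) unfolding below_def by auto
  next
    case False
    then have k: "Poly_Mapping.keys (r (kpath q)) \<subseteq> {p. (p, q) \<in> below\<^sup>+}" using step.IH by blast
    have "Poly_Mapping.keys (r' (kpath p)) \<subseteq> {p. (p, q) \<in> below\<^sup>+}" if p: "p \<in> Poly_Mapping.keys (r (kpath q))" for p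
    proof -
      have "p \<in> P" using p reductions_parset[OF step.hyps(1) keys_kpath_parset[OF assms(2), of 1]] by (auto simp: parset_def)
      moreover have "(p, q) \<in> below\<^sup>+" using p k by blast
      ultimately show ?thesis using basic_below[OF step.hyps(2), of p] by (auto intro: trancl_into_trancl2)
    qed
    then show ?thesis
      by (subst (2) linear_op_lin[OF basic_linear[OF step.hyps(2)]]) (intro disjI2 keys_lin)
  qed
qed simp

lemma below_parset: "(p, q) \<in> below\<^sup>+ \<Longrightarrow> p \<in> parset q"
proof (induction rule: trancl.induct)
  case (r_into_trancl p q)
  then show ?case using basic_parset[OF _ keys_kpath_parset[of q 1]] unfolding below_def by blast
next
  case (trancl_into_trancl p q q')
  then have "q \<in> parset q'" using basic_parset[OF _ keys_kpath_parset[of q' 1]] unfolding below_def by blast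
  then show ?case using trancl_into_trancl.IH par_simps(3)[of p q q'] by (auto simp: parset_def)
qed

lemma below_neq: "(p, q) \<in> below\<^sup>+ \<Longrightarrow> p \<noteq> q"
  using wf_below[THEN wf_trancl] by (auto dest: wf_not_refl)

text \<open>A reduction either fixes q, so that its only term is q with the original coefficient, or
  puts only paths strictly below q into the support. Thus different nonzero multiples of one path
  are incomparable, and strict comparison of nonzero elements is governed by the well-founded
  relation.\<close>

lemma le_cases:
  assumes "rle x y"
  shows "x = y \<or> x = 0 \<or> (\<exists>p l q m. x = Poly_Mapping.single p l \<and> y = Poly_Mapping.single q m \<and> l \<noteq> 0 \<and> m \<noteq> 0 \<and>
    (p, q) \<in> below\<^sup>+)"
  using assms
proof (induction rule: red_le.induct)
  case (trans x y z)
  from trans.IH(1) show ?case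
  proof (elim disjE exE conjE)
    fix p l q m assume 1: "x = Poly_Mapping.single p l" "y = Poly_Mapping.single q m" "l \<noteq> 0" "m \<noteq> 0" "(p, q) \<in> below\<^sup>+"
    from trans.IH(2) show ?case
    proof (elim disjE exE conjE)
      fix q' m' q2 m2 assume 2: "y = Poly_Mapping.single q' m'" "z = Poly_Mapping.single q2 m2" "m' \<noteq> 0" "m2 \<noteq> 0" "(q', q2) \<in> below\<^sup>+"
      have "q' = q" using 1 2 single_eqD by metis
      then have "(p, q2) \<in> below\<^sup>+" using trancl_trans[OF 1(5), of q2] 2(5) by simp
      then show ?thesis using 1 2 by blast
    next
      assume "y = 0" then show ?thesis using 1 by simp
    qed (use 1 in blast)
  qed (use trans.IH in auto)
next
  case (reduce p q l m r x)
  have r: "r (Poly_Mapping.single q m) = scl m (r (kpath q))"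
    using linear_opD(2)[OF reductions_linear[OF reduce(5)], of m "kpath q"] by simp
  have "p \<in> Poly_Mapping.keys (r (Poly_Mapping.single q m))"
    using reduce by (simp add: in_keys_iff lookup_add)
  then have p: "p \<in> Poly_Mapping.keys (r (kpath q))" using r reduce(4) by (simp add: keys_scl_eq)
  from reductions_below[OF reduce(5,2)] show ?case
  proof
    assume e: "r (kpath q) = kpath q"
    then have "p = q" using p by simp
    moreover have "l = m"
      using arg_cong[OF reduce(6), of "\<lambda>y. Poly_Mapping.lookup y p"] reduce(7) e r calculation
      by (simp add: lookup_add in_keys_iff)
    ultimately show ?thesis by simp
  qed (use p reduce in blast)
qed auto

text \<open>A cycle through two distinct elements would make some path strictly smaller than
  itself.\<close>

lemma le_antisym: "rle x y \<Longrightarrow> rle y x \<Longrightarrow> x = y"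
proof (rule ccontr)
  assume a: "rle x y" "rle y x" "x \<noteq> y"
  have e: "Poly_Mapping.single p l \<noteq> (0 :: ('v, 'e, 'k) lincomb)" if "l \<noteq> 0" for p l
    using that by simp
  have n: "\<not> (x = 0 \<and> (y = 0 \<or> (\<exists>p l. y = Poly_Mapping.single p l \<and> l \<noteq> 0 \<and> False)))" using a by auto
  from le_cases[OF a(1)] le_cases[OF a(2)] a(3) e
  obtain p l q m p' l' q' m' where *: "x = Poly_Mapping.single p l" "y = Poly_Mapping.single q m" "l \<noteq> 0" "m \<noteq> 0" "(p, q) \<in> below\<^sup>+"
    "y = Poly_Mapping.single p' l'" "x = Poly_Mapping.single q' m'" "l' \<noteq> 0" "m' \<noteq> 0" "(p', q') \<in> below\<^sup>+"
    by metis
  then have e: "q = p'" "p = q'" using single_eqD by metis+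
  show False using trancl_trans[OF *(5)[unfolded e] *(10)] below_neq by blast
qed

lemma lt_le: "rlt x y \<Longrightarrow> rle x y"
  and le_lt_trans: "rle x y \<Longrightarrow> rlt y z \<Longrightarrow> rlt x z"
  and lt_le_trans: "rlt x y \<Longrightarrow> rle y z \<Longrightarrow> rlt x z"
  using le_antisym red_le.trans unfolding red_less_def by blast+

lemma lt_cases:
  assumes "rlt (Poly_Mapping.single p l) y" "l \<noteq> 0"
  obtains q m where "y = Poly_Mapping.single q m" "m \<noteq> 0" "(p, q) \<in> below\<^sup>+"
proof -
  have "Poly_Mapping.single p l \<noteq> (0 :: ('v, 'e, 'k) lincomb)" using assms(2) by simp
  then obtain p' l' q m where *: "Poly_Mapping.single p l = Poly_Mapping.single p' l'" "l' \<noteq> 0" "y = Poly_Mapping.single q m" "m \<noteq> 0" "(p', q) \<in> below\<^sup>+"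
    using le_cases[OF lt_le[OF assms(1)]] assms(1) unfolding red_less_def by blast
  then have "p' = p" using assms(2) single_eqD by metis
  then show ?thesis using * that by blast
qed

lemma lt_belowI: "rle (Poly_Mapping.single p l) (Poly_Mapping.single q m) \<Longrightarrow> p \<noteq> q \<Longrightarrow> l \<noteq> 0 \<Longrightarrow>
  rlt (Poly_Mapping.single p l) (Poly_Mapping.single q m)"
  unfolding red_less_def using single_eqD by metis

lemma le_scl: "rle x y \<Longrightarrow> rle (scl c x) (scl c y)"
proof (induction rule: red_le.induct)
  case (reduce p q l m r x)
  show ?case
  proof (cases "c = 0")
    case False
    have "r (Poly_Mapping.single q (c * m)) = Poly_Mapping.single p (c * l) + scl c x"
      using linear_opD(2)[OF reductions_linear[OF reduce(5)], of c "Poly_Mapping.single q m"] reduce(6) by (simp add: scl_add)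
    then have "rle (Poly_Mapping.single p (c * l)) (Poly_Mapping.single q (c * m))"
      using reduce(3,4,7) False keys_scl[of c x] by (intro red_le.reduce[OF reduce(1,2) _ _ reduce(5), of _ _ "scl c x"]) auto
    then show ?thesis by simp
  qed (simp add: red_le.refl_zero)
qed (auto intro: red_le.intros)

text \<open>Reductions lift along multiplication, and cancellation keeps the chosen term apart from
  the rest of the sum. If the product does not compose, both sides become 0, since p and q are
  parallel.\<close>

lemma le_sw: assumes "rle x y" "a \<in> P" "c \<in> P" shows "rle (sw a c x) (sw a c y)"
  using assms(1)
proof (induction rule: red_le.induct)
  case (refl p l)
  then show ?case using assms by (auto simp: sandwich_def pcomp_in_paths joinable_pcomp intro: red_le.intros)
next
  case (zero p l)
  then show ?case using assms by (auto simp: sandwich_def pcomp_in_paths joinable_pcomp intro: red_le.intros)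
next
  case (reduce p q l m r x)
  have k: "Poly_Mapping.keys (Poly_Mapping.single p l + x) \<subseteq> parset q"
    using reductions_parset[OF reduce(5) keys_kpath_parset[OF reduce(2), of m]] reduce(6) by simp
  moreover have "p \<in> Poly_Mapping.keys (Poly_Mapping.single p l + x)" using reduce by (simp add: in_keys_iff lookup_add)
  ultimately have p: "par p q" by (auto simp: parset_def)
  have kx: "Poly_Mapping.keys x \<subseteq> parset q"
    using k reduce(7) by (auto simp: in_keys_iff lookup_add lookup_single when_def)
  show ?case
  proof (cases "jn a q \<and> jn q c")
    case True
    obtain r' where r': "r' \<in> reductions Q R" "\<And>x. r' (sw a c x) = sw a c (r x)" using reduction_lift[OF reduce(5) assms(2,3)] by blast
    have 1: "sw a c (Poly_Mapping.single p l) = Poly_Mapping.single (pcomp (pcomp a p) c) l"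
      "sw a c (Poly_Mapping.single q m) = Poly_Mapping.single (pcomp (pcomp a q) c) m"
      using True p by (auto simp: sandwich_def par_simps)
    have "r' (Poly_Mapping.single (pcomp (pcomp a q) c) m) = Poly_Mapping.single (pcomp (pcomp a p) c) l + sw a c x"
      using r'(2)[of "Poly_Mapping.single q m"] reduce(6) by (simp add: 1 sandwich_linear)
    moreover have "pcomp (pcomp a p) c \<notin> Poly_Mapping.keys (sw a c x)"
      using lookup_sandwich[OF kx _ _ p] True reduce(7) by (simp add: in_keys_iff)
    ultimately show ?thesis unfolding 1
      using reduce True p assms by (intro red_le.reduce[OF _ _ _ _ r'(1)]) (auto simp: pcomp_in_paths joinable_pcomp par_simps)
  next
    case False
    have "Poly_Mapping.keys (Poly_Mapping.single p l) \<subseteq> parset q" "Poly_Mapping.keys (Poly_Mapping.single q m) \<subseteq> parset q"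
      using p reduce(1,2) by (simp_all add: parset_def par_simps(4))
    then have "sw a c (Poly_Mapping.single p l) = 0" "sw a c (Poly_Mapping.single q m) = 0"
      using sandwich_eq_0[OF _ False] by blast+
    then show ?thesis by (simp add: red_le.refl_zero)
  qed
qed (auto simp: sandwich_linear intro: red_le.intros)

text \<open>Strictness survives because multiplication by fixed paths is injective where it
  composes.\<close>

lemma lt_sw:
  assumes "rlt (Poly_Mapping.single p l) w" "l \<noteq> 0" "a \<in> P" "c \<in> P" "jn a p" "jn p c"
  shows "rlt (Poly_Mapping.single (pcomp (pcomp a p) c) l) (sw a c w)"
proof -
  obtain q m where w: "w = Poly_Mapping.single q m" "m \<noteq> 0" "(p, q) \<in> below\<^sup>+" using lt_cases[OF assms(1,2)] .
  have p: "par p q" "p \<noteq> q" using below_parset[OF w(3)] below_neq[OF w(3)] by (auto simp: parset_def)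
  have "rle (sw a c (Poly_Mapping.single p l)) (sw a c w)" using le_sw[OF lt_le[OF assms(1)] assms(3,4)] .
  moreover have "pcomp (pcomp a p) c \<noteq> pcomp (pcomp a q) c" using pcomp_cancel[of Q a p q c] p assms by (auto simp: par_simps)
  ultimately show ?thesis using assms p w by (auto simp: sandwich_def par_simps intro: lt_belowI)
qed

lemma lt_scl: "rlt x y \<Longrightarrow> c \<noteq> 0 \<Longrightarrow> rlt (scl c x) (scl c y)"
proof -
  assume a: "rlt x y" "c \<noteq> 0"
  have "scl c x \<noteq> scl c y"
  proof
    assume "scl c x = scl c y"
    then have "scl (inverse c) (scl c x) = scl (inverse c) (scl c y)" by simp
    then show False using a by (simp add: red_less_def)
  qed
  then show ?thesis using a le_scl by (auto simp: red_less_def)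
qed

text \<open>The normal form is a reduct, so each of its terms with its actual coefficient is below p
  by the generating clause of the order. A reducible p is not among them.\<close>

lemma nfp_le:
  assumes "p \<in> P" "b \<in> Poly_Mapping.keys (nfp p)"
  shows "rle (Poly_Mapping.single b (Poly_Mapping.lookup (nfp p) b)) (kpath p)"
    "p \<notin> irrp \<Longrightarrow> rlt (Poly_Mapping.single b (Poly_Mapping.lookup (nfp p) b)) (kpath p)"
proof -
  obtain r where r: "r \<in> reductions Q R" "r (kpath p) = nfp p"
    using nf_reduction[OF path_span_single[OF assms(1), of 1]] by (auto simp: nf_kpath)
  have b: "b \<in> P" "b \<in> irrp" using nfp_keys[OF assms(1)] assms(2) by (auto simp: parset_def)
  show 1: "rle (Poly_Mapping.single b (Poly_Mapping.lookup (nfp p) b)) (kpath p)"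
    using assms b r
    by (intro red_le.reduce[OF _ _ _ _ r(1), of _ _ _ _ "nfp p - Poly_Mapping.single b (Poly_Mapping.lookup (nfp p) b)"])
      (auto simp: in_keys_iff lookup_minus)
  show "p \<notin> irrp \<Longrightarrow> rlt (Poly_Mapping.single b (Poly_Mapping.lookup (nfp p) b)) (kpath p)"
    using lt_belowI[OF 1] b assms(2) by (auto simp: in_keys_iff)
qed

text \<open>That an occurrence of a tip makes the path reducible needs more than the definition: the
  reduction there has to change the path, which is \<open>basic_red_moves\<close>.\<close>

lemma irr_iff: "p \<in> irrp \<longleftrightarrow> p \<in> P \<and> \<not> (\<exists>s\<in>fst ` R. path_divides Q s p)"
proof -
  have "\<not> irreducible_elt Q R (kpath p) \<longleftrightarrow> (\<exists>s\<in>fst ` R. path_divides Q s p)"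
  proof
    assume "\<not> irreducible_elt Q R (kpath p)"
    then obtain r where r: "r \<in> basic_reductions Q R" "r (kpath p) \<noteq> kpath p" by (auto simp: irreducible_elt_def)
    from r(1) show "\<exists>s\<in>fst ` R. path_divides Q s p"
    proof (cases rule: basic_redE)
      case (1 a s c f)
      then have "p = pcomp (pcomp a s) c" using r(2) by (auto split: if_splits)
      then show ?thesis using 1 unfolding path_divides_def by (intro bexI[of _ s] bexI[of _ a] bexI[of _ c]) (auto simp: image_iff intro!: bexI[of _ "(s, f)"])
    qed
  next
    assume "\<exists>s\<in>fst ` R. path_divides Q s p"
    then obtain s f a c where *: "(s, f) \<in> R" "a \<in> P" "c \<in> P" "jn a s" "jn s c" "p = pcomp (pcomp a s) c"
      by (auto simp: path_divides_def)
    then have "basic_red Q a s c f \<in> basic_reductions Q R" unfolding basic_reductions_def by blast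
    moreover have "basic_red Q a s c f (kpath p) \<noteq> kpath p"
      using basic_red_moves[OF *(1,4,5)] *(6) by (simp add: basic_red_conv)
    ultimately show "\<not> irreducible_elt Q R (kpath p)" by (auto simp: irreducible_elt_def)
  qed
  then show ?thesis by (auto simp: irreducible_paths_def)
qed

end

section \<open>Factorizations\<close>

context tips
begin

text \<open>The break \<open>b m\<close> is the position at which the factor \<open>u\<^sub>m\<close> of a left factorization starts.\<close>
definition posfac :: "int \<Rightarrow> nat \<Rightarrow> (nat \<Rightarrow> int) \<Rightarrow> bool"
  where "posfac i n b \<longleftrightarrow> b 0 = i \<and> (n \<ge> 1 \<longrightarrow> b 1 = i + 1) \<and> b n \<le> hi \<and> (\<forall>m<n. b m \<le> b (Suc m)) \<and>
    (\<forall>m. Suc (Suc m) \<le> n \<longrightarrow> red (b m) (b (Suc (Suc m))) \<and>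
      (\<forall>k. b (Suc m) \<le> k \<and> k < b (Suc (Suc m)) \<longrightarrow> \<not> red (b m) k)) \<and>
    (\<forall>m. 1 \<le> m \<and> m < n \<longrightarrow> \<not> red (b m) (b (Suc m)))"

lemma nxt_eqI:
  assumes "lo \<le> i" "red i j" "\<And>k. k < j \<Longrightarrow> \<not> red i k" shows "nx i = j"
proof (rule antisym)
  have j: "j \<le> hi" using bound[OF assms(2)] by simp
  show "nx i \<le> j" using nxt_le_iff[OF assms(1) j] assms(2) by simp
  show "j \<le> nx i"
  proof (rule ccontr)
    assume "\<not> j \<le> nx i"
    then show False using nxt_le_iff[of i "nx i"] assms j by simp
  qed
qed

text \<open>The minimality clause only speaks of ends at or after the next break. A reducible end
  before it would make the factor itself reducible by monotonicity, which is impossible: the first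
  factor is too short, the others are irreducible by assumption. So any valid break sequence is the
  greedy one, and factorizations are unique.\<close>

lemma posfac_amb:
  assumes "lo \<le> i" "posfac i n b"
  shows "(\<forall>m\<le>n. b m = B i m) \<and> Amb n i (b n)"
proof -
  have step: "b m \<le> b (Suc m)" if "m < n" for m using assms(2) that by (simp add: posfac_def)
  have ib: "i \<le> b m" if "m \<le> n" for m
    using that
  proof (induction m)
    case (Suc m)
    then show ?case using step[of m] by simp
  qed (use assms(2) in \<open>simp add: posfac_def\<close>)
  have bn: "b m \<le> hi" if "m \<le> n" for m
  proof -
    have "b m \<le> b n" using that
    proof (induction "n - m" arbitrary: m)
      case (Suc d)
      then have "b (Suc m) \<le> b n" "m < n" by auto
      then show ?case using step[of m] by simp
    qed simp
    then show ?thesis using assms(2) by (simp add: posfac_def)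
  qed
  have nx: "nx (b m) = b (Suc (Suc m))" if m: "Suc (Suc m) \<le> n" for m
  proof (rule nxt_eqI)
    show "lo \<le> b m" using ib[of m] assms(1) m by simp
    show "red (b m) (b (Suc (Suc m)))" using assms(2) m by (simp add: posfac_def)
    have *: "\<And>k. b (Suc m) \<le> k \<Longrightarrow> k < b (Suc (Suc m)) \<Longrightarrow> \<not> red (b m) k" using assms(2) m by (simp add: posfac_def)
    fix k assume k: "k < b (Suc (Suc m))"
    show "\<not> red (b m) k"
    proof (cases "b (Suc m) \<le> k")
      case False
      show ?thesis
      proof
        assume r: "red (b m) k"
        have b1: "red (b m) (b (Suc m))"
          using mono[OF r _ order_refl] False bn[of "Suc m"] m ib[of m] assms(1) by simp
        show False
        proof (cases "b (Suc m) < b (Suc (Suc m))")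
          case True then show ?thesis using *[of "b (Suc m)"] b1 by simp
        next
          case False
          then have e: "b (Suc (Suc m)) = b (Suc m)" using step[of "Suc m"] m by simp
          show ?thesis
          proof (cases m)
            case 0
            then show ?thesis using bound[OF b1] assms(2) m by (simp add: posfac_def)
          next
            case (Suc m')
            then show ?thesis using b1 assms(2) m by (simp add: posfac_def)
          qed
        qed
      qed
    qed (use * k in blast)
  qed
  have eq: "\<forall>m\<le>n. b m = B i m"
  proof (intro allI)
    fix m show "m \<le> n \<longrightarrow> b m = B i m"
    proof (induction m rule: induct_nat_012)
      case (ge2 m)
      then show ?case using nx[of m] by auto
    qed (use assms(2) in \<open>auto simp: posfac_def\<close>)
  qed
  have "B i m < B i (Suc m)" if m: "m \<le> n" for m
  proof -
    consider "m = 0" | "m = 1" | m' where "m = Suc (Suc m')" by (cases m; cases "m - 1") auto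
    then show ?thesis
    proof cases
      case 2
      then show ?thesis using nxt_lower[of i] bn[of 1] eq m by auto
    next
      case 3
      then have r: "\<not> red (b (Suc m')) (b m)" using assms(2) m by (simp add: posfac_def)
      have "lo \<le> b (Suc m')" "b m \<le> hi" using ib[of "Suc m'"] assms(1) bn[of m] m 3 by auto
      then have "b m < nx (b (Suc m'))" using r nxt_le_iff by force
      moreover have "b (Suc m') = B i (Suc m')" "b m = B i m" using eq m 3 by auto
      ultimately show ?thesis using 3 by simp
    qed simp
  qed
  then show ?thesis using eq bn[of n] by (auto simp: amb_def)
qed

lemma amb_posfac:
  assumes "lo \<le> i" "Amb n i j" shows "posfac i n (B i)"
proof -
  have hi: "i \<le> hi" using amb_bounds[OF assms] by simp
  have lt: "B i m < B i (Suc m)" if "m \<le> n" for m using assms(2) that by (simp add: amb_def)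
  have mono: "B i m \<le> B i n" if "m \<le> n" for m
    using that
  proof (induction "n - m" arbitrary: m)
    case (Suc d)
    then have "B i (Suc m) \<le> B i n" "m \<le> n" by auto
    then show ?case using lt[of m] by simp
  qed simp
  have bh: "B i m \<le> hi" if "m \<le> n" for m using mono[OF that] assms(2) by (simp add: amb_def)
  show ?thesis unfolding posfac_def
  proof (intro conjI allI impI)
    fix m assume m: "Suc (Suc m) \<le> n"
    show "red (B i m) (B i (Suc (Suc m)))"
      using nxt_le_iff[OF chain_lo[OF assms(1) hi, of m] bh[OF m]] by simp
    fix k assume "B i (Suc m) \<le> k \<and> k < B i (Suc (Suc m))"
    then show "\<not> red (B i m) k"
      using nxt_le_iff[OF chain_lo[OF assms(1) hi, of m], of k] bh[OF m] by simp
  next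
    fix m assume m: "1 \<le> m \<and> m < n"
    then show "\<not> red (B i m) (B i (Suc m))"
      using nxt_le_iff[OF chain_lo[OF assms(1) hi, of m], of "B i (Suc m)"] bh[of "Suc m"] lt[of "Suc m"] by simp
  qed (use bh lt in \<open>auto simp: order_less_imp_le\<close>)
qed

end

context wf_digraph
begin

section \<open>Cutting a word at positions\<close>

lemma pconcat_Cons: "us \<noteq> [] \<Longrightarrow> pconcat (u # us) = pcomp u (pconcat us)"
  by (simp add: pconcat_def pcomp_def)

lemma pconcat_split:
  assumes "us \<noteq> []" "\<And>m. Suc m < length us \<Longrightarrow> joinable G (us ! m) (us ! Suc m)" "w = pconcat us"
  shows "\<exists>\<beta>. \<beta> 0 = 0 \<and> \<beta> (length us) = plen w \<and> (\<forall>m<length us. \<beta> m \<le> \<beta> (Suc m) \<and> us ! m = seg G w (\<beta> m) (\<beta> (Suc m)))"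
proof -
  have bnd: "i \<le> length us \<Longrightarrow> length (concat (map snd (take i us))) \<le> length (concat (map snd us))" for i and us :: "('a, 'b) path list"
    by (induction us arbitrary: i) (auto simp: take_Cons split: nat.splits)
  have "fst w = fst (us ! 0)" using assms by (simp add: pconcat_def hd_conv_nth)
  have src: "ptgt G (fst w, concat (map snd (take m us))) = fst (us ! m)" if "m < length us" for m
    using that
  proof (induction m)
    case 0
    then show ?case using \<open>fst w = fst (us ! 0)\<close> by simp
  next
    case (Suc m)
    have "joinable G (fst w, concat (map snd (take m us))) (us ! m)" using Suc by (simp add: joinable_def)
    then have "ptgt G (pcomp (fst w, concat (map snd (take m us))) (us ! m)) = ptgt G (us ! m)" by (rule ptgt_pcomp)
    moreover have "pcomp (fst w, concat (map snd (take m us))) (us ! m) = (fst w, concat (map snd (take (Suc m) us)))"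
      using Suc by (simp add: pcomp_def take_Suc_conv_app_nth)
    ultimately show ?case using assms(2)[of m] Suc by (simp add: joinable_def)
  qed
  have "us ! m = seg G w (length (concat (map snd (take m us)))) (length (concat (map snd (take (Suc m) us))))"
    if "m < length us" for m
  proof -
    have w: "snd w = concat (map snd (take m us)) @ snd (us ! m) @ concat (map snd (drop (Suc m) us))"
      using assms(3) id_take_nth_drop[OF that] by (metis concat.simps(2) concat_append list.simps(9) map_append pconcat_def snd_conv)
    have "concat (map snd (take (Suc m) us)) = concat (map snd (take m us)) @ snd (us ! m)"
      using that by (simp add: take_Suc_conv_app_nth)
    then show ?thesis using w src[OF that] by (auto simp: seg_def intro!: prod_eqI)
  qed
  \<comment> \<open>The breaks are the lengths of the initial products.\<close>
  then show ?thesis using assms(3)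
    by (intro exI[of _ "\<lambda>m. length (concat (map snd (take m us)))"])
      (auto simp: pconcat_def take_Suc_conv_app_nth)
qed

lemma pconcat_seg:
  assumes "\<And>m. m \<le> n \<Longrightarrow> \<beta> m \<le> \<beta> (Suc m)" "\<beta> (Suc n) \<le> plen w"
  shows "pconcat (map (\<lambda>m. seg G w (\<beta> m) (\<beta> (Suc m))) [0..<Suc n]) = seg G w (\<beta> 0) (\<beta> (Suc n))"
  using assms
proof (induction n arbitrary: \<beta>)
  case 0
  then show ?case by (simp add: pconcat_def)
next
  case (Suc n)
  note step = Suc.prems(1) and hi = Suc.prems(2) and IH = Suc.IH
  have mono: "\<beta> 1 \<le> \<beta> (Suc m)" if "m \<le> Suc n" for m
    using that
  proof (induction m)
    case (Suc m)
    then have "\<beta> 1 \<le> \<beta> (Suc m)" by simp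
    then show ?case using step[OF Suc.prems] by (rule order_trans)
  qed simp
  have e: "[0..<Suc (Suc n)] = 0 # map Suc [0..<Suc n]" by (subst upt_conv_Cons, simp) (simp only: map_Suc_upt)
  have "pconcat (map (\<lambda>m. seg G w (\<beta> m) (\<beta> (Suc m))) [0..<Suc (Suc n)])
    = pcomp (seg G w (\<beta> 0) (\<beta> 1)) (pconcat (map (\<lambda>m. seg G w (\<beta> (Suc m)) (\<beta> (Suc (Suc m)))) [0..<Suc n]))"
    unfolding e by (simp add: pconcat_Cons comp_def del: upt_Suc)
  also have "\<dots> = pcomp (seg G w (\<beta> 0) (\<beta> 1)) (seg G w (\<beta> 1) (\<beta> (Suc (Suc n))))"
    using IH[of "\<lambda>m. \<beta> (Suc m)"] step hi by simp
  also have "\<dots> = seg G w (\<beta> 0) (\<beta> (Suc (Suc n)))"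
    using step[of 0] hi mono[of "Suc n"] by (intro seg_pcomp) auto
  finally show ?case .
qed

lemma path_divides_seg:
  assumes "w \<in> paths G"
  shows "path_divides G s w \<longleftrightarrow> (\<exists>i j. i \<le> j \<and> j \<le> plen w \<and> seg G w i j = s)"
proof
  assume "path_divides G s w"
  then obtain a b where *: "joinable G a s" "joinable G s b" "w = pcomp (pcomp a s) b"
    by (auto simp: path_divides_def)
  show "\<exists>i j. i \<le> j \<and> j \<le> plen w \<and> seg G w i j = s"
    using seg_pcomp3(2)[OF *] *(3) by (intro exI[of _ "plen a"] exI[of _ "plen a + plen s"]) simp
next
  assume "\<exists>i j. i \<le> j \<and> j \<le> plen w \<and> seg G w i j = s"
  then obtain i j where *: "i \<le> j" "j \<le> plen w" "seg G w i j = s" by blast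
  then show "path_divides G s w" unfolding path_divides_def
    using assms seg_pcomp[of 0 i j w] seg_pcomp[of 0 j "plen w" w]
    by (intro bexI[of _ "seg G w 0 i"] bexI[of _ "seg G w j (plen w)"])
      (auto simp: seg_joinable seg_in_paths)
qed

lemma snd_seg_empty [simp]: "snd (seg G w i i) = []"
  by (simp add: seg_def)

lemma left_divides_seg:
  assumes "w \<in> paths G"
  shows "left_divides G d w \<longleftrightarrow> (\<exists>j. j \<le> plen w \<and> d = seg G w 0 j)"
proof
  assume "left_divides G d w"
  then obtain a b where *: "snd a = []" "joinable G a d" "joinable G d b" "w = pcomp (pcomp a d) b"
    by (auto simp: left_divides_def paths_len_def)
  then show "\<exists>j. j \<le> plen w \<and> d = seg G w 0 j"
    using seg_pcomp3(2)[OF *(2-4)] *(1,4) by (intro exI[of _ "plen d"]) simp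
next
  assume "\<exists>j. j \<le> plen w \<and> d = seg G w 0 j"
  then obtain j where *: "j \<le> plen w" "d = seg G w 0 j" by blast
  then show "left_divides G d w" unfolding left_divides_def
    using assms seg_pcomp[of 0 0 j w] seg_pcomp[of 0 j "plen w" w]
    by (rule_tac bexI[of _ "seg G w 0 0"], rule_tac bexI[of _ "seg G w j (plen w)"])
      (auto simp: seg_joinable seg_in_paths paths_len_def)
qed

lemma right_divides_seg:
  assumes "w \<in> paths G"
  shows "right_divides G d w \<longleftrightarrow> (\<exists>i. i \<le> plen w \<and> d = seg G w i (plen w))"
proof
  assume "right_divides G d w"
  then obtain a b where *: "snd b = []" "joinable G a d" "joinable G d b" "w = pcomp (pcomp a d) b"
    by (auto simp: right_divides_def paths_len_def)
  then show "\<exists>i. i \<le> plen w \<and> d = seg G w i (plen w)"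
    using seg_pcomp3(2)[OF *(2-4)] *(1,4) by (intro exI[of _ "plen a"]) simp
next
  assume "\<exists>i. i \<le> plen w \<and> d = seg G w i (plen w)"
  then obtain i where *: "i \<le> plen w" "d = seg G w i (plen w)" by blast
  then show "right_divides G d w" unfolding right_divides_def
    using assms seg_pcomp[of 0 i "plen w" w] seg_pcomp[of 0 "plen w" "plen w" w]
    by (rule_tac bexI[of _ "seg G w 0 i"], rule_tac bexI[of _ "seg G w (plen w) (plen w)"])
      (auto simp: seg_joinable seg_in_paths paths_len_def)
qed

end

context rsys
begin

section \<open>Words of the quiver in terms of positions\<close>

definition sg :: "('v, 'e) path \<Rightarrow> int \<Rightarrow> int \<Rightarrow> ('v, 'e) path"
  where "sg w i j = seg Q w (nat i) (nat j)"

text \<open>Pairs that do not bound a segment of w count as irreducible. With this convention the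
  calculus of positions applies with bounds 0 and the length of w.\<close>

definition rd :: "('v, 'e) path \<Rightarrow> int \<Rightarrow> int \<Rightarrow> bool"
  where "rd w i j \<longleftrightarrow> 0 \<le> i \<and> i \<le> j \<and> j \<le> int (plen w) \<and> sg w i j \<notin> irrp"

lemma reducible_seg:
  assumes "w \<in> P" "i \<le> j" "j \<le> plen w"
  shows "seg Q w i j \<notin> irrp \<longleftrightarrow> (\<exists>i' j'. i \<le> i' \<and> i' \<le> j' \<and> j' \<le> j \<and> seg Q w i' j' \<in> fst ` R)"
proof -
  have p: "seg Q w i j \<in> P" using assms by (rule seg_in_paths)
  have "seg Q w i j \<notin> irrp \<longleftrightarrow> (\<exists>i' j'. i' \<le> j' \<and> j' \<le> j - i \<and> seg Q w (i + i') (i + j') \<in> fst ` R)"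
    using p assms unfolding irr_iff path_divides_seg[OF p] by (auto simp: seg_seg)
  also have "\<dots> \<longleftrightarrow> (\<exists>i' j'. i \<le> i' \<and> i' \<le> j' \<and> j' \<le> j \<and> seg Q w i' j' \<in> fst ` R)"
  proof
    assume "\<exists>i' j'. i' \<le> j' \<and> j' \<le> j - i \<and> seg Q w (i + i') (i + j') \<in> fst ` R"
    then obtain i' j' where "i' \<le> j' \<and> j' \<le> j - i \<and> seg Q w (i + i') (i + j') \<in> fst ` R" by blast
    then show "\<exists>i' j'. i \<le> i' \<and> i' \<le> j' \<and> j' \<le> j \<and> seg Q w i' j' \<in> fst ` R"
      using assms by (intro exI[of _ "i + i'"] exI[of _ "i + j'"]) auto
  next
    assume "\<exists>i' j'. i \<le> i' \<and> i' \<le> j' \<and> j' \<le> j \<and> seg Q w i' j' \<in> fst ` R"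
    then obtain i' j' where "i \<le> i' \<and> i' \<le> j' \<and> j' \<le> j \<and> seg Q w i' j' \<in> fst ` R" by blast
    then show "\<exists>i' j'. i' \<le> j' \<and> j' \<le> j - i \<and> seg Q w (i + i') (i + j') \<in> fst ` R"
      by (intro exI[of _ "i' - i"] exI[of _ "j' - i"]) auto
  qed
  finally show ?thesis .
qed

lemma tip_len: "s \<in> fst ` R \<Longrightarrow> 2 \<le> plen s"
  using R_D(4) by force

lemma tip_divides: "s \<in> fst ` R \<Longrightarrow> s' \<in> fst ` R \<Longrightarrow> path_divides Q s s' \<Longrightarrow> s = s'"
  using redsys unfolding reduction_system_def by fastforce

lemma tips_word:
  assumes "w \<in> P" shows "tips (rd w) 0 (int (plen w))"
proof
  fix i j i' j' assume r: "rd w i j" "0 \<le> i'" "i' \<le> i" "j \<le> j'" "j' \<le> int (plen w)"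
  then have b: "nat i \<le> nat j" "nat j \<le> plen w" "nat i' \<le> nat j'" "nat j' \<le> plen w" "nat i' \<le> nat i" "nat j \<le> nat j'" by (auto simp: rd_def)
  from r(1) have "\<exists>a c. nat i \<le> a \<and> a \<le> c \<and> c \<le> nat j \<and> seg Q w a c \<in> fst ` R"
    using reducible_seg[OF assms b(1,2)] by (simp add: rd_def sg_def)
  then have "\<exists>a c. nat i' \<le> a \<and> a \<le> c \<and> c \<le> nat j' \<and> seg Q w a c \<in> fst ` R" using b(5,6) by (meson order_trans)
  then show "rd w i' j'" using reducible_seg[OF assms b(3,4)] r by (simp add: rd_def sg_def)
next
  fix i j assume r: "rd w i j"
  then have b: "nat i \<le> nat j" "nat j \<le> plen w" by (auto simp: rd_def)
  from r have "\<exists>a c. nat i \<le> a \<and> a \<le> c \<and> c \<le> nat j \<and> seg Q w a c \<in> fst ` R"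
    using reducible_seg[OF assms b(1,2)] by (simp add: rd_def sg_def)
  then obtain a c where *: "nat i \<le> a" "a \<le> c" "c \<le> nat j" "seg Q w a c \<in> fst ` R" by blast
  then have "2 \<le> c - a" using tip_len[OF *(4)] b by simp
  then have "i + 2 \<le> j" using * b r by (simp add: rd_def)
  then show "0 \<le> i \<and> i + 2 \<le> j \<and> j \<le> int (plen w)" using r by (simp add: rd_def)
qed

text \<open>The shift of degrees: \<open>A n\<close> holds the (n-1)-ambiguities, so vertices,
  arrows and tips have degrees 0, 1 and 2.\<close>

definition A :: "nat \<Rightarrow> ('v, 'e) path set"
  where "A n = ambiguities Q R (int n - 1)"

lemma A_simps: "A 0 = paths_len Q 0" "A (Suc 0) = paths_len Q 1" "A (Suc (Suc 0)) = fst ` R"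
  "A (Suc (Suc (Suc n))) = {p \<in> P. \<exists>us. is_left_factorization Q R (Suc (Suc n)) p us}"
  by (auto simp: A_def ambiguities_def nat_add_distrib Suc_nat_eq_nat_zadd1)

lemma sg_in_paths: "w \<in> P \<Longrightarrow> i \<le> j \<Longrightarrow> j \<le> int (plen w) \<Longrightarrow> sg w i j \<in> P"
  unfolding sg_def by (intro seg_in_paths) auto

lemma rd_iff: "0 \<le> i \<Longrightarrow> i \<le> j \<Longrightarrow> j \<le> int (plen w) \<Longrightarrow> rd w i j \<longleftrightarrow> sg w i j \<notin> irrp"
  by (simp add: rd_def)

lemma sg_pcomp: "0 \<le> i \<Longrightarrow> i \<le> j \<Longrightarrow> j \<le> k \<Longrightarrow> k \<le> int (plen w) \<Longrightarrow> pcomp (sg w i j) (sg w j k) = sg w i k"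
  unfolding sg_def by (intro seg_pcomp) auto

lemma sg_joinable: "0 \<le> i \<Longrightarrow> i \<le> j \<Longrightarrow> j \<le> int (plen w) \<Longrightarrow> jn (sg w i j) (sg w j k)"
  unfolding sg_def by (intro seg_joinable) auto

lemma plen_sg: "0 \<le> i \<Longrightarrow> i \<le> j \<Longrightarrow> j \<le> int (plen w) \<Longrightarrow> int (plen (sg w i j)) = j - i"
  unfolding sg_def by (subst plen_seg) auto

lemma sg_sg: "0 \<le> i' \<Longrightarrow> i' \<le> j' \<Longrightarrow> i + j' \<le> j \<Longrightarrow> 0 \<le> i \<Longrightarrow> j \<le> int (plen w) \<Longrightarrow>
  sg (sg w i j) i' j' = sg w (i + i') (i + j')"
  unfolding sg_def by (subst seg_seg) (auto simp: nat_add_distrib)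

text \<open>Proper left divisors of a factor are the segments with the same start and an earlier
  end, which turns the minimality clause into one about positions.\<close>

lemma left_factorization_posfac:
  assumes "w \<in> P" "is_left_factorization Q R n w us"
  shows "\<exists>b. tips.posfac (rd w) (int (plen w)) 0 (Suc n) b \<and> b (Suc n) = int (plen w) \<and>
    (\<forall>m\<le>n. us ! m = sg w (b m) (b (Suc m)) \<and> 0 \<le> b m \<and> b m \<le> b (Suc m) \<and> b (Suc m) \<le> int (plen w))"
proof -
  interpret t: tips "rd w" 0 "int (plen w)" by (rule tips_word[OF assms(1)])
  have len: "length us = Suc n" and w: "w = pconcat us" and u0: "us ! 0 \<in> paths_len Q 1"
    and irr: "\<And>m. m \<in> {1..n} \<Longrightarrow> us ! m \<in> irrp"
    and j: "\<And>m. m < n \<Longrightarrow> jn (us ! m) (us ! Suc m)"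
    and rdc: "\<And>m. m < n \<Longrightarrow> pcomp (us ! m) (us ! Suc m) \<notin> irrp"
    and min: "\<And>m d. m < n \<Longrightarrow> d \<in> P \<Longrightarrow> left_divides Q d (us ! Suc m) \<Longrightarrow> d \<noteq> us ! Suc m \<Longrightarrow> pcomp (us ! m) d \<in> irrp"
    using assms(2) by (auto simp: is_left_factorization_def)
  have "us \<noteq> []" using len by auto
  then obtain \<beta> where \<beta>: "\<beta> 0 = 0" "\<beta> (Suc n) = plen w" "\<And>m. m \<le> n \<Longrightarrow> \<beta> m \<le> \<beta> (Suc m)"
    "\<And>m. m \<le> n \<Longrightarrow> us ! m = seg Q w (\<beta> m) (\<beta> (Suc m))"
    using pconcat_split[of us w] j len w by (auto simp: less_Suc_eq_le)
  have \<beta>n: "\<beta> m \<le> plen w" if "m \<le> Suc n" for m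
    using that
  proof (induction "Suc n - m" arbitrary: m)
    case (Suc d)
    then have "\<beta> (Suc m) \<le> plen w" "m \<le> n" by auto
    then show ?case using \<beta>(3)[of m] by simp
  qed (use \<beta>(2) in auto)
  have u: "us ! m = sg w (int (\<beta> m)) (int (\<beta> (Suc m)))" if "m \<le> n" for m
    using \<beta>(4)[OF that] by (simp add: sg_def)
  have b1: "\<beta> 1 = 1" using u0 \<beta>(1) \<beta>(4)[of 0] \<beta>n[of 1] by (simp add: paths_len_def)
  have "t.posfac 0 (Suc n) (\<lambda>m. int (\<beta> m))" unfolding t.posfac_def
  proof (intro conjI allI impI)
    fix m assume "Suc (Suc m) \<le> Suc n"
    then have m: "m < n" by simp
    note bb = \<beta>(3)[of m] \<beta>(3)[of "Suc m"] \<beta>n[of "Suc (Suc m)"]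
    show "rd w (int (\<beta> m)) (int (\<beta> (Suc (Suc m))))"
      using rdc[OF m] m bb by (simp add: rd_iff u sg_pcomp)
    fix k assume k: "int (\<beta> (Suc m)) \<le> k \<and> k < int (\<beta> (Suc (Suc m)))"
    define d where "d = sg w (int (\<beta> (Suc m))) k"
    have dP: "d \<in> P" unfolding d_def using k m bb assms(1) by (intro sg_in_paths) auto
    have "d = seg Q (us ! Suc m) 0 (nat k - \<beta> (Suc m))"
      unfolding d_def sg_def \<beta>(4)[of "Suc m", OF m[THEN Suc_leI]] using k m bb by (subst seg_seg) auto
    then have ld: "left_divides Q d (us ! Suc m)"
      using k m bb assms(1) by (subst left_divides_seg) (auto simp: \<beta>(4) intro!: seg_in_paths exI[of _ "nat k - \<beta> (Suc m)"])
    have "int (plen d) < int (plen (us ! Suc m))" using k m bb by (simp add: d_def u plen_sg)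
    then have "pcomp (us ! m) d \<in> irrp" using min[OF m dP ld] by auto
    then show "\<not> rd w (int (\<beta> m)) k" using k m bb by (simp add: rd_iff u d_def sg_pcomp)
  next
    fix m assume m: "1 \<le> m \<and> m < Suc n"
    then show "\<not> rd w (int (\<beta> m)) (int (\<beta> (Suc m)))"
      using irr[of m] \<beta>(3)[of m] \<beta>n[of "Suc m"] by (simp add: rd_iff u)
  qed (use b1 \<beta> in auto)
  then show ?thesis using u \<beta> \<beta>n
    by (intro exI[of _ "\<lambda>m. int (\<beta> m)"]) auto
qed

text \<open>Factors are numbered from the right and positions are negated, so that the same
  predicate on break sequences can be applied to the mirrored word.\<close>

lemma right_factorization_posfac:
  assumes "w \<in> P" "is_right_factorization Q R n w vs"
  shows "\<exists>b. tips.posfac (flip (rd w)) 0 (- int (plen w)) (Suc n) b \<and> b (Suc n) = 0 \<and>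
    (\<forall>m\<le>n. vs ! m = sg w (- b (Suc m)) (- b m) \<and> 0 \<le> - b (Suc m) \<and> b m \<le> b (Suc m) \<and> - b m \<le> int (plen w))"
proof -
  interpret tips "rd w" 0 "int (plen w)" by (rule tips_word[OF assms(1)])
  interpret t: tips "flip (rd w)" "- int (plen w)" 0 using flip by simp
  have len: "length vs = Suc n" and w: "w = pconcat (rev vs)" and u0: "vs ! 0 \<in> paths_len Q 1"
    and irr: "\<And>m. m \<in> {1..n} \<Longrightarrow> vs ! m \<in> irrp"
    and j: "\<And>m. m < n \<Longrightarrow> jn (vs ! Suc m) (vs ! m)"
    and rdc: "\<And>m. m < n \<Longrightarrow> pcomp (vs ! Suc m) (vs ! m) \<notin> irrp"
    and min: "\<And>m d. m < n \<Longrightarrow> d \<in> P \<Longrightarrow> right_divides Q d (vs ! Suc m) \<Longrightarrow> d \<noteq> vs ! Suc m \<Longrightarrow> pcomp d (vs ! m) \<in> irrp"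
    using assms(2) by (auto simp: is_right_factorization_def)
  have "rev vs \<noteq> []" using len by auto
  moreover have "jn (rev vs ! m) (rev vs ! Suc m)" if "Suc m < length (rev vs)" for m
    using j[of "n - Suc m"] that len by (simp add: rev_nth Suc_diff_Suc)
  ultimately obtain \<beta> where \<beta>: "\<beta> 0 = 0" "\<beta> (Suc n) = plen w" "\<And>m. m \<le> n \<Longrightarrow> \<beta> m \<le> \<beta> (Suc m)"
    "\<And>m. m \<le> n \<Longrightarrow> rev vs ! m = seg Q w (\<beta> m) (\<beta> (Suc m))"
    using pconcat_split[of "rev vs" w] len w by (auto simp: less_Suc_eq_le)
  define c where "c m = \<beta> (Suc n - m)" for m
  have c: "c 0 = plen w" "c (Suc n) = 0" "\<And>m. m \<le> n \<Longrightarrow> c (Suc m) \<le> c m"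
    using \<beta>(1,2) \<beta>(3)[of "n - m" for m] by (auto simp: c_def Suc_diff_le)
  have v: "vs ! m = seg Q w (c (Suc m)) (c m)" if "m \<le> n" for m
    using \<beta>(4)[of "n - m"] that len by (simp add: c_def rev_nth Suc_diff_le)
  have cn: "c m \<le> plen w" if "m \<le> Suc n" for m
    using that
  proof (induction m)
    case (Suc m)
    then show ?case using c(3)[of m] by simp
  qed (use c in auto)
  have u: "vs ! m = sg w (int (c (Suc m))) (int (c m))" if "m \<le> n" for m
    using v[OF that] by (simp add: sg_def)
  have b1: "int (c 1) = int (plen w) - 1"
  proof -
    have "plen (vs ! 0) = c 0 - c 1" using v[of 0] c(3)[of 0] cn[of 0] by simp
    then have "c 0 - c 1 = 1" using u0 by (simp add: paths_len_def)
    then show ?thesis using c(1) by linarith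
  qed
  have "t.posfac (- int (plen w)) (Suc n) (\<lambda>m. - int (c m))" unfolding t.posfac_def
  proof (intro conjI allI impI)
    fix m assume "Suc (Suc m) \<le> Suc n"
    then have m: "m < n" by simp
    note bb = c(3)[of m] c(3)[of "Suc m"] cn[of m]
    show "rd w (- (- int (c (Suc (Suc m))))) (- (- int (c m)))"
      using rdc[OF m] m bb by (simp add: rd_iff u sg_pcomp)
    fix k assume k: "- int (c (Suc m)) \<le> k \<and> k < - int (c (Suc (Suc m)))"
    define d where "d = sg w (- k) (int (c (Suc m)))"
    have dP: "d \<in> P" unfolding d_def using k m bb assms(1) by (intro sg_in_paths) auto
    have vv: "plen (vs ! Suc m) = c (Suc m) - c (Suc (Suc m))" using v[of "Suc m"] m bb by simp
    have "d = seg Q (vs ! Suc m) (nat (- k) - c (Suc (Suc m))) (plen (vs ! Suc m))"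
      unfolding d_def sg_def vv unfolding v[of "Suc m", OF m[THEN Suc_leI]] using k m bb by (subst seg_seg) auto
    then have ld: "right_divides Q d (vs ! Suc m)"
      using k m bb assms(1) v[of "Suc m"] by (subst right_divides_seg) (auto intro!: seg_in_paths exI[of _ "nat (- k) - c (Suc (Suc m))"])
    have "int (plen d) < int (plen (vs ! Suc m))" using k m bb by (simp add: d_def u plen_sg)
    then have "pcomp d (vs ! m) \<in> irrp" using min[OF m dP ld] by auto
    then show "\<not> rd w (- k) (- (- int (c m)))" using k m bb by (simp add: rd_iff u d_def sg_pcomp)
  next
    fix m assume m: "1 \<le> m \<and> m < Suc n"
    then show "\<not> rd w (- (- int (c (Suc m)))) (- (- int (c m)))"
      using irr[of m] c(3)[of m] cn[of m] by (simp add: rd_iff u)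
  qed (use b1 c in auto)
  then show ?thesis using u c cn
    by (intro exI[of _ "\<lambda>m. - int (c m)"]) auto
qed

end

context tips
begin

lemma posfac_range:
  assumes "posfac i n b" "m \<le> n" shows "i \<le> b m" "b m \<le> b n"
proof -
  have step: "b m \<le> b (Suc m)" if "m < n" for m using assms(1) that by (simp add: posfac_def)
  show "i \<le> b m" using assms(2)
  proof (induction m)
    case (Suc m)
    then show ?case using step[of m] by simp
  qed (use assms(1) in \<open>simp add: posfac_def\<close>)
  show "b m \<le> b n" using assms(2)
  proof (induction "n - m" arbitrary: m)
    case (Suc d)
    then have "b (Suc m) \<le> b n" "m < n" by auto
    then show ?case using step[of m] by simp
  qed simp
qed

lemma amb_iff_posfac: "lo \<le> i \<Longrightarrow> Amb n i j \<longleftrightarrow> (\<exists>b. posfac i n b \<and> b n = j)"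
  using posfac_amb[of i n] amb_posfac[of i n j] chain_eq[of n i j] by blast

end

context rsys
begin

lemma rd_sg:
  assumes "0 \<le> i" "i \<le> j" "j \<le> int (plen w)" "0 \<le> a" "a \<le> c" "c \<le> j - i"
  shows "rd (sg w i j) a c \<longleftrightarrow> rd w (i + a) (i + c)"
  using assms by (simp add: rd_def plen_sg sg_sg)

text \<open>The greedy chain depends on the right bound of the word through its default value. The
  comparison therefore goes through break sequences, whose conditions mention only segments inside
  the ambiguity.\<close>

lemma amb_sg:
  assumes "w \<in> P" "0 \<le> i" "i \<le> j" "j \<le> int (plen w)"
  shows "amb (rd (sg w i j)) (j - i) n 0 (j - i) \<longleftrightarrow> amb (rd w) (int (plen w)) n i j"
proof -
  interpret t: tips "rd w" 0 "int (plen w)" by (rule tips_word[OF assms(1)])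
  have l: "int (plen (sg w i j)) = j - i" using assms by (simp add: plen_sg)
  interpret u: tips "rd (sg w i j)" 0 "j - i" using tips_word[OF sg_in_paths[OF assms(1,3,4)]] l by simp
  show ?thesis unfolding t.amb_iff_posfac[OF assms(2)] u.amb_iff_posfac[OF order_refl]
  proof
    assume "\<exists>b. u.posfac 0 n b \<and> b n = j - i"
    then obtain b where b: "u.posfac 0 n b" "b n = j - i" by blast
    note rg = u.posfac_range[OF b(1)]
    have 1: "rd (sg w i j) (b m) k \<longleftrightarrow> rd w (i + b m) (i + k)" if "m \<le> n" "b m \<le> k" "k \<le> j - i" for m k
      using rg(1)[OF that(1)] that assms by (intro rd_sg) auto
    have "t.posfac i n (\<lambda>m. i + b m)" unfolding t.posfac_def
    proof (intro conjI allI impI)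
      fix m assume m: "Suc (Suc m) \<le> n"
      have s: "b m \<le> b (Suc m)" "b (Suc m) \<le> b (Suc (Suc m))" using b(1) m by (simp_all add: u.posfac_def)
      show "rd w (i + b m) (i + b (Suc (Suc m)))"
        using b(1) m 1[of m "b (Suc (Suc m))"] rg(2)[of "Suc (Suc m)"] b(2) s by (simp add: u.posfac_def)
      fix k assume k: "i + b (Suc m) \<le> k \<and> k < i + b (Suc (Suc m))"
      have "\<not> rd (sg w i j) (b m) (k - i)" using b(1) m k by (simp add: u.posfac_def)
      then show "\<not> rd w (i + b m) k"
        using 1[of m "k - i"] k m rg(2)[of "Suc (Suc m)"] b(2) s by simp
    next
      fix m assume m: "1 \<le> m \<and> m < n"
      then have "\<not> rd (sg w i j) (b m) (b (Suc m))" "b m \<le> b (Suc m)" using b(1) by (simp_all add: u.posfac_def)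
      then show "\<not> rd w (i + b m) (i + b (Suc m))"
        using 1[of m "b (Suc m)"] m rg(2)[of "Suc m"] b(2) by simp
    qed (use b assms in \<open>auto simp: u.posfac_def\<close>)
    then show "\<exists>b. t.posfac i n b \<and> b n = j" using b(2) by (intro exI[of _ "\<lambda>m. i + b m"]) simp
  next
    assume "\<exists>b. t.posfac i n b \<and> b n = j"
    then obtain b where b: "t.posfac i n b" "b n = j" by blast
    note rg = t.posfac_range[OF b(1)]
    have 1: "rd (sg w i j) (b m - i) (k - i) \<longleftrightarrow> rd w (b m) k" if "m \<le> n" "b m \<le> k" "k \<le> j" for m k
      using rg(1)[OF that(1)] that assms rd_sg[of i j w "b m - i" "k - i"] by simp
    have "u.posfac 0 n (\<lambda>m. b m - i)" unfolding u.posfac_def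
    proof (intro conjI allI impI)
      fix m assume m: "Suc (Suc m) \<le> n"
      have s: "b m \<le> b (Suc m)" "b (Suc m) \<le> b (Suc (Suc m))" using b(1) m by (simp_all add: t.posfac_def)
      show "rd (sg w i j) (b m - i) (b (Suc (Suc m)) - i)"
        using b(1) m 1[of m "b (Suc (Suc m))"] rg(2)[of "Suc (Suc m)"] b(2) s by (simp add: t.posfac_def)
      fix k assume k: "b (Suc m) - i \<le> k \<and> k < b (Suc (Suc m)) - i"
      have "\<not> rd w (b m) (k + i)" using b(1) m k by (simp add: t.posfac_def)
      then show "\<not> rd (sg w i j) (b m - i) k"
        using 1[of m "k + i"] k m rg(2)[of "Suc (Suc m)"] b(2) s by simp
    next
      fix m assume m: "1 \<le> m \<and> m < n"
      then have "\<not> rd w (b m) (b (Suc m))" "b m \<le> b (Suc m)" using b(1) by (simp_all add: t.posfac_def)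
      then show "\<not> rd (sg w i j) (b m - i) (b (Suc m) - i)"
        using 1[of m "b (Suc m)"] m rg(2)[of "Suc m"] b(2) by simp
    qed (use b assms in \<open>auto simp: t.posfac_def\<close>)
    then show "\<exists>b. u.posfac 0 n b \<and> b n = j - i" using b(2) by (intro exI[of _ "\<lambda>m. b m - i"]) simp
  qed
qed

lemma amb_left_factorization:
  assumes "w \<in> P" "amb (rd w) (int (plen w)) (Suc n) 0 (int (plen w))"
  shows "is_left_factorization Q R n w
    (map (\<lambda>m. sg w (chain (rd w) (int (plen w)) 0 m) (chain (rd w) (int (plen w)) 0 (Suc m))) [0..<Suc n])"
proof -
  interpret t: tips "rd w" 0 "int (plen w)" by (rule tips_word[OF assms(1)])
  define b where "b = t.B 0"
  have pf: "t.posfac 0 (Suc n) b" "b (Suc n) = int (plen w)"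
    using t.amb_posfac[OF order_refl assms(2)] t.chain_eq[OF assms(2)] by (simp_all add: b_def)
  note rg = t.posfac_range[OF pf(1)]
  have step: "b m \<le> b (Suc m)" if "m \<le> n" for m using pf(1) that by (simp add: t.posfac_def)
  have bb: "0 \<le> b m" "b m \<le> int (plen w)" if "m \<le> Suc n" for m using rg[OF that] pf(2) by auto
  let ?us = "map (\<lambda>m. sg w (b m) (b (Suc m))) [0..<Suc n]"
  have nth: "?us ! m = sg w (b m) (b (Suc m))" if "m \<le> n" for m using that by (simp del: upt_Suc)
  have b01: "b 0 = 0" "b 1 = 1" by (simp_all add: b_def)
  have "is_left_factorization Q R n w ?us" unfolding is_left_factorization_def
  proof (intro conjI ballI allI impI)
    show "w = pconcat ?us"
      using pconcat_seg[of n "\<lambda>m. nat (b m)" w] step bb pf(2) b01 by (simp add: sg_def nat_mono del: upt_Suc)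
    have n0: "?us ! 0 = sg w (b 0) (b 1)" using nth[of 0] by (simp del: upt_Suc)
    show "?us ! 0 \<in> paths_len Q 1"
      using step[of 0] bb[of 1] b01 assms(1) plen_sg[of 0 1 w] unfolding n0
      by (simp add: paths_len_def sg_in_paths)
    fix m assume "m \<in> {1..n}"
    then show "?us ! m \<in> irrp"
      using pf(1) step[of m] bb[of m] bb[of "Suc m"] rd_iff[of "b m" "b (Suc m)" w] nth[of m] by (simp add: t.posfac_def)
  next
    fix m assume m: "m < n"
    note st = step[of m] step[of "Suc m"] bb[of m] bb[of "Suc m"] bb[of "Suc (Suc m)"]
    have n: "?us ! m = sg w (b m) (b (Suc m))" "?us ! Suc m = sg w (b (Suc m)) (b (Suc (Suc m)))" using nth[of m] nth[of "Suc m"] m by auto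
    show "jn (?us ! m) (?us ! Suc m)" unfolding n using st m by (intro sg_joinable) auto
    have "rd w (b m) (b (Suc (Suc m)))" using pf(1) m by (simp add: t.posfac_def)
    then show "pcomp (?us ! m) (?us ! Suc m) \<notin> irrp" unfolding n using st m by (simp add: sg_pcomp rd_def)
    fix d assume d: "d \<in> P" "left_divides Q d (?us ! Suc m) \<and> d \<noteq> ?us ! Suc m"
    have p: "sg w (b (Suc m)) (b (Suc (Suc m))) \<in> P" using st m assms(1) by (intro sg_in_paths) auto
    have l: "int (plen (sg w (b (Suc m)) (b (Suc (Suc m))))) = b (Suc (Suc m)) - b (Suc m)" using st m by (intro plen_sg) auto
    obtain k where k: "k \<le> plen (?us ! Suc m)" "d = seg Q (?us ! Suc m) 0 k"
      using d(2) p unfolding n by (auto simp: left_divides_seg)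
    have kk: "int k \<le> b (Suc (Suc m)) - b (Suc m)" using k(1) l unfolding n by simp
    have "d = sg (sg w (b (Suc m)) (b (Suc (Suc m)))) 0 (int k)" using k(2) unfolding n by (simp add: sg_def[of _ 0])
    also have "\<dots> = sg w (b (Suc m)) (b (Suc m) + int k)" using sg_sg[of 0 "int k" "b (Suc m)" "b (Suc (Suc m))" w] st m kk by simp
    finally have de: "d = sg w (b (Suc m)) (b (Suc m) + int k)" .
    then have "int k < b (Suc (Suc m)) - b (Suc m)" using d(2) kk unfolding n by (cases "int k = b (Suc (Suc m)) - b (Suc m)") auto
    then have "\<not> rd w (b m) (b (Suc m) + int k)" using pf(1) m by (simp add: t.posfac_def)
    then show "pcomp (?us ! m) d \<in> irrp" unfolding n de using st m kk by (simp add: sg_pcomp rd_iff)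
  qed simp
  then show ?thesis by (simp add: b_def)
qed

lemma amb_right_factorization:
  assumes "w \<in> P" "amb (rd w) (int (plen w)) (Suc n) 0 (int (plen w))"
  shows "is_right_factorization Q R n w
    (map (\<lambda>m. sg w (- chain (flip (rd w)) 0 (- int (plen w)) (Suc m)) (- chain (flip (rd w)) 0 (- int (plen w)) m)) [0..<Suc n])"
proof -
  interpret t0: tips "rd w" 0 "int (plen w)" by (rule tips_word[OF assms(1)])
  interpret t: tips "flip (rd w)" "- int (plen w)" 0 using t0.flip by simp
  have am: "t.Amb (Suc n) (- int (plen w)) 0" using t0.amb_flip[OF order_refl assms(2)] by simp
  define b where "b m = - t.B (- int (plen w)) m" for m
  have pf: "t.posfac (- int (plen w)) (Suc n) (\<lambda>m. - b m)" "b (Suc n) = 0"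
    using t.amb_posfac[OF order_refl am] t.chain_eq[OF am] by (simp_all add: b_def)
  note rg = t.posfac_range[OF pf(1)]
  have step: "b (Suc m) \<le> b m" if "m \<le> n" for m using pf(1) that by (simp add: t.posfac_def)
  have bb: "0 \<le> b m" "b m \<le> int (plen w)" if "m \<le> Suc n" for m using rg[OF that] pf(2) by auto
  let ?vs = "map (\<lambda>m. sg w (b (Suc m)) (b m)) [0..<Suc n]"
  have nth: "?vs ! m = sg w (b (Suc m)) (b m)" if "m \<le> n" for m using that by (simp del: upt_Suc)
  have b01: "b 0 = int (plen w)" "b 1 = int (plen w) - 1" by (simp_all add: b_def)
  have "is_right_factorization Q R n w ?vs" unfolding is_right_factorization_def
  proof (intro conjI ballI allI impI)
    have "rev ?vs = map (\<lambda>m. seg Q w (nat (b (Suc n - m))) (nat (b (Suc n - Suc m)))) [0..<Suc n]"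
      by (rule nth_equalityI) (auto simp: rev_nth sg_def Suc_diff_le simp del: upt_Suc)
    then show "w = pconcat (rev ?vs)"
      using pconcat_seg[of n "\<lambda>m. nat (b (Suc n - m))" w] step[of "n - m" for m] b01 pf(2)
      by (simp add: Suc_diff_le nat_mono del: upt_Suc)
    have n0: "?vs ! 0 = sg w (b 1) (b 0)" using nth[of 0] by (simp del: upt_Suc)
    show "?vs ! 0 \<in> paths_len Q 1"
      using step[of 0] bb[of 1] b01 assms(1) plen_sg[of "b 1" "b 0" w] unfolding n0
      by (simp add: paths_len_def sg_in_paths)
    fix m assume "m \<in> {1..n}"
    then show "?vs ! m \<in> irrp"
      using pf(1) step[of m] bb[of m] bb[of "Suc m"] rd_iff[of "b (Suc m)" "b m" w] nth[of m] by (simp add: t.posfac_def)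
  next
    fix m assume m: "m < n"
    note st = step[of m] step[of "Suc m"] bb[of m] bb[of "Suc m"] bb[of "Suc (Suc m)"]
    have n: "?vs ! m = sg w (b (Suc m)) (b m)" "?vs ! Suc m = sg w (b (Suc (Suc m))) (b (Suc m))" using nth[of m] nth[of "Suc m"] m by auto
    show "jn (?vs ! Suc m) (?vs ! m)" unfolding n using st m by (intro sg_joinable) auto
    have "rd w (b (Suc (Suc m))) (b m)" using pf(1) m by (simp add: t.posfac_def)
    then show "pcomp (?vs ! Suc m) (?vs ! m) \<notin> irrp" unfolding n using st m by (simp add: sg_pcomp rd_def)
    fix d assume d: "d \<in> P" "right_divides Q d (?vs ! Suc m) \<and> d \<noteq> ?vs ! Suc m"
    have p: "sg w (b (Suc (Suc m))) (b (Suc m)) \<in> P" using st m assms(1) by (intro sg_in_paths) auto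
    have l: "int (plen (sg w (b (Suc (Suc m))) (b (Suc m)))) = b (Suc m) - b (Suc (Suc m))" using st m by (intro plen_sg) auto
    obtain k where k: "k \<le> plen (?vs ! Suc m)" "d = seg Q (?vs ! Suc m) k (plen (?vs ! Suc m))"
      using d(2) p unfolding n by (auto simp: right_divides_seg)
    have kk: "int k \<le> b (Suc m) - b (Suc (Suc m))" using k(1) l unfolding n by simp
    have "d = sg (sg w (b (Suc (Suc m))) (b (Suc m))) (int k) (b (Suc m) - b (Suc (Suc m)))"
      using k(2) l unfolding n sg_def[of _ "int k"] by (metis nat_int)
    also have "\<dots> = sg w (b (Suc (Suc m)) + int k) (b (Suc m))" using sg_sg[of "int k" _ "b (Suc (Suc m))" "b (Suc m)" w] st m kk by simp
    finally have de: "d = sg w (b (Suc (Suc m)) + int k) (b (Suc m))" .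
    have "k \<noteq> 0"
    proof
      assume "k = 0"
      then have "d = ?vs ! Suc m" using de unfolding n by simp
      then show False using d(2) by blast
    qed
    moreover have "\<And>k. - b (Suc m) \<le> k \<and> k < - b (Suc (Suc m)) \<Longrightarrow> \<not> rd w (- k) (- (- b m))" using pf(1) m by (simp add: t.posfac_def)
    from this[of "- (b (Suc (Suc m)) + int k)"] have "\<not> rd w (b (Suc (Suc m)) + int k) (b m)" using kk calculation by (simp add: add.commute)
    then show "pcomp d (?vs ! m) \<in> irrp" unfolding n de using st m kk by (simp add: sg_pcomp rd_iff)
  qed simp
  then show ?thesis by (simp add: b_def)
qed

text \<open>The explicit list of factors shows uniqueness, and thereby evaluates the definite
  description in \<open>left_factorization\<close>.\<close>

lemma left_factorization_amb:
  assumes "w \<in> P" "is_left_factorization Q R n w us"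
  shows "amb (rd w) (int (plen w)) (Suc n) 0 (int (plen w))"
    "us = map (\<lambda>m. sg w (chain (rd w) (int (plen w)) 0 m) (chain (rd w) (int (plen w)) 0 (Suc m))) [0..<Suc n]"
proof -
  interpret t: tips "rd w" 0 "int (plen w)" by (rule tips_word[OF assms(1)])
  obtain b where b: "t.posfac 0 (Suc n) b" "b (Suc n) = int (plen w)" "\<And>m. m \<le> n \<Longrightarrow> us ! m = sg w (b m) (b (Suc m))"
    using left_factorization_posfac[OF assms] by blast
  note pa = t.posfac_amb[OF order_refl b(1)]
  show "t.Amb (Suc n) 0 (int (plen w))" using pa b(2) by simp
  have "length us = Suc n" using assms(2) by (simp add: is_left_factorization_def)
  then show "us = map (\<lambda>m. sg w (t.B 0 m) (t.B 0 (Suc m))) [0..<Suc n]"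
    using b(3) pa by (intro nth_equalityI) (auto simp: less_Suc_eq_le simp del: upt_Suc chain.simps)
qed

lemma right_factorization_unique:
  assumes "w \<in> P" "is_right_factorization Q R n w vs"
  shows "vs = map (\<lambda>m. sg w (- chain (flip (rd w)) 0 (- int (plen w)) (Suc m)) (- chain (flip (rd w)) 0 (- int (plen w)) m)) [0..<Suc n]"
proof -
  interpret t0: tips "rd w" 0 "int (plen w)" by (rule tips_word[OF assms(1)])
  interpret t: tips "flip (rd w)" "- int (plen w)" 0 using t0.flip by simp
  obtain b where b: "t.posfac (- int (plen w)) (Suc n) b" "b (Suc n) = 0" "\<And>m. m \<le> n \<Longrightarrow> vs ! m = sg w (- b (Suc m)) (- b m)"
    using right_factorization_posfac[OF assms] by blast
  note pa = t.posfac_amb[OF order_refl b(1)]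
  have "length vs = Suc n" using assms(2) by (simp add: is_right_factorization_def)
  then show ?thesis
    using b(3) pa by (intro nth_equalityI) (auto simp: less_Suc_eq_le simp del: upt_Suc chain.simps)
qed

lemma A_paths: "A n \<subseteq> P"
proof -
  consider "n = 0" | "n = Suc 0" | "n = Suc (Suc 0)" | m where "n = Suc (Suc (Suc m))"
    by (metis not0_implies_Suc)
  then show ?thesis by cases (auto simp: A_simps paths_len_def dest: R_D(1))
qed

text \<open>Degree 2 needs an argument of its own, because tips are given by the reduction system
  and not by factorizations. No tip divides another, so a tip has no reducible proper segment.
  Conversely, a reducible word that becomes irreducible when shortened at either end contains a tip,
  which must be the whole word.\<close>

lemma A_iff:
  assumes "w \<in> P" shows "w \<in> A n \<longleftrightarrow> amb (rd w) (int (plen w)) n 0 (int (plen w))"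
proof -
  interpret t: tips "rd w" 0 "int (plen w)" by (rule tips_word[OF assms(1)])
  consider "n = 0" | "n = Suc 0" | "n = Suc (Suc 0)" | m where "n = Suc (Suc (Suc m))"
    by (metis not0_implies_Suc)
  then show ?thesis
  proof cases
    case 1
    then show ?thesis using assms by (auto simp: A_simps amb_def paths_len_def)
  next
    case 2
    have "t.Amb (Suc 0) 0 (int (plen w)) \<longleftrightarrow> plen w = 1"
    proof
      assume "plen w = 1"
      moreover have "m = 0 \<or> m = 1" if "m \<le> Suc 0" for m using that by linarith
      ultimately show "t.Amb (Suc 0) 0 (int (plen w))" using t.nxt_lower[of 0] unfolding amb_def by fastforce
    qed (simp add: amb_def)
    then show ?thesis using 2 assms by (simp add: A_simps paths_len_def)
  next
    case 3
    show ?thesis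
    proof
      assume "w \<in> A n"
      then have w: "w \<in> fst ` R" using 3 by (simp add: A_simps)
      have len: "2 \<le> plen w" using tip_len[OF w] .
      have proper: "i = 0 \<and> j = int (plen w)" if "rd w i j" for i j
      proof -
        from that have b: "nat i \<le> nat j" "nat j \<le> plen w" "0 \<le> i" "i \<le> j" by (auto simp: rd_def)
        from that obtain i' j' where *: "nat i \<le> i'" "i' \<le> j'" "j' \<le> nat j" "seg Q w i' j' \<in> fst ` R"
          using reducible_seg[OF assms b(1,2)] by (auto simp: rd_def sg_def)
        have "j' \<le> plen w" using *(3) b(2) by (rule order_trans)
        then have "path_divides Q (seg Q w i' j') w" using path_divides_seg[OF assms, of "seg Q w i' j'"] *(2) by blast
        then have "seg Q w i' j' = w" using tip_divides[OF *(4) w] by simp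
        then have "j' - i' = plen w" using plen_seg[of i' j' w] * b by simp
        then show ?thesis using * b by auto
      qed
      have "0 \<le> plen w \<and> plen w \<le> plen w \<and> seg Q w 0 (plen w) = w" by simp
      then have "path_divides Q w w" unfolding path_divides_seg[OF assms] by (rule_tac exI)+
      then have "w \<notin> irrp" using w irr_iff by blast
      then have "rd w 0 (int (plen w))" by (simp add: rd_def sg_def)
      moreover have "\<not> rd w 1 (int (plen w))" using proper[of 1 "int (plen w)"] by auto
      moreover have "\<not> rd w 0 k" if "k < int (plen w)" for k using proper[of 0 k] that by auto
      moreover have "Suc (Suc m) \<le> 2 \<longleftrightarrow> m = 0" "1 \<le> m \<and> m < 2 \<longleftrightarrow> m = 1" for m by auto
      ultimately have "t.posfac 0 2 (\<lambda>m. if m = 0 then 0 else if m = 1 then 1 else int (plen w))"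
        using len unfolding t.posfac_def by (simp add: less_Suc_eq)
      from t.posfac_amb[OF order_refl this] show "t.Amb n 0 (int (plen w))" using 3 by (simp add: numeral_2_eq_2)
    next
      assume "t.Amb n 0 (int (plen w))"
      then have a: "t.posfac 0 2 (t.B 0)" "t.B 0 2 = int (plen w)"
        using t.amb_posfac[of 0 n] 3 by (auto simp: numeral_2_eq_2 amb_def)
      then have r: "rd w 0 (int (plen w))" "\<And>k. 1 \<le> k \<Longrightarrow> k < int (plen w) \<Longrightarrow> \<not> rd w 0 k" "\<not> rd w 1 (int (plen w))"
        by (auto simp: t.posfac_def numeral_2_eq_2)
      then obtain i' j' where *: "i' \<le> j'" "j' \<le> plen w" "seg Q w i' j' \<in> fst ` R"
        using reducible_seg[OF assms, of 0 "plen w"] by (auto simp: rd_def sg_def)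
      have l: "2 \<le> j' - i'" using tip_len[OF *(3)] * by simp
      have red: "rd w i j" if "0 \<le> i" "i \<le> int i'" "int j' \<le> j" "j \<le> int (plen w)" for i j
      proof -
        have "nat i \<le> nat j" "nat j \<le> plen w" "nat i \<le> i'" "j' \<le> nat j" "i \<le> j" using that * by auto
        then show ?thesis using reducible_seg[OF assms, of "nat i" "nat j"] * that by (auto simp: rd_def sg_def)
      qed
      have "i' = 0" using red[of 1 "int (plen w)"] r(3) * by (cases i') auto
      moreover have "j' = plen w" using red[of 0 "int j'"] r(2)[of "int j'"] * l by (cases "j' < plen w") auto
      ultimately show "w \<in> A n" using * 3 by (simp add: A_simps)
    qed
  next
    case (4 m)
    then show ?thesis using assms amb_left_factorization[OF assms, of "Suc (Suc m)"] left_factorization_amb(1)[OF assms, of "Suc (Suc m)"]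
      by (auto simp: A_simps)
  qed
qed

lemma A_sg:
  assumes "w \<in> P" "0 \<le> i" "i \<le> j" "j \<le> int (plen w)"
  shows "sg w i j \<in> A n \<longleftrightarrow> amb (rd w) (int (plen w)) n i j"
  using A_iff[OF sg_in_paths[OF assms(1,3,4)]] amb_sg[OF assms] assms by (simp add: plen_sg)

lemma left_factorization_eq:
  assumes "w \<in> P" "w \<in> A (Suc n)"
  shows "left_factorization Q R n w = map (\<lambda>m. sg w (chain (rd w) (int (plen w)) 0 m) (chain (rd w) (int (plen w)) 0 (Suc m))) [0..<Suc n]"
  unfolding left_factorization_def
  using amb_left_factorization[OF assms(1)] left_factorization_amb(2)[OF assms(1)] assms A_iff by (intro the_equality) blast+

lemma right_factorization_eq:
  assumes "w \<in> P" "w \<in> A (Suc n)"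
  shows "right_factorization Q R n w = map (\<lambda>m. sg w (- chain (flip (rd w)) 0 (- int (plen w)) (Suc m)) (- chain (flip (rd w)) 0 (- int (plen w)) m)) [0..<Suc n]"
  unfolding right_factorization_def
  using amb_right_factorization[OF assms(1)] right_factorization_unique[OF assms(1)] assms A_iff by (intro the_equality) blast+

section \<open>Decompositions\<close>

definition Tr :: "nat \<Rightarrow> ('v, 'e) triple set"
  where "Tr n = {(a, p, c). a \<in> P \<and> p \<in> A n \<and> c \<in> P \<and> jn a p \<and> jn p c}"

definition Dec :: "nat \<Rightarrow> ('v, 'e) path \<Rightarrow> ('v, 'e) triple set"
  where "Dec n w = {t \<in> Tr n. wt t = w}"

definition tr :: "('v, 'e) path \<Rightarrow> int \<times> int \<Rightarrow> ('v, 'e) triple"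
  where "tr w ij = (sg w 0 (fst ij), sg w (fst ij) (snd ij), sg w (snd ij) (int (plen w)))"

text \<open>Occurrences of ambiguities in w as pairs of positions. By \<open>Dec_conv\<close> they
  parametrize the triples with product w, which turns sums over decompositions into sums over
  intervals.\<close>

definition Iv :: "('v, 'e) path \<Rightarrow> nat \<Rightarrow> (int \<times> int) set"
  where "Iv w n = {(i, j). 0 \<le> i \<and> amb (rd w) (int (plen w)) n i j}"

lemma Iv_bounds: "w \<in> P \<Longrightarrow> (i, j) \<in> Iv w n \<Longrightarrow> 0 \<le> i \<and> i \<le> j \<and> j \<le> int (plen w)"
  using tips.amb_bounds(1,3)[OF tips_word, of w i n j] by (simp add: Iv_def)

lemma finite_Iv: assumes "w \<in> P" shows "finite (Iv w n)"
  by (rule finite_subset[of _ "{0..int (plen w)} \<times> {0..int (plen w)}"]) (use Iv_bounds[OF assms] in fastforce)+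

lemma tr_inj: assumes "w \<in> P" shows "inj_on (tr w) (Iv w n)"
proof (rule inj_onI)
  fix x y assume x: "x \<in> Iv w n" and y: "y \<in> Iv w n" and e: "tr w x = tr w y"
  obtain i j i' j' where [simp]: "x = (i, j)" "y = (i', j')" by (cases x; cases y)
  note b = Iv_bounds[OF assms x[simplified]] Iv_bounds[OF assms y[simplified]]
  have "int (plen (sg w 0 i)) = int (plen (sg w 0 i'))" "int (plen (sg w i j)) = int (plen (sg w i' j'))"
    using e by (simp_all add: tr_def)
  then show "x = y" using b by (simp add: plen_sg)
qed

lemma sg_full: "sg w 0 (int (plen w)) = w"
  by (simp add: sg_def)

lemma Dec_conv: assumes "w \<in> P" shows "Dec n w = tr w ` Iv w n"
proof
  show "Dec n w \<subseteq> tr w ` Iv w n"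
  proof
    fix t assume t: "t \<in> Dec n w"
    obtain a p c where [simp]: "t = (a, p, c)" by (cases t)
    have *: "a \<in> P" "p \<in> A n" "c \<in> P" "jn a p" "jn p c" "w = pcomp (pcomp a p) c"
      using t by (auto simp: Dec_def Tr_def wt_def)
    have l: "plen w = plen a + plen p + plen c" using *(6) by simp
    have t': "t = tr w (int (plen a), int (plen a + plen p))"
      using seg_pcomp3[OF *(4-6)] by (simp add: tr_def sg_def del: of_nat_add)
    have "sg w (int (plen a)) (int (plen a + plen p)) \<in> A n" using *(2) t' by (simp add: tr_def)
    then have "(int (plen a), int (plen a + plen p)) \<in> Iv w n"
      using A_sg[OF assms] l by (simp add: Iv_def)
    then show "t \<in> tr w ` Iv w n" using t' by blast
  qed
  show "tr w ` Iv w n \<subseteq> Dec n w"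
  proof
    fix t assume "t \<in> tr w ` Iv w n"
    then obtain i j where *: "(i, j) \<in> Iv w n" "t = tr w (i, j)" by auto
    note b = Iv_bounds[OF assms *(1)]
    show "t \<in> Dec n w" using * b assms A_sg[OF assms, of i j n] 
      by (auto simp: Dec_def Tr_def wt_def tr_def Iv_def sg_in_paths sg_joinable sg_pcomp sg_full)
  qed
qed

lemma finite_Dec: "w \<in> P \<Longrightarrow> finite (Dec n w)"
  by (simp add: Dec_conv finite_Iv)

abbreviation ee :: "('v, 'e) triple \<Rightarrow> (('v, 'e) triple \<Rightarrow>\<^sub>0 'k)"
  where "ee t \<equiv> Poly_Mapping.single t 1"

lemma Iv_sg:
  assumes "w \<in> P" "0 \<le> i" "i \<le> j" "j \<le> int (plen w)"
  shows "Iv (sg w i j) n = (\<lambda>(a, c). (a - i, c - i)) ` {(a, c) \<in> Iv w n. i \<le> a \<and> c \<le> j}"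
proof -
  let ?u = "sg w i j"
  have u: "?u \<in> P" "int (plen ?u) = j - i" using assms by (auto simp: sg_in_paths plen_sg)
  have *: "(a - i, c - i) \<in> Iv ?u n \<longleftrightarrow> (a, c) \<in> Iv w n" if "i \<le> a" "a \<le> c" "c \<le> j" for a c
  proof -
    have "sg ?u (a - i) (c - i) = sg w a c" using sg_sg[of "a - i" "c - i" i j w] that assms by simp
    then show ?thesis using A_sg[OF u(1), of "a - i" "c - i" n] A_sg[OF assms(1), of a c n] that assms u by (simp add: Iv_def)
  qed
  show ?thesis
  proof (intro equalityI subsetI)
    fix x assume x: "x \<in> Iv ?u n"
    obtain a c where [simp]: "x = (a, c)" by (cases x)
    have "0 \<le> a" "a \<le> c" "c \<le> j - i" using Iv_bounds[OF u(1), of a c n] x u(2) by auto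
    then show "x \<in> (\<lambda>(a, c). (a - i, c - i)) ` {(a, c) \<in> Iv w n. i \<le> a \<and> c \<le> j}"
      using *[of "a + i" "c + i"] x by (intro image_eqI[of _ _ "(a + i, c + i)"]) auto
  next
    fix x assume "x \<in> (\<lambda>(a, c). (a - i, c - i)) ` {(a, c) \<in> Iv w n. i \<le> a \<and> c \<le> j}"
    then obtain a c where "x = (a - i, c - i)" "(a, c) \<in> Iv w n" "i \<le> a" "c \<le> j" by auto
    then show "x \<in> Iv ?u n" using *[of a c] Iv_bounds[OF assms(1)] by auto
  qed
qed

text \<open>The differential and the homotopy both sum over decompositions of a segment of w.
  Multiplying by the rest of w shifts positions by i and yields occurrences in w, while the
  condition T on triples becomes \<open>T'\<close> on positions.\<close>

lemma bact_Dec: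
  assumes "w \<in> P" "0 \<le> i" "i \<le> j" "j \<le> int (plen w)"
    and T: "\<And>a c. (a, c) \<in> Iv w n \<Longrightarrow> i \<le> a \<Longrightarrow> c \<le> j \<Longrightarrow> T (tr (sg w i j) (a - i, c - i)) \<longleftrightarrow> T' a c"
  shows "bact Q (kpath (sg w 0 i)) (kpath (sg w j (int (plen w)))) (\<Sum>t\<in>{t \<in> Dec n (sg w i j). T t}. ee t)
    = (\<Sum>x\<in>{(a, c). (a, c) \<in> Iv w n \<and> i \<le> a \<and> c \<le> j \<and> T' a c}. ee (tr w x))"
proof -
  let ?u = "sg w i j"
  have u: "?u \<in> P" "int (plen ?u) = j - i" using assms by (auto simp: sg_in_paths plen_sg)
  let ?X = "{(a, c). (a, c) \<in> Iv w n \<and> i \<le> a \<and> c \<le> j \<and> T' a c}"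
  let ?h = "\<lambda>(a, c). tr ?u (a - i, c - i)"
  have X: "?X \<subseteq> {(a, c) \<in> Iv w n. i \<le> a \<and> c \<le> j}" by auto
  have inj: "inj_on ?h ?X"
  proof (rule inj_onI)
    fix x y assume "x \<in> ?X" "y \<in> ?X" "?h x = ?h y"
    moreover have "(fst z - i, snd z - i) \<in> Iv ?u n" if "z \<in> ?X" for z
      unfolding Iv_sg[OF assms(1-4)] using that by (intro image_eqI[of _ _ z]) auto
    ultimately have "(fst x - i, snd x - i) = (fst y - i, snd y - i)"
      using inj_onD[OF tr_inj[OF u(1), of n], of "(fst x - i, snd x - i)" "(fst y - i, snd y - i)"]
      by (simp add: case_prod_unfold)
    then show "x = y" by (simp add: prod_eq_iff)
  qed
  have set: "{t \<in> Dec n ?u. T t} = ?h ` ?X"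
    unfolding Dec_conv[OF u(1)] Iv_sg[OF assms(1-4)] using T by (auto simp: image_iff) blast+
  have act: "bact Q (kpath (sg w 0 i)) (kpath (sg w j (int (plen w)))) (ee (?h x)) = ee (tr w x)" if x: "x \<in> ?X" for x
  proof -
    obtain a c where [simp]: "x = (a, c)" by (cases x)
    have b: "0 \<le> a" "a \<le> c" "c \<le> j" "i \<le> a" using x Iv_bounds[OF assms(1), of a c n] by auto
    have 1: "sg ?u 0 (a - i) = sg w i a" "sg ?u (a - i) (c - i) = sg w a c" "sg ?u (c - i) (j - i) = sg w c j"
      using sg_sg[of 0 "a - i" i j w] sg_sg[of "a - i" "c - i" i j w] sg_sg[of "c - i" "j - i" i j w] b assms by auto
    show ?thesis using b assms by (simp add: tr_def 1 u(2) bact_single sg_joinable sg_pcomp)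
  qed
  have "bact Q (kpath (sg w 0 i)) (kpath (sg w j (int (plen w)))) (\<Sum>t\<in>{t \<in> Dec n ?u. T t}. ee t)
    = (\<Sum>x\<in>?X. bact Q (kpath (sg w 0 i)) (kpath (sg w j (int (plen w)))) (ee (?h x)))"
    unfolding set bact_sum by (rule sum.reindex[OF inj, unfolded comp_def])
  also have "\<dots> = (\<Sum>x\<in>?X. ee (tr w x))" by (rule sum.cong[OF HOL.refl act])
  finally show ?thesis .
qed

section \<open>Weights\<close>

text \<open>The unreduced counterpart of the sets of lower terms: triples are bounded through the
  word they spell, coefficient included. The strict version on normalized triples is mapped into the
  span of the theorem by \<open>Psi_Lbar\<close>.\<close>

definition Mle :: "('v, 'e) triple set \<Rightarrow> ('v, 'e, 'k) lincomb \<Rightarrow> (('v, 'e) triple \<Rightarrow>\<^sub>0 'k) set"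
  where "Mle T w = zsp {Poly_Mapping.single t l | t l. t \<in> T \<and> rle (Poly_Mapping.single (wt t) l) w}"

definition Mlt :: "('v, 'e) triple set \<Rightarrow> ('v, 'e, 'k) lincomb \<Rightarrow> (('v, 'e) triple \<Rightarrow>\<^sub>0 'k) set"
  where "Mlt T w = zsp {Poly_Mapping.single t l | t l. t \<in> T \<and> rlt (Poly_Mapping.single (wt t) l) w}"

lemma MleI: "t \<in> T \<Longrightarrow> rle (Poly_Mapping.single (wt t) l) w \<Longrightarrow> Poly_Mapping.single t l \<in> Mle T w"
  unfolding Mle_def by (rule zsp.base) blast

lemma MltI: "t \<in> T \<Longrightarrow> rlt (Poly_Mapping.single (wt t) l) w \<Longrightarrow> Poly_Mapping.single t l \<in> Mlt T w"
  unfolding Mlt_def by (rule zsp.base) blast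

lemma M_closed:
  "0 \<in> Mle T w" "x \<in> Mle T w \<Longrightarrow> y \<in> Mle T w \<Longrightarrow> x + y \<in> Mle T w" "x \<in> Mle T w \<Longrightarrow> - x \<in> Mle T w"
  "x \<in> Mle T w \<Longrightarrow> y \<in> Mle T w \<Longrightarrow> x - y \<in> Mle T w"
  "0 \<in> Mlt T w" "x \<in> Mlt T w \<Longrightarrow> y \<in> Mlt T w \<Longrightarrow> x + y \<in> Mlt T w" "x \<in> Mlt T w \<Longrightarrow> - x \<in> Mlt T w"
  "x \<in> Mlt T w \<Longrightarrow> y \<in> Mlt T w \<Longrightarrow> x - y \<in> Mlt T w"
  unfolding Mle_def Mlt_def by (simp_all add: zsp.intros zsp_diff)

lemma M_sum: "(\<And>i. i \<in> J \<Longrightarrow> f i \<in> Mle T w) \<Longrightarrow> sum f J \<in> Mle T w"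
  "(\<And>i. i \<in> J \<Longrightarrow> f i \<in> Mlt T w) \<Longrightarrow> sum f J \<in> Mlt T w"
  unfolding Mle_def Mlt_def by (simp_all add: zsp_sum)

text \<open>Since 0 is a lower bound, generators with coefficient 0 occur. They are disposed of
  here, because strict comparison is transported only for nonzero coefficients.\<close>

lemma Mle_hom:
  assumes "x \<in> Mle T w" "\<And>x y. f (x + y) = f x + f y"
    "\<And>t l. t \<in> T \<Longrightarrow> l \<noteq> 0 \<Longrightarrow> rle (Poly_Mapping.single (wt t) l) w \<Longrightarrow> f (Poly_Mapping.single t l) \<in> zsp S"
  shows "f x \<in> zsp S"
proof (rule zsp_hom[OF assms(1)[unfolded Mle_def] assms(2)])
  fix s assume "s \<in> {Poly_Mapping.single t l | t l. t \<in> T \<and> rle (Poly_Mapping.single (wt t) l) w}"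
  then obtain t l where *: "s = Poly_Mapping.single t l" "t \<in> T" "rle (Poly_Mapping.single (wt t) l) w" by blast
  have "f 0 = 0" using assms(2)[of 0 0] by simp
  then show "f s \<in> zsp S" using assms(3)[OF *(2) _ *(3)] *(1) zsp.zero by (cases "l = 0") auto
qed

lemma Mlt_hom:
  assumes "x \<in> Mlt T w" "\<And>x y. f (x + y) = f x + f y"
    "\<And>t l. t \<in> T \<Longrightarrow> l \<noteq> 0 \<Longrightarrow> rlt (Poly_Mapping.single (wt t) l) w \<Longrightarrow> f (Poly_Mapping.single t l) \<in> zsp S"
  shows "f x \<in> zsp S"
proof (rule zsp_hom[OF assms(1)[unfolded Mlt_def] assms(2)])
  fix s assume "s \<in> {Poly_Mapping.single t l | t l. t \<in> T \<and> rlt (Poly_Mapping.single (wt t) l) w}"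
  then obtain t l where *: "s = Poly_Mapping.single t l" "t \<in> T" "rlt (Poly_Mapping.single (wt t) l) w" by blast
  have "f 0 = 0" using assms(2)[of 0 0] by simp
  then show "f s \<in> zsp S" using assms(3)[OF *(2) _ *(3)] *(1) zsp.zero by (cases "l = 0") auto
qed

lemma M_mono:
  "rle w w' \<Longrightarrow> Mle T w \<subseteq> Mle T w'" "rlt w w' \<Longrightarrow> Mle T w \<subseteq> Mlt T w'" "rle w w' \<Longrightarrow> Mlt T w \<subseteq> Mlt T w'"
  "Mlt T w \<subseteq> Mle T w" "T \<subseteq> T' \<Longrightarrow> Mle T w \<subseteq> Mle T' w" "T \<subseteq> T' \<Longrightarrow> Mlt T w \<subseteq> Mlt T' w"
  unfolding Mle_def Mlt_def
  by (intro zsp_mono, use red_le.trans le_lt_trans lt_le_trans lt_le in blast)+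

lemma Mle_keys: "x \<in> Mle T w \<Longrightarrow> Poly_Mapping.keys x \<subseteq> T"
  unfolding Mle_def
proof (induction rule: zsp.induct)
  case (add x y)
  then show ?case using keys_add[of x y] by blast
next
  case (minus x)
  have "Poly_Mapping.keys (- x) = Poly_Mapping.keys x" by (simp add: set_eq_iff in_keys_iff)
  then show ?case using minus by simp
qed (auto split: if_splits)

lemma Tr_TP: "Tr n \<subseteq> TP"
  by (auto simp: Tr_def TP_def)

lemma Mle_Fsp: "x \<in> Mle (Tr n) w \<Longrightarrow> x \<in> Fsp"
  using Mle_keys Tr_TP unfolding Fsp_def by blast

lemma Mlt_Mle: "x \<in> Mlt T w \<Longrightarrow> x \<in> Mle T w"
  using M_mono(4) by blast

lemma Tr_wt:
  assumes "t \<in> Tr n"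
  shows "wt t \<in> P" "fst (wt t) = fst (fst t)" "ptgt Q (wt t) = ptgt Q (snd (snd t))"
  using assms A_paths[of n] by (auto simp: Tr_def wt_def joinable_pcomp ptgt_pcomp intro!: pcomp_in_paths)

lemma bact_Tr:
  assumes "t \<in> Tr n" "a \<in> P" "c \<in> P"
  shows "bact Q (kpath a) (kpath c) (Poly_Mapping.single t l) = 0 \<or>
    (\<exists>t'\<in>Tr n. bact Q (kpath a) (kpath c) (Poly_Mapping.single t l) = Poly_Mapping.single t' l \<and>
      wt t' = pcomp (pcomp a (wt t)) c \<and> jn a (wt t) \<and> jn (wt t) c)"
proof -
  obtain x p y where t: "t = (x, p, y)" by (cases t)
  show ?thesis
  proof (cases "jn a x \<and> jn y c")
    case True
    then have "(pcomp a x, p, pcomp y c) \<in> Tr n" "wt (pcomp a x, p, pcomp y c) = pcomp (pcomp a (wt t)) c"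
      "jn a (wt t)" "jn (wt t) c"
      using assms t by (auto simp: Tr_def wt_def pcomp_in_paths joinable_pcomp pcomp_assoc)
    then show ?thesis using True t by (intro disjI2 bexI[of _ "(pcomp a x, p, pcomp y c)"]) (auto simp: bact_single)
  qed (auto simp: t bact_single)
qed

lemma bact_Mle:
  assumes "x \<in> Mle (Tr n) w" "a \<in> P" "c \<in> P"
  shows "bact Q (kpath a) (kpath c) x \<in> Mle (Tr n) (sw a c w)"
  unfolding Mle_def[of _ "sw a c w"]
proof (rule Mle_hom[OF assms(1) bact_linear(1)], fold Mle_def)
  fix t l assume t: "t \<in> Tr n" "rle (Poly_Mapping.single (wt t) l) w"
  show "bact Q (kpath a) (kpath c) (Poly_Mapping.single t l) \<in> Mle (Tr n) (sw a c w)"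
    using bact_Tr[OF t(1) assms(2,3), of l] le_sw[OF t(2) assms(2,3)]
    by (auto simp: M_closed sandwich_def intro!: MleI)
qed

lemma bact_Mlt:
  assumes "x \<in> Mlt (Tr n) w" "a \<in> P" "c \<in> P"
  shows "bact Q (kpath a) (kpath c) x \<in> Mlt (Tr n) (sw a c w)"
  unfolding Mlt_def[of _ "sw a c w"]
proof (rule Mlt_hom[OF assms(1) bact_linear(1)], fold Mlt_def)
  fix t l assume t: "t \<in> Tr n" "l \<noteq> 0" "rlt (Poly_Mapping.single (wt t) l) w"
  show "bact Q (kpath a) (kpath c) (Poly_Mapping.single t l) \<in> Mlt (Tr n) (sw a c w)"
    using bact_Tr[OF t(1) assms(2,3), of l] lt_sw[OF t(3,2) assms(2,3)]
    by (auto simp: M_closed sandwich_def intro!: MltI)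
qed

lemma scl_Mle: assumes "x \<in> Mle T w" shows "scl k x \<in> Mle T (scl k w)"
  unfolding Mle_def[of _ "scl k w"]
proof (rule Mle_hom[OF assms scl_add(1)], fold Mle_def)
  fix t l assume "t \<in> T" "rle (Poly_Mapping.single (wt t) l) w"
  then show "scl k (Poly_Mapping.single t l) \<in> Mle T (scl k w)"
    using le_scl[of "Poly_Mapping.single (wt t) l" w k] by (simp add: MleI)
qed

lemma scl_Mlt: assumes "x \<in> Mlt T w" shows "scl k x \<in> Mlt T (scl k w)"
proof (cases "k = 0")
  case False
  show ?thesis unfolding Mlt_def[of _ "scl k w"]
  proof (rule Mlt_hom[OF assms scl_add(1)], fold Mlt_def)
    fix t l assume "t \<in> T" "rlt (Poly_Mapping.single (wt t) l) w"
    then show "scl k (Poly_Mapping.single t l) \<in> Mlt T (scl k w)"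
      using lt_scl[of "Poly_Mapping.single (wt t) l" w k] False by (simp add: MltI)
  qed
qed (simp add: M_closed)

lemma bact_Mle_single:
  assumes "x \<in> Mle (Tr n) (kpath q)" "t = (a, q, c)" "a \<in> P" "c \<in> P" "jn a q" "jn q c"
  shows "scl l (bact Q (kpath a) (kpath c) x) \<in> Mle (Tr n) (Poly_Mapping.single (wt t) l)"
  using scl_Mle[OF bact_Mle[OF assms(1,3,4)], of l] assms by (simp add: sandwich_def wt_def)

lemma bact_Mlt_single:
  assumes "x \<in> Mlt (Tr n) (kpath q)" "t = (a, q, c)" "a \<in> P" "c \<in> P" "jn a q" "jn q c"
  shows "scl l (bact Q (kpath a) (kpath c) x) \<in> Mlt (Tr n) (Poly_Mapping.single (wt t) l)"
  using scl_Mlt[OF bact_Mlt[OF assms(1,3,4)], of l] assms by (simp add: sandwich_def wt_def)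

lemma dif_single: "dif Q g (Poly_Mapping.single (a, q, c) l) = scl l (bact Q (kpath a) (kpath c) (g q))"
  by (simp add: dif_def)

lemma dif_Mle:
  assumes "\<And>q. q \<in> A n \<Longrightarrow> g q \<in> Mle (Tr m) (kpath q)"
  shows "x \<in> Mle (Tr n) w \<Longrightarrow> dif Q g x \<in> Mle (Tr m) w" "x \<in> Mlt (Tr n) w \<Longrightarrow> dif Q g x \<in> Mlt (Tr m) w"
proof -
  have *: "dif Q g (Poly_Mapping.single t l) \<in> Mle (Tr m) (Poly_Mapping.single (wt t) l)" if "t \<in> Tr n" for t l
    using bact_Mle_single[OF assms, of "fst (snd t)" t "fst t" "snd (snd t)" l] that by (cases t) (auto simp: Tr_def dif_single)
  show "dif Q g x \<in> Mle (Tr m) w" if "x \<in> Mle (Tr n) w"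
    unfolding Mle_def[of "Tr m"] by (rule Mle_hom[OF that dif_linear(1)]) (fold Mle_def, use * M_mono(1) in blast)
  show "dif Q g x \<in> Mlt (Tr m) w" if "x \<in> Mlt (Tr n) w"
    unfolding Mlt_def[of "Tr m"] by (rule Mlt_hom[OF that dif_linear(1)]) (fold Mlt_def, use * M_mono(2) in blast)
qed

lemma dif_Mle_Mlt:
  assumes "\<And>q. q \<in> A n \<Longrightarrow> g q \<in> Mlt (Tr m) (kpath q)" "x \<in> Mle (Tr n) w"
  shows "dif Q g x \<in> Mlt (Tr m) w"
proof -
  have *: "dif Q g (Poly_Mapping.single t l) \<in> Mlt (Tr m) (Poly_Mapping.single (wt t) l)" if "t \<in> Tr n" for t l
    using bact_Mlt_single[OF assms(1), of "fst (snd t)" t "fst t" "snd (snd t)" l] that by (cases t) (auto simp: Tr_def dif_single)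
  show ?thesis unfolding Mlt_def
    by (rule Mle_hom[OF assms(2) dif_linear(1)]) (fold Mlt_def, use * M_mono(3) in blast)
qed

text \<open>Normalized triples, which index the coordinates of a tensor with respect to irreducible
  outer paths.\<close>

definition TrN :: "nat \<Rightarrow> ('v, 'e) triple set"
  where "TrN n = {t \<in> Tr n. fst t \<in> irrp \<and> snd (snd t) \<in> irrp}"

lemma tri_expand: "tri x p y = (\<Sum>a\<in>Poly_Mapping.keys x. \<Sum>c\<in>Poly_Mapping.keys y.
    Poly_Mapping.single (a, p, c) (Poly_Mapping.lookup x a * Poly_Mapping.lookup y c))"
  unfolding tri_def lin_def by (simp add: scl_sum)

text \<open>The outer paths are replaced one at a time, the rest of the word serving as context; the
  vertices \<open>e\<close> and \<open>e'\<close> supply the missing factor at the outer side. A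
  reducible outer path makes its replacement strict, and one strict step suffices.\<close>

lemma rho_term:
  assumes "(a, p, c) \<in> Tr n" "l \<noteq> 0" "a' \<in> Poly_Mapping.keys (nfp a)" "c' \<in> Poly_Mapping.keys (nfp c)"
    "m = l * (Poly_Mapping.lookup (nfp a) a' * Poly_Mapping.lookup (nfp c) c')"
  shows "(a', p, c') \<in> TrN n" "rle (Poly_Mapping.single (wt (a', p, c')) m) (Poly_Mapping.single (wt (a, p, c)) l)"
    "a \<notin> irrp \<or> c \<notin> irrp \<Longrightarrow> rlt (Poly_Mapping.single (wt (a', p, c')) m) (Poly_Mapping.single (wt (a, p, c)) l)"
proof -
  let ?x = "Poly_Mapping.lookup (nfp a) a'" and ?y = "Poly_Mapping.lookup (nfp c) c'"
  have t: "a \<in> P" "c \<in> P" "p \<in> A n" "p \<in> P" "jn a p" "jn p c" using assms(1) A_paths[of n] by (auto simp: Tr_def)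
  have n: "a' \<in> P" "par a' a" "a' \<in> irrp" "c' \<in> P" "par c' c" "c' \<in> irrp"
    using nfp_keys[OF t(1)] nfp_keys[OF t(2)] assms(3,4) by (auto simp: parset_def)
  have j: "jn a' p" "jn p c'" using t n by (auto simp: par_simps)
  have nz: "?x \<noteq> 0" "?y \<noteq> 0" using assms(3,4) by (auto simp: in_keys_iff)
  show "(a', p, c') \<in> TrN n" using t n j by (auto simp: TrN_def Tr_def)
  define e where "e = (fst a, [] :: 'e list)"
  define e' where "e' = (ptgt Q c, [] :: 'e list)"
  have e: "e \<in> P" "jn e a'" "jn e a" "e' \<in> P" "jn c' e'" "jn c e'" "pcomp e a' = a'" "pcomp e a = a" "pcomp c' e' = c'" "pcomp c e' = c"
    "pcomp p c' \<in> P" "pcomp a p \<in> P" "jn a (pcomp p c')" "jn a' (pcomp p c')" "jn (pcomp a p) c" "jn (pcomp a p) c'"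
    using n t j fst_in_verts[OF t(1)] ptgt_in_verts[OF t(2)]
    by (auto simp: e_def e'_def par_def intro!: vertex_path pcomp_in_paths) (auto simp: joinable_pcomp)
  have le1: "rle (Poly_Mapping.single (wt (a', p, c')) m) (Poly_Mapping.single (wt (a, p, c')) (l * ?y))"
    using le_scl[OF le_sw[OF nfp_le(1)[OF t(1) assms(3)] e(1,11)], of "l * ?y"] e
    by (simp add: sandwich_def wt_def pcomp_assoc assms(5) mult_ac)
  have le2: "rle (Poly_Mapping.single (wt (a, p, c')) (l * ?y)) (Poly_Mapping.single (wt (a, p, c)) l)"
    using le_scl[OF le_sw[OF nfp_le(1)[OF t(2) assms(4)] e(12,4)], of "l"] e
    by (simp add: sandwich_def wt_def pcomp_assoc)
  show "rle (Poly_Mapping.single (wt (a', p, c')) m) (Poly_Mapping.single (wt (a, p, c)) l)"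
    using le1 le2 by (rule red_le.trans)
  assume "a \<notin> irrp \<or> c \<notin> irrp"
  then show "rlt (Poly_Mapping.single (wt (a', p, c')) m) (Poly_Mapping.single (wt (a, p, c)) l)"
  proof
    assume "a \<notin> irrp"
    then have "rlt (Poly_Mapping.single (wt (a', p, c')) m) (Poly_Mapping.single (wt (a, p, c')) (l * ?y))"
      using lt_scl[OF lt_sw[OF nfp_le(2)[OF t(1) assms(3)] nz(1) e(1,11)], of "l * ?y"] e nz assms(2)
      by (simp add: sandwich_def wt_def pcomp_assoc assms(5) mult_ac)
    then show ?thesis using le2 by (rule lt_le_trans)
  next
    assume "c \<notin> irrp"
    then have "rlt (Poly_Mapping.single (wt (a, p, c')) (l * ?y)) (Poly_Mapping.single (wt (a, p, c)) l)"
      using lt_scl[OF lt_sw[OF nfp_le(2)[OF t(2) assms(4)] nz(2) e(12,4)], of "l"] e nz assms(2)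
      by (simp add: sandwich_def wt_def pcomp_assoc)
    with le1 show ?thesis by (rule le_lt_trans)
  qed
qed

lemma rho_single:
  "rho (Poly_Mapping.single (a, p, c) l) = (\<Sum>a'\<in>Poly_Mapping.keys (nfp a). \<Sum>c'\<in>Poly_Mapping.keys (nfp c).
    Poly_Mapping.single (a', p, c') (l * (Poly_Mapping.lookup (nfp a) a' * Poly_Mapping.lookup (nfp c) c')))"
  by (simp add: rho_def tri_expand scl_sum)

lemma rho_gen:
  assumes "t \<in> Tr n"
  shows "rho (Poly_Mapping.single t l) \<in> Mle (TrN n) (Poly_Mapping.single (wt t) l)"
    "t \<notin> TrN n \<Longrightarrow> rho (Poly_Mapping.single t l) \<in> Mlt (TrN n) (Poly_Mapping.single (wt t) l)"
proof -
  obtain a p c where t: "t = (a, p, c)" by (cases t)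
  show "rho (Poly_Mapping.single t l) \<in> Mle (TrN n) (Poly_Mapping.single (wt t) l)"
  proof (cases "l = 0")
    case False
    show ?thesis unfolding t rho_single
      by (intro M_sum MleI rho_term(1,2)[OF assms[unfolded t] False _ _ HOL.refl])
  qed (simp add: rho_linear M_closed)
  assume "t \<notin> TrN n"
  then have r: "a \<notin> irrp \<or> c \<notin> irrp" using assms t by (auto simp: TrN_def)
  show "rho (Poly_Mapping.single t l) \<in> Mlt (TrN n) (Poly_Mapping.single (wt t) l)"
  proof (cases "l = 0")
    case False
    show ?thesis unfolding t rho_single
      by (intro M_sum MltI rho_term(1)[OF assms[unfolded t] False _ _ HOL.refl] rho_term(3)[OF assms[unfolded t] False _ _ HOL.refl r])
  qed (simp add: rho_linear M_closed)
qed

lemma rho_Mle: assumes "x \<in> Mle (Tr n) w" shows "rho x \<in> Mle (TrN n) w"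
  unfolding Mle_def[of _ w]
  by (rule Mle_hom[OF assms rho_linear(1)], fold Mle_def) (use rho_gen(1) M_mono(1) in blast)

lemma rho_Mlt: assumes "x \<in> Mlt (Tr n) w" shows "rho x \<in> Mlt (TrN n) w"
  unfolding Mlt_def[of _ w]
  by (rule Mlt_hom[OF assms rho_linear(1)], fold Mlt_def) (use rho_gen(1) M_mono(2) in blast)

lemma TrN_Tr: "Mle (TrN n) w \<subseteq> Mle (Tr n) w" "Mlt (TrN n) w \<subseteq> Mlt (Tr n) w"
  by (intro M_mono; auto simp: TrN_def)+

section \<open>The maps of the associated monomial algebra and their contracting homotopy\<close>

text \<open>Both parities are written as sums over decompositions, so that \<open>bact_Dec\<close>
  handles them alike. For odd n just one decomposition touches each end of q
  (\<open>dl_ends\<close>). The parities are opposite to those of \<open>\<delta>\<close> because of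
  the shift.\<close>

definition dl :: "nat \<Rightarrow> ('v, 'e) path \<Rightarrow> (('v, 'e) triple \<Rightarrow>\<^sub>0 'k)"
  where "dl n q = (if odd n
    then (\<Sum>t\<in>{t \<in> Dec (n - 1) q. snd (snd (snd t)) = []}. ee t) - (\<Sum>t\<in>{t \<in> Dec (n - 1) q. snd (fst t) = []}. ee t)
    else (\<Sum>t\<in>{t \<in> Dec (n - 1) q. True}. ee t))"

text \<open>The homotopy is linear over the left factor only: it looks for ambiguities of the next degree
  inside the word \<open>p c\<close>, where c is in normal form.\<close>
definition hs :: "nat \<Rightarrow> ('v, 'e) path \<Rightarrow> ('v, 'e) path \<Rightarrow> (('v, 'e) triple \<Rightarrow>\<^sub>0 'k)"
  where "hs n p c = (if odd n
    then (\<Sum>t\<in>{t \<in> Dec (Suc n) (pcomp p c). snd (fst t) = []}. ee t)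
    else - (\<Sum>t\<in>{t \<in> Dec (Suc n) (pcomp p c). True}. ee t))"

definition vx :: "('v, 'e) path \<Rightarrow> ('v, 'e, 'k) lincomb"
  where "vx p = kpath (ptgt Q p, [])"

text \<open>The vertex \<open>vx c\<close> merely marks the right end: c itself has been absorbed
  into the word that \<open>hs\<close> inspects.\<close>

definition S :: "nat \<Rightarrow> (('v, 'e) triple \<Rightarrow>\<^sub>0 'k) \<Rightarrow> (('v, 'e) triple \<Rightarrow>\<^sub>0 'k)"
  where "S n = lin (\<lambda>(a, p, c). bact Q (kpath a) (vx c) (lin (hs n p) (nfp c)))"

lemma S_linear: "S n (x + y) = S n x + S n y" "S n (x - y) = S n x - S n y" "S n (scl k x) = scl k (S n x)" "S n 0 = 0"
  "S n (- x) = - S n x" "S n (sum f J) = (\<Sum>i\<in>J. S n (f i))"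
  by (simp_all add: S_def lin_add lin_diff lin_scl lin_minus lin_sum)

lemma dif_sum: "dif Q g (sum f J) = (\<Sum>i\<in>J. dif Q g (f i))"
  by (simp add: dif_def lin_sum)

lemma Dec_Mle: "w \<in> P \<Longrightarrow> t \<in> Dec n w \<Longrightarrow> ee t \<in> Mle (Tr n) (kpath w)"
  by (rule MleI) (auto simp: Dec_def intro: red_le.refl)

lemma dl_Mle: "q \<in> P \<Longrightarrow> dl n q \<in> Mle (Tr (n - 1)) (kpath q)"
  unfolding dl_def by (auto intro!: M_closed M_sum Dec_Mle)

lemma hs_Mle: "p \<in> P \<Longrightarrow> c \<in> P \<Longrightarrow> jn p c \<Longrightarrow> hs n p c \<in> Mle (Tr (Suc n)) (kpath (pcomp p c))"
  unfolding hs_def by (auto intro!: M_closed M_sum Dec_Mle pcomp_in_paths)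

lemma hs_nfp_Mle:
  assumes "p \<in> P" "c \<in> P" "jn p c"
  shows "lin (hs n p) (nfp c) \<in> Mle (Tr (Suc n)) (kpath (pcomp p c))"
  unfolding lin_def
proof (intro M_sum)
  fix c' assume c': "c' \<in> Poly_Mapping.keys (nfp c)"
  then have n: "c' \<in> P" "par c' c" using nfp_keys[OF assms(2)] by (auto simp: parset_def)
  define e' where "e' = (ptgt Q c, [] :: 'e list)"
  have e': "e' \<in> P" "jn c' e'" "jn c e'" using n assms ptgt_in_verts[of c] by (auto simp: e'_def par_def vertex_path)
  have "scl (Poly_Mapping.lookup (nfp c) c') (hs n p c')
      \<in> Mle (Tr (Suc n)) (Poly_Mapping.single (pcomp p c') (Poly_Mapping.lookup (nfp c) c'))"
    using scl_Mle[where k = "Poly_Mapping.lookup (nfp c) c'", OF hs_Mle[OF assms(1) n(1), of n]] assms n by (simp add: par_simps)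
  moreover have "rle (Poly_Mapping.single (pcomp p c') (Poly_Mapping.lookup (nfp c) c')) (kpath (pcomp p c))"
    using le_sw[OF nfp_le(1)[OF assms(2) c'] assms(1) e'(1)] assms n e' by (simp add: sandwich_def par_simps e'_def)
  ultimately show "scl (Poly_Mapping.lookup (nfp c) c') (hs n p c') \<in> Mle (Tr (Suc n)) (kpath (pcomp p c))"
    using M_mono(1) by blast
qed

lemma S_gen:
  assumes "t \<in> Tr n" shows "S n (Poly_Mapping.single t l) \<in> Mle (Tr (Suc n)) (Poly_Mapping.single (wt t) l)"
proof -
  obtain a p c where t: "t = (a, p, c)" by (cases t)
  have *: "a \<in> P" "c \<in> P" "p \<in> P" "jn a p" "jn p c" using assms t A_paths by (auto simp: Tr_def)
  define e' where "e' = (ptgt Q c, [] :: 'e list)"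
  have e': "e' \<in> P" "jn c e'" "jn a (pcomp p c)" "jn (pcomp p c) e'"
    using * ptgt_in_verts[of c] by (auto simp: e'_def vertex_path joinable_pcomp ptgt_pcomp)
  have "scl l (bact Q (kpath a) (kpath e') (lin (hs n p) (nfp c))) \<in> Mle (Tr (Suc n)) (Poly_Mapping.single (wt t) l)"
    using scl_Mle[OF bact_Mle[OF hs_nfp_Mle[OF *(3,2,5)] *(1) e'(1)], of l] e'
    by (simp add: sandwich_def t wt_def pcomp_assoc e'_def)
  then show ?thesis by (simp add: S_def t vx_def e'_def)
qed

lemma S_Mle: assumes "x \<in> Mle (Tr n) w" shows "S n x \<in> Mle (Tr (Suc n)) w"
  unfolding Mle_def[of _ w]
  by (rule Mle_hom[OF assms S_linear(1)], fold Mle_def) (use S_gen M_mono(1) in blast)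

lemma S_Mlt: assumes "x \<in> Mlt (Tr n) w" shows "S n x \<in> Mlt (Tr (Suc n)) w"
  unfolding Mlt_def[of _ w]
  by (rule Mlt_hom[OF assms S_linear(1)], fold Mlt_def) (use S_gen M_mono(2) in blast)

lemma S_tri:
  assumes "Poly_Mapping.keys v \<subseteq> parset c"
  shows "S n (tri u p v) = bact Q u (vx c) (lin (hs n p) (nf v))"
proof (induction u rule: lincomb_induct)
  case (single a k)
  show ?case using assms
  proof (induction v rule: keys_induct)
    case (single c' l)
    then have "vx c' = vx c" by (auto simp: vx_def parset_def par_def)
    moreover have "Poly_Mapping.single a k = scl k (kpath a)" by simp
    ultimately show ?case by (simp only: bact_args) (simp add: tri_single S_def nf_def lin_scl bact_linear mult.commute)
  qed (auto simp: tri_linear S_linear nf_linear lin_add bact_linear)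
qed (auto simp: tri_linear S_linear bact_args)

lemma vx_span: "c \<in> P \<Longrightarrow> vx c \<in> path_span P"
  unfolding vx_def by (intro kpath_span vertex_path ptgt_in_verts)

text \<open>The homotopy begins by normalizing the right component and acts linearly through the
  left one, so prior normalization changes neither up to a final \<open>rho\<close>.\<close>

lemma rho_S:
  assumes "Poly_Mapping.keys x \<subseteq> Tr n" shows "rho (S n (rho x)) = rho (S n x)"
  using assms
proof (induction x rule: keys_induct)
  case (single t l)
  obtain a p c where t: "t = (a, p, c)" by (cases t)
  have *: "a \<in> P" "c \<in> P" "p \<in> P" "jn a p" "jn p c" using single t A_paths by (auto simp: Tr_def)
  have s: "Poly_Mapping.single t l = scl l (tri (kpath a) p (kpath c))" by (simp add: t tri_single)
  have k: "Poly_Mapping.keys (kpath c :: ('v, 'e, 'k) lincomb) \<subseteq> parset c" using keys_kpath_parset[OF *(2)] .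
  have "rho (bact Q (nf (kpath a)) (vx c) (lin (hs n p) (nf (nf (kpath c))))) = rho (bact Q (kpath a) (vx c) (lin (hs n p) (nf (kpath c))))"
    unfolding nf_nf[OF kpath_span[OF *(2)]]
    by (rule rho_bact_eq[OF Mle_Fsp[OF hs_nfp_Mle[OF *(3,2,5), folded nf_kpath]] nf_span[OF kpath_span[OF *(1)]]
      vx_span[OF *(2)] kpath_span[OF *(1)] vx_span[OF *(2)] nf_nf[OF kpath_span[OF *(1)]] HOL.refl])
  then show ?case
    unfolding s rho_linear S_linear rho_tri S_tri[OF k] S_tri[OF nf_parset[OF k]] by simp
qed (auto simp: rho_linear S_linear)

text \<open>Only a vertex acts from the right, since S reads the right component; from the left any
  element may act.\<close>

lemma S_bact: "S n (bact Q u (kpath (v, [])) x) = bact Q u (kpath (v, [])) (S n x)"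
proof (induction x rule: lincomb_induct)
  case (single t l)
  obtain a p c where t: "t = (a, p, c)" by (cases t)
  have s: "Poly_Mapping.single t l = scl l (tri (kpath a) p (kpath c))" by (simp add: t tri_single)
  have S0: "S n (tri u' p (kpath c)) = bact Q u' (vx c) (lin (hs n p) (nfp c))" for u'
    by (induction u' rule: lincomb_induct) (auto simp: tri_single S_def tri_linear lin_add bact_args simp flip: bact_args(3))
  show ?case unfolding s bact_linear S_linear bact_tri
    by (auto simp: S0 bact_bact pmult_single vx_def tri_linear S_linear bact_args)
qed (auto simp: S_linear bact_linear)

lemma sg_vertex:
  assumes "w \<in> P" "0 \<le> j" "j \<le> int (plen w)"
  shows "kpath (sg w (int (plen w)) (int (plen w))) = vx (sg w j (int (plen w)))"
proof -
  have "jn (sg w j (int (plen w))) (sg w (int (plen w)) (int (plen w)))" using assms by (intro sg_joinable) auto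
  then have "sg w (int (plen w)) (int (plen w)) = (ptgt Q (sg w j (int (plen w))), [])"
    using seg_empty[of w "plen w"] by (simp add: joinable_def sg_def)
  then show ?thesis by (simp add: vx_def)
qed

lemma plen_0_iff: "0 \<le> i \<Longrightarrow> i \<le> j \<Longrightarrow> j \<le> int (plen w) \<Longrightarrow> snd (sg w i j) = [] \<longleftrightarrow> i = j"
  using plen_sg[of i j w] by (metis diff_eq_eq add_0 length_0_conv of_nat_eq_0_iff of_nat_0)

lemma tr_ends:
  assumes "w \<in> P" "0 \<le> i" "i \<le> a" "a \<le> c" "c \<le> j" "j \<le> int (plen w)"
  shows "snd (fst (tr (sg w i j) (a - i, c - i))) = [] \<longleftrightarrow> a = i"
    "snd (snd (snd (tr (sg w i j) (a - i, c - i)))) = [] \<longleftrightarrow> c = j"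
proof -
  have l: "int (plen (sg w i j)) = j - i" using assms by (simp add: plen_sg)
  show "snd (fst (tr (sg w i j) (a - i, c - i))) = [] \<longleftrightarrow> a = i"
    using plen_0_iff[of 0 "a - i" "sg w i j"] l assms by (auto simp: tr_def)
  show "snd (snd (snd (tr (sg w i j) (a - i, c - i)))) = [] \<longleftrightarrow> c = j"
    using plen_0_iff[of "c - i" "j - i" "sg w i j"] l assms by (auto simp: tr_def)
qed

section \<open>The differential and the homotopy as sums over occurrences in a word\<close>

abbreviation sumI :: "('v, 'e) path \<Rightarrow> (int \<times> int) set \<Rightarrow> (('v, 'e) triple \<Rightarrow>\<^sub>0 'k)"
  where "sumI w Z \<equiv> (\<Sum>x\<in>Z. ee (tr w x))"

lemma dif_dl_tr:
  assumes "w \<in> P" "(i, j) \<in> Iv w n"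
  shows "dif Q (dl n) (ee (tr w (i, j))) = (if odd n
    then sumI w {(a, c). (a, c) \<in> Iv w (n - 1) \<and> i \<le> a \<and> c \<le> j \<and> c = j}
      - sumI w {(a, c). (a, c) \<in> Iv w (n - 1) \<and> i \<le> a \<and> c \<le> j \<and> a = i}
    else sumI w {(a, c). (a, c) \<in> Iv w (n - 1) \<and> i \<le> a \<and> c \<le> j \<and> True})"
proof -
  have b: "0 \<le> i" "i \<le> j" "j \<le> int (plen w)" using Iv_bounds[OF assms] by auto
  have t: "snd (fst (tr (sg w i j) (a - i, c - i))) = [] \<longleftrightarrow> a = i"
    "snd (snd (snd (tr (sg w i j) (a - i, c - i)))) = [] \<longleftrightarrow> c = j"
    if "(a, c) \<in> Iv w (n - 1)" "i \<le> a" "c \<le> j" for a c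
    using tr_ends[OF assms(1) b(1) that(2) _ that(3) b(3)] Iv_bounds[OF assms(1) that(1)] by auto
  show ?thesis
    using bact_Dec[OF assms(1) b, of "n - 1" "\<lambda>t. snd (snd (snd t)) = []" "\<lambda>a c. c = j"]
      bact_Dec[OF assms(1) b, of "n - 1" "\<lambda>t. snd (fst t) = []" "\<lambda>a c. a = i"]
      bact_Dec[OF assms(1) b, of "n - 1" "\<lambda>t. True" "\<lambda>a c. True"] t
    unfolding tr_def[of w "(i, j)"] by (auto simp: dif_single dl_def bact_linear)
qed

text \<open>An irreducible tail is its own normal form, so the homotopy only reads occurrences in w
  itself.\<close>

lemma S_tr:
  assumes "w \<in> P" "(i, j) \<in> Iv w n" "\<not> rd w j (int (plen w))"
  shows "S n (ee (tr w (i, j))) = (if odd n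
    then sumI w {(a, c). (a, c) \<in> Iv w (Suc n) \<and> i \<le> a \<and> c \<le> int (plen w) \<and> a = i}
    else - sumI w {(a, c). (a, c) \<in> Iv w (Suc n) \<and> i \<le> a \<and> c \<le> int (plen w) \<and> True})"
proof -
  have b: "0 \<le> i" "i \<le> j" "j \<le> int (plen w)" using Iv_bounds[OF assms(1,2)] by auto
  then have b': "i \<le> int (plen w)" "0 \<le> j" by auto
  have irr: "sg w j (int (plen w)) \<in> irrp" using assms(3) b by (simp add: rd_def)
  have t: "snd (fst (tr (sg w i (int (plen w))) (a - i, c - i))) = [] \<longleftrightarrow> a = i"
    if "(a, c) \<in> Iv w (Suc n)" "i \<le> a" "c \<le> int (plen w)" for a c
    using tr_ends(1)[OF assms(1) b(1) that(2) _ that(3) order_refl] Iv_bounds[OF assms(1) that(1)] by auto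
  have e: "S n (ee (tr w (i, j))) = bact Q (kpath (sg w 0 i)) (kpath (sg w (int (plen w)) (int (plen w)))) (hs n (sg w i j) (sg w j (int (plen w))))"
    using irr by (simp add: S_def tr_def sg_vertex[OF assms(1) b'(2) b(3)] nfp_irr)
  have p: "pcomp (sg w i j) (sg w j (int (plen w))) = sg w i (int (plen w))" using b by (intro sg_pcomp) auto
  show ?thesis
    using bact_Dec[OF assms(1) b(1) b'(1) order_refl, of "Suc n" "\<lambda>t. snd (fst t) = []" "\<lambda>a c. a = i"]
      bact_Dec[OF assms(1) b(1) b'(1) order_refl, of "Suc n" "\<lambda>t. True" "\<lambda>a c. True"] t
    unfolding e hs_def p by (auto simp: bact_linear)
qed

text \<open>Smallness is tested after normalization, because terms with a reducible outer path
  become small only then.\<close>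

definition low :: "nat \<Rightarrow> ('v, 'e, 'k) lincomb \<Rightarrow> (('v, 'e) triple \<Rightarrow>\<^sub>0 'k) \<Rightarrow> bool"
  where "low n w x \<longleftrightarrow> rho x \<in> Mlt (TrN n) w"

lemma low_closed: "low n w 0" "low n w x \<Longrightarrow> low n w y \<Longrightarrow> low n w (x + y)" "low n w x \<Longrightarrow> low n w (- x)"
  "low n w x \<Longrightarrow> low n w y \<Longrightarrow> low n w (x - y)" "(\<And>i. i \<in> J \<Longrightarrow> low n w (f i)) \<Longrightarrow> low n w (sum f J)"
  by (simp_all add: low_def rho_linear rho_sum M_closed M_sum)

lemma tr_Tr: "w \<in> P \<Longrightarrow> x \<in> Iv w n \<Longrightarrow> tr w x \<in> Tr n" "w \<in> P \<Longrightarrow> x \<in> Iv w n \<Longrightarrow> wt (tr w x) = w"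
  using Dec_conv[of w n] by (auto simp: Dec_def)

lemma Iv_fun: "(a, c) \<in> Iv w n \<Longrightarrow> (a, c') \<in> Iv w n \<Longrightarrow> c = c'"
  by (simp add: Iv_def amb_def)

lemma Iv_inj: "w \<in> P \<Longrightarrow> (a, c) \<in> Iv w n \<Longrightarrow> (a', c) \<in> Iv w n \<Longrightarrow> a = a'"
  using tips.amb_inj[OF tips_word, of w a a' n c] by (simp add: Iv_def)

definition GI :: "('v, 'e) path \<Rightarrow> nat \<Rightarrow> (int \<times> int) set"
  where "GI w n = {(a, c) \<in> Iv w n. \<not> rd w 0 a \<and> \<not> rd w c (int (plen w))}"

lemma low_tr: assumes "w \<in> P" "x \<in> Iv w n" "x \<notin> GI w n" shows "low n (kpath w) (ee (tr w x))"
proof -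
  obtain i j where x: "x = (i, j)" by (cases x)
  have "rd w 0 i \<or> rd w j (int (plen w))" using assms(2,3) x by (simp add: GI_def)
  then have "tr w x \<notin> TrN n" by (auto simp: x tr_def TrN_def rd_def)
  then show ?thesis using rho_gen(2)[OF tr_Tr(1)[OF assms(1,2)], of 1] tr_Tr(2)[OF assms(1,2)] by (simp add: low_def)
qed

lemma low_sumI:
  assumes "w \<in> P" "Z \<subseteq> Iv w n" shows "low n (kpath w) (sumI w Z - sumI w (Z \<inter> GI w n))"
proof -
  have "finite Z" using finite_subset[OF assms(2) finite_Iv[OF assms(1)]] .
  then have "sumI w Z - sumI w (Z \<inter> GI w n) = sumI w (Z - GI w n)"
    by (subst sum.Int_Diff[of Z _ "GI w n"]) auto
  moreover have "low n (kpath w) (sumI w (Z - GI w n))"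
    using assms by (intro low_closed(5) low_tr) auto
  ultimately show ?thesis by simp
qed

lemma low_S: assumes "Poly_Mapping.keys x \<subseteq> Tr n" "low n w x" shows "low (Suc n) w (S n x)"
  unfolding low_def rho_S[OF assms(1), symmetric]
  using assms(2) TrN_Tr(2) unfolding low_def by (intro rho_Mlt S_Mlt) blast

text \<open>Write x for the given occurrence and G for the sum of the good ones, and compute modulo
  lower terms. The boundary of x is its suffix minus its prefix, and S sends the suffix to -(G - x).
  If the tail after the prefix is reducible, the prefix contributes only lower terms, and
  \<open>d S x\<close> is G. Otherwise x has no extension, so S x = 0, and S sends the prefix to -G.
  Either way \<open>d S x + S d x\<close> is x.\<close>

lemma homotopy_word_odd:
  assumes w: "w \<in> P" and n: "odd n" and x: "(0, j) \<in> Iv w n" and irr: "\<not> rd w j (int (plen w))"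
  shows "low n (kpath w) (ee (tr w (0, j)) - dif Q (dl (Suc n)) (S n (ee (tr w (0, j)))) - S (n - 1) (dif Q (dl n) (ee (tr w (0, j)))))"
proof -
  let ?L = "int (plen w)"
  interpret t: tips "rd w" 0 ?L by (rule tips_word[OF w])
  obtain m where m: "n = Suc m" "even m" using n by (cases n) auto
  note bx = Iv_bounds[OF w x]
  have ax: "t.Amb n 0 j" using x by (simp add: Iv_def)
  define k where "k = t.C j m"
  define b where "b = t.B 0 m"
  have k: "t.Amb m k j" "0 < k" using t.amb_suffix[of 0 m j] ax m by (auto simp: k_def)
  have b: "t.Amb m 0 b" "b < j" using t.amb_prefix[of m 0 j] ax m by (auto simp: b_def)
  have kI: "(k, j) \<in> Iv w m" and bI: "(0, b) \<in> Iv w m" using k b by (auto simp: Iv_def)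
  have suf: "{(a, c). (a, c) \<in> Iv w m \<and> 0 \<le> a \<and> c \<le> j \<and> c = j} = {(k, j)}"
    using kI k(2) by (auto dest: Iv_inj[OF w _ kI])
  have pre: "{(a, c). (a, c) \<in> Iv w m \<and> 0 \<le> a \<and> c \<le> j \<and> a = 0} = {(0, b)}"
    using bI b(2) by (auto dest: Iv_fun[OF _ bI])
  have good: "t.Good n a c \<longleftrightarrow> (a, c) \<in> GI w n" for a c by (auto simp: t.Good_def GI_def Iv_def)
  have xG: "(0, j) \<in> GI w n" using x irr t.bound[of 0 0] by (auto simp: GI_def)
  have start: "a = 0 \<and> c = j" if "(a, c) \<in> GI w n" "a < k" for a c
  proof -
    have "a = 0" using t.good_odd_start[OF n ax _ _ that(1)[folded good] that(2)] k m by auto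
    moreover have "t.Amb n a c" using that(1) by (simp add: GI_def Iv_def)
    ultimately show ?thesis using t.amb_fun[OF _ ax] by auto
  qed
  define Z1 where "Z1 = {(a, c). (a, c) \<in> Iv w n \<and> k \<le> a \<and> c \<le> ?L \<and> True}"
  have S1: "S m (ee (tr w (k, j))) = - sumI w Z1"
    using S_tr[OF w kI irr] m by (simp add: Z1_def)
  have D: "dif Q (dl n) (ee (tr w (0, j))) = ee (tr w (k, j)) - ee (tr w (0, b))"
    using dif_dl_tr[OF w x] n m suf pre by simp
  have ext: "(\<exists>J. t.Amb (Suc n) 0 J) \<longleftrightarrow> rd w b ?L"
    using t.amb_extend[of 0 m j] ax irr m by (simp add: b_def)
  \<comment> \<open>Good occurrences that start before k start at 0, hence coincide with the given
    one.\<close>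
  have GI_Z1: "Z1 \<inter> GI w n = GI w n - {(0, j)}"
  proof -
    have "Z1 \<inter> GI w n = {(a, c) \<in> GI w n. k \<le> a}"
      using Iv_bounds[OF w] by (auto simp: Z1_def GI_def)
    then show ?thesis using start k(2) by force
  qed
  have key: "ee (tr w (0, j)) - sumI w (GI w n) + sumI w (GI w n - {(0, j)}) = 0"
    using xG finite_subset[OF _ finite_Iv[OF w, of n], of "GI w n"]
    by (subst sum.remove[of "GI w n" "(0, j)"]) (auto simp: GI_def)
  have Z1: "low n (kpath w) (sumI w Z1 - sumI w (GI w n - {(0, j)}))"
    using low_sumI[OF w, of Z1 n] GI_Z1 by (auto simp: Z1_def)
  show ?thesis
  proof (cases "rd w b ?L")
    case True
    then obtain J where J: "t.Amb (Suc n) 0 J" using ext by blast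
    have JI: "(0, J) \<in> Iv w (Suc n)" using J by (simp add: Iv_def)
    have "{(a, c). (a, c) \<in> Iv w (Suc n) \<and> 0 \<le> a \<and> c \<le> ?L \<and> a = 0} = {(0, J)}"
      using JI t.amb_bounds(3)[OF order_refl J] by (auto dest: Iv_fun[OF _ JI])
    then have Sx: "S n (ee (tr w (0, j))) = ee (tr w (0, J))" using S_tr[OF w x irr] n by simp
    define Z2 where "Z2 = {(a, c). (a, c) \<in> Iv w n \<and> 0 \<le> a \<and> c \<le> J \<and> True}"
    have D2: "dif Q (dl (Suc n)) (ee (tr w (0, J))) = sumI w Z2" using dif_dl_tr[OF w JI] n by (simp add: Z2_def)
    have "Z2 \<inter> GI w n = GI w n"
      using t.good_odd_end[OF n J] good by (auto simp: Z2_def GI_def Iv_def)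
    then have Z2: "low n (kpath w) (sumI w Z2 - sumI w (GI w n))"
      using low_sumI[OF w, of Z2 n] by (auto simp: Z2_def)
    have "low m (kpath w) (ee (tr w (0, b)))" using low_tr[OF w bI] True by (auto simp: GI_def)
    then have l: "low n (kpath w) (S m (ee (tr w (0, b))))"
      using low_S[of "ee (tr w (0, b))" m] tr_Tr(1)[OF w bI] m by simp
    have e: "ee (tr w (0, j)) - dif Q (dl (Suc n)) (S n (ee (tr w (0, j)))) - S (n - 1) (dif Q (dl n) (ee (tr w (0, j))))
      = - (sumI w Z2 - sumI w (GI w n)) + (sumI w Z1 - sumI w (GI w n - {(0, j)})) + S m (ee (tr w (0, b)))
        + (ee (tr w (0, j)) - sumI w (GI w n) + sumI w (GI w n - {(0, j)}))"
      unfolding Sx D2 D using m by (simp add: S_linear S1)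
    show ?thesis unfolding e key by (intro low_closed Z1 Z2 l)
  next
    case False
    then have emp: "{(a, c). (a, c) \<in> Iv w (Suc n) \<and> 0 \<le> a \<and> c \<le> ?L \<and> a = 0} = {}"
      using ext by (auto simp: Iv_def)
    have Sx: "S n (ee (tr w (0, j))) = 0" using S_tr[OF w x irr] n unfolding emp by simp
    define Z3 where "Z3 = {(a, c). (a, c) \<in> Iv w n \<and> 0 \<le> a \<and> c \<le> ?L \<and> True}"
    have S3: "S m (ee (tr w (0, b))) = - sumI w Z3"
      using S_tr[OF w bI False] m by (simp add: Z3_def)
    have "Z3 \<inter> GI w n = GI w n"
      using Iv_bounds[OF w] by (auto simp: Z3_def GI_def)
    then have Z3: "low n (kpath w) (sumI w Z3 - sumI w (GI w n))"
      using low_sumI[OF w, of Z3 n] by (auto simp: Z3_def)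
    have e: "ee (tr w (0, j)) - dif Q (dl (Suc n)) (S n (ee (tr w (0, j)))) - S (n - 1) (dif Q (dl n) (ee (tr w (0, j))))
      = - (sumI w Z3 - sumI w (GI w n)) + (sumI w Z1 - sumI w (GI w n - {(0, j)}))
        + (ee (tr w (0, j)) - sumI w (GI w n) + sumI w (GI w n - {(0, j)}))"
      unfolding Sx D using m by (simp add: S_linear S1 S3 dif_linear)
    show ?thesis unfolding e key by (intro low_closed Z1 Z3)
  qed
qed

text \<open>With x and G as in the odd case, modulo lower terms: \<open>d S x\<close> is minus the
  suffixes plus the prefixes of all occurrences of the next degree, and \<open>S d x\<close>
  collects the extensions of the shorter occurrences inside x. Every good occurrence except x is
  such a suffix. Each good occurrence is either such a prefix or such an extension, according to
  whether the tail after its own prefix is reducible. The total is -(G - x) + G = x.\<close>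

lemma homotopy_word_even:
  assumes w: "w \<in> P" and n: "even n" "n > 0" and x: "(0, j) \<in> Iv w n" and irr: "\<not> rd w j (int (plen w))"
  shows "low n (kpath w) (ee (tr w (0, j)) - dif Q (dl (Suc n)) (S n (ee (tr w (0, j)))) - S (n - 1) (dif Q (dl n) (ee (tr w (0, j)))))"
proof -
  let ?L = "int (plen w)"
  interpret t: tips "rd w" 0 ?L by (rule tips_word[OF w])
  obtain m where m: "n = Suc m" "odd m" using n by (cases n) auto
  note bx = Iv_bounds[OF w x]
  have ax: "t.Amb n 0 j" using x by (simp add: Iv_def)
  have good: "t.Good n a c \<longleftrightarrow> (a, c) \<in> GI w n" for a c by (auto simp: t.Good_def GI_def Iv_def)
  have xG: "(0, j) \<in> GI w n" using x irr t.bound[of 0 0] by (auto simp: GI_def)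
  define suf where "suf = (\<lambda>(a :: int, c). (t.C c n, c))"
  define pre where "pre = (\<lambda>(a, c :: int). (a, t.B a n))"
  let ?I = "Iv w (Suc n)"
  have sufI: "suf y \<in> Iv w n \<and> fst y < fst (suf y)" if "y \<in> ?I" for y
    using t.amb_suffix[of "fst y" n "snd y"] that by (cases y) (auto simp: Iv_def suf_def)
  have preI: "pre y \<in> Iv w n \<and> snd (pre y) < snd y" if "y \<in> ?I" for y
    using t.amb_prefix[of n "fst y" "snd y"] that by (cases y) (auto simp: Iv_def pre_def)
  have Sx: "S n (ee (tr w (0, j))) = - sumI w ?I"
  proof -
    have "{(a, c). (a, c) \<in> Iv w (Suc n) \<and> 0 \<le> a \<and> c \<le> ?L \<and> True} = ?I" using Iv_bounds[OF w, of _ _ "Suc n"] by auto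
    then show ?thesis using S_tr[OF w x irr] n by simp
  qed
  have Dy: "dif Q (dl (Suc n)) (ee (tr w y)) = ee (tr w (suf y)) - ee (tr w (pre y))" if y: "y \<in> ?I" for y
  proof -
    obtain a c where ac: "y = (a, c)" by (cases y)
    have am: "0 \<le> a" "t.Amb (Suc n) a c" using y ac by (auto simp: Iv_def)
    have "{(a', c'). (a', c') \<in> Iv w n \<and> a \<le> a' \<and> c' \<le> c \<and> c' = c} = {suf y}"
      using sufI[OF y] unfolding ac suf_def by (auto dest: Iv_inj[OF w, of _ c n "t.C c n"])
    moreover have "{(a', c'). (a', c') \<in> Iv w n \<and> a \<le> a' \<and> c' \<le> c \<and> a' = a} = {pre y}"
      using preI[OF y] unfolding ac pre_def by (auto dest: Iv_fun[of a _ w n "t.B a n"])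
    ultimately show ?thesis using dif_dl_tr[OF w y[unfolded ac]] n by (simp add: ac)
  qed
  have sinj: "inj_on suf ?I"
  proof (rule inj_onI)
    fix y z assume y: "y \<in> ?I" and z: "z \<in> ?I" and e: "suf y = suf z"
    obtain a c where ac: "y = (a, c)" by (cases y)
    obtain a' c' where ac': "z = (a', c')" by (cases z)
    have "c = c'" using e by (simp add: suf_def ac ac')
    then show "y = z" using Iv_inj[OF w, of a c "Suc n" a'] y z ac ac' by simp
  qed
  have pinj: "inj_on pre ?I"
  proof (rule inj_onI)
    fix y z assume y: "y \<in> ?I" and z: "z \<in> ?I" and e: "pre y = pre z"
    obtain a c where ac: "y = (a, c)" by (cases y)
    obtain a' c' where ac': "z = (a', c')" by (cases z)
    have "a = a'" using e by (simp add: pre_def ac ac')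
    then show "y = z" using Iv_fun[of a c w "Suc n" c'] y z ac ac' by simp
  qed
  define Xs where "Xs = suf ` ?I"
  define Xp where "Xp = pre ` ?I"
  have DS: "dif Q (dl (Suc n)) (S n (ee (tr w (0, j)))) = - (sumI w Xs - sumI w Xp)"
  proof -
    have "dif Q (dl (Suc n)) (S n (ee (tr w (0, j)))) = - (\<Sum>y\<in>?I. ee (tr w (suf y)) - ee (tr w (pre y)))"
      unfolding Sx dif_linear dif_sum using Dy by simp
    then show ?thesis by (simp add: sum_subtractf Xs_def Xp_def sum.reindex[OF sinj] sum.reindex[OF pinj])
  qed
  define Z where "Z = {(a, c). (a, c) \<in> Iv w m \<and> 0 \<le> a \<and> c \<le> j \<and> True}"
  define Z0 where "Z0 = {(a, c) \<in> Z. \<not> rd w c ?L}"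
  have finZ: "finite Z" using finite_subset[OF _ finite_Iv[OF w, of m], of Z] by (auto simp: Z_def)
  have D: "dif Q (dl n) (ee (tr w (0, j))) = sumI w Z"
    using dif_dl_tr[OF w x] n m by (simp add: Z_def)
  \<comment> \<open>The occurrence starting at a, as a set with at most one element, which also
    covers the case that there is none.\<close>
  define Y where "Y a = {(a', c'). (a', c') \<in> Iv w n \<and> a \<le> a' \<and> c' \<le> ?L \<and> a' = a}" for a
  define Xe where "Xe = (\<Union>z\<in>Z0. Y (fst z))"
  have SZ0: "S m (sumI w Z0) = sumI w Xe"
  proof -
    have "S m (sumI w Z0) = (\<Sum>z\<in>Z0. sumI w (Y (fst z)))" unfolding S_linear
    proof (rule sum.cong[OF HOL.refl])
      fix z assume z: "z \<in> Z0"
      obtain a c where ac: "z = (a, c)" by (cases z)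
      have zI: "(a, c) \<in> Iv w m" "\<not> rd w c ?L" using z ac by (auto simp: Z0_def Z_def)
      show "S m (ee (tr w z)) = sumI w (Y (fst z))"
        using S_tr[OF w zI] m by (simp add: ac Y_def)
    qed
    also have "\<dots> = sumI w Xe" unfolding Xe_def
    proof (rule sum.UNION_disjoint[symmetric])
      show "finite Z0" by (rule finite_subset[OF _ finZ]) (auto simp: Z0_def)
      show "\<forall>z\<in>Z0. finite (Y (fst z))"
        by (intro ballI finite_subset[OF _ finite_Iv[OF w, of n]]) (auto simp: Y_def)
      show "\<forall>z\<in>Z0. \<forall>z'\<in>Z0. z \<noteq> z' \<longrightarrow> Y (fst z) \<inter> Y (fst z') = {}"
        by (auto simp: Y_def Z0_def Z_def dest: Iv_fun)
    qed
    finally show ?thesis .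
  qed
  \<comment> \<open>Shorter occurrences with a reducible tail are lower terms already, and the
    homotopy keeps them lower.\<close>
  have lowZ: "low n (kpath w) (S m (sumI w Z) - S m (sumI w Z0))"
  proof -
    have "Z0 \<subseteq> Z" by (auto simp: Z0_def)
    then have "sumI w Z - sumI w Z0 = sumI w (Z - Z0)" by (rule sum_diff[OF finZ, symmetric])
    moreover have "low n (kpath w) (S m (sumI w (Z - Z0)))" unfolding S_linear
    proof (rule low_closed(5))
      fix z assume z: "z \<in> Z - Z0"
      then have zI: "z \<in> Iv w m" "z \<notin> GI w m" by (auto simp: Z_def Z0_def GI_def)
      then show "low n (kpath w) (S m (ee (tr w z)))"
        using low_S[OF _ low_tr[OF w zI]] tr_Tr(1)[OF w zI(1)] m by simp
    qed
    ultimately show ?thesis by (simp flip: S_linear(2))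
  qed
  have Xs_sub: "Xs \<subseteq> Iv w n" and Xp_sub: "Xp \<subseteq> Iv w n" and Xe_sub: "Xe \<subseteq> Iv w n"
    using sufI preI by (auto simp: Xs_def Xp_def Xe_def Y_def)
  have am: "0 \<le> a" "t.Amb n a c" "\<not> rd w c ?L" if "(a, c) \<in> GI w n" for a c
    using that by (auto simp: GI_def Iv_def)
  have XsG: "Xs \<inter> GI w n = GI w n - {(0, j)}"
  proof -
    have "(a, c) \<in> Xs \<longleftrightarrow> (a, c) \<noteq> (0, j)" if g: "(a, c) \<in> GI w n" for a c
    proof -
      have "(a, c) \<in> Xs \<longleftrightarrow> (\<exists>i\<ge>0. t.Amb (Suc n) i c)"
        using t.chain_flip_eq[OF am(1,2)[OF g]] by (force simp: Xs_def suf_def Iv_def image_iff)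
      also have "\<dots> \<longleftrightarrow> a \<noteq> 0" using t.good_even_left[OF n ax] g good by blast
      also have "\<dots> \<longleftrightarrow> (a, c) \<noteq> (0, j)" using t.amb_fun[OF ax] am(2)[OF g] by auto
      finally show ?thesis .
    qed
    then show ?thesis by auto
  qed
  have Xpe: "Xp \<inter> GI w n \<union> Xe \<inter> GI w n = GI w n" "(Xp \<inter> GI w n) \<inter> (Xe \<inter> GI w n) = {}"
  proof -
    have "(a, c) \<in> Xp \<longleftrightarrow> rd w (t.B a m) ?L" "(a, c) \<in> Xe \<longleftrightarrow> \<not> rd w (t.B a m) ?L" if g: "(a, c) \<in> GI w n" for a c
    proof -
      have "(a, c) \<in> Xp \<longleftrightarrow> (\<exists>J. t.Amb (Suc n) a J)"
        using t.chain_eq[OF am(2)[OF g]] am(1)[OF g] by (auto simp: Xp_def pre_def Iv_def image_iff)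
      also have "\<dots> \<longleftrightarrow> rd w (t.B a m) ?L"
        using t.amb_extend[of a m c] am[OF g] m by simp
      finally show "(a, c) \<in> Xp \<longleftrightarrow> rd w (t.B a m) ?L" .
      have p: "t.Amb m a (t.B a m)" using t.amb_prefix[of m a c] am(2)[OF g] m by simp
      have "t.B a m \<le> j" using t.good_even_prefix[OF n ax] g good m by auto
      then have pz: "(a, t.B a m) \<in> Z" using p am(1)[OF g] by (simp add: Z_def Iv_def)
      have "(a, c) \<in> Y a" using g Iv_bounds[OF w] by (auto simp: Y_def GI_def)
      then have "(a, c) \<in> Y a' \<longleftrightarrow> a' = a" for a' by (auto simp: Y_def)
      then have "(a, c) \<in> Xe \<longleftrightarrow> (\<exists>z\<in>Z0. fst z = a)" by (simp add: Xe_def)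
      also have "\<dots> \<longleftrightarrow> (\<exists>c'. (a, c') \<in> Z0)"
      proof
        assume "\<exists>z\<in>Z0. fst z = a"
        then obtain z where "z \<in> Z0" "fst z = a" by blast
        then show "\<exists>c'. (a, c') \<in> Z0" by (intro exI[of _ "snd z"]) (cases z, simp)
      next
        assume "\<exists>c'. (a, c') \<in> Z0"
        then obtain c' where "(a, c') \<in> Z0" by blast
        then show "\<exists>z\<in>Z0. fst z = a" by (rule rev_bexI) simp
      qed
      finally have "(a, c) \<in> Xe \<longleftrightarrow> (\<exists>c'. (a, c') \<in> Z0)" .
      also have "\<dots> \<longleftrightarrow> \<not> rd w (t.B a m) ?L"
        using pz by (auto simp: Z0_def Z_def dest: Iv_fun)
      finally show "(a, c) \<in> Xe \<longleftrightarrow> \<not> rd w (t.B a m) ?L" .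
    qed
    then show "Xp \<inter> GI w n \<union> Xe \<inter> GI w n = GI w n" "(Xp \<inter> GI w n) \<inter> (Xe \<inter> GI w n) = {}" by auto
  qed
  have finG: "finite (GI w n)" by (rule finite_subset[OF _ finite_Iv[OF w, of n]]) (auto simp: GI_def)
  have sumpe: "sumI w (Xp \<inter> GI w n) + sumI w (Xe \<inter> GI w n) = sumI w (GI w n)"
    using sum.union_disjoint[of "Xp \<inter> GI w n" "Xe \<inter> GI w n" "\<lambda>x. ee (tr w x)"] finG Xpe by simp
  have key: "ee (tr w (0, j)) - sumI w (GI w n) + sumI w (GI w n - {(0, j)}) = 0"
    using xG finG by (subst sum.remove[of "GI w n" "(0, j)"]) auto
  have e: "ee (tr w (0, j)) - dif Q (dl (Suc n)) (S n (ee (tr w (0, j)))) - S (n - 1) (dif Q (dl n) (ee (tr w (0, j))))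
    = (sumI w Xs - sumI w (Xs \<inter> GI w n)) - (sumI w Xp - sumI w (Xp \<inter> GI w n)) - (sumI w Xe - sumI w (Xe \<inter> GI w n))
      - (S m (sumI w Z) - S m (sumI w Z0))
      + (ee (tr w (0, j)) - (sumI w (Xp \<inter> GI w n) + sumI w (Xe \<inter> GI w n)) + sumI w (Xs \<inter> GI w n))"
    unfolding DS D SZ0 using m by simp
  show ?thesis unfolding e sumpe XsG key
    using low_sumI[OF w Xs_sub] low_sumI[OF w Xp_sub] low_sumI[OF w Xe_sub] lowZ XsG
    by (auto intro!: low_closed)
qed

section \<open>From words to all elements of bounded weight\<close>

definition Ho :: "nat \<Rightarrow> (('v, 'e) triple \<Rightarrow>\<^sub>0 'k) \<Rightarrow> (('v, 'e) triple \<Rightarrow>\<^sub>0 'k)"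
  where "Ho n x = x - dif Q (dl (Suc n)) (S n x) - S (n - 1) (dif Q (dl n) x)"

lemma Ho_linear: "Ho n (x + y) = Ho n x + Ho n y" "Ho n (scl k x) = scl k (Ho n x)"
  by (simp_all add: Ho_def S_linear dif_linear scl_diff)

lemma Ho_bact: "Ho n (bact Q u (kpath (v, [])) x) = bact Q u (kpath (v, [])) (Ho n x)"
  by (simp add: Ho_def S_bact dif_bact bact_linear)

lemma dl_Mle': "q \<in> A n \<Longrightarrow> dl n q \<in> Mle (Tr (n - 1)) (kpath q)"
  using dl_Mle A_paths by blast

lemma dl_Fsp: "q \<in> A n \<Longrightarrow> dl n q \<in> Fsp"
  using dl_Mle' Mle_Fsp by blast

lemma rho_dif_Tr:
  assumes "Poly_Mapping.keys x \<subseteq> Tr n" "\<And>q. q \<in> A n \<Longrightarrow> g q \<in> Fsp"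
  shows "rho (dif Q g (rho x)) = rho (dif Q g x)"
  by (rule rho_dif[of x "A n"]) (use assms in \<open>auto simp: Tr_def\<close>)

lemma Ho_Mle:
  assumes "n > 0" "x \<in> Mle (Tr n) w" shows "Ho n x \<in> Mle (Tr n) w"
proof -
  have "dif Q (dl (Suc n)) (S n x) \<in> Mle (Tr n) w"
    using dif_Mle(1)[of "Suc n" "dl (Suc n)" n] dl_Mle'[of _ "Suc n"] S_Mle[OF assms(2)] by simp
  moreover have "S (n - 1) (dif Q (dl n) x) \<in> Mle (Tr n) w"
    using S_Mle[OF dif_Mle(1)[OF dl_Mle'[of _ n] assms(2)]] assms(1) by simp
  ultimately show ?thesis using assms(2) by (simp add: Ho_def M_closed)
qed

lemma rho_Ho:
  assumes "n > 0" "x \<in> Mle (Tr n) w" shows "rho (Ho n (rho x)) = rho (Ho n x)"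
proof -
  have k: "Poly_Mapping.keys x \<subseteq> Tr n" using Mle_keys[OF assms(2)] .
  have kr: "rho x \<in> Mle (Tr n) w" using rho_Mle[OF assms(2)] TrN_Tr by blast
  have 1: "rho (dif Q (dl (Suc n)) (S n (rho x))) = rho (dif Q (dl (Suc n)) (S n x))"
    using rho_dif_Tr[OF Mle_keys[OF S_Mle[OF assms(2)]] dl_Fsp] rho_dif_Tr[OF Mle_keys[OF S_Mle[OF kr]] dl_Fsp] rho_S[OF k]
    by simp
  have d: "dif Q (dl n) x \<in> Mle (Tr (n - 1)) w" "dif Q (dl n) (rho x) \<in> Mle (Tr (n - 1)) w"
    using dif_Mle(1)[OF dl_Mle'] assms(2) kr by blast+
  have 2: "rho (S (n - 1) (dif Q (dl n) (rho x))) = rho (S (n - 1) (dif Q (dl n) x))"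
    using rho_S[OF Mle_keys[OF d(1)]] rho_S[OF Mle_keys[OF d(2)]] rho_dif_Tr[OF k dl_Fsp] by simp
  show ?thesis unfolding Ho_def rho_linear 1 2 using rho_rho[OF Mle_Fsp[OF assms(2)]] by simp
qed

text \<open>After normalization c is irreducible, and (a, p, c) is the left multiple by a of the
  occurrence of p at the start of the word p c. Since \<open>Ho n\<close> commutes with left
  multiplication and with vertices on the right, the computation on words suffices.\<close>

theorem homotopy:
  assumes "n > 0" "x \<in> Mle (Tr n) w" shows "low n w (Ho n x)"
proof -
  have *: "rho (Ho n (Poly_Mapping.single t l)) \<in> Mlt (TrN n) w" if t: "t \<in> TrN n" "rle (Poly_Mapping.single (wt t) l) w" for t l
  proof -
    obtain a p c where tt: "t = (a, p, c)" by (cases t)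
    have h: "a \<in> P" "p \<in> P" "c \<in> P" "p \<in> A n" "jn a p" "jn p c" "c \<in> irrp"
      using t tt A_paths[of n] by (auto simp: TrN_def Tr_def)
    define W where "W = pcomp p c"
    define e where "e = (fst p, [] :: 'e list)"
    define e' where "e' = (ptgt Q c, [] :: 'e list)"
    have W: "W \<in> P" using h by (simp add: W_def pcomp_in_paths)
    have e: "e \<in> P" "e' \<in> P" "jn a e" "jn c e'" "jn e p" "pcomp a e = a" "pcomp c e' = c" "jn a W" "jn W e'"
      using h fst_in_verts[OF h(2)] ptgt_in_verts[OF h(3)]
      by (auto simp: e_def e'_def W_def vertex_path joinable_pcomp ptgt_pcomp) (auto simp: joinable_def)
    have trW: "tr W (0, int (plen p)) = (e, p, c)"
      using seg_pcomp_split[OF h(6) W_def] seg_empty[of W 0] by (simp add: tr_def sg_def e_def)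
        (simp add: seg_def ptgt_conv W_def)
    have Iv: "(0, int (plen p)) \<in> Iv W n"
      using A_sg[OF W, of 0 "int (plen p)" n] trW h by (simp add: tr_def Iv_def W_def)
    have irr: "\<not> rd W (int (plen p)) (int (plen W))" using trW h by (simp add: rd_def tr_def)
    have L: "low n (kpath W) (Ho n (ee (e, p, c)))"
      using homotopy_word_odd[OF W _ Iv irr] homotopy_word_even[OF W _ assms(1) Iv irr] trW
      by (cases "odd n") (simp_all add: Ho_def)
    have eT: "ee (e, p, c) \<in> Mle (Tr n) (kpath W)"
      using tr_Tr[OF W Iv] W trW by (intro MleI) (auto intro: red_le.refl)
    have s: "Poly_Mapping.single t l = scl l (bact Q (kpath a) (kpath e') (ee (e, p, c)))"
      using e by (simp add: tt bact_single)
    have "rho (Ho n (Poly_Mapping.single t l)) = scl l (rho (bact Q (kpath a) (kpath e') (rho (Ho n (ee (e, p, c))))))"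
      unfolding s Ho_linear e'_def Ho_bact rho_linear
      using rho_bact(2)[OF Mle_Fsp[OF Ho_Mle[OF assms(1) eT]] kpath_span[OF h(1)] kpath_span[OF e(2)]] by (simp add: e'_def)
    moreover have "scl l (rho (bact Q (kpath a) (kpath e') (rho (Ho n (ee (e, p, c)))))) \<in> Mlt (TrN n) (scl l (sw a e' (kpath W)))"
      using L TrN_Tr(2) h(1) e(2) unfolding low_def by (intro scl_Mlt rho_Mlt bact_Mlt) blast+
    moreover have "scl l (sw a e' (kpath W)) = Poly_Mapping.single (wt t) l"
      using e by (simp add: sandwich_def tt wt_def W_def pcomp_assoc)
    ultimately show ?thesis using M_mono(3)[OF t(2)] by auto
  qed
  have "rho (Ho n (rho x)) \<in> Mlt (TrN n) w"
    unfolding Mlt_def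
    by (rule Mle_hom[OF rho_Mle[OF assms(2)], where f = "\<lambda>x. rho (Ho n x)"])
      (simp add: Ho_linear rho_linear, fold Mlt_def, rule *)
  then show ?thesis using rho_Ho[OF assms] by (simp add: low_def)
qed

section \<open>Exactness in degree \<open>-1\<close>\<close>

text \<open>The multiplication of A followed by the section
  \<open>x \<mapsto> x \<otimes> 1\<close>, written on triples with the target vertex of c in place
  of 1.\<close>

definition eps :: "(('v, 'e) triple \<Rightarrow>\<^sub>0 'k) \<Rightarrow> (('v, 'e) triple \<Rightarrow>\<^sub>0 'k)"
  where "eps = lin (\<lambda>(a, v, c). tri (pmult Q (kpath a) (kpath c)) (ptgt Q c, []) (vx c))"

lemma eps_linear: "eps (x + y) = eps x + eps y" "eps (x - y) = eps x - eps y" "eps (scl k x) = scl k (eps x)" "eps 0 = 0"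
  by (simp_all add: eps_def lin_add lin_diff lin_scl)

lemma eps_tri:
  assumes "Poly_Mapping.keys v \<subseteq> parset c"
  shows "eps (tri u p v) = tri (pmult Q u v) (ptgt Q c, []) (vx c)"
proof (induction u rule: lincomb_induct)
  case (single a k)
  have a: "Poly_Mapping.single a k = scl k (kpath a)" by simp
  show ?case using assms
  proof (induction v rule: keys_induct)
    case (single c' l)
    then have "ptgt Q c' = ptgt Q c" by (simp add: parset_def par_def)
    moreover have "Poly_Mapping.single c' l = scl l (kpath c')" by simp
    ultimately show ?case unfolding a
      by (simp only: tri_linear eps_linear pmult_scl_left pmult_scl_right) (simp add: tri_single eps_def vx_def)
  qed (auto simp: tri_linear eps_linear pmult_add_right)
qed (auto simp: tri_linear eps_linear pmult_add_left)

lemma eps_single: "jn a c \<Longrightarrow> eps (Poly_Mapping.single (a, p, c) l) = Poly_Mapping.single (pcomp a c, (ptgt Q c, []), (ptgt Q c, [])) l"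
  by (simp add: eps_def pmult_single tri_single vx_def)

lemma rho_eps:
  assumes "Poly_Mapping.keys x \<subseteq> Tr n" shows "rho (eps (rho x)) = rho (eps x)"
  using assms
proof (induction x rule: keys_induct)
  case (single t l)
  obtain a p c where t: "t = (a, p, c)" by (cases t)
  have *: "a \<in> P" "c \<in> P" using single t by (auto simp: Tr_def)
  have s: "Poly_Mapping.single t l = scl l (tri (kpath a) p (kpath c))" by (simp add: t tri_single)
  have k: "Poly_Mapping.keys (kpath c :: ('v, 'e, 'k) lincomb) \<subseteq> parset c" using keys_kpath_parset[OF *(2)] .
  have "nf (pmult Q (nf (kpath a)) (nf (kpath c))) = nf (pmult Q (kpath a) (kpath c))"
    using pmult_nf(1)[OF kpath_span[OF *(1)] nf_span[OF kpath_span[OF *(2)]]] pmult_nf(2)[OF kpath_span[OF *(1)] kpath_span[OF *(2)]] by simp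
  then show ?case unfolding s eps_linear rho_linear rho_tri eps_tri[OF k] eps_tri[OF nf_parset[OF k]] by simp
qed (auto simp: eps_linear rho_linear)

lemma Iv_low:
  assumes "w \<in> P"
  shows "Iv w 0 = (\<lambda>i. (i, i)) ` {0..int (plen w)}" "Iv w (Suc 0) = (\<lambda>i. (i, i + 1)) ` {0..<int (plen w)}"
proof -
  interpret t: tips "rd w" 0 "int (plen w)" by (rule tips_word[OF assms])
  show "Iv w 0 = (\<lambda>i. (i, i)) ` {0..int (plen w)}" by (auto simp: Iv_def amb_def)
  have "t.Amb (Suc 0) i (i + 1)" if "0 \<le> i" "i < int (plen w)" for i
  proof -
    have "m = 0 \<or> m = 1" if "m \<le> Suc 0" for m using that by linarith
    then show ?thesis using t.nxt_lower[of i] that unfolding amb_def by fastforce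
  qed
  then show "Iv w (Suc 0) = (\<lambda>i. (i, i + 1)) ` {0..<int (plen w)}"
    by (auto simp: Iv_def) (auto simp: amb_def)
qed

lemma telescope: "(\<Sum>i\<in>{0..<int n}. f (i + 1) - f i) = f (int n) - (f 0 :: 'a::ab_group_add)"
proof (induction n)
  case (Suc n)
  have "{0..<int (Suc n)} = insert (int n) {0..<int n}" by auto
  then show ?case using Suc by (simp add: add.commute)
qed simp

text \<open>S produces one term for each arc of the word, and their boundaries telescope. In this
  degree no lower terms appear.\<close>

lemma homotopy_word_0:
  assumes w: "w \<in> P" and irr: "w \<in> irrp"
  shows "dif Q (dl (Suc 0)) (S 0 (ee (tr w (0, 0)))) = ee (tr w (0, 0)) - ee (tr w (int (plen w), int (plen w)))"
proof -
  let ?L = "int (plen w)"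
  have x: "(0, 0) \<in> Iv w 0" by (simp add: Iv_low[OF w])
  have ir: "\<not> rd w 0 ?L" using irr by (simp add: rd_def sg_full)
  have "{(a, c). (a, c) \<in> Iv w (Suc 0) \<and> 0 \<le> a \<and> c \<le> ?L \<and> True} = (\<lambda>i. (i, i + 1)) ` {0..<?L}"
    using Iv_bounds[OF w] unfolding Iv_low[OF w] by auto
  then have Sx: "S 0 (ee (tr w (0, 0))) = - (\<Sum>i\<in>{0..<?L}. ee (tr w (i, i + 1)))"
    using S_tr[OF w x ir] by (simp add: sum.reindex inj_on_def)
  have D: "dif Q (dl (Suc 0)) (ee (tr w (i, i + 1))) = ee (tr w (i + 1, i + 1)) - ee (tr w (i, i))" if i: "i \<in> {0..<?L}" for i
  proof -
    have I: "(i, i + 1) \<in> Iv w (Suc 0)" using i by (simp add: Iv_low[OF w])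
    have "{(a, c). (a, c) \<in> Iv w 0 \<and> i \<le> a \<and> c \<le> i + 1 \<and> c = i + 1} = {(i + 1, i + 1)}"
      "{(a, c). (a, c) \<in> Iv w 0 \<and> i \<le> a \<and> c \<le> i + 1 \<and> a = i} = {(i, i)}"
      using i unfolding Iv_low[OF w] by auto
    then show ?thesis using dif_dl_tr[OF w I] by simp
  qed
  have "dif Q (dl (Suc 0)) (S 0 (ee (tr w (0, 0)))) = - (\<Sum>i\<in>{0..<?L}. ee (tr w (i + 1, i + 1)) - ee (tr w (i, i)))"
    unfolding Sx dif_linear dif_sum using D by simp
  then show ?thesis using telescope[of "\<lambda>i. ee (tr w (i, i))" "plen w"] by simp
qed

text \<open>At the bottom of the complex \<open>eps\<close> takes the place of the missing term
  \<open>S d\<close>, and the identity is exact on normalized triples.\<close>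

lemma homotopy_0:
  assumes "Poly_Mapping.keys z \<subseteq> Tr 0"
  shows "rho (dif Q (dl (Suc 0)) (S 0 z)) = rho (z - eps z)"
proof -
  have *: "dif Q (dl (Suc 0)) (S 0 (Poly_Mapping.single t l)) = Poly_Mapping.single t l - eps (Poly_Mapping.single t l)" if t: "t \<in> TrN 0" for t l
  proof -
    obtain a v c where tt: "t = (a, v, c)" by (cases t)
    have h: "a \<in> P" "c \<in> P" "jn a v" "jn v c" "c \<in> irrp" "snd v = []"
      using t tt by (auto simp: TrN_def Tr_def A_simps paths_len_def)
    have v: "v = (fst c, [])" using h by (auto simp: joinable_def ptgt_conv intro: prod_eqI)
    have j: "jn a c" using h v by (simp add: joinable_def)
    define e' where "e' = (ptgt Q c, [] :: 'e list)"
    have tr0: "tr c (0, 0) = (v, v, c)" using v by (simp add: tr_def sg_full) (simp add: sg_def seg_def ptgt_conv)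
    have trL: "tr c (int (plen c), int (plen c)) = (c, e', e')"
      using v by (simp add: tr_def sg_full) (simp add: sg_def seg_def e'_def)
    have s: "Poly_Mapping.single t l = scl l (bact Q (kpath a) (kpath e') (ee (v, v, c)))"
      using h v by (simp add: tt bact_single e'_def)
    have "dif Q (dl (Suc 0)) (S 0 (Poly_Mapping.single t l)) = scl l (bact Q (kpath a) (kpath e') (ee (v, v, c) - ee (c, e', e')))"
      unfolding s dif_linear S_linear e'_def S_bact dif_bact
      using homotopy_word_0[OF h(2,5)] tr0 trL by (simp add: e'_def)
    also have "\<dots> = Poly_Mapping.single t l - Poly_Mapping.single (pcomp a c, e', e') l"
      using j unfolding s by (simp add: bact_linear scl_diff bact_single e'_def)
    finally show ?thesis using eps_single[OF j] by (simp add: tt e'_def)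
  qed
  have **: "dif Q (dl (Suc 0)) (S 0 x) = x - eps x" if "Poly_Mapping.keys x \<subseteq> TrN 0" for x
    using that
  proof (induction x rule: keys_induct)
    case (single t l) then show ?case by (rule *)
  next
    case (add x y) then show ?case by (simp add: S_linear dif_linear eps_linear)
  qed (simp add: S_linear dif_linear eps_linear)
  have kz: "Poly_Mapping.keys (rho z) \<subseteq> TrN 0" "z \<in> Fsp" "Poly_Mapping.keys (S 0 z) \<subseteq> Tr (Suc 0)" "Poly_Mapping.keys (S 0 (rho z)) \<subseteq> Tr (Suc 0)"
  proof -
    have *: "Poly_Mapping.keys (S 0 x) \<subseteq> Tr (Suc 0)" if "Poly_Mapping.keys x \<subseteq> Tr 0" for x
      using that
    proof (induction x rule: keys_induct)
      case (add x y) then show ?case using keys_add[of "S 0 x" "S 0 y"] by (auto simp: S_linear)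
    qed (use Mle_keys[OF S_gen] in \<open>auto simp: S_linear\<close>)
    show 1: "Poly_Mapping.keys (rho z) \<subseteq> TrN 0"
      using assms
    proof (induction z rule: keys_induct)
      case (add x y) then show ?case using keys_add[of "rho x" "rho y"] by (auto simp: rho_linear)
    qed (use Mle_keys[OF rho_gen(1)] in \<open>auto simp: rho_linear\<close>)
    show "z \<in> Fsp" using assms Tr_TP by (auto simp: Fsp_def)
    show "Poly_Mapping.keys (S 0 z) \<subseteq> Tr (Suc 0)" "Poly_Mapping.keys (S 0 (rho z)) \<subseteq> Tr (Suc 0)"
      using * assms 1 by (auto simp: TrN_def)
  qed
  have "rho (dif Q (dl (Suc 0)) (S 0 z)) = rho (dif Q (dl (Suc 0)) (S 0 (rho z)))"
    using rho_dif_Tr[OF kz(3) dl_Fsp] rho_dif_Tr[OF kz(4) dl_Fsp] rho_S[OF assms] by simp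
  also have "\<dots> = rho (z - eps z)"
    unfolding **[OF kz(1)] rho_linear rho_eps[OF assms] rho_rho[OF kz(2)] ..
  finally show ?thesis .
qed

lemma le_par: "rle (Poly_Mapping.single p l) (Poly_Mapping.single q m) \<Longrightarrow> l \<noteq> 0 \<Longrightarrow> par p q"
proof -
  assume a: "rle (Poly_Mapping.single p l) (Poly_Mapping.single q m)" "l \<noteq> 0"
  show "par p q"
  proof (cases "p = q")
    case False
    then have "rlt (Poly_Mapping.single p l) (Poly_Mapping.single q m)" using lt_belowI a by blast
    then obtain q' m' where *: "Poly_Mapping.single q m = Poly_Mapping.single q' m'" "m' \<noteq> 0" "(p, q') \<in> below\<^sup>+"
      using lt_cases a(2) by blast
    then have "q' = q" using single_eqD by metis
    then show ?thesis using below_parset[OF *(3)] by (simp add: parset_def)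
  qed (simp add: par_simps)
qed

text \<open>Terms bounded by q are parallel to q, so its end vertices act as units. The integral
  span of the empty set is 0, which lets \<open>Mle_hom\<close> prove an equation.\<close>

lemma bact_id:
  assumes "x \<in> Mle (Tr n) (Poly_Mapping.single q l)"
  shows "bact Q (kpath (fst q, [])) (vx q) x = x"
proof -
  have "bact Q (kpath (fst q, [])) (vx q) x - x \<in> zsp {}"
  proof (rule Mle_hom[OF assms, where f = "\<lambda>x. bact Q (kpath (fst q, [])) (vx q) x - x"])
    fix t k assume t: "t \<in> Tr n" "k \<noteq> 0" "rle (Poly_Mapping.single (wt t) k) (Poly_Mapping.single q l)"
    have "par (wt t) q" using le_par t by blast
    then have "fst (fst t) = fst q" "ptgt Q (snd (snd t)) = ptgt Q q" using Tr_wt[OF t(1)] by (simp_all add: par_def)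
    then have "bact Q (kpath (fst q, [])) (vx q) (Poly_Mapping.single t k) = Poly_Mapping.single t k"
      by (cases t) (simp add: bact_single vx_def)
    then show "bact Q (kpath (fst q, [])) (vx q) (Poly_Mapping.single t k) - Poly_Mapping.single t k \<in> zsp {}" by (simp add: zsp.zero)
  qed (simp add: bact_linear)
  moreover have "y = 0" if "y \<in> zsp {}" for y :: "('v, 'e) triple \<Rightarrow>\<^sub>0 'k" using that by induction auto
  ultimately have "bact Q (kpath (fst q, [])) (vx q) x - x = 0" by blast
  then show ?thesis by simp
qed

section \<open>Perturbation of the monomial differential\<close>

text \<open>Condition (2) of the theorem in coordinates, before normalization of the outer
  paths.\<close>

definition close_gen :: "nat \<Rightarrow> (('v, 'e) path \<Rightarrow> (('v, 'e) triple \<Rightarrow>\<^sub>0 'k)) \<Rightarrow> bool"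
  where "close_gen n g \<longleftrightarrow> (\<forall>q\<in>A n. g q - dl n q \<in> Mlt (Tr (n - 1)) (kpath q))"

text \<open>Exactness in a form that survives perturbation: a boundary has a preimage that agrees with the
  one given by the homotopy up to lower terms.\<close>
definition exact_gen :: "nat \<Rightarrow> (('v, 'e) path \<Rightarrow> (('v, 'e) triple \<Rightarrow>\<^sub>0 'k)) \<Rightarrow> bool"
  where "exact_gen n g \<longleftrightarrow> (\<forall>w. \<forall>x\<in>Mle (Tr n) w. \<exists>y\<in>Mle (Tr n) w.
    rho (dif Q g y) = rho (dif Q g x) \<and> low n w (y - S (n - 1) (dif Q g x)))"

lemma close_gen_Mle: assumes "close_gen n g" "q \<in> A n" shows "g q \<in> Mle (Tr (n - 1)) (kpath q)"
proof -
  have "(g q - dl n q) + dl n q \<in> Mle (Tr (n - 1)) (kpath q)"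
    using assms dl_Mle' Mlt_Mle unfolding close_gen_def by (intro M_closed(2)) blast+
  then show ?thesis by simp
qed

lemma close_gen_Fsp: "close_gen n g \<Longrightarrow> q \<in> A n \<Longrightarrow> g q \<in> Fsp"
  using close_gen_Mle Mle_Fsp by blast

lemma close_dif:
  assumes "close_gen n g" "x \<in> Mle (Tr n) w"
  shows "dif Q g x \<in> Mle (Tr (n - 1)) w" "dif Q g x - dif Q (dl n) x \<in> Mlt (Tr (n - 1)) w"
proof -
  show "dif Q g x \<in> Mle (Tr (n - 1)) w" using dif_Mle(1)[OF close_gen_Mle[OF assms(1)] assms(2)] .
  have "dif Q (\<lambda>q. g q - dl n q) x \<in> Mlt (Tr (n - 1)) w"
    using assms(1) by (intro dif_Mle_Mlt[OF _ assms(2)]) (auto simp: close_gen_def)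
  moreover have "dif Q (\<lambda>q. g q - dl n q) x = dif Q g x - dif Q (dl n) x"
    by (simp add: dif_def bact_linear case_prod_unfold lin_fun_diff)
  ultimately show "dif Q g x - dif Q (dl n) x \<in> Mlt (Tr (n - 1)) w" by simp
qed

lemma Mlt_low: "x \<in> Mlt (Tr n) w \<Longrightarrow> low n w x"
  unfolding low_def by (rule rho_Mlt)

text \<open>Multiplication annihilates boundaries of arrows, so \<open>eps\<close> vanishes on them
  and S itself gives a preimage; the deviation from the homotopy is 0.\<close>

lemma exact_1: "exact_gen (Suc 0) (dl (Suc 0))"
  unfolding exact_gen_def
proof (intro allI ballI)
  fix w x assume x: "x \<in> Mle (Tr (Suc 0)) w"
  have cg: "close_gen (Suc 0) (dl (Suc 0))" by (simp add: close_gen_def M_closed)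
  let ?z = "dif Q (dl (Suc 0)) x"
  have z: "?z \<in> Mle (Tr 0) w" using close_dif(1)[OF cg x] by simp
  have "eps ?z = 0" using Mle_keys[OF x]
  proof (induction x rule: keys_induct)
    case (single t l)
    obtain a q c where t: "t = (a, q, c)" by (cases t)
    have h: "a \<in> P" "q \<in> P" "c \<in> P" "jn a q" "jn q c" "plen q = 1" using single t by (auto simp: Tr_def A_simps paths_len_def)
    have I0: "Iv q 0 = {(0, 0), (1, 1)}" "(0, 1) \<in> Iv q (Suc 0)"
      unfolding Iv_low[OF h(2)] using h(6) by force+
    have tr: "tr q (0, 1) = ((fst q, []), q, (ptgt Q q, []))" "tr q (0, 0) = ((fst q, []), (fst q, []), q)"
      "tr q (1, 1) = (q, (ptgt Q q, []), (ptgt Q q, []))"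
      using h(6) by (simp_all add: tr_def sg_def seg_def ptgt_conv)
    have "{(a, c). (a, c) \<in> Iv q 0 \<and> 0 \<le> a \<and> c \<le> 1 \<and> c = 1} = {(1, 1)}" "{(a, c). (a, c) \<in> Iv q 0 \<and> 0 \<le> a \<and> c \<le> 1 \<and> a = 0} = {(0, 0)}"
      unfolding I0 by auto
    then have D: "dif Q (dl (Suc 0)) (ee ((fst q, []), q, (ptgt Q q, []))) = ee (q, (ptgt Q q, []), (ptgt Q q, [])) - ee ((fst q, []), (fst q, []), q)"
      using dif_dl_tr[OF h(2) I0(2)] tr by simp
    have s: "Poly_Mapping.single t l = scl l (bact Q (kpath a) (kpath c) (ee ((fst q, []), q, (ptgt Q q, []))))"
      using h by (simp add: t bact_single) (simp add: joinable_def)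
    show ?case unfolding s dif_linear dif_bact D using h
      by (simp add: bact_linear bact_single eps_linear)
        (simp add: joinable_def eps_single ptgt_pcomp joinable_pcomp pcomp_assoc)
  qed (auto simp: dif_linear eps_linear)
  then have "rho (dif Q (dl (Suc 0)) (S 0 ?z)) = rho ?z" using homotopy_0[OF Mle_keys[OF z]] by simp
  then show "\<exists>y\<in>Mle (Tr (Suc 0)) w. rho (dif Q (dl (Suc 0)) y) = rho (dif Q (dl (Suc 0)) x)
      \<and> low (Suc 0) w (y - S (Suc 0 - 1) (dif Q (dl (Suc 0)) x))"
    using S_Mle[OF z] by (intro bexI[of _ "S 0 ?z"]) (auto simp: low_closed)
qed

text \<open>The tail after the proper prefix is the last factor of q, which is irreducible, and q is
  the only occurrence of its degree in q. The homotopy therefore recovers q from the prefix up to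
  sign.\<close>

lemma amb_last:
  assumes "q \<in> A (Suc n)" "n > 0"
  shows "\<exists>b. (0, b) \<in> Iv q n \<and> \<not> rd q b (int (plen q)) \<and>
    S n (ee (tr q (0, b))) = (if odd n then ee (tr q (0, int (plen q))) else - ee (tr q (0, int (plen q))))"
proof -
  have q: "q \<in> P" using assms(1) A_paths by blast
  let ?L = "int (plen q)"
  interpret t: tips "rd q" 0 ?L by (rule tips_word[OF q])
  have am: "t.Amb (Suc n) 0 ?L" using A_iff[OF q] assms(1) by simp
  define b where "b = t.B 0 n"
  have b: "(0, b) \<in> Iv q n" using t.amb_prefix[OF am] by (simp add: Iv_def b_def)
  have irr: "\<not> rd q b ?L"
  proof -
    have "\<forall>m. 1 \<le> m \<and> m < Suc n \<longrightarrow> \<not> rd q (t.B 0 m) (t.B 0 (Suc m))"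
      using t.amb_posfac[OF order_refl am] unfolding t.posfac_def by blast
    from this[THEN spec[of _ n]] have "\<not> rd q (t.B 0 n) (t.B 0 (Suc n))" using assms(2) by (simp del: chain.simps)
    then show ?thesis unfolding t.chain_eq[OF am] b_def .
  qed
  have full: "(0, ?L) \<in> Iv q (Suc n)" using am by (simp add: Iv_def)
  have "{(a, c). (a, c) \<in> Iv q (Suc n) \<and> 0 \<le> a \<and> c \<le> ?L \<and> a = 0} = {(0, ?L)}"
    using full by (auto dest: Iv_fun[OF _ full])
  moreover have "{(a, c). (a, c) \<in> Iv q (Suc n) \<and> 0 \<le> a \<and> c \<le> ?L \<and> True} = {(0, ?L)}"
  proof -
    have u: "a = 0 \<and> c = ?L" if ac: "(a, c) \<in> Iv q (Suc n)" for a c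
    proof -
      have "0 \<le> a" "t.Amb (Suc n) a c" "c \<le> ?L" using ac Iv_bounds[OF q ac] by (auto simp: Iv_def)
      then have "\<not> 0 < a" using t.amb_mono[OF order_refl _ am, of a c] by linarith
      then have "a = 0" using \<open>0 \<le> a\<close> by simp
      then show ?thesis using Iv_fun[OF _ full, of c] ac by simp
    qed
    show ?thesis using full by (auto dest: u)
  qed
  ultimately show ?thesis using b irr S_tr[OF q b irr] by (intro exI[of _ b]) simp
qed

lemma dif_full: assumes "q \<in> A n" shows "dif Q g (ee (tr q (0, int (plen q)))) = bact Q (kpath (fst q, [])) (vx q) (g q)"
proof -
  have "tr q (0, int (plen q)) = ((fst q, []), q, (ptgt Q q, []))"
    by (simp add: tr_def sg_def seg_def ptgt_conv)
  then show ?thesis by (simp add: dif_single vx_def)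
qed

text \<open>If x is the proper prefix of q that is an ambiguity of one degree less, then the value at q is
  \<open>x - y\<close> up to sign, where y is a preimage of the boundary of x close to the one given by
  the homotopy.\<close>
lemma perturb_gen:
  assumes n: "n > 0" and g: "close_gen n g" "exact_gen n g"
  shows "\<exists>g'. close_gen (Suc n) g' \<and> (\<forall>q\<in>A (Suc n). rho (dif Q g (g' q)) = 0)"
proof -
  have "\<exists>h. h - dl (Suc n) q \<in> Mlt (Tr n) (kpath q) \<and> rho (dif Q g h) = 0" if q: "q \<in> A (Suc n)" for q
  proof -
    let ?w = "kpath q :: ('v, 'e, 'k) lincomb"
    have qP: "q \<in> P" using q A_paths by blast
    obtain b where b: "(0, b) \<in> Iv q n" "S n (ee (tr q (0, b))) = (if odd n then ee (tr q (0, int (plen q))) else - ee (tr q (0, int (plen q))))"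
      using amb_last[OF q n] by blast
    let ?x = "ee (tr q (0, b))"
    have x: "?x \<in> Mle (Tr n) ?w" using Dec_Mle[OF qP] b(1) Dec_conv[OF qP] by blast
    obtain y where y: "y \<in> Mle (Tr n) ?w" "rho (dif Q g y) = rho (dif Q g ?x)" "low n ?w (y - S (n - 1) (dif Q g ?x))"
      using g(2) x unfolding exact_gen_def by blast
    define \<sigma> :: 'k where "\<sigma> = (if odd n then 1 else - 1)"
    have dq: "dif Q (dl (Suc n)) (S n ?x) = scl \<sigma> (dl (Suc n) q)"
    proof -
      have "bact Q (kpath (fst q, [])) (vx q) (dl (Suc n) q) = dl (Suc n) q"
        by (rule bact_id[OF dl_Mle'[OF q]])
      then show ?thesis using b(2) dif_full[OF q, of "dl (Suc n)"]
        by (simp add: \<sigma>_def dif_linear scl_uminus_one)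
    qed
    have l1: "low n ?w (S (n - 1) (dif Q g ?x) - S (n - 1) (dif Q (dl n) ?x))"
      using Mlt_low S_Mlt[OF close_dif(2)[OF g(1) x]] n by (simp add: S_linear)
    have l2: "low n ?w (?x - scl \<sigma> (dl (Suc n) q) - S (n - 1) (dif Q (dl n) ?x))"
      using homotopy[OF n x] by (simp add: Ho_def dq)
    \<comment> \<open>The homotopy identity at x, the closeness of g to the monomial differential
      and the closeness of y to the homotopy combine: the terms S d x cancel, and x - y agrees with
      the signed monomial boundary of q up to lower terms.\<close>
    have l3: "low n ?w ((?x - y) - scl \<sigma> (dl (Suc n) q))"
      using low_closed(4)[OF low_closed(4)[OF l2 l1] y(3)] by (simp add: algebra_simps)
    have ss: "\<sigma> * \<sigma> = 1" by (simp add: \<sigma>_def)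
    define u where "u = scl \<sigma> (?x - y) - dl (Suc n) q"
    have "low n ?w (scl \<sigma> v)" if "low n ?w v" for v
      using that by (cases "odd n") (simp_all add: \<sigma>_def scl_uminus_one low_closed(3))
    from this[OF l3] have lu: "low n ?w u" by (simp add: u_def scl_diff ss)
    have dM: "dl (Suc n) q \<in> Mle (Tr n) ?w" using dl_Mle'[OF q] by simp
    have uM: "u \<in> Mle (Tr n) ?w"
    proof -
      have "scl \<sigma> (?x - y) \<in> Mle (Tr n) ?w"
        using M_closed(3,4) x y(1) by (auto simp: \<sigma>_def scl_uminus_one M_closed)
      then show ?thesis using dM by (simp add: u_def M_closed)
    qed
    \<comment> \<open>Only \<open>rho u\<close> is known to be lower, not u. Both represent the same
      tensor, so replacing u by \<open>rho u\<close> keeps the cycle condition.\<close>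
    define h where "h = dl (Suc n) q + rho u"
    have "rho (dif Q g h) = rho (dif Q g (dl (Suc n) q)) + rho (dif Q g u)"
      using rho_dif_Tr[OF Mle_keys[OF uM] close_gen_Fsp[OF g(1)]] by (simp add: h_def dif_linear rho_linear)
    also have "\<dots> = scl \<sigma> (rho (dif Q g ?x) - rho (dif Q g y))"
      by (simp add: u_def dif_linear rho_linear)
    also have "\<dots> = 0" using y(2) by simp
    finally have 1: "rho (dif Q g h) = 0" .
    have "h - dl (Suc n) q \<in> Mlt (Tr n) ?w" using lu TrN_Tr(2) by (auto simp: h_def low_def)
    then show ?thesis using 1 by blast
  qed
  then obtain g' where "\<And>q. q \<in> A (Suc n) \<Longrightarrow> g' q - dl (Suc n) q \<in> Mlt (Tr n) (kpath q) \<and> rho (dif Q g (g' q)) = 0" by metis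
  then show ?thesis by (intro exI[of _ g']) (simp add: close_gen_def)
qed

lemma rho_dif_dif:
  assumes "close_gen n g" "close_gen (Suc n) g'" "\<forall>q\<in>A (Suc n). rho (dif Q g (g' q)) = 0" "Poly_Mapping.keys x \<subseteq> Tr (Suc n)"
  shows "rho (dif Q g (dif Q g' x)) = 0"
  using assms(4)
proof (induction x rule: keys_induct)
  case (single t l)
  obtain a q c where t: "t = (a, q, c)" by (cases t)
  have h: "a \<in> P" "q \<in> A (Suc n)" "c \<in> P" using single t by (auto simp: Tr_def)
  have F: "dif Q g (g' q) \<in> Fsp"
    using close_gen_Mle[OF assms(2) h(2)] Mle_Fsp[OF close_dif(1)[OF assms(1)]] by simp
  have "rho (dif Q g (dif Q g' (Poly_Mapping.single t l))) = scl l (rho (bact Q (kpath a) (kpath c) (rho (dif Q g (g' q)))))"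
    unfolding t dif_single dif_linear dif_bact rho_linear rho_bact(2)[OF F kpath_span[OF h(1)] kpath_span[OF h(3)]] ..
  then show ?case using assms(3) h by (simp add: bact_linear rho_linear)
qed (auto simp: dif_linear rho_linear)

text \<open>The operator M below lowers the weight strictly, so well-foundedness makes it nilpotent on every
  element; a preimage is the sum of the homotopy applied to its iterates.\<close>
lemma perturb_exact:
  assumes n: "n > 0" and g: "close_gen n g" and g': "close_gen (Suc n) g'" "\<forall>q\<in>A (Suc n). rho (dif Q g (g' q)) = 0"
  shows "exact_gen (Suc n) g'"
proof -
  define M where "M z = rho (z - dif Q g' (S n z) - S (n - 1) (dif Q g z))" for z
  have M_add: "M (x + y) = M x + M y" for x y by (simp add: M_def dif_linear S_linear rho_linear)
  have M_0: "M 0 = 0" by (simp add: M_def dif_linear S_linear rho_linear)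
  have M_lt: "M z \<in> Mlt (TrN n) w" if z: "z \<in> Mle (Tr n) w" for z w
  proof -
    have 1: "low n w (Ho n z)" by (rule homotopy[OF n z])
    have 2: "low n w (dif Q g' (S n z) - dif Q (dl (Suc n)) (S n z))"
      using Mlt_low close_dif(2)[OF g'(1) S_Mle[OF z]] by simp
    have 3: "low n w (S (n - 1) (dif Q g z) - S (n - 1) (dif Q (dl n) z))"
      using Mlt_low S_Mlt[OF close_dif(2)[OF g z]] n by (simp add: S_linear)
    have e: "z - dif Q g' (S n z) - S (n - 1) (dif Q g z) = Ho n z - (dif Q g' (S n z) - dif Q (dl (Suc n)) (S n z))
       - (S (n - 1) (dif Q g z) - S (n - 1) (dif Q (dl n) z))" by (simp add: Ho_def)
    show ?thesis using low_closed(4)[OF low_closed(4)[OF 1 2] 3] unfolding M_def e low_def .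
  qed
  have Mk_0: "(M ^^ k) 0 = 0" for k by (induction k) (auto simp: M_0)
  have Mk_add: "(M ^^ k) (x + y) = (M ^^ k) x + (M ^^ k) y" for k x y by (induction k) (auto simp: M_add)
  have Mk_minus: "(M ^^ k) (- x) = - (M ^^ k) x" for k x
    using Mk_add[of k x "- x"] Mk_0 by (simp add: eq_neg_iff_add_eq_0 add.commute)
  \<comment> \<open>Elements annihilated by some power of M. They are closed under sums because
    exponents can be added.\<close>
  define K where "K = {z. \<exists>k. (M ^^ k) z = 0}"
  have K_add: "x + y \<in> K" if xy: "x \<in> K" "y \<in> K" for x y
  proof -
    obtain k l where kl: "(M ^^ k) x = 0" "(M ^^ l) y = 0" using xy by (auto simp: K_def)
    have "(M ^^ (l + k)) x = 0" "(M ^^ (k + l)) y = 0"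
      unfolding funpow_add comp_apply kl Mk_0 by (rule HOL.refl)+
    then have "(M ^^ (k + l)) (x + y) = 0" unfolding Mk_add by (simp add: add.commute[of l k])
    then show ?thesis unfolding K_def by blast
  qed
  have K_zsp: "zsp Z \<subseteq> K" if "Z \<subseteq> K" for Z
  proof
    fix x assume "x \<in> zsp Z" then show "x \<in> K"
    proof induction
      case zero
      have "(M ^^ 0) 0 = 0" by simp
      then show ?case unfolding K_def by blast
    next
      case (minus x)
      then show ?case unfolding K_def using Mk_minus by auto
    qed (use that K_add in auto)
  qed
  \<comment> \<open>M turns a triple into an integral combination of triples spelling strictly
    smaller words, so induction along the well-founded order applies.\<close>
  have K_single: "Poly_Mapping.single t l \<in> K" if "t \<in> Tr n" "wt t = p" for t l p
    using wf_trancl[OF wf_below] that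
  proof (induction p arbitrary: t l rule: wf_induct_rule)
    case (less p)
    have t: "Poly_Mapping.single t l \<in> Mle (Tr n) (Poly_Mapping.single p l)"
      using less.prems Tr_wt(1)[OF less.prems(1)] by (intro MleI) (auto intro: red_le.refl)
    have "{Poly_Mapping.single t' l' | t' l'. t' \<in> TrN n \<and> rlt (Poly_Mapping.single (wt t') l') (Poly_Mapping.single p l)} \<subseteq> K"
    proof (clarsimp simp del: split_paired_All split_paired_Ex)
      fix t' l' assume t': "t' \<in> TrN n" "rlt (Poly_Mapping.single (wt t') l') (Poly_Mapping.single p l)"
      show "Poly_Mapping.single t' l' \<in> K"
      proof (cases "l' = 0")
        case True
        then show ?thesis using K_zsp[of "{}"] zsp.zero by auto
      next
        case False
        then obtain q m where q: "Poly_Mapping.single p l = Poly_Mapping.single q m" "m \<noteq> 0" "(wt t', q) \<in> below\<^sup>+"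
          using lt_cases[OF t'(2)] by blast
        then have "q = p" using single_eqD by metis
        then show ?thesis using less.IH[OF _ _ HOL.refl] q(3) t'(1) by (auto simp: TrN_def)
      qed
    qed
    then have "M (Poly_Mapping.single t l) \<in> K" using M_lt[OF t] K_zsp unfolding Mlt_def by blast
    then obtain k where "(M ^^ k) (M (Poly_Mapping.single t l)) = 0" by (auto simp: K_def)
    then have "(M ^^ Suc k) (Poly_Mapping.single t l) = 0" by (simp add: funpow_swap1)
    then show ?case unfolding K_def by blast
  qed
  have K_all: "z \<in> K" if "z \<in> Mle (Tr n) w" for z w
    using Mle_keys[OF that]
  proof (induction z rule: keys_induct)
    case zero
    then show ?case using K_zsp[of "{}"] zsp.zero by auto
  qed (use K_single K_add in auto)
  \<comment> \<open>For a cycle z the part S d z vanishes after normalization, so M z is z minus the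
    boundary of S z. It is again a cycle, with a smaller exponent, and a preimage of M z plus S z is
    a preimage of z. Everything added to S z is lower, which keeps the result close to the
    homotopy.\<close>
  have solve: "\<exists>y\<in>Mle (Tr (Suc n)) w. rho (dif Q g' y) = rho z \<and> low (Suc n) w (y - S n z)"
    if "z \<in> Mle (Tr n) w" "rho (dif Q g z) = 0" "(M ^^ k) z = 0" for k z w
    using that
  proof (induction k arbitrary: z)
    case 0
    then show ?case by (intro bexI[of _ 0]) (auto simp: dif_linear rho_linear S_linear low_closed M_closed)
  next
    case (Suc k)
    have z: "z \<in> Mle (Tr n) w" and c: "rho (dif Q g z) = 0" by (rule Suc.prems)+
    have Sz: "S n z \<in> Mle (Tr (Suc n)) w" by (rule S_Mle[OF z])
    have dS: "dif Q g' (S n z) \<in> Mle (Tr n) w" using close_dif(1)[OF g'(1) Sz] by simp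
    have dz: "dif Q g z \<in> Mle (Tr (n - 1)) w" using close_dif(1)[OF g z] .
    have "rho (S (n - 1) (dif Q g z)) = 0"
      using rho_S[OF Mle_keys[OF dz]] c by (simp add: S_linear rho_linear)
    then have Mz: "M z = rho (z - dif Q g' (S n z))" by (simp add: M_def rho_linear)
    have d: "z - dif Q g' (S n z) \<in> Mle (Tr n) w" using z dS by (simp add: M_closed)
    have lt: "M z \<in> Mlt (Tr n) w" using M_lt[OF z] TrN_Tr(2) by blast
    have "rho (dif Q g (M z)) = rho (dif Q g (z - dif Q g' (S n z)))"
      unfolding Mz by (rule rho_dif_Tr[OF Mle_keys[OF d] close_gen_Fsp[OF g]])
    then have "rho (dif Q g (M z)) = 0"
      using c rho_dif_dif[OF g g' Mle_keys[OF Sz]] by (simp add: dif_linear rho_linear)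
    moreover have "(M ^^ k) (M z) = 0" using Suc.prems(3) by (simp add: funpow_swap1)
    ultimately obtain y where y: "y \<in> Mle (Tr (Suc n)) w" "rho (dif Q g' y) = rho (M z)" "low (Suc n) w (y - S n (M z))"
      using Suc.IH[OF Mlt_Mle[OF lt]] by blast
    have "rho (dif Q g' (S n z + y)) = rho z"
      using y(2) rho_rho[OF Mle_Fsp[OF d]] by (simp add: dif_linear rho_linear Mz)
    moreover have "low (Suc n) w (S n z + y - S n z)"
      using low_closed(2)[OF y(3) Mlt_low[OF S_Mlt[OF lt]]] by simp
    ultimately show ?case using M_closed(2)[OF Sz y(1)] by blast
  qed
  show ?thesis unfolding exact_gen_def
  proof (intro allI ballI)
    fix w x assume x: "x \<in> Mle (Tr (Suc n)) w"
    have z: "dif Q g' x \<in> Mle (Tr n) w" using close_dif(1)[OF g'(1) x] by simp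
    obtain k where k: "(M ^^ k) (dif Q g' x) = 0" using K_all[OF z] by (auto simp: K_def)
    show "\<exists>y\<in>Mle (Tr (Suc n)) w. rho (dif Q g' y) = rho (dif Q g' x) \<and> low (Suc n) w (y - S (Suc n - 1) (dif Q g' x))"
      using solve[OF z rho_dif_dif[OF g g' Mle_keys[OF x]] k] by simp
  qed
qed

text \<open>Dependent choice. Exactness belongs to the invariant because the correction in the next
  degree consumes it, and the lowest map is fixed to be the unperturbed one.\<close>

theorem perturbed_differential:
  "\<exists>G. G (Suc 0) = dl (Suc 0) \<and> (\<forall>n>0. close_gen n (G n)) \<and>
    (\<forall>n>0. \<forall>q\<in>A (Suc n). rho (dif Q (G n) (G (Suc n) q)) = 0)"
proof -
  have "\<exists>f. \<forall>n. (close_gen (Suc n) (f n) \<and> exact_gen (Suc n) (f n) \<and> (n = 0 \<longrightarrow> f n = dl (Suc 0))) \<and>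
    (\<forall>q\<in>A (Suc (Suc n)). rho (dif Q (f n) (f (Suc n) q)) = 0)"
  proof (rule dependent_nat_choice)
    show "\<exists>g. close_gen (Suc 0) g \<and> exact_gen (Suc 0) g \<and> (0 = 0 \<longrightarrow> g = dl (Suc 0))"
      using exact_1 by (intro exI[of _ "dl (Suc 0)"]) (simp add: close_gen_def M_closed)
  next
    fix g n assume g: "close_gen (Suc n) g \<and> exact_gen (Suc n) g \<and> (n = 0 \<longrightarrow> g = dl (Suc 0))"
    then obtain g' where g': "close_gen (Suc (Suc n)) g'" "\<forall>q\<in>A (Suc (Suc n)). rho (dif Q g (g' q)) = 0"
      using perturb_gen[of "Suc n" g] by blast
    then show "\<exists>g'. (close_gen (Suc (Suc n)) g' \<and> exact_gen (Suc (Suc n)) g' \<and> (Suc n = 0 \<longrightarrow> g' = dl (Suc 0))) \<and>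
        (\<forall>q\<in>A (Suc (Suc n)). rho (dif Q g (g' q)) = 0)"
      using perturb_exact[OF _ _ g'] g by blast
  qed
  then obtain f where f: "\<And>n. close_gen (Suc n) (f n)" "f 0 = dl (Suc 0)"
    "\<And>n. \<forall>q\<in>A (Suc (Suc n)). rho (dif Q (f n) (f (Suc n) q)) = 0" by blast
  have "close_gen n (f (n - 1))" if "n > 0" for n using f(1)[of "n - 1"] that by simp
  moreover have "\<forall>q\<in>A (Suc n). rho (dif Q (f (n - 1)) (f (Suc n - 1) q)) = 0" if "n > 0" for n
    using f(3)[of "n - 1"] that by simp
  ultimately show ?thesis using f(2) by (intro exI[of _ "\<lambda>n. f (n - 1)"]) simp
qed

end

section \<open>The tensor product\<close>

text \<open>The quotient of the free abelian group is treated once in general. Afterwards tensors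
  are handled through pure tensors, induction and the universal property.\<close>

locale tensor_data = A: ring A + M: comm_group M
  for A :: "('a, 'z) ring_scheme" and M :: "('r, 'm, 'y) bimod_scheme" +
  fixes E :: "'r set" and \<phi> :: "'r \<Rightarrow> 'a"
  assumes phi_closed: "e \<in> E \<Longrightarrow> \<phi> e \<in> carrier A"
    and lact_closed: "e \<in> E \<Longrightarrow> m \<in> carrier M \<Longrightarrow> lact M e m \<in> carrier M"
    and ract_closed: "e \<in> E \<Longrightarrow> m \<in> carrier M \<Longrightarrow> ract M m e \<in> carrier M"
begin

abbreviation "T \<equiv> tensor A E \<phi> M"
abbreviation "t \<equiv> pure_tensor A E \<phi> M"
abbreviation "Fr \<equiv> tensor_free A M"
abbreviation "N \<equiv> tensor_null A E \<phi> M"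
abbreviation "X3 \<equiv> carrier A \<times> carrier M \<times> carrier A"

definition cs :: "('a \<times> 'm \<times> 'a \<Rightarrow>\<^sub>0 int) \<Rightarrow> ('a \<times> 'm \<times> 'a \<Rightarrow>\<^sub>0 int) set"
  where "cs c = N #>\<^bsub>Fr\<^esub> c"

lemma Fr_simps [simp]: "c \<in> carrier Fr \<longleftrightarrow> Poly_Mapping.keys c \<subseteq> X3" "c \<otimes>\<^bsub>Fr\<^esub> d = c + d" "\<one>\<^bsub>Fr\<^esub> = 0"
  by (simp_all add: tensor_free_def)

lemma Fr_group: "group Fr" "comm_group Fr"
  by (simp_all add: tensor_free_def abelian_free_Abelian_group)

lemma rels_closed: "tensor_rels A E \<phi> M \<subseteq> carrier Fr"
proof -
  have d: "c - d \<in> carrier Fr" if "c \<in> carrier Fr" "d \<in> carrier Fr" for c d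
    using that keys_diff[of c d] by auto
  have f: "frag_of (x, m, y) \<in> carrier Fr" if "x \<in> carrier A" "m \<in> carrier M" "y \<in> carrier A" for x m y
    using that by simp
  show ?thesis unfolding tensor_rels_def
    by (rule subsetI, elim UnE CollectE exE conjE)
      (hypsubst, intro d f A.a_closed A.m_closed M.m_closed phi_closed lact_closed ract_closed; assumption)+
qed

lemma N_subgroup: "subgroup N Fr"
  unfolding tensor_null_def by (rule group.generate_is_subgroup[OF Fr_group(1) rels_closed])

lemma N_normal: "N \<lhd> Fr"
  using comm_group.normal_iff_subgroup[OF Fr_group(2)] N_subgroup by blast

lemma inv_Fr: "Poly_Mapping.keys c \<subseteq> X3 \<Longrightarrow> inv\<^bsub>Fr\<^esub> c = - c"
  by (simp add: tensor_free_def)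

lemma N_closed: "c \<in> N \<Longrightarrow> Poly_Mapping.keys c \<subseteq> X3" "0 \<in> N" "c \<in> N \<Longrightarrow> d \<in> N \<Longrightarrow> c + d \<in> N" "c \<in> N \<Longrightarrow> - c \<in> N"
  "c \<in> N \<Longrightarrow> d \<in> N \<Longrightarrow> c - d \<in> N"
proof -
  show k: "c \<in> N \<Longrightarrow> Poly_Mapping.keys c \<subseteq> X3" for c using subsetD[OF subgroup.subset[OF N_subgroup], of c] by simp
  show "0 \<in> N" using subgroup.one_closed[OF N_subgroup] by simp
  show p: "c \<in> N \<Longrightarrow> d \<in> N \<Longrightarrow> c + d \<in> N" for c d using subgroup.m_closed[OF N_subgroup] by simp
  show m: "c \<in> N \<Longrightarrow> - c \<in> N" for c using subgroup.m_inv_closed[OF N_subgroup, of c] inv_Fr[OF k] by simp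
  show "c \<in> N \<Longrightarrow> d \<in> N \<Longrightarrow> c - d \<in> N" using p[of c "- d"] m by simp
qed

lemma cs_conv: "cs c = (\<lambda>n. n + c) ` N"
  unfolding cs_def r_coset_def by auto

lemma cs_eq_iff: "cs c = cs d \<longleftrightarrow> c - d \<in> N"
proof
  assume "cs c = cs d"
  moreover have "c \<in> cs c" unfolding cs_conv using N_closed(2) by force
  ultimately show "c - d \<in> N" unfolding cs_conv by auto
next
  assume cd: "c - d \<in> N"
  have "cs c \<subseteq> cs d" if "c - d \<in> N" for c d
  proof
    fix x assume "x \<in> cs c"
    then obtain n where "n \<in> N" "x = n + c" unfolding cs_conv by blast
    then show "x \<in> cs d" unfolding cs_conv using N_closed(3)[OF _ that, of n] by (intro image_eqI[of _ _ "n + (c - d)"]) auto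
  qed
  then show "cs c = cs d" using cd N_closed(4)[OF cd] by (metis minus_diff_eq subset_antisym)
qed

lemma T_carrier: "carrier T = cs ` carrier Fr"
  by (auto simp: tensor_def Let_def FactGroup_def RCOSETS_def cs_def)

lemma T_one: "\<one>\<^bsub>T\<^esub> = cs 0"
  unfolding cs_conv by (simp add: tensor_def Let_def FactGroup_def)

lemma T_mult: "cs c \<otimes>\<^bsub>T\<^esub> cs d = cs (c + d)"
proof -
  have "cs c \<otimes>\<^bsub>T\<^esub> cs d = (\<Union>x\<in>cs c. \<Union>y\<in>cs d. {x + y})"
    by (simp add: tensor_def Let_def FactGroup_def set_mult_def)
  also have "\<dots> = cs (c + d)"
  proof (intro equalityI subsetI)
    fix z assume "z \<in> (\<Union>x\<in>cs c. \<Union>y\<in>cs d. {x + y})"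
    then obtain n m where "n \<in> N" "m \<in> N" "z = (n + c) + (m + d)" unfolding cs_conv by blast
    then show "z \<in> cs (c + d)" unfolding cs_conv using N_closed(3)[of n m] by (intro image_eqI[of _ _ "n + m"]) (auto simp: algebra_simps)
  next
    fix z assume "z \<in> cs (c + d)"
    then obtain n where "n \<in> N" "z = n + (c + d)" unfolding cs_conv by blast
    then have "z = (n + c) + (0 + d)" "n + c \<in> cs c" "0 + d \<in> cs d" unfolding cs_conv using N_closed(2) by (auto simp: algebra_simps)
    then show "z \<in> (\<Union>x\<in>cs c. \<Union>y\<in>cs d. {x + y})" by blast
  qed
  finally show ?thesis .
qed

lemma Fr_closed: "0 \<in> carrier Fr" "c \<in> carrier Fr \<Longrightarrow> d \<in> carrier Fr \<Longrightarrow> c + d \<in> carrier Fr" "c \<in> carrier Fr \<Longrightarrow> - c \<in> carrier Fr"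
  using keys_add[of c d] by (auto simp: in_keys_iff)

lemma T_comm_group: "comm_group T"
proof (rule comm_groupI)
  fix x assume "x \<in> carrier T"
  then obtain c where c: "c \<in> carrier Fr" "x = cs c" unfolding T_carrier by blast
  have "cs (- c) \<in> carrier T" unfolding T_carrier using Fr_closed(3)[OF c(1)] by blast
  moreover have "cs (- c) \<otimes>\<^bsub>T\<^esub> x = \<one>\<^bsub>T\<^esub>" by (simp add: c T_mult T_one)
  ultimately show "\<exists>y\<in>carrier T. y \<otimes>\<^bsub>T\<^esub> x = \<one>\<^bsub>T\<^esub>" by blast
qed (use Fr_closed in \<open>auto simp: T_carrier T_mult T_one add_ac simp del: Fr_simps(1)\<close>)

lemma T_inv: assumes "c \<in> carrier Fr" shows "inv\<^bsub>T\<^esub> cs c = cs (- c)"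
proof -
  interpret T: comm_group T by (rule T_comm_group)
  show ?thesis
    using assms Fr_closed(3)[OF assms] by (intro T.inv_equality) (auto simp: T_mult T_one T_carrier simp del: Fr_simps(1))
qed

lemma pure_conv: "t x m y = cs (frag_of (x, m, y))"
  by (simp add: pure_tensor_def cs_def)

lemma pure_closed: "x \<in> carrier A \<Longrightarrow> m \<in> carrier M \<Longrightarrow> y \<in> carrier A \<Longrightarrow> t x m y \<in> carrier T"
  unfolding pure_conv T_carrier by (intro imageI) simp

lemma N_rel: "c \<in> tensor_rels A E \<phi> M \<Longrightarrow> c \<in> N"
  unfolding tensor_null_def by (rule generate.incl)

lemma pure_add:
  "x \<in> carrier A \<Longrightarrow> x' \<in> carrier A \<Longrightarrow> m \<in> carrier M \<Longrightarrow> y \<in> carrier A \<Longrightarrow>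
    t (x \<oplus>\<^bsub>A\<^esub> x') m y = t x m y \<otimes>\<^bsub>T\<^esub> t x' m y"
  "x \<in> carrier A \<Longrightarrow> m \<in> carrier M \<Longrightarrow> m' \<in> carrier M \<Longrightarrow> y \<in> carrier A \<Longrightarrow>
    t x (m \<otimes>\<^bsub>M\<^esub> m') y = t x m y \<otimes>\<^bsub>T\<^esub> t x m' y"
  "x \<in> carrier A \<Longrightarrow> m \<in> carrier M \<Longrightarrow> y \<in> carrier A \<Longrightarrow> y' \<in> carrier A \<Longrightarrow>
    t x m (y \<oplus>\<^bsub>A\<^esub> y') = t x m y \<otimes>\<^bsub>T\<^esub> t x m y'"
  unfolding pure_conv T_mult cs_eq_iff diff_diff_eq[symmetric]
  by (rule N_rel, unfold tensor_rels_def, blast)+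

lemma pure_balanced:
  "x \<in> carrier A \<Longrightarrow> e \<in> E \<Longrightarrow> m \<in> carrier M \<Longrightarrow> y \<in> carrier A \<Longrightarrow> t (x \<otimes>\<^bsub>A\<^esub> \<phi> e) m y = t x (lact M e m) y"
  "x \<in> carrier A \<Longrightarrow> e \<in> E \<Longrightarrow> m \<in> carrier M \<Longrightarrow> y \<in> carrier A \<Longrightarrow> t x (ract M m e) y = t x m (\<phi> e \<otimes>\<^bsub>A\<^esub> y)"
  unfolding pure_conv cs_eq_iff
  by (rule N_rel, unfold tensor_rels_def, blast)+

lemma T_induct [consumes 1, case_names one pure mult inv]:
  assumes "z \<in> carrier T" "Pr \<one>\<^bsub>T\<^esub>"
    "\<And>x m y. x \<in> carrier A \<Longrightarrow> m \<in> carrier M \<Longrightarrow> y \<in> carrier A \<Longrightarrow> Pr (t x m y)"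
    "\<And>u v. u \<in> carrier T \<Longrightarrow> v \<in> carrier T \<Longrightarrow> Pr u \<Longrightarrow> Pr v \<Longrightarrow> Pr (u \<otimes>\<^bsub>T\<^esub> v)"
    "\<And>u. u \<in> carrier T \<Longrightarrow> Pr u \<Longrightarrow> Pr (inv\<^bsub>T\<^esub> u)"
  shows "Pr z"
proof -
  obtain c where c: "c \<in> carrier Fr" "z = cs c" using assms(1) unfolding T_carrier by blast
  have "Poly_Mapping.keys c \<subseteq> X3" using c by simp
  then have "c \<in> carrier Fr \<and> Pr (cs c)"
  proof (induction c rule: frag_induction)
    case zero
    then show ?case using assms(2) Fr_closed(1) by (simp add: T_one)
  next
    case (one x)
    obtain a m b where x: "x = (a, m, b)" by (cases x)
    then show ?case using one assms(3)[of a m b] by (simp add: pure_conv)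
  next
    case (diff a b)
    have "cs (a - b) = cs a \<otimes>\<^bsub>T\<^esub> inv\<^bsub>T\<^esub> cs b" using diff by (simp add: T_inv T_mult del: Fr_simps(1))
    moreover have "cs (- b) \<in> carrier T" "cs a \<in> carrier T" "cs b \<in> carrier T"
      unfolding T_carrier using diff Fr_closed(3) by blast+
    moreover have "a - b \<in> carrier Fr" using diff Fr_closed(2)[of a "- b"] Fr_closed(3)[of b] by simp
    ultimately show ?case using diff assms(4)[of "cs a" "inv\<^bsub>T\<^esub> cs b"] assms(5)[of "cs b"] by (simp add: T_inv del: Fr_simps(1))
  qed
  then show ?thesis using c by simp
qed

lemma T_universal:
  assumes G: "comm_group G"
    and f: "\<And>x m y. x \<in> carrier A \<Longrightarrow> m \<in> carrier M \<Longrightarrow> y \<in> carrier A \<Longrightarrow> f x m y \<in> carrier G"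
    and add1: "\<And>x x' m y. x \<in> carrier A \<Longrightarrow> x' \<in> carrier A \<Longrightarrow> m \<in> carrier M \<Longrightarrow> y \<in> carrier A \<Longrightarrow>
      f (x \<oplus>\<^bsub>A\<^esub> x') m y = f x m y \<otimes>\<^bsub>G\<^esub> f x' m y"
    and add2: "\<And>x m m' y. x \<in> carrier A \<Longrightarrow> m \<in> carrier M \<Longrightarrow> m' \<in> carrier M \<Longrightarrow> y \<in> carrier A \<Longrightarrow>
      f x (m \<otimes>\<^bsub>M\<^esub> m') y = f x m y \<otimes>\<^bsub>G\<^esub> f x m' y"
    and add3: "\<And>x m y y'. x \<in> carrier A \<Longrightarrow> m \<in> carrier M \<Longrightarrow> y \<in> carrier A \<Longrightarrow> y' \<in> carrier A \<Longrightarrow>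
      f x m (y \<oplus>\<^bsub>A\<^esub> y') = f x m y \<otimes>\<^bsub>G\<^esub> f x m y'"
    and bal1: "\<And>x e m y. x \<in> carrier A \<Longrightarrow> e \<in> E \<Longrightarrow> m \<in> carrier M \<Longrightarrow> y \<in> carrier A \<Longrightarrow>
      f (x \<otimes>\<^bsub>A\<^esub> \<phi> e) m y = f x (lact M e m) y"
    and bal2: "\<And>x e m y. x \<in> carrier A \<Longrightarrow> e \<in> E \<Longrightarrow> m \<in> carrier M \<Longrightarrow> y \<in> carrier A \<Longrightarrow>
      f x (ract M m e) y = f x m (\<phi> e \<otimes>\<^bsub>A\<^esub> y)"
  obtains h where "h \<in> hom T G" "\<And>x m y. x \<in> carrier A \<Longrightarrow> m \<in> carrier M \<Longrightarrow> y \<in> carrier A \<Longrightarrow> h (t x m y) = f x m y"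
proof -
  interpret G: comm_group G by (rule G)
  have "(\<lambda>(x, m, y). f x m y) ` X3 \<subseteq> carrier G" using f by auto
  then obtain h where h: "h \<in> hom (free_Abelian_group X3) G" "\<And>z. z \<in> X3 \<Longrightarrow> h (frag_of z) = (\<lambda>(x, m, y). f x m y) z"
    using G.free_Abelian_group_universal by blast
  have hF: "h \<in> hom Fr G" using h(1) by (simp add: tensor_free_def)
  interpret h: group_hom Fr G h using hF Fr_group(1) by (simp add: group_hom_def group_hom_axioms_def)
  have hf: "h (frag_of (x, m, y)) = f x m y" if "x \<in> carrier A" "m \<in> carrier M" "y \<in> carrier A" for x m y
    using h(2)[of "(x, m, y)"] that by simp
  have hadd: "h (c + d) = h c \<otimes>\<^bsub>G\<^esub> h d" if "c \<in> carrier Fr" "d \<in> carrier Fr" for c d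
    using h.hom_mult[OF that] by simp
  have hdiff: "h (c - d) = h c \<otimes>\<^bsub>G\<^esub> inv\<^bsub>G\<^esub> h d" if "c \<in> carrier Fr" "d \<in> carrier Fr" for c d
    using hadd[OF that(1) Fr_closed(3)[OF that(2)]] h.hom_inv[OF that(2)] inv_Fr that(2) by simp
  have fr: "frag_of (x, m, y) \<in> carrier Fr" if "x \<in> carrier A" "m \<in> carrier M" "y \<in> carrier A" for x m y
    using that by simp
  have frd: "c - d \<in> carrier Fr" if "c \<in> carrier Fr" "d \<in> carrier Fr" for c d
    using Fr_closed(2)[OF that(1) Fr_closed(3)[OF that(2)]] by simp
  have cancel: "a \<otimes>\<^bsub>G\<^esub> b \<otimes>\<^bsub>G\<^esub> inv\<^bsub>G\<^esub> a \<otimes>\<^bsub>G\<^esub> inv\<^bsub>G\<^esub> b = \<one>\<^bsub>G\<^esub>" if "a \<in> carrier G" "b \<in> carrier G" for a b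
    using that by (metis G.inv_closed G.inv_solve_right' G.l_inv G.m_closed G.m_comm G.m_assoc G.r_inv G.r_one)
  have "tensor_rels A E \<phi> M \<subseteq> kernel Fr G h"
  proof
    fix c assume c: "c \<in> tensor_rels A E \<phi> M"
    then have "c \<in> carrier Fr" using rels_closed by blast
    moreover have "h c = \<one>\<^bsub>G\<^esub>"
      using c unfolding tensor_rels_def
      by (elim UnE CollectE exE conjE)
        (simp_all add: hdiff fr frd hf f add1 add2 add3 bal1 bal2 cancel phi_closed lact_closed ract_closed del: Fr_simps(1))
    ultimately show "c \<in> kernel Fr G h" by (simp add: kernel_def del: Fr_simps(1))
  qed
  then have "N \<subseteq> kernel Fr G h"
    unfolding tensor_null_def by (rule group.generate_subgroup_incl[OF Fr_group(1) _ h.subgroup_kernel])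
  then obtain k where k: "k \<in> hom (Fr Mod N) G" "\<And>x. x \<in> carrier Fr \<Longrightarrow> k (N #>\<^bsub>Fr\<^esub> x) = h x"
    using h.FactGroup_universal_kernel[OF N_normal] by blast
  have "k \<in> hom T G" using k(1) by (simp add: hom_def tensor_def Let_def)
  moreover have "k (t x m y) = f x m y" if "x \<in> carrier A" "m \<in> carrier M" "y \<in> carrier A" for x m y
    using k(2)[OF fr[OF that]] hf[OF that] by (simp add: pure_tensor_def)
  ultimately show ?thesis using that by blast
qed

lemma act_null:
  assumes g: "\<And>x m y. x \<in> carrier A \<Longrightarrow> m \<in> carrier M \<Longrightarrow> y \<in> carrier A \<Longrightarrow> g (x, m, y) \<in> carrier Fr"
    and rel: "\<And>c. c \<in> tensor_rels A E \<phi> M \<Longrightarrow> frag_extend g c \<in> N" and c: "c \<in> N"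
  shows "frag_extend g c \<in> N"
  using c unfolding tensor_null_def
proof (induction c rule: generate.induct)
  case one
  then show ?case using N_closed(2) by (simp add: tensor_null_def)
next
  case (incl c)
  then show ?case using rel by (simp add: tensor_null_def)
next
  case (inv c)
  have "Poly_Mapping.keys c \<subseteq> X3" using subsetD[OF rels_closed inv] by simp
  then show ?case using rel[OF inv] N_closed(4) by (simp add: inv_Fr frag_extend_minus tensor_null_def)
next
  case (eng c d)
  then show ?case using N_closed(3) by (simp add: frag_extend_add tensor_null_def)
qed

text \<open>The actions are defined as unions over representatives. Such a union is a single coset
  because the map on the free group preserves the relations.\<close>

lemma act_coset:
  assumes g: "\<And>x m y. x \<in> carrier A \<Longrightarrow> m \<in> carrier M \<Longrightarrow> y \<in> carrier A \<Longrightarrow> g (x, m, y) \<in> carrier Fr"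
    and rel: "\<And>c. c \<in> tensor_rels A E \<phi> M \<Longrightarrow> frag_extend g c \<in> N"
  shows "(\<Union>c'\<in>cs c. N #>\<^bsub>Fr\<^esub> frag_extend g c') = cs (frag_extend g c)"
proof -
  have "cs (frag_extend g c') = cs (frag_extend g c)" if c': "c' \<in> cs c" for c'
  proof -
    obtain n where "n \<in> N" "c' = n + c" using c' unfolding cs_conv by blast
    then show ?thesis using act_null[OF g rel, of n] by (simp add: cs_eq_iff frag_extend_add)
  qed
  moreover have "c \<in> cs c" unfolding cs_conv using N_closed(2) by force
  ultimately show ?thesis unfolding cs_def[symmetric] by blast
qed

lemma lact_rel:
  assumes "a \<in> carrier A" "c \<in> tensor_rels A E \<phi> M"
  shows "frag_extend (\<lambda>(x, m, y). frag_of (a \<otimes>\<^bsub>A\<^esub> x, m, y)) c \<in> N"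
  using assms(2) unfolding tensor_rels_def
  by (elim UnE CollectE exE conjE)
    (simp add: frag_extend_diff A.r_distr assms(1) A.m_assoc[symmetric] phi_closed, rule N_rel,
     unfold tensor_rels_def, use assms(1) A.m_closed in blast)+

lemma ract_rel:
  assumes "a \<in> carrier A" "c \<in> tensor_rels A E \<phi> M"
  shows "frag_extend (\<lambda>(x, m, y). frag_of (x, m, y \<otimes>\<^bsub>A\<^esub> a)) c \<in> N"
  using assms(2) unfolding tensor_rels_def
  by (elim UnE CollectE exE conjE)
    (simp add: frag_extend_diff A.l_distr assms(1) A.m_assoc phi_closed, rule N_rel,
     unfold tensor_rels_def, use assms(1) A.m_closed in blast)+

lemma lact_cs: assumes "a \<in> carrier A" shows "lact T a (cs c) = cs (frag_extend (\<lambda>(x, m, y). frag_of (a \<otimes>\<^bsub>A\<^esub> x, m, y)) c)"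
proof -
  have "lact T a (cs c) = (\<Union>c'\<in>cs c. N #>\<^bsub>Fr\<^esub> frag_extend (\<lambda>(x, m, y). frag_of (a \<otimes>\<^bsub>A\<^esub> x, m, y)) c')"
    by (simp add: tensor_def Let_def)
  also have "\<dots> = cs (frag_extend (\<lambda>(x, m, y). frag_of (a \<otimes>\<^bsub>A\<^esub> x, m, y)) c)"
    by (rule act_coset) (use assms lact_rel in auto)
  finally show ?thesis .
qed

lemma ract_cs: assumes "a \<in> carrier A" shows "ract T (cs c) a = cs (frag_extend (\<lambda>(x, m, y). frag_of (x, m, y \<otimes>\<^bsub>A\<^esub> a)) c)"
proof -
  have "ract T (cs c) a = (\<Union>c'\<in>cs c. N #>\<^bsub>Fr\<^esub> frag_extend (\<lambda>(x, m, y). frag_of (x, m, y \<otimes>\<^bsub>A\<^esub> a)) c')"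
    by (simp add: tensor_def Let_def)
  also have "\<dots> = cs (frag_extend (\<lambda>(x, m, y). frag_of (x, m, y \<otimes>\<^bsub>A\<^esub> a)) c)"
    by (rule act_coset) (use assms ract_rel in auto)
  finally show ?thesis .
qed

lemma act_pure:
  "a \<in> carrier A \<Longrightarrow> lact T a (t x m y) = t (a \<otimes>\<^bsub>A\<^esub> x) m y"
  "a \<in> carrier A \<Longrightarrow> ract T (t x m y) a = t x m (y \<otimes>\<^bsub>A\<^esub> a)"
  by (simp_all add: pure_conv lact_cs ract_cs)

lemma lact_hom: assumes "a \<in> carrier A" shows "lact T a \<in> hom T T"
proof (rule homI)
  fix u v assume "u \<in> carrier T" "v \<in> carrier T"
  then obtain c d where "u = cs c" "v = cs d" unfolding T_carrier by blast
  then show "lact T a (u \<otimes>\<^bsub>T\<^esub> v) = lact T a u \<otimes>\<^bsub>T\<^esub> lact T a v"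
    using assms by (simp add: T_mult lact_cs frag_extend_add)
next
  fix u assume "u \<in> carrier T"
  then obtain c where c: "u = cs c" "Poly_Mapping.keys c \<subseteq> X3" unfolding T_carrier by auto
  have "frag_extend (\<lambda>(x, m, y). frag_of (a \<otimes>\<^bsub>A\<^esub> x, m, y)) c \<in> carrier Fr" using c(2)
    by (induction c rule: frag_induction) (use assms Fr_closed in \<open>auto simp: frag_extend_diff dest!: subsetD[OF keys_diff]\<close>)
  then show "lact T a u \<in> carrier T" unfolding c(1) lact_cs[OF assms] T_carrier by blast
qed

lemma ract_hom: assumes "a \<in> carrier A" shows "(\<lambda>u. ract T u a) \<in> hom T T"
proof (rule homI)
  fix u v assume "u \<in> carrier T" "v \<in> carrier T"
  then obtain c d where "u = cs c" "v = cs d" unfolding T_carrier by blast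
  then show "ract T (u \<otimes>\<^bsub>T\<^esub> v) a = ract T u a \<otimes>\<^bsub>T\<^esub> ract T v a"
    using assms by (simp add: T_mult ract_cs frag_extend_add)
next
  fix u assume "u \<in> carrier T"
  then obtain c where c: "u = cs c" "Poly_Mapping.keys c \<subseteq> X3" unfolding T_carrier by auto
  have "frag_extend (\<lambda>(x, m, y). frag_of (x, m, y \<otimes>\<^bsub>A\<^esub> a)) c \<in> carrier Fr" using c(2)
    by (induction c rule: frag_induction) (use assms Fr_closed in \<open>auto simp: frag_extend_diff dest!: subsetD[OF keys_diff]\<close>)
  then show "ract T u a \<in> carrier T" unfolding c(1) ract_cs[OF assms] T_carrier by blast
qed

lemma hom_ext:
  assumes "group G" "h \<in> hom T G" "k \<in> hom T G"
    "\<And>x m y. x \<in> carrier A \<Longrightarrow> m \<in> carrier M \<Longrightarrow> y \<in> carrier A \<Longrightarrow> h (t x m y) = k (t x m y)" "z \<in> carrier T"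
  shows "h z = k z"
proof -
  interpret h: group_hom T G h
    using assms(1,2) comm_group.axioms(2)[OF T_comm_group] by (simp add: group_hom_def group_hom_axioms_def)
  interpret k: group_hom T G k
    using assms(1,3) comm_group.axioms(2)[OF T_comm_group] by (simp add: group_hom_def group_hom_axioms_def)
  show ?thesis using assms(5)
    by (induction z rule: T_induct) (simp_all add: assms(4))
qed

end

context rsys
begin

section \<open>The bimodules in coordinates\<close>

abbreviation "AA \<equiv> path_algebra Q Quot I"
abbreviation "pr \<equiv> proj Q I"
abbreviation E0 :: "('v, 'e, 'k) lincomb set" where "E0 \<equiv> path_span (paths_len Q 0)"
abbreviation "Mn n \<equiv> span_bimod Q (A n) :: (('v, 'e, 'k) lincomb, ('v, 'e, 'k) lincomb) bimod"
abbreviation "TT n \<equiv> tensor AA E0 pr (Mn n)"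
abbreviation "tt n \<equiv> pure_tensor AA E0 pr (Mn n)"

lemma resbimod_eq: "resbimod Q I R (int n - 1) = TT n" "resbimod Q I R (int n) = TT (Suc n)"
  "tens Q I R (int n - 1) = tt n" "tens Q I R (int n) = tt (Suc n)"
  by (simp_all add: resbimod_def tens_def A_def)

lemma AA_facts:
  shows ring_AA: "ring AA"
    and carrier_AA: "carrier AA = pr ` path_span P"
    and pr_mult: "x \<in> path_span P \<Longrightarrow> y \<in> path_span P \<Longrightarrow> pr x \<otimes>\<^bsub>AA\<^esub> pr y = pr (pmult Q x y)"
    and pr_add: "x \<in> path_span P \<Longrightarrow> y \<in> path_span P \<Longrightarrow> pr x \<oplus>\<^bsub>AA\<^esub> pr y = pr (x + y)"
    and pr_one: "\<one>\<^bsub>AA\<^esub> = pr one_pa"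
    and pr_eq_iff: "x \<in> path_span P \<Longrightarrow> y \<in> path_span P \<Longrightarrow> pr x = pr y \<longleftrightarrow> nf x = nf y"
proof -
  interpret i: ideal I "path_algebra Q" by (rule ideal_I)
  show "ring AA" by (rule i.quotient_is_ring)
  show "carrier AA = pr ` path_span P" by (auto simp: FactRing_def A_RCOSETS_def' proj_def)
  show "x \<in> path_span P \<Longrightarrow> y \<in> path_span P \<Longrightarrow> pr x \<otimes>\<^bsub>AA\<^esub> pr y = pr (pmult Q x y)"
    using i.rcoset_mult_add[of x y] by (simp add: FactRing_def proj_def)
  show "x \<in> path_span P \<Longrightarrow> y \<in> path_span P \<Longrightarrow> pr x \<oplus>\<^bsub>AA\<^esub> pr y = pr (x + y)"
    using i.a_rcos_sum[of x y] by (simp add: FactRing_def proj_def)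
  show "\<one>\<^bsub>AA\<^esub> = pr one_pa" by (simp add: FactRing_def proj_def)
  have coset: "pr x = {h + x | h. h \<in> I}" for x
    by (auto simp: proj_def a_r_coset_def r_coset_def)
  have "pr x = pr y \<longleftrightarrow> x - y \<in> I" for x y
  proof
    assume "pr x = pr y"
    moreover have "0 + x \<in> pr x" unfolding coset using I_closed(3) by blast
    ultimately show "x - y \<in> I" unfolding coset by auto
  next
    have "pr x \<subseteq> pr y" if "x - y \<in> I" for x y
    proof
      fix z assume "z \<in> pr x"
      then obtain h where h: "h \<in> I" "z = h + x" unfolding coset by blast
      then have "z = (h + (x - y)) + y" by simp
      then show "z \<in> pr y" unfolding coset using I_closed(2)[OF h(1) that] by blast
    qed
    moreover assume "x - y \<in> I"
    moreover have "y - x \<in> I" using I_closed(4)[OF calculation(2)] by simp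
    ultimately show "pr x = pr y" by blast
  qed
  then show "x \<in> path_span P \<Longrightarrow> y \<in> path_span P \<Longrightarrow> pr x = pr y \<longleftrightarrow> nf x = nf y" using nf_eq_iff by simp
qed

lemma pr_closed: "x \<in> path_span P \<Longrightarrow> pr x \<in> carrier AA"
  by (simp add: carrier_AA)

lemma pr_nf: "x \<in> path_span P \<Longrightarrow> pr (nf x) = pr x"
  using pr_eq_iff[OF nf_span] nf_nf by blast

lemma E0_span: "e \<in> E0 \<Longrightarrow> e \<in> path_span P"
  by (auto simp: path_span_def paths_len_def)

lemma E0_single: "v \<in> verts Q \<Longrightarrow> Poly_Mapping.single (v, []) k \<in> E0"
  using vertex_path by (simp add: path_span_def paths_len_def)

lemma E0_induct [consumes 1, case_names zero single add]:
  assumes "e \<in> E0" "T 0" "\<And>v k. v \<in> verts Q \<Longrightarrow> T (Poly_Mapping.single (v, []) k)" "\<And>x y. T x \<Longrightarrow> T y \<Longrightarrow> T (x + y)"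
  shows "T e"
  using assms(1) unfolding path_span_def mem_Collect_eq
proof (induction e rule: keys_induct)
  case (single a c)
  then have "a = (fst a, [])" "fst a \<in> verts Q" using fst_in_verts by (auto simp: paths_len_def intro: prod_eqI)
  then show ?case using assms(3) by metis
qed (use assms in auto)

lemma keys_pmult:
  "Poly_Mapping.keys (pmult Q x y) \<subseteq> {pcomp a b | a b. a \<in> Poly_Mapping.keys x \<and> b \<in> Poly_Mapping.keys y \<and> jn a b}"
  unfolding pmult_def by (intro keys_sum_subset) (auto split: if_splits)

lemma E0_keys:
  assumes "e \<in> E0"
  shows "Poly_Mapping.keys (pmult Q x e) \<subseteq> Poly_Mapping.keys x" "Poly_Mapping.keys (pmult Q e x) \<subseteq> Poly_Mapping.keys x"
proof -
  have e: "snd b = []" if "b \<in> Poly_Mapping.keys e" for b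
    using assms that by (auto simp: path_span_def paths_len_def)
  have "pcomp a b = a" if "b \<in> Poly_Mapping.keys e" for a b using e[OF that] by (simp add: pcomp_def)
  then show "Poly_Mapping.keys (pmult Q x e) \<subseteq> Poly_Mapping.keys x" using keys_pmult[of x e] by fastforce
  have "pcomp b a = a" if "b \<in> Poly_Mapping.keys e" "jn b a" for a b
    using e[OF that(1)] that(2) by (simp add: pcomp_def joinable_def ptgt_conv)
  then show "Poly_Mapping.keys (pmult Q e x) \<subseteq> Poly_Mapping.keys x" using keys_pmult[of e x] by fastforce
qed

lemma keys_vertex:
  "Poly_Mapping.keys (pmult Q x (kpath (v, []))) \<subseteq> {a \<in> Poly_Mapping.keys x. ptgt Q a = v}"
  "Poly_Mapping.keys (pmult Q (kpath (v, [])) x) \<subseteq> {a \<in> Poly_Mapping.keys x. fst a = v}"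
  using keys_pmult[of x "kpath (v, [])"] keys_pmult[of "kpath (v, [])" x] by (auto simp: pcomp_def joinable_def ptgt_conv)

lemma span_bimod_group: "comm_group (Mn n)"
proof (rule comm_groupI)
  fix x assume "x \<in> carrier (Mn n)"
  then show "\<exists>y\<in>carrier (Mn n). y \<otimes>\<^bsub>Mn n\<^esub> x = \<one>\<^bsub>Mn n\<^esub>"
    by (intro bexI[of _ "- x"]) (auto simp: span_bimod_def path_span_closed)
qed (auto simp: span_bimod_def path_span_closed add_ac)

lemma td: "tensor_data AA (Mn n) E0 pr"
proof (intro tensor_data.intro tensor_data_axioms.intro ring_AA span_bimod_group)
  fix e m assume *: "e \<in> E0" "m \<in> carrier (Mn n)"
  then show "lact (Mn n) e m \<in> carrier (Mn n)" "ract (Mn n) m e \<in> carrier (Mn n)"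
    using E0_keys[OF *(1), of m] by (auto simp: span_bimod_def path_span_def)
qed (simp add: pr_closed E0_span)

interpretation td: tensor_data AA "Mn n" E0 pr for n
  by (rule td)

text \<open>The additive group of coordinates as a monoid record, the target for the universal
  property.\<close>

definition FF :: "(('v, 'e) triple \<Rightarrow>\<^sub>0 'k) monoid"
  where "FF = \<lparr>carrier = UNIV, monoid.mult = (+), one = 0\<rparr>"

lemma FF_group: "comm_group FF"
proof (rule comm_groupI)
  fix x :: "('v, 'e) triple \<Rightarrow>\<^sub>0 'k"
  show "\<exists>y\<in>carrier FF. y \<otimes>\<^bsub>FF\<^esub> x = \<one>\<^bsub>FF\<^esub>" by (intro bexI[of _ "- x"]) (auto simp: FF_def)
qed (auto simp: FF_def add_ac)

text \<open>The normal form depends only on the class, so the choice of a representative is harmless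
  (\<open>nfc_pr\<close>).\<close>

definition nfc :: "('v, 'e, 'k) lincomb set \<Rightarrow> ('v, 'e, 'k) lincomb"
  where "nfc C = nf (SOME x. x \<in> path_span P \<and> pr x = C)"

lemma nfc_pr: assumes "x \<in> path_span P" shows "nfc (pr x) = nf x"
proof -
  have "(SOME y. y \<in> path_span P \<and> pr y = pr x) \<in> path_span P \<and> pr (SOME y. y \<in> path_span P \<and> pr y = pr x) = pr x"
    by (rule someI[of _ x]) (use assms in simp)
  then show ?thesis unfolding nfc_def using pr_eq_iff[OF _ assms] by blast
qed

text \<open>Coordinates of \<open>1 \<otimes> p \<otimes> 1\<close>: balance over E replaces the two
  units by the end vertices of p.\<close>

definition id3 :: "('v, 'e) path \<Rightarrow> ('v, 'e) triple"
  where "id3 p = ((fst p, []), p, (ptgt Q p, []))"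

definition emb :: "('v, 'e, 'k) lincomb \<Rightarrow> (('v, 'e) triple \<Rightarrow>\<^sub>0 'k)"
  where "emb = lin (\<lambda>p. ee (id3 p))"

lemma emb_linear: "emb (x + y) = emb x + emb y" "emb 0 = 0" "emb (scl k x) = scl k (emb x)"
  by (simp_all add: emb_def lin_add lin_scl)

lemma emb_single: "emb (Poly_Mapping.single p l) = Poly_Mapping.single (id3 p) l"
  by (simp add: emb_def)

lemma bact_id3: "bact Q u v (Poly_Mapping.single (id3 p) l) = scl l (tri (pmult Q u (kpath (fst p, []))) p (pmult Q (kpath (ptgt Q p, [])) v))"
  by (simp add: bact_def id3_def)

lemma emb_act:
  assumes "e \<in> E0" "m \<in> path_span (A n)"
  shows "emb (pmult Q e m) = bact Q e one_pa (emb m)" "emb (pmult Q m e) = bact Q one_pa e (emb m)"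
proof -
  have "emb (pmult Q e m) = bact Q e one_pa (emb m) \<and> emb (pmult Q m e) = bact Q one_pa e (emb m)"
    using assms(2) unfolding path_span_def mem_Collect_eq
  proof (induction m rule: keys_induct)
    case (single p l)
    have p: "p \<in> P" using single A_paths by blast
    have pt: "ptgt Q (x, []) = x" for x by (simp add: ptgt_conv)
    have o: "pmult Q (kpath (ptgt Q p, [])) one_pa = (kpath (ptgt Q p, []) :: ('v, 'e, 'k) lincomb)" "pmult Q one_pa (kpath (fst p, [])) = (kpath (fst p, []) :: ('v, 'e, 'k) lincomb)"
      using pmult_one[OF kpath_span[OF vertex_path[OF ptgt_in_verts[OF p]]]] pmult_one[OF kpath_span[OF vertex_path[OF fst_in_verts[OF p]]]] by simp_all
    show ?case using assms(1)
    proof (induction e rule: E0_induct)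
      case (single v k)
      then show ?case
        by (auto simp: pmult_single emb_single bact_id3[unfolded id3_def] o tri_single tri_linear emb_linear joinable_def pt id3_def mult.commute)
    qed (auto simp: pmult_add_left pmult_add_right emb_linear bact_args)
  qed (auto simp: pmult_add_left pmult_add_right emb_linear bact_linear)
  then show "emb (pmult Q e m) = bact Q e one_pa (emb m)" "emb (pmult Q m e) = bact Q one_pa e (emb m)" by auto
qed

lemma nf_vertex:
  assumes "u \<in> path_span P" "e \<in> E0"
  shows "nf (pmult Q u e) = pmult Q (nf u) e" "nf (pmult Q e u) = pmult Q e (nf u)"
proof -
  have "Poly_Mapping.keys (pmult Q (nf u) e) \<subseteq> irrp" "Poly_Mapping.keys (pmult Q e (nf u)) \<subseteq> irrp"
    using E0_keys[OF assms(2)] nf_keys[OF assms(1)] by blast+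
  then show "nf (pmult Q u e) = pmult Q (nf u) e" "nf (pmult Q e u) = pmult Q e (nf u)"
    using pmult_nf(1)[OF assms(1) E0_span[OF assms(2)]] pmult_nf(2)[OF E0_span[OF assms(2)] assms(1)] nf_fixed by simp_all
qed

text \<open>Normal forms depend additively on classes and commute with multiplication by elements of
  E. The latter is balance in coordinates.\<close>

lemma Phi_exists:
  "\<exists>h. h \<in> hom (TT n) FF \<and> (\<forall>u\<in>path_span P. \<forall>m\<in>path_span (A n). \<forall>v\<in>path_span P.
    h (tt n (pr u) m (pr v)) = bact Q (nf u) (nf v) (emb m))"
proof -
  have cM: "carrier (Mn n) = path_span (A n)" by (simp add: span_bimod_def)
  obtain h where h: "h \<in> hom (TT n) FF" "\<And>x m y. x \<in> carrier AA \<Longrightarrow> m \<in> carrier (Mn n) \<Longrightarrow> y \<in> carrier AA \<Longrightarrow>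
    h (tt n x m y) = bact Q (nfc x) (nfc y) (emb m)"
  proof (rule td.T_universal[OF FF_group, where f = "\<lambda>x m y. bact Q (nfc x) (nfc y) (emb m)" and n = n])
    fix x e m y assume *: "x \<in> carrier AA" "e \<in> E0" "m \<in> carrier (Mn n)" "y \<in> carrier AA"
    then obtain u v where u: "u \<in> path_span P" "x = pr u" and v: "v \<in> path_span P" "y = pr v" by (auto simp: carrier_AA)
    have e: "e \<in> path_span P" using E0_span[OF *(2)] .
    have m: "m \<in> path_span (A n)" using *(3) cM by simp
    have nn: "nf u \<in> path_span P" "nf v \<in> path_span P" using u v nf_span by auto
    show "bact Q (nfc (x \<otimes>\<^bsub>AA\<^esub> pr e)) (nfc y) (emb m) = bact Q (nfc x) (nfc y) (emb (lact (Mn n) e m))"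
      using u v e nn by (simp add: pr_mult nfc_pr pmult_closed[OF wf_digraph_axioms] nf_vertex[OF u(1) *(2)] span_bimod_def
        emb_act[OF *(2) m] bact_bact pmult_one)
    show "bact Q (nfc x) (nfc y) (emb (ract (Mn n) m e)) = bact Q (nfc x) (nfc (pr e \<otimes>\<^bsub>AA\<^esub> y)) (emb m)"
      using u v e nn by (simp add: pr_mult nfc_pr pmult_closed[OF wf_digraph_axioms] nf_vertex[OF v(1) *(2)] span_bimod_def
        emb_act[OF *(2) m] bact_bact pmult_one)
  qed (auto simp: carrier_AA pr_add nfc_pr path_span_closed nf_linear bact_args FF_def span_bimod_def emb_linear bact_linear)
  have "h (tt n (pr u) m (pr v)) = bact Q (nf u) (nf v) (emb m)"
    if "u \<in> path_span P" "m \<in> path_span (A n)" "v \<in> path_span P" for u m v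
    using h(2)[of "pr u" m "pr v"] that by (simp add: cM pr_closed nfc_pr)
  then show ?thesis using h(1) by blast
qed

section \<open>The correspondence between tensors and normalized triples\<close>

definition Phi :: "nat \<Rightarrow> _ \<Rightarrow> (('v, 'e) triple \<Rightarrow>\<^sub>0 'k)"
  where "Phi n = (SOME h. h \<in> hom (TT n) FF \<and> (\<forall>u\<in>path_span P. \<forall>m\<in>path_span (A n). \<forall>v\<in>path_span P.
    h (tt n (pr u) m (pr v)) = bact Q (nf u) (nf v) (emb m)))"

lemma Phi_hom: "Phi n \<in> hom (TT n) FF"
  and Phi_pure: "u \<in> path_span P \<Longrightarrow> m \<in> path_span (A n) \<Longrightarrow> v \<in> path_span P \<Longrightarrow>
    Phi n (tt n (pr u) m (pr v)) = bact Q (nf u) (nf v) (emb m)"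
  using someI_ex[OF Phi_exists[of n]] unfolding Phi_def by blast+

lemma Phi_mult: "x \<in> carrier (TT n) \<Longrightarrow> y \<in> carrier (TT n) \<Longrightarrow> Phi n (x \<otimes>\<^bsub>TT n\<^esub> y) = Phi n x + Phi n y"
  using hom_mult[OF Phi_hom] by (simp add: FF_def)

lemma Phi_one: "Phi n \<one>\<^bsub>TT n\<^esub> = 0"
  using hom_one[OF Phi_hom comm_group.axioms(2)[OF td.T_comm_group] comm_group.axioms(2)[OF FF_group]] by (simp add: FF_def)

lemma Phi_inv: assumes "x \<in> carrier (TT n)" shows "Phi n (inv\<^bsub>TT n\<^esub> x) = - Phi n x"
proof -
  interpret G: comm_group "TT n" by (rule td.T_comm_group)
  have "Phi n (inv\<^bsub>TT n\<^esub> x) + Phi n x = 0"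
    using Phi_mult[of "inv\<^bsub>TT n\<^esub> x" n x] assms Phi_one[of n] by simp
  then show ?thesis by (simp add: eq_neg_iff_add_eq_0)
qed

lemma T_gen_induct [consumes 1, case_names one pure mult inv]:
  assumes "z \<in> carrier (TT n)" "Pr \<one>\<^bsub>TT n\<^esub>"
    "\<And>u m v. u \<in> path_span P \<Longrightarrow> m \<in> path_span (A n) \<Longrightarrow> v \<in> path_span P \<Longrightarrow> Pr (tt n (pr u) m (pr v))"
    "\<And>u v. u \<in> carrier (TT n) \<Longrightarrow> v \<in> carrier (TT n) \<Longrightarrow> Pr u \<Longrightarrow> Pr v \<Longrightarrow> Pr (u \<otimes>\<^bsub>TT n\<^esub> v)"
    "\<And>u. u \<in> carrier (TT n) \<Longrightarrow> Pr u \<Longrightarrow> Pr (inv\<^bsub>TT n\<^esub> u)"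
  shows "Pr z"
  using assms(1)
proof (induction z rule: td.T_induct)
  case (pure x m y)
  then show ?case using assms(3) by (auto simp: carrier_AA span_bimod_def)
qed (use assms in auto)

lemma keys_tri: "Poly_Mapping.keys (tri x p y) \<subseteq> {(a, p', c). a \<in> Poly_Mapping.keys x \<and> p' = p \<and> c \<in> Poly_Mapping.keys y}"
  unfolding tri_expand by (intro keys_sum_subset) (auto split: if_splits)

lemma Phi_keys: assumes "z \<in> carrier (TT n)" shows "Poly_Mapping.keys (Phi n z) \<subseteq> TrN n"
  using assms
proof (induction z rule: T_gen_induct)
  case (pure u m v)
  have *: "Poly_Mapping.keys (bact Q u' v' (emb m)) \<subseteq> TrN n" if uv: "Poly_Mapping.keys u' \<subseteq> irrp" "Poly_Mapping.keys v' \<subseteq> irrp" for u' v'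
    using pure(2) unfolding path_span_def mem_Collect_eq
  proof (induction m rule: keys_induct)
    case (single p l)
    have k1: "Poly_Mapping.keys (pmult Q u' (kpath (fst p, []))) \<subseteq> {a \<in> irrp. jn a p}"
      using keys_vertex(1)[of u' "fst p"] uv(1) by (auto simp: joinable_def)
    have k2: "Poly_Mapping.keys (pmult Q (kpath (ptgt Q p, [])) v') \<subseteq> {c \<in> irrp. jn p c}"
      using keys_vertex(2)[of "ptgt Q p" v'] uv(2) by (auto simp: joinable_def)
    have "Poly_Mapping.keys (tri (pmult Q u' (kpath (fst p, []))) p (pmult Q (kpath (ptgt Q p, [])) v')) \<subseteq> TrN n"
      using keys_tri[of "pmult Q u' (kpath (fst p, []))" p "pmult Q (kpath (ptgt Q p, [])) v'"] k1 k2 single irrpD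
      unfolding TrN_def Tr_def by fastforce
    then show ?case unfolding emb_single bact_id3 by (rule order_trans[OF keys_scl])
  next
    case (add x y)
    then show ?case using keys_add[of "bact Q u' v' (emb x)" "bact Q u' v' (emb y)"] by (auto simp: emb_linear bact_linear)
  qed (simp add: emb_linear bact_linear)
  show ?case unfolding Phi_pure[OF pure] by (intro * nf_keys pure)
next
  case (mult u v)
  then show ?case using keys_add[of "Phi n u" "Phi n v"] by (auto simp: Phi_mult)
next
  case (inv u)
  then show ?case by (simp add: Phi_inv in_keys_iff subset_iff)
qed (simp add: Phi_one)

text \<open>The scalar is placed in the left component, where the sets of lower terms in the theorem
  also have it.\<close>

definition psi :: "nat \<Rightarrow> ('v, 'e) triple \<Rightarrow> 'k \<Rightarrow> _"
  where "psi n t l = tt n (pr (Poly_Mapping.single (fst t) l)) (kpath (fst (snd t))) (pr (kpath (snd (snd t))))"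

definition Psi :: "nat \<Rightarrow> (('v, 'e) triple \<Rightarrow>\<^sub>0 'k) \<Rightarrow> _"
  where "Psi n x = finprod (TT n) (\<lambda>t. psi n t (Poly_Mapping.lookup x t)) (Poly_Mapping.keys x)"

lemma psi_closed: "t \<in> Tr n \<Longrightarrow> psi n t l \<in> carrier (TT n)"
  unfolding psi_def by (rule td.pure_closed) (auto simp: Tr_def pr_closed kpath_span span_bimod_def path_span_def)

lemma psi_add: "t \<in> Tr n \<Longrightarrow> psi n t (k + l) = psi n t k \<otimes>\<^bsub>TT n\<^esub> psi n t l"
proof -
  assume t: "t \<in> Tr n"
  have *: "pr (Poly_Mapping.single (fst t) (k + l)) = pr (Poly_Mapping.single (fst t) k) \<oplus>\<^bsub>AA\<^esub> pr (Poly_Mapping.single (fst t) l)"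
    using t by (subst pr_add) (auto simp: single_add Tr_def kpath_span)
  show ?thesis unfolding psi_def *
    by (rule td.pure_add(1)) (use t in \<open>auto simp: Tr_def pr_closed kpath_span span_bimod_def path_span_def\<close>)
qed

lemma psi_zero: assumes "t \<in> Tr n" shows "psi n t 0 = \<one>\<^bsub>TT n\<^esub>"
proof -
  interpret G: comm_group "TT n" by (rule td.T_comm_group)
  show ?thesis using psi_add[OF assms, of 0 0] psi_closed[OF assms, of 0] by simp
qed

lemma Psi_superset:
  assumes "finite Y" "Poly_Mapping.keys x \<subseteq> Y" "Y \<subseteq> Tr n"
  shows "Psi n x = finprod (TT n) (\<lambda>t. psi n t (Poly_Mapping.lookup x t)) Y"
proof -
  interpret G: comm_group "TT n" by (rule td.T_comm_group)
  show ?thesis unfolding Psi_def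
    by (rule G.finprod_mono_neutral_cong_left) (use assms psi_zero psi_closed in \<open>auto simp: in_keys_iff\<close>)
qed

lemma Psi_closed: assumes "Poly_Mapping.keys x \<subseteq> Tr n" shows "Psi n x \<in> carrier (TT n)"
proof -
  interpret G: comm_group "TT n" by (rule td.T_comm_group)
  show ?thesis unfolding Psi_def by (rule G.finprod_closed) (use assms psi_closed in auto)
qed

lemma Psi_add:
  assumes "Poly_Mapping.keys x \<subseteq> Tr n" "Poly_Mapping.keys y \<subseteq> Tr n"
  shows "Psi n (x + y) = Psi n x \<otimes>\<^bsub>TT n\<^esub> Psi n y"
proof -
  interpret G: comm_group "TT n" by (rule td.T_comm_group)
  let ?Y = "Poly_Mapping.keys x \<union> Poly_Mapping.keys y"
  have Y: "finite ?Y" "?Y \<subseteq> Tr n" "Poly_Mapping.keys (x + y) \<subseteq> ?Y" using assms keys_add[of x y] by auto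
  have "Psi n (x + y) = finprod (TT n) (\<lambda>t. psi n t (Poly_Mapping.lookup x t) \<otimes>\<^bsub>TT n\<^esub> psi n t (Poly_Mapping.lookup y t)) ?Y"
    unfolding Psi_superset[OF Y(1,3,2)] using Y psi_add psi_closed by (intro G.finprod_cong') (auto simp: lookup_add)
  also have "\<dots> = Psi n x \<otimes>\<^bsub>TT n\<^esub> Psi n y"
    using Psi_superset[OF Y(1) _ Y(2), of x] Psi_superset[OF Y(1) _ Y(2), of y] Y psi_closed
    by (subst G.finprod_multf) auto
  finally show ?thesis .
qed

lemma Psi_single: "t \<in> Tr n \<Longrightarrow> Psi n (Poly_Mapping.single t l) = psi n t l"
proof -
  interpret G: comm_group "TT n" by (rule td.T_comm_group)
  assume "t \<in> Tr n"
  then show ?thesis using Psi_superset[of "{t}" "Poly_Mapping.single t l" n] psi_closed by simp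
qed

lemma Psi_zero: "Psi n 0 = \<one>\<^bsub>TT n\<^esub>"
proof -
  interpret G: comm_group "TT n" by (rule td.T_comm_group)
  show ?thesis by (simp add: Psi_def)
qed

lemma Psi_minus: assumes "Poly_Mapping.keys x \<subseteq> Tr n" shows "Psi n (- x) = inv\<^bsub>TT n\<^esub> Psi n x"
proof -
  interpret G: comm_group "TT n" by (rule td.T_comm_group)
  have k: "Poly_Mapping.keys (- x) \<subseteq> Tr n" using assms by (auto simp: in_keys_iff)
  have "Psi n (- x) \<otimes>\<^bsub>TT n\<^esub> Psi n x = \<one>\<^bsub>TT n\<^esub>" using Psi_add[OF k assms] Psi_zero by simp
  then show ?thesis using Psi_closed[OF k] Psi_closed[OF assms] by (metis G.inv_equality)
qed

lemma tt_zero: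
  shows "m \<in> path_span (A n) \<Longrightarrow> v \<in> carrier AA \<Longrightarrow> tt n (pr 0) m v = \<one>\<^bsub>TT n\<^esub>"
    and "u \<in> carrier AA \<Longrightarrow> m \<in> path_span (A n) \<Longrightarrow> tt n u m (pr 0) = \<one>\<^bsub>TT n\<^esub>"
    and "u \<in> carrier AA \<Longrightarrow> v \<in> carrier AA \<Longrightarrow> tt n u 0 v = \<one>\<^bsub>TT n\<^esub>"
proof -
  interpret G: comm_group "TT n" by (rule td.T_comm_group)
  have z: "pr 0 \<in> carrier AA" "pr 0 \<oplus>\<^bsub>AA\<^esub> pr 0 = pr 0"
    using pr_closed[OF path_span_closed(1)] pr_add[OF path_span_closed(1) path_span_closed(1)] by simp_all
  have m0: "0 \<in> carrier (Mn n)" using path_span_closed(1) by (auto simp: span_bimod_def)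
  have mz: "0 \<otimes>\<^bsub>Mn n\<^esub> 0 = 0" by (simp add: span_bimod_def)
  have mm: "m \<in> path_span (A n) \<Longrightarrow> m \<in> carrier (Mn n)" by (simp add: span_bimod_def)
  note c = td.pure_closed[of _ _ n]
  show "tt n (pr 0) m v = \<one>\<^bsub>TT n\<^esub>" if m: "m \<in> path_span (A n)" and v: "v \<in> carrier AA"
    using td.pure_add(1)[OF z(1) z(1) mm[OF m] v] z c[OF z(1) mm[OF m] v] by simp
  show "tt n u m (pr 0) = \<one>\<^bsub>TT n\<^esub>" if u: "u \<in> carrier AA" and m: "m \<in> path_span (A n)"
    using td.pure_add(3)[OF u mm[OF m] z(1) z(1)] z c[OF u mm[OF m] z(1)] by simp
  show "tt n u 0 v = \<one>\<^bsub>TT n\<^esub>" if u: "u \<in> carrier AA" and v: "v \<in> carrier AA"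
    using td.pure_add(2)[OF u m0 m0 v] c[OF u m0 v] unfolding mz by simp
qed

text \<open>Scalars move across the tensor signs because \<open>E\<close> contains the multiples of the vertices.\<close>
lemma tt_scalar:
  assumes "u \<in> path_span P" "p \<in> A n" "v \<in> path_span P"
  shows "tt n (pr u) (Poly_Mapping.single p l) (pr v) = tt n (pr (pmult Q u (Poly_Mapping.single (fst p, []) l))) (kpath p) (pr v)"
    "tt n (pr u) (Poly_Mapping.single p l) (pr v) = tt n (pr u) (kpath p) (pr (pmult Q (Poly_Mapping.single (ptgt Q p, []) l) v))"
proof -
  have p: "p \<in> P" using assms A_paths by blast
  have e: "Poly_Mapping.single (fst p, []) l \<in> E0" "Poly_Mapping.single (ptgt Q p, []) l \<in> E0"
    using fst_in_verts[OF p] ptgt_in_verts[OF p] by (auto intro!: E0_single)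
  have m: "kpath p \<in> carrier (Mn n)" using assms by (simp add: span_bimod_def path_span_def)
  have "lact (Mn n) (Poly_Mapping.single (fst p, []) l) (kpath p) = Poly_Mapping.single p l"
    "ract (Mn n) (kpath p) (Poly_Mapping.single (ptgt Q p, []) l) = Poly_Mapping.single p l"
    by (simp_all add: span_bimod_def pmult_single)
  then show "tt n (pr u) (Poly_Mapping.single p l) (pr v) = tt n (pr (pmult Q u (Poly_Mapping.single (fst p, []) l))) (kpath p) (pr v)"
    "tt n (pr u) (Poly_Mapping.single p l) (pr v) = tt n (pr u) (kpath p) (pr (pmult Q (Poly_Mapping.single (ptgt Q p, []) l) v))"
    using td.pure_balanced(1)[OF pr_closed[OF assms(1)] e(1) m pr_closed[OF assms(3)]]
      td.pure_balanced(2)[OF pr_closed[OF assms(1)] e(2) m pr_closed[OF assms(3)]] assms e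
    by (simp_all add: pr_mult E0_span)
qed

lemma keys_tri_Tr:
  assumes "Poly_Mapping.keys u \<subseteq> {a \<in> P. jn a p}" "p \<in> A n" "Poly_Mapping.keys v \<subseteq> {c \<in> P. jn p c}"
  shows "Poly_Mapping.keys (tri u p v) \<subseteq> Tr n"
  using keys_tri[of u p v] assms unfolding Tr_def by fastforce

lemma Psi_tri:
  assumes "Poly_Mapping.keys u \<subseteq> {a \<in> P. jn a p}" "p \<in> A n" "Poly_Mapping.keys v \<subseteq> {c \<in> P. jn p c}"
  shows "Psi n (tri u p v) = tt n (pr u) (kpath p) (pr v)"
proof -
  have m: "kpath p \<in> carrier (Mn n)" "kpath p \<in> path_span (A n)" using assms(2) by (simp_all add: span_bimod_def path_span_def)
  have vP: "v \<in> path_span P" using assms(3) by (auto simp: path_span_def)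
  have "Poly_Mapping.keys u \<subseteq> {a \<in> P. jn a p} \<and> Psi n (tri u p v) = tt n (pr u) (kpath p) (pr v)"
    using assms(1)
  proof (induction u rule: keys_induct)
    case (single a k)
    have aP: "a \<in> P" "jn a p" using single by auto
    have "Poly_Mapping.keys v \<subseteq> {c \<in> P. jn p c} \<and> Psi n (tri (Poly_Mapping.single a k) p v) = tt n (pr (Poly_Mapping.single a k)) (kpath p) (pr v)"
      using assms(3)
    proof (induction v rule: keys_induct)
      case (single c l)
      then have c: "c \<in> P" "jn p c" by auto
      have t: "(a, p, c) \<in> Tr n" using aP c assms(2) by (simp add: Tr_def)
      have "pmult Q (Poly_Mapping.single a k) (Poly_Mapping.single (fst p, []) l) = Poly_Mapping.single a (k * l)"
        "pmult Q (Poly_Mapping.single (ptgt Q p, []) l) (kpath c) = Poly_Mapping.single c l"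
        using aP c by (auto simp: pmult_single joinable_def ptgt_conv)
      then show ?case
        using tt_scalar[OF kpath_span[OF aP(1), of k] assms(2) kpath_span[OF c(1), of 1], of l] c
        by (simp add: tri_single Psi_single[OF t] psi_def)
    next
      case (add x y)
      then have xy: "x \<in> path_span P" "y \<in> path_span P" by (auto simp: path_span_def)
      have k: "Poly_Mapping.keys (Poly_Mapping.single a k) \<subseteq> {a \<in> P. jn a p}" using aP by simp
      show ?case using add keys_add[of x y] aP xy m
        by (auto simp: tri_linear Psi_add keys_tri_Tr[OF k assms(2)] pr_add[symmetric] td.pure_add pr_closed kpath_span)
    qed (use aP m tt_zero(2)[OF pr_closed[OF kpath_span[OF aP(1)]] m(2)] in \<open>simp add: tri_linear Psi_zero\<close>)
    then show ?case using aP by simp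
  next
    case (add x y)
    then have xy: "x \<in> path_span P" "y \<in> path_span P" by (auto simp: path_span_def)
    show ?case using add keys_add[of x y] xy m vP
      by (auto simp: tri_linear Psi_add keys_tri_Tr[OF _ assms(2,3)] pr_add[symmetric] td.pure_add pr_closed)
  qed (use tt_zero(1)[OF m(2) pr_closed[OF vP]] in \<open>simp add: tri_linear Psi_zero\<close>)
  then show ?thesis by simp
qed

lemma keys_induct' [consumes 1, case_names zero single add]:
  assumes "Poly_Mapping.keys x \<subseteq> K" "T 0" "\<And>a c. a \<in> K \<Longrightarrow> T (Poly_Mapping.single a c)"
    "\<And>x y. Poly_Mapping.keys x \<subseteq> K \<Longrightarrow> Poly_Mapping.keys y \<subseteq> K \<Longrightarrow> T x \<Longrightarrow> T y \<Longrightarrow> T (x + y)"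
  shows "T (x :: 'a \<Rightarrow>\<^sub>0 'k)"
proof -
  have "Poly_Mapping.keys x \<subseteq> K \<and> T x"
    using assms(1)
  proof (induction x rule: keys_induct)
    case (add x y)
    then show ?case using assms(4) keys_add[of x y] by blast
  qed (use assms in auto)
  then show ?thesis by blast
qed

lemma one_span: "(one_pa :: ('v, 'e, 'k) lincomb) \<in> path_span P"
  using monoid.one_closed[OF ring.axioms(2)[OF ring_pa]] by simp

lemma rho_keys: "Poly_Mapping.keys x \<subseteq> Tr n \<Longrightarrow> Poly_Mapping.keys (rho x) \<subseteq> TrN n"
proof (induction x rule: keys_induct)
  case (single t l)
  then show ?case using Mle_keys[OF rho_gen(1)] by simp
next
  case (add x y)
  then show ?case using keys_add[of "rho x" "rho y"] by (auto simp: rho_linear)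
qed (simp add: rho_linear)

lemma TrN_sub: "TrN n \<subseteq> Tr n"
  by (auto simp: TrN_def)

text \<open>A tensor sees the outer paths only through their classes in A.\<close>

lemma Psi_rho: assumes "Poly_Mapping.keys x \<subseteq> Tr n" shows "Psi n (rho x) = Psi n x"
  using assms
proof (induction x rule: keys_induct')
  case (single t l)
  obtain a p c where t: "t = (a, p, c)" by (cases t)
  have h: "a \<in> P" "p \<in> A n" "c \<in> P" "jn a p" "jn p c" using single t by (auto simp: Tr_def)
  have "Poly_Mapping.keys (nf (Poly_Mapping.single a l)) \<subseteq> parset a" "Poly_Mapping.keys (nf (kpath c)) \<subseteq> parset c"
    by (intro nf_parset; use h in \<open>simp add: parset_def par_simps\<close>)+
  then have k: "Poly_Mapping.keys (nf (Poly_Mapping.single a l)) \<subseteq> {a \<in> P. jn a p}" "Poly_Mapping.keys (nf (kpath c)) \<subseteq> {c \<in> P. jn p c}"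
    using h(4,5) par_simps(1,2) unfolding parset_def by blast+
  have s: "Poly_Mapping.single t l = tri (Poly_Mapping.single a l) p (kpath c)" by (simp add: t tri_single)
  show ?case unfolding s rho_tri Psi_tri[OF k(1) h(2) k(2)] pr_nf[OF kpath_span[OF h(1)]] pr_nf[OF kpath_span[OF h(3)]]
    by (rule Psi_tri[symmetric]) (use h in auto)
next
  case (add x y)
  then show ?case using order_trans[OF rho_keys TrN_sub] by (simp add: rho_linear Psi_add)
qed (simp add: rho_linear)

lemma Psi_bact_emb:
  assumes "u \<in> path_span P" "v \<in> path_span P" "m \<in> path_span (A n)"
  shows "Psi n (bact Q u v (emb m)) = tt n (pr u) m (pr v)"
proof -
  have "Poly_Mapping.keys (bact Q u v (emb m)) \<subseteq> Tr n \<and> Psi n (bact Q u v (emb m)) = tt n (pr u) m (pr v) \<and> Poly_Mapping.keys m \<subseteq> A n"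
    using assms(3)[unfolded path_span_def mem_Collect_eq]
  proof (induction m rule: keys_induct)
    case zero
    then show ?case using assms by (simp add: emb_linear bact_linear Psi_zero tt_zero pr_closed)
  next
    case (single p l)
    have p: "p \<in> A n" "p \<in> P" using single A_paths by auto
    let ?u = "pmult Q u (Poly_Mapping.single (fst p, []) l)" and ?v = "pmult Q (kpath (ptgt Q p, [])) v"
    have e: "?u = scl l (pmult Q u (kpath (fst p, [])))" by (simp flip: pmult_scl_right)
    have "Poly_Mapping.keys (pmult Q u (kpath (fst p, []))) \<subseteq> {a \<in> P. jn a p}"
      using keys_vertex(1)[of u "fst p"] assms(1) by (auto simp: joinable_def path_span_def)
    then have k1: "Poly_Mapping.keys ?u \<subseteq> {a \<in> P. jn a p}" unfolding e by (rule order_trans[OF keys_scl])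
    have k2: "Poly_Mapping.keys ?v \<subseteq> {c \<in> P. jn p c}"
      using keys_vertex(2)[of "ptgt Q p" v] assms(2) by (auto simp: joinable_def path_span_def)
    note k = k1 k2
    have b: "bact Q u v (emb (Poly_Mapping.single p l)) = tri ?u p ?v"
      unfolding emb_single bact_id3 e by (simp add: tri_linear)
    have "?u \<in> path_span P" using k(1) by (auto simp: path_span_def)
    from tt_scalar(2)[OF this p(1) assms(2), of 1] tt_scalar(1)[OF assms(1) p(1) assms(2), of l]
    have "tt n (pr u) (Poly_Mapping.single p l) (pr v) = tt n (pr ?u) (kpath p) (pr ?v)" by simp
    then show ?case using Psi_tri[OF k(1) p(1) k(2)] keys_tri_Tr[OF k(1) p(1) k(2)] p by (simp add: b)
  next
    case (add x y)
    then have xy: "x \<in> carrier (Mn n)" "y \<in> carrier (Mn n)" by (auto simp: span_bimod_def path_span_def)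
    have pl: "x \<otimes>\<^bsub>Mn n\<^esub> y = x + y" by (simp add: span_bimod_def)
    have "Poly_Mapping.keys (bact Q u v (emb x) + bact Q u v (emb y)) \<subseteq> Tr n"
      using add keys_add[of "bact Q u v (emb x)" "bact Q u v (emb y)"] by blast
    moreover have "tt n (pr u) (x + y) (pr v) = tt n (pr u) x (pr v) \<otimes>\<^bsub>TT n\<^esub> tt n (pr u) y (pr v)"
      using td.pure_add(2)[OF pr_closed[OF assms(1)] xy pr_closed[OF assms(2)]] unfolding pl .
    ultimately show ?case using add keys_add[of x y] by (auto simp: emb_linear bact_linear Psi_add)
  qed
  then show ?thesis by blast
qed

lemma Psi_Phi: assumes "z \<in> carrier (TT n)" shows "Psi n (Phi n z) = z"
proof -
  have k: "Poly_Mapping.keys (Phi n z) \<subseteq> Tr n" if "z \<in> carrier (TT n)" for z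
    using Phi_keys[OF that] TrN_sub by blast
  show ?thesis using assms
  proof (induction z rule: T_gen_induct)
    case (pure u m v)
    then show ?case by (simp add: Phi_pure Psi_bact_emb nf_span pr_nf)
  qed (simp_all add: Phi_one Psi_zero Phi_mult Phi_inv Psi_add Psi_minus k)
qed

lemma pmult_vertex_right:
  assumes "\<And>a. a \<in> Poly_Mapping.keys x \<Longrightarrow> ptgt Q a = v" shows "pmult Q x (kpath (v, [])) = x"
proof -
  have "Poly_Mapping.keys x \<subseteq> {a. ptgt Q a = v}" using assms by auto
  then show ?thesis
  proof (induction x rule: keys_induct)
    case (single p l)
    then show ?case by (auto simp: pmult_single joinable_def)
  qed (simp_all add: pmult_add_left)
qed

lemma pmult_vertex_left:
  assumes "\<And>a. a \<in> Poly_Mapping.keys x \<Longrightarrow> fst a = v" shows "pmult Q (kpath (v, [])) x = x"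
proof -
  have "Poly_Mapping.keys x \<subseteq> {a. fst a = v}" using assms by auto
  then show ?thesis
  proof (induction x rule: keys_induct)
    case (single p l)
    then show ?case by (auto simp: pmult_single joinable_def ptgt_conv)
  qed (simp_all add: pmult_add_right)
qed

text \<open>Together with \<open>Psi_Phi\<close> this identifies the tensor product with the
  combinations of normalized triples, \<open>rho\<close> being the projection onto them.\<close>

lemma Phi_Psi: assumes "Poly_Mapping.keys x \<subseteq> Tr n" shows "Phi n (Psi n x) = rho x"
  using assms
proof (induction x rule: keys_induct')
  case (single t l)
  obtain a p c where t: "t = (a, p, c)" by (cases t)
  have h: "a \<in> P" "p \<in> A n" "c \<in> P" "jn a p" "jn p c" using single t by (auto simp: Tr_def)
  have pt: "t \<in> Tr n" using single by simp
  have "Poly_Mapping.keys (nf (Poly_Mapping.single a l)) \<subseteq> parset a" "Poly_Mapping.keys (nf (kpath c)) \<subseteq> parset c"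
    by (intro nf_parset; use h in \<open>simp add: parset_def par_simps\<close>)+
  then have v: "pmult Q (nf (Poly_Mapping.single a l)) (kpath (fst p, [])) = nf (Poly_Mapping.single a l)"
    "pmult Q (kpath (ptgt Q p, [])) (nf (kpath c)) = nf (kpath c)"
    using h(4,5) by (intro pmult_vertex_right pmult_vertex_left; auto simp: parset_def par_def joinable_def)+
  have s: "Poly_Mapping.single t l = tri (Poly_Mapping.single a l) p (kpath c)" by (simp add: t tri_single)
  have "Phi n (Psi n (Poly_Mapping.single t l)) = tri (nf (Poly_Mapping.single a l)) p (nf (kpath c))"
    unfolding t Psi_single[OF pt[unfolded t]] psi_def fst_conv snd_conv Phi_pure[OF kpath_span[OF h(1)] path_span_single[OF h(2)] kpath_span[OF h(3)]]
    by (simp add: emb_single bact_id3 v)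
  then show ?case unfolding s rho_tri .
next
  case (add x y)
  then show ?case by (simp add: rho_linear Psi_add Phi_mult Psi_closed)
qed (simp add: rho_linear Psi_zero Phi_one)

lemma Psi_act:
  assumes "w \<in> path_span P" "Poly_Mapping.keys x \<subseteq> Tr n"
  shows "Poly_Mapping.keys (bact Q w one_pa x) \<subseteq> Tr n" "Psi n (bact Q w one_pa x) = lact (TT n) (pr w) (Psi n x)"
    "Poly_Mapping.keys (bact Q one_pa w x) \<subseteq> Tr n" "Psi n (bact Q one_pa w x) = ract (TT n) (Psi n x) (pr w)"
proof -
  have G: "group (TT n)" by (rule comm_group.axioms(2)[OF td.T_comm_group])
  note hl = td.lact_hom[OF pr_closed[OF assms(1)], of n] and hr = td.ract_hom[OF pr_closed[OF assms(1)], of n]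
  have "(Poly_Mapping.keys (bact Q w one_pa x) \<subseteq> Tr n \<and> Psi n (bact Q w one_pa x) = lact (TT n) (pr w) (Psi n x)) \<and>
    (Poly_Mapping.keys (bact Q one_pa w x) \<subseteq> Tr n \<and> Psi n (bact Q one_pa w x) = ract (TT n) (Psi n x) (pr w))"
    using assms(2)
  proof (induction x rule: keys_induct')
    case zero
    then show ?case using hom_one[OF hl G G] hom_one[OF hr G G] by (simp add: bact_linear Psi_zero)
  next
    case (single t l)
    obtain a p c where t: "t = (a, p, c)" by (cases t)
    have h: "a \<in> P" "p \<in> A n" "c \<in> P" "jn a p" "jn p c" using single t by (auto simp: Tr_def)
    have s: "Poly_Mapping.single t l = tri (Poly_Mapping.single a l) p (kpath c)" by (simp add: t tri_single)
    note o = pmult_one(1)[OF kpath_span[OF h(1)]] pmult_one(2)[OF kpath_span[OF h(3)]]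
    have k0: "Poly_Mapping.keys (Poly_Mapping.single a l) \<subseteq> {a \<in> P. jn a p}" "Poly_Mapping.keys (kpath c :: ('v, 'e, 'k) lincomb) \<subseteq> {c \<in> P. jn p c}"
      using h by auto
    have k1: "Poly_Mapping.keys (pmult Q w (Poly_Mapping.single a l)) \<subseteq> {a \<in> P. jn a p}"
      using keys_pmult[of w "Poly_Mapping.single a l"] assms(1) h
      by (fastforce simp: path_span_def joinable_pcomp pcomp_in_paths split: if_splits)
    have k2: "Poly_Mapping.keys (pmult Q (kpath c) w) \<subseteq> {c \<in> P. jn p c}"
      using keys_pmult[of "kpath c" w] assms(1) h
      by (fastforce simp: path_span_def joinable_pcomp pcomp_in_paths split: if_splits)
    note cl = pr_closed[OF kpath_span[OF h(1)], of l] pr_closed[OF kpath_span[OF h(3)], of 1] pr_closed[OF assms(1)]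
    show ?case unfolding s bact_tri o
      using Psi_tri[OF k1 h(2) k0(2)] Psi_tri[OF k0(1) h(2) k2] Psi_tri[OF k0(1) h(2) k0(2)]
        keys_tri_Tr[OF k1 h(2) k0(2)] keys_tri_Tr[OF k0(1) h(2) k2]
        td.act_pure(1)[OF cl(3), where n = n and x = "pr (Poly_Mapping.single a l)" and m = "kpath p" and y = "pr (kpath c)"]
        td.act_pure(2)[OF cl(3), where n = n and x = "pr (Poly_Mapping.single a l)" and m = "kpath p" and y = "pr (kpath c)"]
        pr_mult[OF assms(1) kpath_span[OF h(1)], of l] pr_mult[OF kpath_span[OF h(3)] assms(1), of 1]
      by simp
  next
    case (add x y)
    have "Poly_Mapping.keys (bact Q w one_pa x + bact Q w one_pa y) \<subseteq> Tr n" "Poly_Mapping.keys (bact Q one_pa w x + bact Q one_pa w y) \<subseteq> Tr n"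
      using add keys_add[of "bact Q w one_pa x" "bact Q w one_pa y"] keys_add[of "bact Q one_pa w x" "bact Q one_pa w y"] by blast+
    then show ?case using add hom_mult[OF hl] hom_mult[OF hr] by (simp add: bact_linear Psi_add Psi_closed)
  qed
  then show "Poly_Mapping.keys (bact Q w one_pa x) \<subseteq> Tr n" "Psi n (bact Q w one_pa x) = lact (TT n) (pr w) (Psi n x)"
    "Poly_Mapping.keys (bact Q one_pa w x) \<subseteq> Tr n" "Psi n (bact Q one_pa w x) = ract (TT n) (Psi n x) (pr w)" by auto
qed

section \<open>The differentials\<close>

definition dT :: "nat \<Rightarrow> (('v, 'e) path \<Rightarrow> (('v, 'e) triple \<Rightarrow>\<^sub>0 'k)) \<Rightarrow> _ \<Rightarrow> _"
  where "dT n g z = Psi n (dif Q g (Phi (Suc n) z))"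

lemma dif_keys:
  assumes "close_gen (Suc n) g" "Poly_Mapping.keys x \<subseteq> Tr (Suc n)"
  shows "Poly_Mapping.keys (dif Q g x) \<subseteq> Tr n"
  using assms(2)
proof (induction x rule: keys_induct)
  case (single t l)
  then have t: "t \<in> Tr (Suc n)" by simp
  have "Poly_Mapping.single t l \<in> Mle (Tr (Suc n)) (Poly_Mapping.single (wt t) l)"
    using Tr_wt(1)[OF t] by (intro MleI t red_le.refl)
  then show ?case using Mle_keys[OF close_dif(1)[OF assms(1)]] by simp
next
  case (add x y)
  then show ?case using keys_add[of "dif Q g x" "dif Q g y"] by (auto simp: dif_linear)
qed (simp add: dif_linear)

text \<open>Any coordinates of a tensor may be used, not only normalized ones, because prior
  normalization does not affect \<open>dif\<close> up to a final \<open>rho\<close>.\<close>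

lemma dT_Psi:
  assumes "close_gen (Suc n) g" "Poly_Mapping.keys x \<subseteq> Tr (Suc n)"
  shows "dT n g (Psi (Suc n) x) = Psi n (dif Q g x)"
proof -
  have r: "Poly_Mapping.keys (rho x) \<subseteq> Tr (Suc n)" using rho_keys[OF assms(2)] TrN_sub by blast
  have "rho (dif Q g (rho x)) = rho (dif Q g x)"
    using rho_dif_Tr[OF assms(2) close_gen_Fsp[OF assms(1)]] .
  then show ?thesis
    unfolding dT_def Phi_Psi[OF assms(2)] using Psi_rho[OF dif_keys[OF assms(1) r]] Psi_rho[OF dif_keys[OF assms]] by simp
qed

lemma T_Psi_cases:
  assumes "z \<in> carrier (TT n)" obtains x where "z = Psi n x" "Poly_Mapping.keys x \<subseteq> Tr n"
  by (rule that[OF Psi_Phi[OF assms, symmetric] order_trans[OF Phi_keys[OF assms] TrN_sub]])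

lemma dT_hom: assumes "close_gen (Suc n) g" shows "dT n g \<in> bimod_hom AA (TT (Suc n)) (TT n)"
proof -
  have 1: "dT n g \<in> hom (TT (Suc n)) (TT n)"
  proof (rule homI)
    fix z assume "z \<in> carrier (TT (Suc n))"
    then obtain x where x: "z = Psi (Suc n) x" "Poly_Mapping.keys x \<subseteq> Tr (Suc n)" by (rule T_Psi_cases)
    show "dT n g z \<in> carrier (TT n)" unfolding x dT_Psi[OF assms x(2)] by (rule Psi_closed[OF dif_keys[OF assms x(2)]])
    fix z' assume "z' \<in> carrier (TT (Suc n))"
    then obtain y where y: "z' = Psi (Suc n) y" "Poly_Mapping.keys y \<subseteq> Tr (Suc n)" by (rule T_Psi_cases)
    have xy: "Poly_Mapping.keys (x + y) \<subseteq> Tr (Suc n)" using keys_add[of x y] x y by blast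
    show "dT n g (z \<otimes>\<^bsub>TT (Suc n)\<^esub> z') = dT n g z \<otimes>\<^bsub>TT n\<^esub> dT n g z'"
      unfolding x(1) y(1) Psi_add[OF x(2) y(2), symmetric] dT_Psi[OF assms x(2)] dT_Psi[OF assms y(2)] dT_Psi[OF assms xy] dif_linear
      by (rule Psi_add[OF dif_keys[OF assms x(2)] dif_keys[OF assms y(2)]])
  qed
  have 2: "dT n g (lact (TT (Suc n)) a z) = lact (TT n) a (dT n g z)" "dT n g (ract (TT (Suc n)) z a) = ract (TT n) (dT n g z) a"
    if az: "a \<in> carrier AA" "z \<in> carrier (TT (Suc n))" for a z
  proof -
    obtain x where x: "z = Psi (Suc n) x" "Poly_Mapping.keys x \<subseteq> Tr (Suc n)" using az(2) by (rule T_Psi_cases)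
    obtain w where w: "a = pr w" "w \<in> path_span P" using az(1) by (auto simp: carrier_AA)
    note s = Psi_act[OF w(2) x(2)] and d = Psi_act[OF w(2) dif_keys[OF assms x(2)]]
    show "dT n g (lact (TT (Suc n)) a z) = lact (TT n) a (dT n g z)"
      unfolding x(1) w(1) s(2)[symmetric] dT_Psi[OF assms s(1)] dT_Psi[OF assms x(2)] dif_bact d(2) ..
    show "dT n g (ract (TT (Suc n)) z a) = ract (TT n) (dT n g z) a"
      unfolding x(1) w(1) s(4)[symmetric] dT_Psi[OF assms s(3)] dT_Psi[OF assms x(2)] dif_bact d(4) ..
  qed
  show ?thesis using 1 2 unfolding bimod_hom_def by blast
qed

lemma id3_Tr: assumes "p \<in> A n" shows "id3 p \<in> Tr n"
proof -
  have p: "p \<in> P" using assms A_paths by blast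
  then show ?thesis using vertex_path[OF fst_in_verts[OF p]] vertex_path[OF ptgt_in_verts[OF p]] assms
    by (simp add: id3_def Tr_def)
qed

lemma Psi_id3: assumes "p \<in> A n" shows "Psi n (ee (id3 p)) = tt n \<one>\<^bsub>AA\<^esub> (kpath p) \<one>\<^bsub>AA\<^esub>"
proof -
  have p: "p \<in> P" using assms A_paths by blast
  have e: "kpath (fst p, []) \<in> path_span P" "(kpath (ptgt Q p, []) :: ('v, 'e, 'k) lincomb) \<in> path_span P"
    using vertex_path[OF fst_in_verts[OF p]] vertex_path[OF ptgt_in_verts[OF p]] by (simp_all add: kpath_span)
  show ?thesis unfolding Psi_single[OF id3_Tr[OF assms]] psi_def pr_one
    using tt_scalar(1)[OF one_span assms one_span, of 1] tt_scalar(2)[OF e(1) assms one_span, of 1]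
    by (simp add: id3_def pmult_one e)
qed

lemma dT_gen:
  assumes "close_gen (Suc n) g" "q \<in> A (Suc n)"
  shows "dT n g (tt (Suc n) \<one>\<^bsub>AA\<^esub> (kpath q) \<one>\<^bsub>AA\<^esub>) = Psi n (g q)"
proof -
  have k: "Poly_Mapping.keys (ee (id3 q)) \<subseteq> Tr (Suc n)" using id3_Tr[OF assms(2)] by simp
  have "dif Q g (ee (id3 q)) = g q"
    using bact_id[OF close_gen_Mle[OF assms]] by (simp add: id3_def dif_single vx_def)
  then show ?thesis unfolding Psi_id3[OF assms(2), symmetric] dT_Psi[OF assms(1) k] by simp
qed

lemma dT_dT:
  assumes "close_gen (Suc n) g" "close_gen (Suc (Suc n)) g'" "\<forall>q\<in>A (Suc (Suc n)). rho (dif Q g (g' q)) = 0" "z \<in> carrier (TT (Suc (Suc n)))"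
  shows "dT n g (dT (Suc n) g' z) = \<one>\<^bsub>TT n\<^esub>"
proof -
  obtain x where x: "z = Psi (Suc (Suc n)) x" "Poly_Mapping.keys x \<subseteq> Tr (Suc (Suc n))" using assms(4) by (rule T_Psi_cases)
  note d = dif_keys[OF assms(2) x(2)]
  have "dT n g (dT (Suc n) g' z) = Psi n (dif Q g (dif Q g' x))"
    unfolding x(1) dT_Psi[OF assms(2) x(2)] dT_Psi[OF assms(1) d] ..
  also have "\<dots> = Psi n 0"
    using Psi_rho[OF dif_keys[OF assms(1) d]] rho_dif_dif[OF assms(1-3) x(2)] by simp
  finally show ?thesis by (simp add: Psi_zero)
qed

text \<open>Each tensor is a sum of terms obtained from \<open>1 \<otimes> p \<otimes> 1\<close> by
  the two actions. This gives the uniqueness behind the definite description in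
  \<open>delta\<close>.\<close>

lemma bimod_hom_ext:
  assumes "group M" "f \<in> bimod_hom AA (TT n) M" "f' \<in> bimod_hom AA (TT n) M"
    "\<And>p. p \<in> A n \<Longrightarrow> f (tt n \<one>\<^bsub>AA\<^esub> (kpath p) \<one>\<^bsub>AA\<^esub>) = f' (tt n \<one>\<^bsub>AA\<^esub> (kpath p) \<one>\<^bsub>AA\<^esub>)" "z \<in> carrier (TT n)"
  shows "f z = f' z"
proof -
  have G: "group (TT n)" by (rule comm_group.axioms(2)[OF td.T_comm_group])
  have h: "f \<in> hom (TT n) M" "f' \<in> hom (TT n) M" using assms by (auto simp: bimod_hom_def)
  obtain x where x: "z = Psi n x" "Poly_Mapping.keys x \<subseteq> Tr n" using assms(5) by (rule T_Psi_cases)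
  interpret A: ring AA by (rule ring_AA)
  have "f (Psi n x) = f' (Psi n x)" using x(2)
  proof (induction x rule: keys_induct')
    case zero
    then show ?case using hom_one[OF h(1) G assms(1)] hom_one[OF h(2) G assms(1)] by (simp add: Psi_zero)
  next
    case (single t l)
    obtain a p c where t: "t = (a, p, c)" by (cases t)
    have h: "a \<in> P" "p \<in> A n" "c \<in> P" using single t by (auto simp: Tr_def)
    have m: "kpath p \<in> carrier (Mn n)" using h by (simp add: span_bimod_def path_span_def)
    note cl = pr_closed[OF kpath_span[OF h(1)], of l] pr_closed[OF kpath_span[OF h(3)], of 1]
    let ?t = "tt n \<one>\<^bsub>AA\<^esub> (kpath p) \<one>\<^bsub>AA\<^esub>"
    have tc: "?t \<in> carrier (TT n)" "ract (TT n) ?t (pr (kpath c)) \<in> carrier (TT n)"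
      using m cl by (simp_all add: td.pure_closed td.act_pure)
    have "Psi n (Poly_Mapping.single t l) = lact (TT n) (pr (Poly_Mapping.single a l)) (ract (TT n) ?t (pr (kpath c)))"
      using single m cl by (simp add: Psi_single psi_def t td.act_pure)
    then show ?case using assms(2,3) cl tc assms(4)[OF h(2)] unfolding bimod_hom_def by simp
  next
    case (add x y)
    then show ?case using hom_mult[OF h(1)] hom_mult[OF h(2)] by (simp add: Psi_add Psi_closed)
  qed
  then show ?thesis using x(1) by simp
qed

section \<open>The maps \<open>\<delta>\<close> in coordinates\<close>

text \<open>Only the last factor and the product of the others enter \<open>\<delta>\<close>. The
  former is a segment by the explicit factorization; cancelling it from q identifies the
  latter.\<close>

lemma left_split:
  assumes "q \<in> A (Suc n)" "n > 0" "b = chain (rd q) (int (plen q)) 0 n"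
  shows "left_factorization Q R n q ! n = sg q b (int (plen q))" "pconcat (take n (left_factorization Q R n q)) = sg q 0 b"
proof -
  let ?L = "int (plen q)" and ?us = "left_factorization Q R n q"
  have q: "q \<in> P" using assms(1) A_paths by blast
  interpret t: tips "rd q" 0 ?L by (rule tips_word[OF q])
  have am: "t.Amb (Suc n) 0 ?L" using A_iff[OF q] assms(1) by simp
  have b: "0 \<le> b" "b \<le> ?L" using t.amb_bounds[of 0 n b] t.amb_prefix[OF am] assms(3) by auto
  show n: "?us ! n = sg q b ?L"
    unfolding left_factorization_eq[OF q assms(1)] using t.chain_eq[OF am] assms(3) by (simp del: upt_Suc)
  have "is_left_factorization Q R n q ?us"
    unfolding left_factorization_eq[OF q assms(1)] by (rule amb_left_factorization[OF q am])
  then have us: "length ?us = Suc n" "q = pconcat ?us" by (auto simp: is_left_factorization_def)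
  have s: "?us = take n ?us @ [?us ! n]" using us(1) by (metis lessI take_Suc_conv_app_nth take_all_iff order_refl)
  have t: "take n ?us \<noteq> []" using us(1) assms(2) by auto
  have "q = pcomp (pconcat (take n ?us)) (?us ! n)"
    by (subst us(2), subst s) (use t in \<open>simp add: pconcat_def pcomp_def\<close>)
  moreover have "q = pcomp (sg q 0 b) (sg q b ?L)"
    using sg_pcomp[of 0 b ?L q] b sg_full[of q] by simp
  ultimately show "pconcat (take n ?us) = sg q 0 b"
    unfolding n pcomp_def by (metis append_same_eq fst_conv snd_conv prod_eqI)
qed

lemma right_split:
  assumes "q \<in> A (Suc n)" "n > 0" "k = - chain (flip (rd q)) 0 (- int (plen q)) n"
  shows "right_factorization Q R n q ! n = sg q 0 k" "pconcat (rev (take n (right_factorization Q R n q))) = sg q k (int (plen q))"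
proof -
  let ?L = "int (plen q)" and ?vs = "right_factorization Q R n q"
  have q: "q \<in> P" using assms(1) A_paths by blast
  interpret t: tips "rd q" 0 ?L by (rule tips_word[OF q])
  have am: "t.Amb (Suc n) 0 ?L" using A_iff[OF q] assms(1) by simp
  have k: "0 \<le> k" "k \<le> ?L" using t.amb_bounds[of k n ?L] t.amb_suffix[OF order_refl am] assms(3) by auto
  have "- chain (flip (rd q)) 0 (- ?L) (Suc n) = 0" using t.chain_flip_eq[OF order_refl am] by simp
  then show n: "?vs ! n = sg q 0 k"
    unfolding right_factorization_eq[OF q assms(1)] using assms(3) by (simp del: upt_Suc)
  have "is_right_factorization Q R n q ?vs"
    unfolding right_factorization_eq[OF q assms(1)] by (rule amb_right_factorization[OF q am])
  then have vs: "length ?vs = Suc n" "q = pconcat (rev ?vs)" "\<forall>i<n. jn (?vs ! Suc i) (?vs ! i)"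
    by (auto simp: is_right_factorization_def)
  have j: "jn (?vs ! n) (?vs ! (n - 1))" using vs(3)[rule_format, of "n - 1"] assms(2) by simp
  have "?vs = take n ?vs @ [?vs ! n]" using vs(1) by (metis lessI take_Suc_conv_app_nth take_all_iff order_refl)
  then have s: "rev ?vs = ?vs ! n # rev (take n ?vs)" by (metis rev.simps(2) rev_rev_ident rev_swap)
  have t: "rev (take n ?vs) \<noteq> []" using vs(1) assms(2) by auto
  \<comment> \<open>Cancelling the left factor determines the arcs of the remainder but not its
    source, which is traced through the factorization.\<close>
  have "fst (pconcat (rev (take n ?vs))) = fst (?vs ! (n - 1))"
    using t vs(1) assms(2) by (simp add: pconcat_def hd_rev last_conv_nth)
  also have "\<dots> = ptgt Q (?vs ! n)" using j by (simp add: joinable_def)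
  also have "\<dots> = fst (sg q k ?L)"
    using sg_joinable[of 0 k q ?L] k q n by (simp add: joinable_def)
  finally have f: "fst (pconcat (rev (take n ?vs))) = fst (sg q k ?L)" .
  have "q = pcomp (?vs ! n) (pconcat (rev (take n ?vs)))"
    by (subst vs(2), subst s) (rule pconcat_Cons[OF t])
  moreover have "q = pcomp (sg q 0 k) (sg q k ?L)"
    using sg_pcomp[of 0 k ?L q] k sg_full[of q] by simp
  ultimately show "pconcat (rev (take n ?vs)) = sg q k ?L"
    using f unfolding n pcomp_def by (metis same_append_eq fst_conv snd_conv prod_eqI)
qed

text \<open>An occurrence is determined by either of its ends, so just one touches each end of q.
  The two are what remains after removing the last factor of the left and of the right
  factorization.\<close>

lemma dl_ends:
  assumes "q \<in> A (Suc n)" "even n" "b = chain (rd q) (int (plen q)) 0 n" "k = - chain (flip (rd q)) 0 (- int (plen q)) n"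
  shows "dl (Suc n) q = ee (tr q (k, int (plen q))) - ee (tr q (0, b))"
    "tr q (k, int (plen q)) \<in> Tr n" "tr q (0, b) \<in> Tr n"
proof -
  let ?L = "int (plen q)"
  have q: "q \<in> P" using assms(1) A_paths by blast
  interpret t: tips "rd q" 0 ?L by (rule tips_word[OF q])
  have am: "t.Amb (Suc n) 0 ?L" using A_iff[OF q] assms(1) by simp
  have I: "(0, b) \<in> Iv q n" "(k, ?L) \<in> Iv q n"
    using t.amb_prefix[OF am] t.amb_suffix[OF order_refl am] assms(3,4) by (auto simp: Iv_def)
  then show "tr q (k, ?L) \<in> Tr n" "tr q (0, b) \<in> Tr n" using Dec_conv[OF q, of n] by (auto simp: Dec_def)
  have e: "snd (fst (tr q (a, c))) = [] \<longleftrightarrow> a = 0" "snd (snd (snd (tr q (a, c)))) = [] \<longleftrightarrow> c = ?L"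
    if "(a, c) \<in> Iv q n" for a c
    using tr_ends[OF q order_refl, of a c ?L] Iv_bounds[OF q that] by (simp_all add: sg_full)
  have "{t \<in> Dec n q. snd (snd (snd t)) = []} = {tr q (k, ?L)}"
  proof -
    have "x = (k, ?L)" if x: "x \<in> Iv q n" "snd (snd (snd (tr q x))) = []" for x
    proof -
      have *: "(fst x, snd x) \<in> Iv q n" using x(1) by simp
      then have "snd x = ?L" using e(2)[OF *] x(2) by simp
      then show ?thesis using Iv_inj[OF q _ I(2)] * by (metis prod.collapse)
    qed
    moreover have "snd (snd (snd (tr q (k, ?L)))) = []" using e(2)[OF I(2)] by simp
    ultimately show ?thesis unfolding Dec_conv[OF q] using I(2) by blast
  qed
  moreover have "{t \<in> Dec n q. snd (fst t) = []} = {tr q (0, b)}"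
  proof -
    have "x = (0, b)" if x: "x \<in> Iv q n" "snd (fst (tr q x)) = []" for x
    proof -
      have *: "(fst x, snd x) \<in> Iv q n" using x(1) by simp
      then have "fst x = 0" using e(1)[OF *] x(2) by simp
      then show ?thesis using Iv_fun[OF _ I(1)] * by (metis prod.collapse)
    qed
    moreover have "snd (fst (tr q (0, b))) = []" using e(1)[OF I(1)] by simp
    ultimately show ?thesis unfolding Dec_conv[OF q] using I(1) by blast
  qed
  ultimately show "dl (Suc n) q = ee (tr q (k, ?L)) - ee (tr q (0, b))"
    using assms(2) by (simp add: dl_def)
qed

lemma tt_unit:
  assumes "u \<in> path_span P" "p \<in> A n"
  shows "tt n (pr u) (kpath p) (pr (kpath (ptgt Q p, []))) = tt n (pr u) (kpath p) \<one>\<^bsub>AA\<^esub>"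
    "tt n (pr (kpath (fst p, []))) (kpath p) (pr u) = tt n \<one>\<^bsub>AA\<^esub> (kpath p) (pr u)"
proof -
  have p: "p \<in> P" using assms A_paths by blast
  have e: "kpath (fst p, []) \<in> path_span P" "(kpath (ptgt Q p, []) :: ('v, 'e, 'k) lincomb) \<in> path_span P"
    using vertex_path[OF fst_in_verts[OF p]] vertex_path[OF ptgt_in_verts[OF p]] by (simp_all add: kpath_span)
  show "tt n (pr u) (kpath p) (pr (kpath (ptgt Q p, []))) = tt n (pr u) (kpath p) \<one>\<^bsub>AA\<^esub>"
    "tt n (pr (kpath (fst p, []))) (kpath p) (pr u) = tt n \<one>\<^bsub>AA\<^esub> (kpath p) (pr u)"
    using tt_scalar(2)[OF assms one_span, of 1] tt_scalar(1)[OF one_span assms(2,1), of 1]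
    by (simp_all add: pr_one pmult_one e)
qed

lemma Psi_sum:
  assumes "finite Y" "Y \<subseteq> Tr n" shows "Psi n (\<Sum>t\<in>Y. ee t) = finprod (TT n) (\<lambda>t. psi n t 1) Y"
proof -
  interpret G: comm_group "TT n" by (rule td.T_comm_group)
  have "Poly_Mapping.keys (\<Sum>t\<in>Y. ee t) \<subseteq> Tr n \<and> Psi n (\<Sum>t\<in>Y. ee t) = finprod (TT n) (\<lambda>t. psi n t 1) Y"
    using assms
  proof (induction Y rule: finite_induct)
    case empty
    then show ?case by (simp add: Psi_zero)
  next
    case (insert t Y)
    have "Poly_Mapping.keys (ee t + (\<Sum>t\<in>Y. ee t)) \<subseteq> Tr n" using insert keys_add[of "ee t" "\<Sum>t\<in>Y. ee t"] by auto
    moreover have "finprod (TT n) (\<lambda>t. psi n t 1) (insert t Y) = psi n t 1 \<otimes>\<^bsub>TT n\<^esub> finprod (TT n) (\<lambda>t. psi n t 1) Y"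
      using insert psi_closed by (intro G.finprod_insert) auto
    ultimately show ?case using insert by (simp add: Psi_add Psi_single)
  qed
  then show ?thesis by blast
qed

lemma Psi_diff:
  assumes "Poly_Mapping.keys x \<subseteq> Tr n" "Poly_Mapping.keys y \<subseteq> Tr n"
  shows "Psi n (x - y) = Psi n x \<otimes>\<^bsub>TT n\<^esub> inv\<^bsub>TT n\<^esub> Psi n y"
proof -
  have "Poly_Mapping.keys (- y) \<subseteq> Tr n" using assms(2) by (auto simp: in_keys_iff)
  from Psi_add[OF assms(1) this] show ?thesis by (simp add: Psi_minus[OF assms(2)])
qed

lemma psi_ends:
  assumes "q \<in> P" "0 \<le> i" "i \<le> int (plen q)"
  shows "tr q (i, int (plen q)) \<in> Tr n \<Longrightarrow> psi n (tr q (i, int (plen q))) 1 = tt n (pr (kpath (sg q 0 i))) (kpath (sg q i (int (plen q)))) \<one>\<^bsub>AA\<^esub>"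
    "tr q (0, i) \<in> Tr n \<Longrightarrow> psi n (tr q (0, i)) 1 = tt n \<one>\<^bsub>AA\<^esub> (kpath (sg q 0 i)) (pr (kpath (sg q i (int (plen q)))))"
proof -
  let ?L = "int (plen q)"
  show "psi n (tr q (i, ?L)) 1 = tt n (pr (kpath (sg q 0 i))) (kpath (sg q i ?L)) \<one>\<^bsub>AA\<^esub>" if "tr q (i, ?L) \<in> Tr n"
    using that tt_unit(1)[of "kpath (sg q 0 i)" "sg q i ?L" n] sg_vertex[OF assms]
    by (simp add: psi_def tr_def Tr_def kpath_span vx_def)
  have v: "sg q 0 0 = (fst (sg q 0 i), [])" by (simp add: sg_def seg_def)
  show "psi n (tr q (0, i)) 1 = tt n \<one>\<^bsub>AA\<^esub> (kpath (sg q 0 i)) (pr (kpath (sg q i ?L)))" if "tr q (0, i) \<in> Tr n"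
    using that tt_unit(2)[of "kpath (sg q i ?L)" "sg q 0 i" n] v
    by (simp add: psi_def tr_def Tr_def kpath_span)
qed

text \<open>In degree -1 the middle unit is the sum of all vertices; balancing against an end of p
  keeps only the vertex at that end.\<close>

lemma tt_vertex:
  assumes "p \<in> P"
  shows "tt 0 (pr (kpath p)) one_pa \<one>\<^bsub>AA\<^esub> = tt 0 (pr (kpath p)) (kpath (ptgt Q p, [])) \<one>\<^bsub>AA\<^esub>"
    "tt 0 \<one>\<^bsub>AA\<^esub> one_pa (pr (kpath p)) = tt 0 \<one>\<^bsub>AA\<^esub> (kpath (fst p, [])) (pr (kpath p))"
proof -
  have e: "kpath (fst p, []) \<in> E0" "(kpath (ptgt Q p, []) :: ('v, 'e, 'k) lincomb) \<in> E0"
    using E0_single fst_in_verts[OF assms] ptgt_in_verts[OF assms] by auto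
  have o: "one_pa \<in> carrier (Mn 0)"
    using vertex_path unfolding span_bimod_def path_span_def A_simps path_algebra_def
    by (auto simp: paths_len_def dest!: subsetD[OF keys_sum])
  have c: "pr (kpath p) \<in> carrier AA" by (rule pr_closed[OF kpath_span[OF assms]])
  have m: "pmult Q (kpath p) (kpath (ptgt Q p, [])) = (kpath p :: ('v, 'e, 'k) lincomb)" "pmult Q (kpath (fst p, [])) (kpath p) = (kpath p :: ('v, 'e, 'k) lincomb)"
    by (simp_all add: pmult_single)
  have l: "lact (Mn 0) (kpath (ptgt Q p, [])) one_pa = kpath (ptgt Q p, [])" "ract (Mn 0) one_pa (kpath (fst p, [])) = kpath (fst p, [])"
    using pmult_one E0_span[OF e(1)] E0_span[OF e(2)] by (simp_all add: span_bimod_def)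
  show "tt 0 (pr (kpath p)) one_pa \<one>\<^bsub>AA\<^esub> = tt 0 (pr (kpath p)) (kpath (ptgt Q p, [])) \<one>\<^bsub>AA\<^esub>"
    using td.pure_balanced(1)[OF c e(2) o td.A.one_closed] by (simp add: pr_mult kpath_span assms E0_span e m l)
  show "tt 0 \<one>\<^bsub>AA\<^esub> one_pa (pr (kpath p)) = tt 0 \<one>\<^bsub>AA\<^esub> (kpath (fst p, [])) (pr (kpath p))"
    using td.pure_balanced(2)[OF td.A.one_closed e(1) o c] by (simp add: pr_mult kpath_span assms E0_span e m l)
qed

text \<open>For n = 0 the definition places a unit in the middle and uses no factorization, so that
  case goes through \<open>tt_vertex\<close>.\<close>

lemma delta_gen_eq:
  assumes "q \<in> A (Suc n)" shows "delta_gen Q I R n q = Psi n (dl (Suc n) q)"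
proof -
  let ?L = "int (plen q)"
  have q: "q \<in> P" using assms A_paths by blast
  show ?thesis
  proof (cases "even n")
    case True
    define b k where "b = chain (rd q) ?L 0 n" and "k = - chain (flip (rd q)) 0 (- ?L) n"
    note d = dl_ends[OF assms True b_def k_def]
    interpret t: tips "rd q" 0 ?L by (rule tips_word[OF q])
    have am: "t.Amb (Suc n) 0 ?L" using A_iff[OF q] assms by simp
    have bk: "0 \<le> b" "b \<le> ?L" "0 \<le> k" "k \<le> ?L"
      using t.amb_bounds[of 0 n b] t.amb_prefix[OF am] t.amb_bounds[of k n ?L] t.amb_suffix[OF order_refl am] by (auto simp: b_def k_def)
    have P: "Psi n (dl (Suc n) q) = tt n (pr (kpath (sg q 0 k))) (kpath (sg q k ?L)) \<one>\<^bsub>AA\<^esub> \<otimes>\<^bsub>TT n\<^esub>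
        inv\<^bsub>TT n\<^esub> tt n \<one>\<^bsub>AA\<^esub> (kpath (sg q 0 b)) (pr (kpath (sg q b ?L)))"
      unfolding d(1) using d(2,3) psi_ends(1)[OF q bk(3,4) d(2)] psi_ends(2)[OF q bk(1,2) d(3)]
      by (subst Psi_diff) (simp_all add: Psi_single)
    show ?thesis
    proof (cases "n = 0")
      case n: True
      have "b = 0" "k = ?L" using n by (simp_all add: b_def k_def)
      moreover have "sg q 0 0 = (fst q, [])" by (simp add: sg_def seg_def)
      moreover have "kpath (sg q ?L ?L) = (kpath (ptgt Q q, []) :: ('v, 'e, 'k) lincomb)"
        using sg_vertex[OF q order_refl] by (simp add: vx_def sg_full)
      ultimately show ?thesis using P n tt_vertex[OF q]
        by (simp add: delta_gen_def Let_def resbimod_def tens_def A_def sg_full)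
    next
      case n: False
      show ?thesis unfolding P using left_split[OF assms _ b_def] right_split[OF assms _ k_def] n True
        by (simp add: delta_gen_def Let_def resbimod_def tens_def A_def)
    qed
  next
    case False
    have "{(a, p, c). p \<in> ambiguities Q R (int n - 1) \<and> a \<in> P \<and> c \<in> P \<and> jn a p \<and> jn p c \<and> pcomp (pcomp a p) c = q} = Dec n q"
      by (auto simp: Dec_def Tr_def A_def wt_def)
    then have "delta_gen Q I R n q = finprod (TT n) (\<lambda>t. psi n t 1) (Dec n q)"
      using False by (auto simp: delta_gen_def Let_def resbimod_eq psi_def case_prod_unfold)
    then show ?thesis using False Psi_sum[OF finite_Dec[OF q], of n n] by (simp add: dl_def Dec_def)
  qed
qed

text \<open>The actions stay inside the carrier, so a change of values outside it, as in passing to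
  an extensional function, is harmless.\<close>

lemma bimod_hom_cong:
  assumes "f \<in> bimod_hom AA (TT n) M" "\<And>x. x \<in> carrier (TT n) \<Longrightarrow> f' x = f x"
  shows "f' \<in> bimod_hom AA (TT n) M"
proof -
  interpret G: comm_group "TT n" by (rule td.T_comm_group)
  have c: "lact (TT n) a x \<in> carrier (TT n)" "ract (TT n) x a \<in> carrier (TT n)" if "a \<in> carrier AA" "x \<in> carrier (TT n)" for a x
    using hom_in_carrier[OF td.lact_hom[OF that(1)] that(2)] hom_in_carrier[OF td.ract_hom[OF that(1)] that(2)] by auto
  show ?thesis using assms c unfolding bimod_hom_def hom_def Pi_def by simp
qed

lemma gen_closed: assumes "p \<in> A n" shows "tt n \<one>\<^bsub>AA\<^esub> (kpath p) \<one>\<^bsub>AA\<^esub> \<in> carrier (TT n)"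
  using Psi_id3[OF assms] Psi_closed[of "ee (id3 p)" n] id3_Tr[OF assms] by simp

lemma close_dl: "close_gen n (dl n)"
  by (simp add: close_gen_def M_closed)

lemma delta_eq:
  assumes "z \<in> carrier (TT (Suc n))" shows "delta Q I R n z = dT n (dl (Suc n)) z"
proof -
  let ?f = "restrict (dT n (dl (Suc n))) (carrier (TT (Suc n)))"
  note h = dT_hom[OF close_dl, of n]
  have "delta Q I R n = ?f"
    unfolding delta_def Let_def resbimod_eq
  proof (rule the_equality)
    show "?f \<in> bimod_hom AA (TT (Suc n)) (TT n) \<and> ?f \<in> extensional (carrier (TT (Suc n))) \<and>
      (\<forall>q\<in>ambiguities Q R (int n). ?f (tt (Suc n) \<one>\<^bsub>AA\<^esub> (kpath q) \<one>\<^bsub>AA\<^esub>) = delta_gen Q I R n q)"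
      using bimod_hom_cong[OF h, of ?f] gen_closed[of _ "Suc n"] dT_gen[OF close_dl, of _ n] delta_gen_eq[of _ n]
      by (simp add: A_def)
    fix f assume f: "f \<in> bimod_hom AA (TT (Suc n)) (TT n) \<and> f \<in> extensional (carrier (TT (Suc n))) \<and>
      (\<forall>q\<in>ambiguities Q R (int n). f (tt (Suc n) \<one>\<^bsub>AA\<^esub> (kpath q) \<one>\<^bsub>AA\<^esub>) = delta_gen Q I R n q)"
    show "f = ?f"
    proof (rule extensionalityI)
      fix x assume x: "x \<in> carrier (TT (Suc n))"
      have "f x = dT n (dl (Suc n)) x"
        by (rule bimod_hom_ext[OF comm_group.axioms(2)[OF td.T_comm_group] _ h _ x])
          (use f dT_gen[OF close_dl, of _ n] delta_gen_eq[of _ n] in \<open>auto simp: A_def\<close>)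
      then show "f x = ?f x" using x by simp
    qed (use f in auto)
  qed
  then show ?thesis using assms by simp
qed

section \<open>The augmentation\<close>

lemma regular_group: "comm_group (regular_bimod AA)"
proof -
  show ?thesis
    by (rule comm_groupI) (auto simp: regular_bimod_def td.A.a_ac td.A.l_zero intro: td.A.l_neg)
qed

text \<open>The universal property gives existence and the values on pure tensors give uniqueness;
  together they evaluate the definite description.\<close>

lemma delta_aug:
  shows "delta_aug Q I R \<in> bimod_hom AA (TT 0) (regular_bimod AA)"
    and "x \<in> carrier AA \<Longrightarrow> e \<in> E0 \<Longrightarrow> y \<in> carrier AA \<Longrightarrow> delta_aug Q I R (tt 0 x e y) = x \<otimes>\<^bsub>AA\<^esub> pr e \<otimes>\<^bsub>AA\<^esub> y"
proof -
  have G: "group (regular_bimod AA)" by (rule comm_group.axioms(2)[OF regular_group])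
  have M0: "carrier (Mn 0) = E0" by (simp add: span_bimod_def A_simps)
  have ee: "pr e \<in> carrier AA" if "e \<in> E0" for e using that by (simp add: pr_closed E0_span)
  obtain h where h: "h \<in> hom (TT 0) (regular_bimod AA)"
    "\<And>x m y. x \<in> carrier AA \<Longrightarrow> m \<in> carrier (Mn 0) \<Longrightarrow> y \<in> carrier AA \<Longrightarrow> h (tt 0 x m y) = x \<otimes>\<^bsub>AA\<^esub> pr m \<otimes>\<^bsub>AA\<^esub> y"
    by (rule td.T_universal[OF regular_group, where f = "\<lambda>x m y. x \<otimes>\<^bsub>AA\<^esub> pr m \<otimes>\<^bsub>AA\<^esub> y" and n = 0])
      (simp_all add: A_simps(1) ee regular_bimod_def td.A.l_distr td.A.r_distr td.A.m_assoc span_bimod_def E0_span pr_add[symmetric] pr_mult[symmetric])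
  have act: "h (lact (TT 0) a z) = a \<otimes>\<^bsub>AA\<^esub> h z" "h (ract (TT 0) z a) = h z \<otimes>\<^bsub>AA\<^esub> a" if a: "a \<in> carrier AA" and z: "z \<in> carrier (TT 0)" for a z
  proof -
    have hc: "h z \<in> carrier AA" if "z \<in> carrier (TT 0)" for z using hom_in_carrier[OF h(1) that] by (simp add: regular_bimod_def)
    have hm: "h (u \<otimes>\<^bsub>TT 0\<^esub> v) = h u \<oplus>\<^bsub>AA\<^esub> h v" if "u \<in> carrier (TT 0)" "v \<in> carrier (TT 0)" for u v
      using hom_mult[OF h(1) that] by (simp add: regular_bimod_def)
    have 1: "(\<lambda>z. h (lact (TT 0) a z)) \<in> hom (TT 0) (regular_bimod AA)" "(\<lambda>z. h (ract (TT 0) z a)) \<in> hom (TT 0) (regular_bimod AA)"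
      using hom_compose[OF td.lact_hom[OF a] h(1)] hom_compose[OF td.ract_hom[OF a] h(1)] by (simp_all add: comp_def)
    have 2: "(\<lambda>z. a \<otimes>\<^bsub>AA\<^esub> h z) \<in> hom (TT 0) (regular_bimod AA)" "(\<lambda>z. h z \<otimes>\<^bsub>AA\<^esub> a) \<in> hom (TT 0) (regular_bimod AA)"
      by (intro homI; use a hc hm in \<open>simp add: regular_bimod_def td.A.r_distr td.A.l_distr\<close>)+
    show "h (lact (TT 0) a z) = a \<otimes>\<^bsub>AA\<^esub> h z"
      by (rule td.hom_ext[OF G 1(1) 2(1) _ z]) (simp add: td.act_pure a h(2) M0 ee td.A.m_assoc)
    show "h (ract (TT 0) z a) = h z \<otimes>\<^bsub>AA\<^esub> a"
      by (rule td.hom_ext[OF G 1(2) 2(2) _ z]) (simp add: td.act_pure a h(2) M0 ee td.A.m_assoc)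
  qed
  have hb: "h \<in> bimod_hom AA (TT 0) (regular_bimod AA)"
    using h(1) act by (simp add: bimod_hom_def) (simp add: regular_bimod_def)
  let ?h = "restrict h (carrier (TT 0))"
  have eq: "delta_aug Q I R = ?h"
    unfolding delta_aug_def Let_def resbimod_eq[of 0, simplified]
  proof (rule the_equality)
    show "?h \<in> bimod_hom AA (TT 0) (regular_bimod AA) \<and> ?h \<in> extensional (carrier (TT 0)) \<and>
      (\<forall>x\<in>carrier AA. \<forall>e\<in>E0. \<forall>y\<in>carrier AA. ?h (tt 0 x e y) = x \<otimes>\<^bsub>AA\<^esub> pr e \<otimes>\<^bsub>AA\<^esub> y)"
      using bimod_hom_cong[OF hb, of ?h] h(2) td.pure_closed[of _ _ 0] by (simp add: M0)
    fix f assume f: "f \<in> bimod_hom AA (TT 0) (regular_bimod AA) \<and> f \<in> extensional (carrier (TT 0)) \<and>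
      (\<forall>x\<in>carrier AA. \<forall>e\<in>E0. \<forall>y\<in>carrier AA. f (tt 0 x e y) = x \<otimes>\<^bsub>AA\<^esub> pr e \<otimes>\<^bsub>AA\<^esub> y)"
    show "f = ?h"
    proof (rule extensionalityI)
      fix x assume x: "x \<in> carrier (TT 0)"
      have "f x = h x" by (rule td.hom_ext[OF G _ h(1) _ x]) (use f h(2) in \<open>auto simp: bimod_hom_def M0\<close>)
      then show "f x = ?h x" using x by simp
    qed (use f in auto)
  qed
  show "delta_aug Q I R \<in> bimod_hom AA (TT 0) (regular_bimod AA)"
    unfolding eq by (rule bimod_hom_cong[OF hb]) simp
  show "x \<in> carrier AA \<Longrightarrow> e \<in> E0 \<Longrightarrow> y \<in> carrier AA \<Longrightarrow> delta_aug Q I R (tt 0 x e y) = x \<otimes>\<^bsub>AA\<^esub> pr e \<otimes>\<^bsub>AA\<^esub> y"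
    unfolding eq using h(2) td.pure_closed[of _ _ 0] by (simp add: M0)
qed

text \<open>On the generator of an arrow the two terms of \<open>\<delta>\<close> are both
  multiplied out to the class of that arrow.\<close>

lemma delta_aug_dT:
  assumes "z \<in> carrier (TT (Suc 0))" shows "delta_aug Q I R (dT 0 (dl (Suc 0)) z) = \<zero>\<^bsub>AA\<^esub>"
proof -
  note h = delta_aug(1) and d = dT_hom[OF close_dl, of 0]
  have G: "group (regular_bimod AA)" by (rule comm_group.axioms(2)[OF regular_group])
  have T: "group (TT 0)" by (rule comm_group.axioms(2)[OF td.T_comm_group])
  interpret hh: group_hom "TT 0" "regular_bimod AA" "delta_aug Q I R"
    using h T G by (simp add: group_hom_def group_hom_axioms_def bimod_hom_def)
  have c: "(\<lambda>z. delta_aug Q I R (dT 0 (dl (Suc 0)) z)) \<in> bimod_hom AA (TT (Suc 0)) (regular_bimod AA)"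
    using h d hom_compose[of "dT 0 (dl (Suc 0))" "TT (Suc 0)" "TT 0" "delta_aug Q I R" "regular_bimod AA"]
      hom_in_carrier[of "dT 0 (dl (Suc 0))" "TT (Suc 0)" "TT 0"]
    by (simp add: bimod_hom_def comp_def)
  have z: "(\<lambda>z. \<zero>\<^bsub>AA\<^esub>) \<in> bimod_hom AA (TT (Suc 0)) (regular_bimod AA)"
    by (simp add: bimod_hom_def hom_def regular_bimod_def)
  show ?thesis
  proof (rule bimod_hom_ext[OF G c z _ assms])
    fix p assume p: "p \<in> A (Suc 0)"
    then have pP: "p \<in> P" using A_paths by blast
    have o: "one_pa \<in> E0"
      using vertex_path unfolding path_span_def path_algebra_def
      by (auto simp: paths_len_def dest!: subsetD[OF keys_sum])
    have cl: "pr (kpath p) \<in> carrier AA" "one_pa \<in> carrier (Mn 0)"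
      using o by (simp_all add: pr_closed kpath_span pP span_bimod_def A_simps)
    have t: "tt 0 (pr (kpath p)) one_pa \<one>\<^bsub>AA\<^esub> \<in> carrier (TT 0)" "tt 0 \<one>\<^bsub>AA\<^esub> one_pa (pr (kpath p)) \<in> carrier (TT 0)"
      using cl by (simp_all add: td.pure_closed)
    have v: "delta_aug Q I R (tt 0 (pr (kpath p)) one_pa \<one>\<^bsub>AA\<^esub>) = pr (kpath p)" "delta_aug Q I R (tt 0 \<one>\<^bsub>AA\<^esub> one_pa (pr (kpath p))) = pr (kpath p)"
      using cl o by (simp_all add: delta_aug(2) pr_one[symmetric])
    have "dT 0 (dl (Suc 0)) (tt (Suc 0) \<one>\<^bsub>AA\<^esub> (kpath p) \<one>\<^bsub>AA\<^esub>) =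
        tt 0 (pr (kpath p)) one_pa \<one>\<^bsub>AA\<^esub> \<otimes>\<^bsub>TT 0\<^esub> inv\<^bsub>TT 0\<^esub> tt 0 \<one>\<^bsub>AA\<^esub> one_pa (pr (kpath p))"
      unfolding dT_gen[OF close_dl p] delta_gen_eq[OF p, symmetric] delta_gen_def Let_def
      by (simp add: resbimod_def tens_def A_def)
    then have "delta_aug Q I R (dT 0 (dl (Suc 0)) (tt (Suc 0) \<one>\<^bsub>AA\<^esub> (kpath p) \<one>\<^bsub>AA\<^esub>)) =
        pr (kpath p) \<otimes>\<^bsub>regular_bimod AA\<^esub> inv\<^bsub>regular_bimod AA\<^esub> pr (kpath p)"
      using t by (simp add: v)
    also have "\<dots> = \<one>\<^bsub>regular_bimod AA\<^esub>"
      using cl by (intro group.r_inv[OF G]) (simp add: regular_bimod_def)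
    finally show "delta_aug Q I R (dT 0 (dl (Suc 0)) (tt (Suc 0) \<one>\<^bsub>AA\<^esub> (kpath p) \<one>\<^bsub>AA\<^esub>)) = \<zero>\<^bsub>AA\<^esub>"
      by (simp add: regular_bimod_def)
  qed
qed

text \<open>A normalized triple has irreducible outer paths and carries its scalar on the left,
  exactly as the generators in \<open>Lbar\<close> do; sums and negatives become products and
  inverses.\<close>

lemma Psi_Lbar:
  assumes "x \<in> Mlt (TrN n) w" shows "Psi n x \<in> generate (TT n) (Lbar Q I R (int n - 1) w)"
proof -
  interpret G: comm_group "TT n" by (rule td.T_comm_group)
  let ?L = "Lbar Q I R (int n - 1) w"
  have kk: "kscale l (kpath b) = (Poly_Mapping.single b l :: ('v, 'e, 'k) lincomb)" for l b
    by (simp add: kscale_eq_scl)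
  have "?L \<subseteq> carrier (TT n)"
  proof
    fix z assume "z \<in> ?L"
    then obtain l b p b' where *: "z = tt n (pr (Poly_Mapping.single b l)) (kpath p) (pr (kpath b'))" "b \<in> irrp" "b' \<in> irrp" "p \<in> A n"
      unfolding Lbar_def resbimod_eq kk by (auto simp: A_def)
    have "kpath p \<in> carrier (Mn n)" using *(4) by (simp add: span_bimod_def path_span_def)
    then show "z \<in> carrier (TT n)"
      unfolding *(1) using *(2,3) by (intro td.pure_closed pr_closed kpath_span irrpD)
  qed
  then have s: "subgroup (generate (TT n) ?L) (TT n)" by (rule G.generate_is_subgroup)
  have "Poly_Mapping.keys x \<subseteq> Tr n \<and> Psi n x \<in> generate (TT n) ?L"
    using assms unfolding Mlt_def
  proof (induction rule: zsp.induct)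
    case (base z)
    then obtain t l where t: "z = Poly_Mapping.single t l" "t \<in> TrN n" "rlt (Poly_Mapping.single (wt t) l) w" by blast
    obtain a p c where e: "t = (a, p, c)" by (cases t)
    have h: "a \<in> irrp" "p \<in> A n" "c \<in> irrp" "jn a p" "jn p c" using t(2) by (auto simp: e TrN_def Tr_def)
    have "pmult Q (pmult Q (kpath a) (kpath p)) (kpath c) = (kpath (wt t) :: ('v, 'e, 'k) lincomb)"
      using h by (simp add: pmult_single e wt_def joinable_pcomp)
    then have "rlt (kscale l (pmult Q (pmult Q (kpath a) (kpath p)) (kpath c))) w" using t(3) by (simp add: kk)
    then have "psi n t l \<in> ?L"
      using h unfolding Lbar_def resbimod_eq psi_def e A_def kk[of l a, symmetric] fst_conv snd_conv by blast
    moreover have "t \<in> Tr n" using t(2) TrN_sub by blast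
    ultimately show ?case by (simp add: t(1) Psi_single generate.incl)
  next
    case (add x y)
    then show ?case using keys_add[of x y] by (auto simp: Psi_add intro: generate.eng)
  next
    case (minus x)
    moreover have "Poly_Mapping.keys (- x) = Poly_Mapping.keys x" by (simp add: set_eq_iff in_keys_iff)
    ultimately show ?case using subgroup.m_inv_closed[OF s] by (simp add: Psi_minus)
  qed (simp add: Psi_zero generate.one)
  then show ?thesis by blast
qed

theorem resolution_differential:
  "\<exists>d. (\<forall>i. d i \<in> bimod_hom AA (TT (Suc i)) (TT i)) \<and>
    (\<forall>x\<in>carrier (TT (Suc 0)). delta_aug Q I R (d 0 x) = \<zero>\<^bsub>AA\<^esub>) \<and>
    (\<forall>i. \<forall>x\<in>carrier (TT (Suc (Suc i))). d i (d (Suc i) x) = \<one>\<^bsub>TT i\<^esub>) \<and>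
    (\<forall>i. \<forall>q\<in>A (Suc i). d i (tt (Suc i) \<one>\<^bsub>AA\<^esub> (kpath q) \<one>\<^bsub>AA\<^esub>) \<otimes>\<^bsub>TT i\<^esub>
      inv\<^bsub>TT i\<^esub> delta Q I R i (tt (Suc i) \<one>\<^bsub>AA\<^esub> (kpath q) \<one>\<^bsub>AA\<^esub>) \<in> generate (TT i) (Lbar Q I R (int i - 1) (kpath q)))"
proof -
  obtain G where G: "G (Suc 0) = dl (Suc 0)" "\<And>n. n > 0 \<Longrightarrow> close_gen n (G n)"
    "\<And>n. n > 0 \<Longrightarrow> \<forall>q\<in>A (Suc n). rho (dif Q (G n) (G (Suc n) q)) = 0"
    using perturbed_differential by blast
  have "dT i (G (Suc i)) (tt (Suc i) \<one>\<^bsub>AA\<^esub> (kpath q) \<one>\<^bsub>AA\<^esub>) \<otimes>\<^bsub>TT i\<^esub>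
      inv\<^bsub>TT i\<^esub> delta Q I R i (tt (Suc i) \<one>\<^bsub>AA\<^esub> (kpath q) \<one>\<^bsub>AA\<^esub>) \<in> generate (TT i) (Lbar Q I R (int i - 1) (kpath q))"
    if q: "q \<in> A (Suc i)" for i q
  proof -
    have lt: "G (Suc i) q - dl (Suc i) q \<in> Mlt (Tr i) (kpath q)"
      using G(2)[of "Suc i"] q by (simp add: close_gen_def)
    have k: "Poly_Mapping.keys (G (Suc i) q) \<subseteq> Tr i" "Poly_Mapping.keys (dl (Suc i) q) \<subseteq> Tr i"
      using Mle_keys[OF close_gen_Mle[OF G(2) q]] Mle_keys[OF close_gen_Mle[OF close_dl q]] by simp_all
    \<comment> \<open>Normalization passes from composable to normalized triples without changing
      the tensor, and the lower terms stay lower.\<close>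
    have "Psi i (G (Suc i) q - dl (Suc i) q) \<in> generate (TT i) (Lbar Q I R (int i - 1) (kpath q))"
      using Psi_Lbar[OF rho_Mlt[OF lt]] Psi_rho[OF Mle_keys[OF Mlt_Mle[OF lt]]] by simp
    then show ?thesis
      unfolding delta_eq[OF gen_closed[OF q]] dT_gen[OF close_dl q] dT_gen[OF G(2)[OF zero_less_Suc] q] Psi_diff[OF k] .
  qed
  \<comment> \<open>The lowest map is left uncorrected, so its composite with the augmentation is
    the one already computed for \<open>\<delta>\<close>.\<close>
  then show ?thesis
    using dT_hom[OF G(2)[OF zero_less_Suc]] dT_dT[OF G(2)[OF zero_less_Suc] G(2)[OF zero_less_Suc] G(3)[OF zero_less_Suc]]
      delta_aug_dT G(1)
    by (intro exI[of _ "\<lambda>i. dT i (G (Suc i))"]) simp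
qed

end

theorem theorem4p2:
  fixes Q :: "('v, 'e) pre_digraph"
    and I :: "('v, 'e, 'k::field) lincomb set"
    and R :: "('v, 'e, 'k) redsys"
  assumes "wf_digraph Q" and "finite (verts Q)"
    and "ideal I (path_algebra Q)"
    and "proj_independent Q I (paths_len Q 0 \<union> paths_len Q 1)"
    and "reduction_system Q R"
    and "diamond Q R I"
    and "fst ` R \<subseteq> paths_ge Q 2"
  defines "A \<equiv> path_algebra Q Quot I"
    and "T \<equiv> resbimod Q I R"
  shows "\<exists>(d :: nat \<Rightarrow> ('v, 'e, 'k) tenselt \<Rightarrow> ('v, 'e, 'k) tenselt)
          (d' :: ('v, 'e, 'k) tenselt \<Rightarrow> ('v, 'e, 'k) algelt).
    (\<forall>i. d i \<in> bimod_hom A (T (int i)) (T (int i - 1))) \<and>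
    d' \<in> bimod_hom A (T (-1)) (regular_bimod A) \<and>
    (\<forall>x \<in> carrier (T (-1)). d' x = delta_aug Q I R x) \<and>
    (\<forall>x \<in> carrier (T 0). d' (d 0 x) = \<zero>\<^bsub>A\<^esub>) \<and>
    (\<forall>i\<ge>1. \<forall>x \<in> carrier (T (int i)). d (i - 1) (d i x) = \<one>\<^bsub>T (int i - 2)\<^esub>) \<and>
    (\<forall>i. \<forall>q \<in> ambiguities Q R (int i).
       d i (tens Q I R (int i) \<one>\<^bsub>A\<^esub> (kpath q) \<one>\<^bsub>A\<^esub>) \<otimes>\<^bsub>T (int i - 1)\<^esub>
       inv\<^bsub>T (int i - 1)\<^esub> delta Q I R i (tens Q I R (int i) \<one>\<^bsub>A\<^esub> (kpath q) \<one>\<^bsub>A\<^esub>)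
       \<in> generate (T (int i - 1)) (Lbar Q I R (int i - 1) (kpath q)))"
proof -
  interpret rsys Q I R
    using assms(1,2,3,5,6,7) by (intro rsys.intro rsys_axioms.intro)
  obtain d where d: "\<And>i. d i \<in> bimod_hom AA (TT (Suc i)) (TT i)"
    "\<And>x. x \<in> carrier (TT (Suc 0)) \<Longrightarrow> delta_aug Q I R (d 0 x) = \<zero>\<^bsub>AA\<^esub>"
    "\<And>i x. x \<in> carrier (TT (Suc (Suc i))) \<Longrightarrow> d i (d (Suc i) x) = \<one>\<^bsub>TT i\<^esub>"
    "\<And>i q. q \<in> rsys.A Q R (Suc i) \<Longrightarrow> d i (tt (Suc i) \<one>\<^bsub>AA\<^esub> (kpath q) \<one>\<^bsub>AA\<^esub>) \<otimes>\<^bsub>TT i\<^esub>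
      inv\<^bsub>TT i\<^esub> delta Q I R i (tt (Suc i) \<one>\<^bsub>AA\<^esub> (kpath q) \<one>\<^bsub>AA\<^esub>) \<in> generate (TT i) (Lbar Q I R (int i - 1) (kpath q))"
    using resolution_differential by blast
  \<comment> \<open>Translation between the integer degrees of the statement and the shifted natural
    ones.\<close>
  have e: "T (int i) = TT (Suc i)" "T (int i - 1) = TT i" "T (- 1) = TT 0" "T 0 = TT (Suc 0)" for i
    using resbimod_eq[of i] resbimod_eq[of 0] by (simp_all add: T_def)
  show ?thesis
  proof (intro exI[of _ d] exI[of _ "delta_aug Q I R"] conjI allI ballI impI)
    fix i x assume i: "1 \<le> (i :: nat)" and x: "x \<in> carrier (T (int i))"
    then obtain j where j: "i = Suc j" by (cases i) auto
    have "T (int i - 2) = TT j" using e(2)[of j] by (simp add: j)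
    then show "d (i - 1) (d i x) = \<one>\<^bsub>T (int i - 2)\<^esub>" using d(3)[of x j] x by (simp add: j e(1)[of "Suc j", simplified])
  next
    fix i q assume "q \<in> ambiguities Q R (int i)"
    then show "d i (tens Q I R (int i) \<one>\<^bsub>A\<^esub> (kpath q) \<one>\<^bsub>A\<^esub>) \<otimes>\<^bsub>T (int i - 1)\<^esub>
       inv\<^bsub>T (int i - 1)\<^esub> delta Q I R i (tens Q I R (int i) \<one>\<^bsub>A\<^esub> (kpath q) \<one>\<^bsub>A\<^esub>)
       \<in> generate (T (int i - 1)) (Lbar Q I R (int i - 1) (kpath q))"
      using d(4)[of q i] unfolding e resbimod_eq A_def by (simp add: rsys.A_def[OF rsys_axioms] assms(8))
  qed (use d delta_aug(1) in \<open>simp_all add: e assms(8)\<close>)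
qed

end
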